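(* Let $(H,L)$ be a Liouville integrable Hamiltonian system with two degrees of freedom on a four-dimensional symplectic manifold $(M,\Omega)$, with energy-momentum map $F=(H,L)$, and suppose that it has a focus-focus singularity $m\in M$ with loxodromic eigenvalues $\pm\alpha\pm\mathrm{i}\omega$ ($\alpha\neq 0$, $\omega\neq 0$), normalized so that $F(m)=(0,0)$. Then for each value $h$ of the energy $H$ close to the critical value $0=H(m)$ there exists a regular torus of energy $h$ with vanishing twist. For this energy $h$, all other regular tori of energy $h$ that are close enough to the singular fibre (the connected component of $F^{-1}(0,0)$ containing $m$) have non-vanishing twist.
   Context: All objects are $C^\infty$. The Hamiltonian vector field $\mathcal{X}_H$ is, in canonical coordinates with $\Omega=dx\wedge dp_x+dy\wedge dp_y$, given by $\dot x=\partial H/\partial p_x$, $\dot y=\partial H/\partial p_y$, $\dot p_x=-\partial H/\partial x$, $\dot p_y=-\partial H/\partial y$. The system is Liouville integrable if $\{H,L\}=0$ and $F=(H,L)$ is regular almost everywhere. Focus-focus singularity with loxodromic eigenvalues: $m$ is an equilibrium, $dH(m)=0$, and the linearization of $\mathcal{X}_H$ at $m$ has a quadruple of eigenvalues $\pm\alpha\pm\mathrm{i}\omega$ with $\alpha,\omega$ non-zero reals; the connected component of $F^{-1}(F(m))$ containing $m$ is compact; and $m$ is the only critical point of $F$ on it. Moreover (Eliasson normal form), there are symplectic coordinates $(x,y,p_x,p_y)$ near $m$, centred at $m$, in which $F=g\circ(J_1,J_2)$ with $J_1=xp_x+yp_y$, $J_2=xp_y-yp_x$ and $g$ a local diffeomorphism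 of $\mathbb{R}^2$ near the origin. Connected components of fibres of $F$ away from the singular fibre are disregarded. A regular torus is a compact connected component of a fibre $F^{-1}(c)$, $c=(h,l)$, consisting of regular points of $F$; $h$ is its energy. Near it there are action-angle coordinates $(\theta_1,\theta_2,I_1,I_2)$ with $\Omega=\sum_i d\theta_i\wedge dI_i$, $H=H(I_1,I_2)$, and frequencies $\omega_i=\partial H/\partial I_i$. The rotation number $W$ is the frequency ratio $[\omega_1:\omega_2]\in\mathbb{R}P^1$, a function of $c=(h,l)$ near the given regular value. The torus has vanishing twist if $\partial W/\partial l=0$ there, the derivative being taken at constant energy $h$ (i.e. along the family of nearby tori of the same energy); otherwise it has non-vanishing twist. This condition does not depend on the choice of action variables.
   Formalization: The energy value h = 0 itself is excluded: the claim is for all h ≠ 0 close to 0, since at h = 0 the only fibre near the singular one at which the twist condition degenerates is the singular fibre, which is not a regular torus. *)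

theory Defs
  imports "HOL-Analysis.Analysis"
begin

section \<open>Smooth maps between open subsets of normed spaces\<close>

text \<open>These notions are only used on open sets; the targets and sources are finite-dimensional, so
  continuity of all iterated directional derivatives is the usual \<open>C\<^sup>k\<close> condition.\<close>

primrec Ck_on :: "nat \<Rightarrow> ('a::real_normed_vector \<Rightarrow> 'b::real_normed_vector) \<Rightarrow> 'a set \<Rightarrow> bool" where
  "Ck_on 0 f S \<longleftrightarrow> continuous_on S f"
| "Ck_on (Suc k) f S \<longleftrightarrow>
     (\<forall>x\<in>S. f differentiable (at x)) \<and> (\<forall>v. Ck_on k (\<lambda>x. frechet_derivative f (at x) v) S)"

definition smooth_on :: "('a::real_normed_vector \<Rightarrow> 'b::real_normed_vector) \<Rightarrow> 'a set \<Rightarrow> bool" where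
  "smooth_on f S \<longleftrightarrow> (\<forall>k. Ck_on k f S)"

definition smooth_diffeo :: "('a::real_normed_vector \<Rightarrow> 'b::real_normed_vector) \<Rightarrow> 'a set \<Rightarrow> bool" where
  "smooth_diffeo f S \<longleftrightarrow> open S \<and> open (f ` S) \<and> inj_on f S \<and>
     smooth_on f S \<and> smooth_on (inv_into S f) (f ` S)"


section \<open>Smooth 4-manifolds\<close>

text \<open>A chart is a pair \<open>(U, \<phi>)\<close>; the values of \<open>\<phi>\<close> outside \<open>U\<close> are irrelevant.\<close>

type_synonym 'm chart = "'m set \<times> ('m \<Rightarrow> real^4)"

definition is_chart :: "'m::topological_space chart \<Rightarrow> bool" where
  "is_chart c \<longleftrightarrow> open (fst c) \<and> open (snd c ` fst c) \<and>
     homeomorphism (fst c) (snd c ` fst c) (snd c) (inv_into (fst c) (snd c))"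

text \<open>Representative of a function on the manifold in the coordinates of a chart.\<close>

definition in_chart :: "'m chart \<Rightarrow> ('m \<Rightarrow> 'b) \<Rightarrow> real^4 \<Rightarrow> 'b" where
  "in_chart c f = f \<circ> inv_into (fst c) (snd c)"

definition compatible :: "'m chart \<Rightarrow> 'm chart \<Rightarrow> bool" where
  "compatible c d \<longleftrightarrow>
     smooth_on (in_chart c (snd d)) (snd c ` (fst c \<inter> fst d)) \<and>
     smooth_on (in_chart d (snd c)) (snd d ` (fst c \<inter> fst d))"

definition smooth_structure :: "'m::topological_space chart set \<Rightarrow> bool" where
  "smooth_structure A \<longleftrightarrow>
     (\<forall>c\<in>A. is_chart c) \<and> (\<Union>c\<in>A. fst c) = UNIV \<and>
     (\<forall>c\<in>A. \<forall>d\<in>A. compatible c d) \<and>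
     (\<forall>c. is_chart c \<and> (\<forall>d\<in>A. compatible c d) \<longrightarrow> c \<in> A)"

definition smooth_fun :: "'m chart set \<Rightarrow> ('m \<Rightarrow> real) \<Rightarrow> bool" where
  "smooth_fun A f \<longleftrightarrow> (\<forall>c\<in>A. smooth_on (in_chart c f) (snd c ` fst c))"

definition smooth_map_into ::
  "'m::topological_space chart set \<Rightarrow> 'a::real_normed_vector set \<Rightarrow> ('a \<Rightarrow> 'm) \<Rightarrow> bool" where
  "smooth_map_into A S \<Psi> \<longleftrightarrow> continuous_on S \<Psi> \<and>
     (\<forall>c\<in>A. smooth_on (snd c \<circ> \<Psi>) {z \<in> S. \<Psi> z \<in> fst c})"


section \<open>Symplectic forms\<close>

text \<open>A 2-form is given by its Gram matrices in all charts: if \<open>c = (U, \<phi>)\<close> then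
  \<open>Om c x\<close> has entries \<open>\<Omega>(\<partial>\<^sub>i, \<partial>\<^sub>j)\<close> at the point with coordinates \<open>x \<in> \<phi>(U)\<close>.\<close>

type_synonym 'm form2 = "'m chart \<Rightarrow> real^4 \<Rightarrow> real^4^4"

definition pairing :: "real^4^4 \<Rightarrow> real^4 \<Rightarrow> real^4 \<Rightarrow> real" where
  "pairing G u v = u \<bullet> (G *v v)"

definition partial :: "'n::finite \<Rightarrow> (real^'n \<Rightarrow> real) \<Rightarrow> real^'n \<Rightarrow> real" where
  "partial i f x = frechet_derivative f (at x) (axis i 1)"

definition is_2form :: "'m chart set \<Rightarrow> 'm form2 \<Rightarrow> bool" where
  "is_2form A Om \<longleftrightarrow>
     (\<forall>c\<in>A. smooth_on (Om c) (snd c ` fst c) \<and>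
        (\<forall>x\<in>snd c ` fst c. transpose (Om c x) = - Om c x)) \<and>
     (\<forall>c\<in>A. \<forall>d\<in>A. \<forall>p\<in>fst c \<inter> fst d. \<forall>u v.
        (let \<tau> = frechet_derivative (in_chart c (snd d)) (at (snd c p))
         in pairing (Om d (snd d p)) (\<tau> u) (\<tau> v) = pairing (Om c (snd c p)) u v))"

definition closed_2form :: "'m chart set \<Rightarrow> 'm form2 \<Rightarrow> bool" where
  "closed_2form A Om \<longleftrightarrow>
     (\<forall>c\<in>A. \<forall>x\<in>snd c ` fst c. \<forall>i j k.
        partial i (\<lambda>y. Om c y $ j $ k) x + partial j (\<lambda>y. Om c y $ k $ i) x
          + partial k (\<lambda>y. Om c y $ i $ j) x = 0)"

definition nondegenerate :: "'m chart set \<Rightarrow> 'm form2 \<Rightarrow> bool" where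
  "nondegenerate A Om \<longleftrightarrow> (\<forall>c\<in>A. \<forall>x\<in>snd c ` fst c. invertible (Om c x))"

definition symplectic_manifold :: "'m::topological_space chart set \<Rightarrow> 'm form2 \<Rightarrow> bool" where
  "symplectic_manifold A Om \<longleftrightarrow>
     smooth_structure A \<and> is_2form A Om \<and> closed_2form A Om \<and> nondegenerate A Om"

text \<open>Canonical coordinates are ordered \<open>(x, y, p\<^sub>x, p\<^sub>y)\<close>, indexed by 1, 2, 3, 4; this is the Gram matrix
  of \<open>dx \<and> dp\<^sub>x + dy \<and> dp\<^sub>y\<close>.\<close>

definition std_form :: "real^4^4" where
  "std_form = (\<chi> i j. if (i, j) = (1, 3) \<or> (i, j) = (2, 4) then 1
                      else if (i, j) = (3, 1) \<or> (i, j) = (4, 2) then -1 else 0)"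

definition canonical_chart :: "'m chart set \<Rightarrow> 'm form2 \<Rightarrow> 'm chart \<Rightarrow> bool" where
  "canonical_chart A Om c \<longleftrightarrow> c \<in> A \<and> (\<forall>x\<in>snd c ` fst c. Om c x = std_form)"


section \<open>Hamiltonian vector fields and integrable systems\<close>

text \<open>The vector field determined by \<open>\<Omega>(X, \<cdot>) = df\<close>, in the coordinates of the chart \<open>c\<close>. The lemma
  below fixes the sign convention.\<close>

definition ham_vf :: "'m form2 \<Rightarrow> 'm chart \<Rightarrow> ('m \<Rightarrow> real) \<Rightarrow> real^4 \<Rightarrow> real^4" where
  "ham_vf Om c f x =
     (THE X. \<forall>v. pairing (Om c x) X v = frechet_derivative (in_chart c f) (at x) v)"

lemma ham_vf_canonical:
  assumes "Om c x = std_form" and diff: "in_chart c f differentiable (at x)"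
  defines "df \<equiv> \<lambda>i. partial i (in_chart c f) x"
  shows "ham_vf Om c f x = vector [df 3, df 4, - df 1, - df 2]"
proof -
  let ?D = "frechet_derivative (in_chart c f) (at x)"
  have lin: "linear ?D"
    using diff by (rule linear_frechet_derivative)
  have D: "?D v = v$1 * df 1 + v$2 * df 2 + v$3 * df 3 + v$4 * df 4" for v
  proof -
    have "v = v$1 *\<^sub>R axis 1 1 + v$2 *\<^sub>R axis 2 1 + v$3 *\<^sub>R axis 3 1 + v$4 *\<^sub>R axis 4 1"
      by (simp add: vec_eq_iff forall_4 axis_def)
    then have "?D v = ?D (v$1 *\<^sub>R axis 1 1 + v$2 *\<^sub>R axis 2 1 + v$3 *\<^sub>R axis 3 1 + v$4 *\<^sub>R axis 4 1)"
      by simp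
    then show ?thesis
      by (simp add: linear_add[OF lin] linear_scale[OF lin] df_def partial_def)
  qed
  have P: "pairing std_form X v = X$1 * v$3 + X$2 * v$4 - X$3 * v$1 - X$4 * v$2" for X v
    by (simp add: pairing_def std_form_def inner_vec_def sum_4 matrix_vector_mult_def)
  show ?thesis
    unfolding ham_vf_def assms(1)
  proof (rule the_equality)
    show "\<forall>v. pairing std_form (vector [df 3, df 4, - df 1, - df 2]) v = ?D v"
      by (simp add: P D vector_def algebra_simps)
  next
    fix X assume X: "\<forall>v. pairing std_form X v = ?D v"
    have "X$3 = - df 1" "X$4 = - df 2" "X$1 = df 3" "X$2 = df 4"
      using X[rule_format, of "axis 1 1"] X[rule_format, of "axis 2 1"]
        X[rule_format, of "axis 3 1"] X[rule_format, of "axis 4 1"]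
      unfolding P D by (simp_all add: axis_def)
    then show "X = vector [df 3, df 4, - df 1, - df 2]"
      by (simp add: vec_eq_iff forall_4 vector_def)
  qed
qed

definition poisson :: "'m form2 \<Rightarrow> 'm chart \<Rightarrow> ('m \<Rightarrow> real) \<Rightarrow> ('m \<Rightarrow> real) \<Rightarrow> real^4 \<Rightarrow> real" where
  "poisson Om c f g x = pairing (Om c x) (ham_vf Om c f x) (ham_vf Om c g x)"

definition em_map :: "('m \<Rightarrow> real) \<Rightarrow> ('m \<Rightarrow> real) \<Rightarrow> 'm \<Rightarrow> real \<times> real" where
  "em_map H L p = (H p, L p)"

definition regular_point :: "'m chart set \<Rightarrow> ('m \<Rightarrow> real) \<Rightarrow> ('m \<Rightarrow> real) \<Rightarrow> 'm \<Rightarrow> bool" where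
  "regular_point A H L p \<longleftrightarrow>
     (\<forall>c\<in>A. p \<in> fst c \<longrightarrow> surj (frechet_derivative (in_chart c (em_map H L)) (at (snd c p))))"

definition liouville_integrable ::
  "'m chart set \<Rightarrow> 'm form2 \<Rightarrow> ('m \<Rightarrow> real) \<Rightarrow> ('m \<Rightarrow> real) \<Rightarrow> bool" where
  "liouville_integrable A Om H L \<longleftrightarrow>
     smooth_fun A H \<and> smooth_fun A L \<and>
     (\<forall>c\<in>A. \<forall>x\<in>snd c ` fst c. poisson Om c H L x = 0) \<and>
     (\<forall>c\<in>A. negligible (snd c ` {p \<in> fst c. \<not> regular_point A H L p}))"


section \<open>Focus-focus singularities\<close>

definition complex_eigenvalues :: "real^'n^'n \<Rightarrow> complex set" where
  "complex_eigenvalues B =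
     {z. \<exists>v. v \<noteq> 0 \<and> map_matrix complex_of_real B *v v = z *s v}"

definition linearization :: "'m form2 \<Rightarrow> 'm chart \<Rightarrow> ('m \<Rightarrow> real) \<Rightarrow> 'm \<Rightarrow> real^4^4" where
  "linearization Om c H m = matrix (frechet_derivative (ham_vf Om c H) (at (snd c m)))"

definition singular_fibre ::
  "('m::topological_space \<Rightarrow> real) \<Rightarrow> ('m \<Rightarrow> real) \<Rightarrow> 'm \<Rightarrow> 'm set" where
  "singular_fibre H L m = connected_component_set (em_map H L -` {em_map H L m}) m"

definition J1 :: "real^4 \<Rightarrow> real" where
  "J1 z = z$1 * z$3 + z$2 * z$4"

definition J2 :: "real^4 \<Rightarrow> real" where
  "J2 z = z$1 * z$4 - z$2 * z$3"

definition eliasson_normal_form ::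
  "'m chart set \<Rightarrow> 'm form2 \<Rightarrow> ('m \<Rightarrow> real) \<Rightarrow> ('m \<Rightarrow> real) \<Rightarrow> 'm \<Rightarrow> bool" where
  "eliasson_normal_form A Om H L m \<longleftrightarrow>
     (\<exists>c. canonical_chart A Om c \<and> m \<in> fst c \<and> snd c m = 0 \<and>
        (\<exists>(g :: real \<times> real \<Rightarrow> real \<times> real) V. (0, 0) \<in> V \<and> smooth_diffeo g V \<and>
           (\<forall>p\<in>fst c. (J1 (snd c p), J2 (snd c p)) \<in> V \<and>
              em_map H L p = g (J1 (snd c p), J2 (snd c p)))))"

text \<open>The normal form is included as part of the data of a focus-focus singularity.\<close>

definition focus_focus ::
  "'m::topological_space chart set \<Rightarrow> 'm form2 \<Rightarrow> ('m \<Rightarrow> real) \<Rightarrow> ('m \<Rightarrow> real) \<Rightarrow> 'm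
     \<Rightarrow> real \<Rightarrow> real \<Rightarrow> bool" where
  "focus_focus A Om H L m \<alpha> \<omega> \<longleftrightarrow>
     \<alpha> \<noteq> 0 \<and> \<omega> \<noteq> 0 \<and>
     (\<forall>c\<in>A. m \<in> fst c \<longrightarrow>
        frechet_derivative (in_chart c H) (at (snd c m)) = (\<lambda>v. 0) \<and>
        complex_eigenvalues (linearization Om c H m) =
          {Complex \<alpha> \<omega>, Complex \<alpha> (- \<omega>), Complex (- \<alpha>) \<omega>, Complex (- \<alpha>) (- \<omega>)}) \<and>
     compact (singular_fibre H L m) \<and>
     (\<forall>p\<in>singular_fibre H L m. p \<noteq> m \<longrightarrow> regular_point A H L p) \<and>
     eliasson_normal_form A Om H L m"


section \<open>Regular tori, action-angle coordinates and twist\<close>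

definition regular_torus ::
  "'m::topological_space chart set \<Rightarrow> ('m \<Rightarrow> real) \<Rightarrow> ('m \<Rightarrow> real) \<Rightarrow> real \<times> real \<Rightarrow> 'm set \<Rightarrow> bool" where
  "regular_torus A H L c T \<longleftrightarrow>
     T \<in> components (em_map H L -` {c}) \<and> compact T \<and> (\<forall>p\<in>T. regular_point A H L p)"

text \<open>Action-angle coordinates near the torus \<open>T\<close> are given by the inverse coordinate map, with the
  angles lifted to the universal cover: \<open>\<Psi>\<close> sends \<open>(\<theta>\<^sub>1, \<theta>\<^sub>2, I\<^sub>1, I\<^sub>2)\<close> with \<open>(I\<^sub>1, I\<^sub>2) \<in> D\<close> to a point of the
  manifold, is \<open>2\<pi>\<close>-periodic in both angles and otherwise injective. The pullback of the symplectic form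
  is \<open>d\<theta>\<^sub>1 \<and> dI\<^sub>1 + d\<theta>\<^sub>2 \<and> dI\<^sub>2\<close>, so \<open>\<Psi>\<close> is a local diffeomorphism and its image is an open neighbourhood of \<open>T\<close>.
  The diffeomorphism \<open>f\<close> expresses \<open>(H, L)\<close> through the actions.\<close>

definition act :: "real^4 \<Rightarrow> real \<times> real" where
  "act z = (z$3, z$4)"

definition same_angles :: "real^4 \<Rightarrow> real^4 \<Rightarrow> bool" where
  "same_angles z z' \<longleftrightarrow>
     (\<exists>a b :: int. z'$1 = z$1 + 2 * pi * of_int a \<and> z'$2 = z$2 + 2 * pi * of_int b)"

definition action_angle ::
  "'m::topological_space chart set \<Rightarrow> 'm form2 \<Rightarrow> ('m \<Rightarrow> real) \<Rightarrow> ('m \<Rightarrow> real) \<Rightarrow> 'm set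
     \<Rightarrow> (real \<times> real) set \<Rightarrow> (real^4 \<Rightarrow> 'm) \<Rightarrow> (real \<times> real \<Rightarrow> real \<times> real) \<Rightarrow> bool" where
  "action_angle A Om H L T D \<Psi> f \<longleftrightarrow>
     smooth_diffeo f D \<and>
     smooth_map_into A {z. act z \<in> D} \<Psi> \<and>
     (\<forall>z z'. act z \<in> D \<and> act z' \<in> D \<longrightarrow>
        (\<Psi> z = \<Psi> z' \<longleftrightarrow> act z = act z' \<and> same_angles z z')) \<and>
     (\<forall>c\<in>A. \<forall>z. act z \<in> D \<and> \<Psi> z \<in> fst c \<longrightarrow>
        (let \<delta> = frechet_derivative (snd c \<circ> \<Psi>) (at z)
         in \<forall>u v. pairing (Om c (snd c (\<Psi> z))) (\<delta> u) (\<delta> v) = pairing std_form u v)) \<and>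
     (\<forall>z. act z \<in> D \<longrightarrow> em_map H L (\<Psi> z) = f (act z)) \<and>
     (\<exists>I\<in>D. T = \<Psi> ` {z. act z = I})"

text \<open>The frequencies \<open>\<partial>H/\<partial>I\<^sub>i\<close> as functions of the value \<open>c = (h, l)\<close>.\<close>

definition frequencies :: "(real \<times> real) set \<Rightarrow> (real \<times> real \<Rightarrow> real \<times> real) \<Rightarrow> real \<times> real \<Rightarrow> real \<times> real" where
  "frequencies D f c =
     (let dH = frechet_derivative (\<lambda>I. fst (f I)) (at (inv_into D f c)) in (dH (1, 0), dH (0, 1)))"

text \<open>Points of the real projective line are lines through the origin of the plane. A curve in the
  projective line is stationary at \<open>t\<close> if its derivative vanishes in one of the two affine charts
  \<open>[1 : s] \<mapsto> s\<close> and \<open>[s : 1] \<mapsto> s\<close>.\<close>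

definition rotation_number ::
  "(real \<times> real) set \<Rightarrow> (real \<times> real \<Rightarrow> real \<times> real) \<Rightarrow> real \<times> real \<Rightarrow> (real \<times> real) set" where
  "rotation_number D f c = span {frequencies D f c}"

definition rp1_stationary :: "(real \<Rightarrow> (real \<times> real) set) \<Rightarrow> real \<Rightarrow> bool" where
  "rp1_stationary \<gamma> t \<longleftrightarrow>
     (\<exists>s. (1, s) \<in> \<gamma> t) \<and> ((\<lambda>u. THE s. (1, s) \<in> \<gamma> u) has_real_derivative 0) (at t) \<or>
     (\<exists>s. (s, 1) \<in> \<gamma> t) \<and> ((\<lambda>u. THE s. (s, 1) \<in> \<gamma> u) has_real_derivative 0) (at t)"

definition vanishing_twist ::
  "'m::topological_space chart set \<Rightarrow> 'm form2 \<Rightarrow> ('m \<Rightarrow> real) \<Rightarrow> ('m \<Rightarrow> real) \<Rightarrow> real \<times> real \<Rightarrow> 'm set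
     \<Rightarrow> bool" where
  "vanishing_twist A Om H L c T \<longleftrightarrow>
     (\<exists>D \<Psi> f. action_angle A Om H L T D \<Psi> f \<and>
        rp1_stationary (\<lambda>l. rotation_number D f (fst c, l)) (snd c))"

end

theory Submission
  imports Defs
begin

text \<open>
  Let \<open>J = (J\<^sub>1, J\<^sub>2)\<close> be the integrals of the normal form, with values \<open>w\<close>, and \<open>(H, L) = g \<circ> J\<close>. Near a
  regular point there are Darboux charts in which the Hamiltonian flows of \<open>J\<^sub>1\<close> and \<open>J\<^sub>2\<close> are translations;
  together with the explicit linear flow near \<open>m\<close> they replace the integration of vector fields. Compactness of
  the singular fibre makes the joint flow complete there, and a section of the unstable manifold of \<open>m\<close> comes back
  along the stable manifold. Hence for small \<open>w \<noteq> 0\<close> the fibre is a torus with period lattice generated by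
  \<open>(0, 2\<pi>)\<close> and a vector \<open>\<tau>(w)\<close> with \<open>\<tau>\<^sub>1 + i \<tau>\<^sub>2 = - ln (cnj w) + smooth\<close>: the logarithm is the time spent near \<open>m\<close>.

  The frequency vector of any action-angle coordinates is, up to integer combinations that are locally constant,
  given by \<open>a \<tau>\<^sub>1 - \<tau>\<^sub>2\<close> with \<open>a = H\<^sub>2 / H\<^sub>1\<close>, where \<open>H\<^sub>i\<close> are the partial derivatives of the energy with respect to
  \<open>w\<close>; both are non-zero since the eigenvalues are loxodromic. So the twist vanishes iff
  \<open>(- a \<partial>\<^sub>1 + \<partial>\<^sub>2) (a \<tau>\<^sub>1 - \<tau>\<^sub>2) = 0\<close>. Multiplied by \<open>|w|\<^sup>2\<close>, the left hand side extends to a \<open>C\<^sup>1\<close> function at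
  \<open>w = 0\<close> with differential \<open>(a\<^sup>2 - 1, - 2 a)\<close>, which is independent of the differential \<open>H\<^sub>1 (1, a)\<close> of the energy.
  By the inverse function theorem, each small energy has exactly one torus without twist near the singular fibre.
\<close>

section \<open>Calculus of smooth maps\<close>

text \<open>A trajectory is known only through the property of being a translation in suitable
  charts (\<open>orbit_map\<close>), so uniqueness, gluing and completeness have to come from
  connectedness and compactness. Everything global is read off from one map \<open>Phi\<close> of
  flow times and value w, started on the section |u| = \<open>dl\<close> of the Eliasson bidisc.
  There the value is cnj u * v, and the flow multiplies u and v by exp (s + i a) and exp (- s + i
  a); one complex equation for the passage therefore gives return time and return angle together.
  The choice of action-angle coordinates is harmless because the frequency ratio is always a
  projective map, with constant coefficients and non-zero determinant, of the same function of w,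
  and such maps have no critical points. After multiplication by |w|^2 the differentiated logarithm,
  a multiple of 1 / cnj w, becomes linear in w, and these linear terms decide the differential at 0.
  The undifferentiated logarithm becomes |w|^2 ln |w|, which is C^1 but not C^2. This is why the
  last step uses the C^1 inverse function theorem although all data are smooth.\<close>

lemma Ck_on_cong:
  fixes f g :: "'a::real_normed_vector \<Rightarrow> 'b::real_normed_vector"
  assumes "open S" and "\<And>x. x \<in> S \<Longrightarrow> f x = g x" and "Ck_on k f S"
  shows "Ck_on k g S"
  using assms(2,3)
proof (induction k arbitrary: f g)
  case 0
  then show ?case by (simp cong: continuous_on_cong)
next
  case (Suc k)
  have d: "(g has_derivative frechet_derivative f (at x)) (at x)" if "x \<in> S" for x
  proof -
    have "(f has_derivative frechet_derivative f (at x)) (at x)"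
      using Suc.prems that by (simp add: frechet_derivative_works)
    then show ?thesis
      by (rule has_derivative_transform_within_open[OF _ assms(1) that]) (use Suc.prems(1) in auto)
  qed
  have eq: "frechet_derivative g (at x) = frechet_derivative f (at x)" if "x \<in> S" for x
    using frechet_derivative_at[OF d[OF that]] by simp
  have "Ck_on k (\<lambda>x. frechet_derivative g (at x) v) S" for v
    by (rule Suc.IH[of "\<lambda>x. frechet_derivative f (at x) v"]) (use Suc.prems eq in auto)
  then show ?case
    using d by (simp) (metis differentiable_def)
qed

lemma Ck_on_SucI:
  assumes "open S" and "\<And>x. x \<in> S \<Longrightarrow> (f has_derivative f' x) (at x)"
    and "\<And>v. Ck_on k (\<lambda>x. f' x v) S"
  shows "Ck_on (Suc k) f S"
proof -
  have "Ck_on k (\<lambda>x. frechet_derivative f (at x) v) S" for v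
    by (rule Ck_on_cong[OF assms(1) _ assms(3)[of v]])
      (use frechet_derivative_at[OF assms(2)] in auto)
  then show ?thesis using assms(2) by (auto simp: differentiable_def)
qed

lemma Ck_on_has_derivative:
  assumes "Ck_on (Suc k) f S" and "x \<in> S"
  shows "(f has_derivative frechet_derivative f (at x)) (at x)"
  using assms by (simp add: frechet_derivative_works)

lemma Ck_on_continuous: "Ck_on k f S \<Longrightarrow> continuous_on S f"
  by (cases k) (auto intro!: continuous_at_imp_continuous_on differentiable_imp_continuous_within)

lemma Ck_on_SucD: "Ck_on (Suc k) f S \<Longrightarrow> Ck_on k f S"
proof (induction k arbitrary: f)
  case 0
  then show ?case using Ck_on_continuous[of "Suc 0" f S] by simp
next
  case (Suc k)
  have "\<forall>x\<in>S. f differentiable (at x)" using Suc.prems by simp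
  moreover have "Ck_on k (\<lambda>x. frechet_derivative f (at x) v) S" for v
    using Suc.IH[of "\<lambda>x. frechet_derivative f (at x) v"] Suc.prems by simp
  ultimately show ?case by simp
qed

lemma Ck_on_subset: "Ck_on k f S \<Longrightarrow> T \<subseteq> S \<Longrightarrow> Ck_on k f T"
  by (induction k arbitrary: f) (auto intro: continuous_on_subset)

lemma Ck_on_const [intro]: "open S \<Longrightarrow> Ck_on k (\<lambda>x. c) S"
proof (induction k arbitrary: c)
  case (Suc k)
  then show ?case by (intro Ck_on_SucI[where f' = "\<lambda>x v. 0"]) auto
qed auto

lemma Ck_on_bounded_linear: "open S \<Longrightarrow> bounded_linear f \<Longrightarrow> Ck_on k f S"
proof (cases k)
  case 0
  assume "bounded_linear f"
  then show ?thesis using 0 by (auto simp: linear_continuous_on)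
next
  case (Suc j)
  assume "open S" "bounded_linear f"
  then show ?thesis unfolding Suc
    by (intro Ck_on_SucI[where f' = "\<lambda>x. f"]) (auto intro: bounded_linear_imp_has_derivative)
qed

lemma Ck_on_add:
  assumes "open S"
  shows "Ck_on k f S \<Longrightarrow> Ck_on k g S \<Longrightarrow> Ck_on k (\<lambda>x. f x + g x) S"
proof (induction k arbitrary: f g)
  case 0
  then show ?case by (auto intro: continuous_on_add)
next
  case (Suc k)
  show ?case
  proof (rule Ck_on_SucI[OF assms])
    show "((\<lambda>x. f x + g x) has_derivative
        (\<lambda>v. frechet_derivative f (at x) v + frechet_derivative g (at x) v)) (at x)" if "x \<in> S" for x
      using Ck_on_has_derivative Suc.prems that by (intro has_derivative_add) blast+
  qed (use Suc in auto)
qed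

lemma Ck_on_compose_bounded_linear:
  assumes "open S" and h: "bounded_linear h"
  shows "Ck_on k f S \<Longrightarrow> Ck_on k (\<lambda>x. h (f x)) S"
proof (induction k arbitrary: f)
  case 0
  then show ?case
    using bounded_linear.continuous_on[OF h] by auto
next
  case (Suc k)
  show ?case
  proof (rule Ck_on_SucI[OF assms(1)])
    show "((\<lambda>x. h (f x)) has_derivative (\<lambda>v. h (frechet_derivative f (at x) v))) (at x)" if "x \<in> S" for x
      using Ck_on_has_derivative[OF Suc.prems that] bounded_linear.has_derivative[OF h] by blast
  qed (use Suc in auto)
qed

lemma Ck_on_bilinear:
  assumes "open S" and "bounded_bilinear h"
  shows "Ck_on k f S \<Longrightarrow> Ck_on k g S \<Longrightarrow> Ck_on k (\<lambda>x. h (f x) (g x)) S"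
proof (induction k arbitrary: f g)
  case 0
  then show ?case using bounded_bilinear.continuous_on[OF assms(2)] by auto
next
  case (Suc k)
  show ?case
  proof (rule Ck_on_SucI[OF assms(1)])
    show "((\<lambda>x. h (f x) (g x)) has_derivative
       (\<lambda>v. h (f x) (frechet_derivative g (at x) v) + h (frechet_derivative f (at x) v) (g x))) (at x)"
      if "x \<in> S" for x
      using bounded_bilinear.FDERIV[OF assms(2) Ck_on_has_derivative[OF Suc.prems(1) that]
        Ck_on_has_derivative[OF Suc.prems(2) that]] .
    show "Ck_on k (\<lambda>x. h (f x) (frechet_derivative g (at x) v) + h (frechet_derivative f (at x) v) (g x)) S"
      for v
      using Ck_on_SucD[OF Suc.prems(1)] Ck_on_SucD[OF Suc.prems(2)] Suc.prems
      by (intro Ck_on_add[OF assms(1)] Suc.IH) (simp_all only: Ck_on.simps)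
  qed
qed

lemma Ck_on_sum:
  "open S \<Longrightarrow> (\<And>i. i \<in> I \<Longrightarrow> Ck_on k (f i) S) \<Longrightarrow> Ck_on k (\<lambda>x. \<Sum>i\<in>I. f i x) S"
  by (induction I rule: infinite_finite_induct) (auto intro: Ck_on_add)

lemma Ck_on_prod:
  fixes f :: "'i \<Rightarrow> 'a::real_normed_vector \<Rightarrow> real"
  shows "open S \<Longrightarrow> (\<And>i. i \<in> I \<Longrightarrow> Ck_on k (f i) S) \<Longrightarrow> Ck_on k (\<lambda>x. \<Prod>i\<in>I. f i x) S"
  by (induction I rule: infinite_finite_induct) (auto intro: Ck_on_bilinear[OF _ bounded_bilinear_mult])

lemma linear_Basis_expand:
  fixes L :: "'a::euclidean_space \<Rightarrow> 'b::real_vector"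
  assumes "linear L"
  shows "L u = (\<Sum>b\<in>Basis. (u \<bullet> b) *\<^sub>R L b)"
proof -
  have "L u = L (\<Sum>b\<in>Basis. (u \<bullet> b) *\<^sub>R b)" by (simp only: euclidean_representation)
  also have "\<dots> = (\<Sum>b\<in>Basis. (u \<bullet> b) *\<^sub>R L b)"
    by (simp only: linear_sum[OF assms] linear_scale[OF assms])
  finally show ?thesis .
qed

text \<open>\<open>Ck_on\<close> differentiates in fixed directions only, whereas in Dg (f x) (Df x
  v) the direction moves with x. Expanding Df x v over \<open>Basis\<close> separates the two
  dependences into products, to which the induction hypothesis applies; hence the Euclidean middle
  space.\<close>

lemma Ck_on_compose:
  fixes f :: "'a::real_normed_vector \<Rightarrow> 'b::euclidean_space" and g :: "'b \<Rightarrow> 'c::real_normed_vector"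
  assumes "open S" "open T" "f ` S \<subseteq> T"
  shows "Ck_on k f S \<Longrightarrow> Ck_on k g T \<Longrightarrow> Ck_on k (\<lambda>x. g (f x)) S"
proof (induction k arbitrary: g)
  case 0
  then show ?case using assms by (auto intro: continuous_on_compose2)
next
  case (Suc k)
  show ?case
  proof (rule Ck_on_SucI[OF assms(1)])
    fix x assume x: "x \<in> S"
    have f: "(f has_derivative frechet_derivative f (at x)) (at x)"
      using Ck_on_has_derivative[OF Suc.prems(1) x] .
    have fx: "f x \<in> T" using x assms by auto
    have g: "(g has_derivative frechet_derivative g (at (f x))) (at (f x))"
      using Ck_on_has_derivative[OF Suc.prems(2) fx] .
    have lin: "linear (frechet_derivative g (at (f x)))" using g has_derivative_linear by blast
    have eq: "(\<lambda>v. frechet_derivative g (at (f x)) (frechet_derivative f (at x) v)) =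
        (\<lambda>v. \<Sum>b\<in>Basis. (frechet_derivative f (at x) v \<bullet> b) *\<^sub>R frechet_derivative g (at (f x)) b)"
      by (intro ext linear_Basis_expand[OF lin])
    show "((\<lambda>x. g (f x)) has_derivative (\<lambda>v. \<Sum>b\<in>Basis. (frechet_derivative f (at x) v \<bullet> b)
        *\<^sub>R frechet_derivative g (at (f x)) b)) (at x)"
      using has_derivative_compose[OF f g] unfolding eq .
  next
    fix v
    have "Ck_on k (\<lambda>x. frechet_derivative g (at (f x)) b) S" for b
      by (rule Suc.IH) (use Ck_on_SucD[OF Suc.prems(1)] Suc.prems(2) in \<open>simp_all only: Ck_on.simps\<close>)
    moreover have "Ck_on k (\<lambda>x. frechet_derivative f (at x) v \<bullet> b) S" for b
      using Suc.prems by (intro Ck_on_compose_bounded_linear[OF assms(1) bounded_linear_inner_left]) auto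
    ultimately show "Ck_on k (\<lambda>x. \<Sum>b\<in>Basis. (frechet_derivative f (at x) v \<bullet> b)
        *\<^sub>R frechet_derivative g (at (f x)) b) S"
      by (intro Ck_on_sum[OF assms(1)] Ck_on_bilinear[OF assms(1) bounded_bilinear_scaleR])
  qed
qed

lemma Ck_on_euclidean:
  fixes f :: "'a::real_normed_vector \<Rightarrow> 'b::euclidean_space"
  assumes "open S" "\<And>b. b \<in> Basis \<Longrightarrow> Ck_on k (\<lambda>x. f x \<bullet> b) S"
  shows "Ck_on k f S"
proof -
  have "Ck_on k (\<lambda>x. \<Sum>b\<in>Basis. (f x \<bullet> b) *\<^sub>R b) S"
    using assms by (intro Ck_on_sum Ck_on_bilinear[OF _ bounded_bilinear_scaleR]) auto
  then show ?thesis by (simp add: euclidean_representation)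
qed

lemma Ck_on_inverse:
  fixes f :: "'a::real_normed_vector \<Rightarrow> 'b::real_normed_field"
  assumes "open S" "\<And>x. x \<in> S \<Longrightarrow> f x \<noteq> 0"
  shows "Ck_on k f S \<Longrightarrow> Ck_on k (\<lambda>x. inverse (f x)) S"
proof (induction k)
  case 0
  then show ?case using assms by (auto intro: continuous_on_inverse)
next
  case (Suc k)
  show ?case
  proof (rule Ck_on_SucI[OF assms(1)])
    show "((\<lambda>x. inverse (f x)) has_derivative
        (\<lambda>v. - (inverse (f x) * frechet_derivative f (at x) v * inverse (f x)))) (at x)" if "x \<in> S" for x
      using Ck_on_has_derivative[OF Suc.prems that] assms(2)[OF that] by (rule Deriv.has_derivative_inverse[rotated])
    have "Ck_on k (\<lambda>x. inverse (f x)) S" using Suc Ck_on_SucD by blast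
    then show "Ck_on k (\<lambda>x. - (inverse (f x) * frechet_derivative f (at x) v * inverse (f x))) S" for v
      using Suc.prems
      by (intro Ck_on_compose_bounded_linear[OF assms(1) bounded_linear_minus[OF bounded_linear_ident]]
          Ck_on_bilinear[OF assms(1) bounded_bilinear_mult]) auto
  qed
qed

lemma Ck_on_exp:
  fixes f :: "'a::real_normed_vector \<Rightarrow> 'b::{real_normed_field,banach}"
  assumes "open S"
  shows "Ck_on k f S \<Longrightarrow> Ck_on k (\<lambda>x. exp (f x)) S"
proof (induction k)
  case 0
  then show ?case by (auto intro: continuous_on_exp)
next
  case (Suc k)
  show ?case
  proof (rule Ck_on_SucI[OF assms(1)])
    show "((\<lambda>x. exp (f x)) has_derivative (\<lambda>v. frechet_derivative f (at x) v * exp (f x))) (at x)"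
      if "x \<in> S" for x
    proof -
      have "(exp has_derivative (\<lambda>v. exp (f x) * v)) (at (f x))"
        using DERIV_exp[of "f x"] by (simp add: has_field_derivative_def)
      from has_derivative_compose[OF Ck_on_has_derivative[OF Suc.prems that] this]
      show ?thesis by (simp add: mult.commute)
    qed
    have "Ck_on k (\<lambda>x. exp (f x)) S" using Suc Ck_on_SucD by blast
    then show "Ck_on k (\<lambda>x. frechet_derivative f (at x) v * exp (f x)) S" for v
      using Suc.prems by (intro Ck_on_bilinear[OF assms(1) bounded_bilinear_mult]) auto
  qed
qed

lemma Ck_on_ln:
  assumes "open S" "\<And>x. x \<in> S \<Longrightarrow> f x > (0::real)" "Ck_on k f S"
  shows "Ck_on k (\<lambda>x. ln (f x)) S"
proof (cases k)
  case 0
  then show ?thesis using assms by (auto intro!: continuous_intros dest: assms(2))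
next
  case (Suc j)
  show ?thesis unfolding Suc
  proof (rule Ck_on_SucI[OF assms(1)])
    show "((\<lambda>x. ln (f x)) has_derivative (\<lambda>v. frechet_derivative f (at x) v * inverse (f x))) (at x)"
      if "x \<in> S" for x
      using Ck_on_has_derivative[OF assms(3)[unfolded Suc] that] assms(2)[OF that]
      by (auto intro!: derivative_eq_intros simp: divide_inverse)
    show "Ck_on j (\<lambda>x. frechet_derivative f (at x) v * inverse (f x)) S" for v
      using assms(3) Ck_on_SucD[OF assms(3)[unfolded Suc]] assms(2)
      by (intro Ck_on_bilinear[OF assms(1) bounded_bilinear_mult] Ck_on_inverse[OF assms(1)])
        (auto simp: Suc less_imp_neq[symmetric])
  qed
qed

lemma has_derivative_Ln:
  assumes "(f has_derivative f') (at x)" "f x \<notin> \<real>\<^sub>\<le>\<^sub>0"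
  shows "((\<lambda>x. Ln (f x)) has_derivative (\<lambda>v. f' v * inverse (f x))) (at x)"
proof -
  have "(Ln has_derivative (\<lambda>v. inverse (f x) * v)) (at (f x))"
    using has_field_derivative_Ln[OF assms(2)] by (simp add: has_field_derivative_def)
  from has_derivative_compose[OF assms(1) this] show ?thesis by (simp add: mult.commute)
qed

lemma Ck_on_Ln:
  assumes "open S" "\<And>x. x \<in> S \<Longrightarrow> f x \<notin> \<real>\<^sub>\<le>\<^sub>0" "Ck_on k f S"
  shows "Ck_on k (\<lambda>x. Ln (f x)) S"
proof (cases k)
  case 0
  then show ?thesis using assms by (auto intro: continuous_on_compose2[OF continuous_on_Ln[of "f ` S"]])
next
  case (Suc j)
  have nz: "f x \<noteq> 0" if "x \<in> S" for x using assms(2)[OF that] by auto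
  show ?thesis unfolding Suc
  proof (rule Ck_on_SucI[OF assms(1)])
    show "((\<lambda>x. Ln (f x)) has_derivative (\<lambda>v. frechet_derivative f (at x) v * inverse (f x))) (at x)"
      if "x \<in> S" for x
      using Ck_on_has_derivative[OF assms(3)[unfolded Suc] that] assms(2)[OF that]
      by (rule has_derivative_Ln)
    show "Ck_on j (\<lambda>x. frechet_derivative f (at x) v * inverse (f x)) S" for v
      using assms(3) Ck_on_SucD[OF assms(3)[unfolded Suc]] nz
      by (intro Ck_on_bilinear[OF assms(1) bounded_bilinear_mult] Ck_on_inverse[OF assms(1)]) (auto simp: Suc)
  qed
qed

section \<open>Closure properties of smooth maps\<close>

lemma smooth_on_Ck: "smooth_on f S \<Longrightarrow> Ck_on k f S"
  by (simp add: smooth_on_def)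

lemma smooth_on_has_derivative:
  assumes "smooth_on f S" "x \<in> S"
  shows "(f has_derivative frechet_derivative f (at x)) (at x)"
  using Ck_on_has_derivative[of 0 f S] assms smooth_on_Ck by blast

lemma smooth_on_continuous: "smooth_on f S \<Longrightarrow> continuous_on S f"
  using smooth_on_Ck[of f S 0] by simp

lemma smooth_on_frechet_derivative: "smooth_on f S \<Longrightarrow> smooth_on (\<lambda>x. frechet_derivative f (at x) v) S"
  unfolding smooth_on_def using Ck_on.simps(2) by blast

lemma smooth_on_subset: "smooth_on f S \<Longrightarrow> T \<subseteq> S \<Longrightarrow> smooth_on f T"
  unfolding smooth_on_def using Ck_on_subset by blast

lemma smooth_on_cong:
  "open S \<Longrightarrow> (\<And>x. x \<in> S \<Longrightarrow> f x = g x) \<Longrightarrow> smooth_on f S \<Longrightarrow> smooth_on g S"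
  unfolding smooth_on_def by (intro allI Ck_on_cong[of S f g]) auto


lemma Ck_on_local:
  assumes "\<And>x. x \<in> S \<Longrightarrow> \<exists>T. open T \<and> x \<in> T \<and> Ck_on k f T"
  shows "Ck_on k f S"
  using assms
proof (induction k arbitrary: f)
  case 0
  have "isCont f x" if x: "x \<in> S" for x
  proof -
    obtain T where "open T" "x \<in> T" "continuous_on T f" using 0 x by auto
    then show ?thesis using continuous_on_eq_continuous_at by blast
  qed
  then show ?case by (simp add: continuous_at_imp_continuous_on)
next
  case (Suc k)
  have "Ck_on k (\<lambda>x. frechet_derivative f (at x) v) S" for v
  proof (rule Suc.IH)
    fix x assume "x \<in> S"
    from Suc.prems[OF this] obtain T where "open T" "x \<in> T" "Ck_on (Suc k) f T" by blast
    then show "\<exists>T. open T \<and> x \<in> T \<and> Ck_on k (\<lambda>x. frechet_derivative f (at x) v) T"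
      by (intro exI[of _ T]) simp
  qed
  moreover have "f differentiable (at x)" if x: "x \<in> S" for x
  proof -
    obtain T where "x \<in> T" "Ck_on (Suc k) f T" using Suc.prems[OF x] by blast
    then show ?thesis by simp
  qed
  ultimately show ?case by simp
qed

lemma smooth_on_local:
  assumes "\<And>x. x \<in> S \<Longrightarrow> \<exists>T. open T \<and> x \<in> T \<and> smooth_on f T"
  shows "smooth_on f S"
  unfolding smooth_on_def
proof (intro allI Ck_on_local)
  fix k x assume "x \<in> S"
  from assms[OF this] obtain T where "open T" "x \<in> T" "smooth_on f T" by blast
  then show "\<exists>T. open T \<and> x \<in> T \<and> Ck_on k f T"
    by (intro exI[of _ T]) (simp add: smooth_on_def)
qed

lemma smooth_on_const: "open S \<Longrightarrow> smooth_on (\<lambda>x. c) S"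
  unfolding smooth_on_def by auto

lemma smooth_on_bounded_linear: "open S \<Longrightarrow> bounded_linear f \<Longrightarrow> smooth_on f S"
  unfolding smooth_on_def using Ck_on_bounded_linear by blast

lemma smooth_on_compose_bounded_linear:
  "open S \<Longrightarrow> smooth_on f S \<Longrightarrow> bounded_linear h \<Longrightarrow> smooth_on (\<lambda>x. h (f x)) S"
  unfolding smooth_on_def using Ck_on_compose_bounded_linear by blast

lemma smooth_on_add:
  "open S \<Longrightarrow> smooth_on f S \<Longrightarrow> smooth_on g S \<Longrightarrow> smooth_on (\<lambda>x. f x + g x) S"
  unfolding smooth_on_def using Ck_on_add by blast

lemma smooth_on_minus: "open S \<Longrightarrow> smooth_on f S \<Longrightarrow> smooth_on (\<lambda>x. - f x) S"
  using smooth_on_compose_bounded_linear[OF _ _ bounded_linear_minus[OF bounded_linear_ident]] .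

lemma smooth_on_diff:
  "open S \<Longrightarrow> smooth_on f S \<Longrightarrow> smooth_on g S \<Longrightarrow> smooth_on (\<lambda>x. f x - g x) S"
  using smooth_on_add[of S f "\<lambda>x. - g x"] smooth_on_minus[of S g] by simp

lemma smooth_on_bilinear:
  "open S \<Longrightarrow> bounded_bilinear h \<Longrightarrow> smooth_on f S \<Longrightarrow> smooth_on g S \<Longrightarrow> smooth_on (\<lambda>x. h (f x) (g x)) S"
  unfolding smooth_on_def by (intro allI Ck_on_bilinear[of S h _ f g]) auto

lemmas smooth_on_mult = smooth_on_bilinear[OF _ bounded_bilinear_mult]
lemmas smooth_on_scaleR = smooth_on_bilinear[OF _ bounded_bilinear_scaleR]
lemmas smooth_on_inner = smooth_on_bilinear[OF _ bounded_bilinear_inner]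

lemma smooth_on_inverse:
  fixes f :: "'a::real_normed_vector \<Rightarrow> 'b::real_normed_field"
  shows "open S \<Longrightarrow> smooth_on f S \<Longrightarrow> (\<And>x. x \<in> S \<Longrightarrow> f x \<noteq> 0) \<Longrightarrow> smooth_on (\<lambda>x. inverse (f x)) S"
  unfolding smooth_on_def by (intro allI Ck_on_inverse[of S f]) auto

lemma smooth_on_divide:
  fixes f :: "'a::real_normed_vector \<Rightarrow> 'b::real_normed_field"
  shows "open S \<Longrightarrow> smooth_on f S \<Longrightarrow> smooth_on g S \<Longrightarrow> (\<And>x. x \<in> S \<Longrightarrow> g x \<noteq> 0) \<Longrightarrow> smooth_on (\<lambda>x. f x / g x) S"
  unfolding divide_inverse by (intro smooth_on_mult smooth_on_inverse)

lemma smooth_on_exp: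
  fixes f :: "'a::real_normed_vector \<Rightarrow> 'b::{real_normed_field,banach}"
  shows "open S \<Longrightarrow> smooth_on f S \<Longrightarrow> smooth_on (\<lambda>x. exp (f x)) S"
  unfolding smooth_on_def by (intro allI Ck_on_exp[of S _ f]) auto

lemma smooth_on_ln:
  "open S \<Longrightarrow> smooth_on f S \<Longrightarrow> (\<And>x. x \<in> S \<Longrightarrow> f x > (0::real)) \<Longrightarrow> smooth_on (\<lambda>x. ln (f x)) S"
  unfolding smooth_on_def by (intro allI Ck_on_ln[of S f]) auto

lemma smooth_on_Ln:
  "open S \<Longrightarrow> smooth_on f S \<Longrightarrow> (\<And>x. x \<in> S \<Longrightarrow> f x \<notin> \<real>\<^sub>\<le>\<^sub>0) \<Longrightarrow> smooth_on (\<lambda>x. Ln (f x)) S"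
  unfolding smooth_on_def by (intro allI Ck_on_Ln[of S f]) auto

lemma smooth_on_compose:
  fixes f :: "'a::real_normed_vector \<Rightarrow> 'b::euclidean_space" and g :: "'b \<Rightarrow> 'c::real_normed_vector"
  shows "open S \<Longrightarrow> open T \<Longrightarrow> smooth_on f S \<Longrightarrow> smooth_on g T \<Longrightarrow> f ` S \<subseteq> T \<Longrightarrow> smooth_on (\<lambda>x. g (f x)) S"
  unfolding smooth_on_def by (intro allI Ck_on_compose[of S T f _ g]) auto

lemma smooth_on_nth: "open S \<Longrightarrow> smooth_on f S \<Longrightarrow> smooth_on (\<lambda>x. f x $ i) S"
  using smooth_on_compose_bounded_linear[OF _ _ bounded_linear_vec_nth] .

lemma smooth_on_fst: "open S \<Longrightarrow> smooth_on f S \<Longrightarrow> smooth_on (\<lambda>x. fst (f x)) S"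
  using smooth_on_compose_bounded_linear[OF _ _ bounded_linear_fst] .

lemma smooth_on_snd: "open S \<Longrightarrow> smooth_on f S \<Longrightarrow> smooth_on (\<lambda>x. snd (f x)) S"
  using smooth_on_compose_bounded_linear[OF _ _ bounded_linear_snd] .

lemma smooth_on_Pair:
  fixes f :: "'a::real_normed_vector \<Rightarrow> 'b::real_normed_vector"
    and g :: "'a \<Rightarrow> 'c::real_normed_vector"
  assumes "open S" "smooth_on f S" "smooth_on g S"
  shows "smooth_on (\<lambda>x. (f x, g x)) S"
proof -
  have 1: "bounded_linear (\<lambda>x::'b. (x, 0::'c))"
    by (intro bounded_linear_Pair bounded_linear_ident bounded_linear_zero)
  have 2: "bounded_linear (\<lambda>x::'c. (0::'b, x))"
    by (intro bounded_linear_Pair bounded_linear_ident bounded_linear_zero)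
  have "smooth_on (\<lambda>x. (f x, 0) + (0, g x)) S"
    using smooth_on_add[OF assms(1) smooth_on_compose_bounded_linear[OF assms(1,2) 1]
        smooth_on_compose_bounded_linear[OF assms(1,3) 2]] .
  then show ?thesis by simp
qed

lemma smooth_on_ident: "open S \<Longrightarrow> smooth_on (\<lambda>x. x) S"
  using smooth_on_bounded_linear[OF _ bounded_linear_ident] .

lemmas smooth_intros = smooth_on_add smooth_on_diff smooth_on_minus smooth_on_mult smooth_on_scaleR
  smooth_on_const smooth_on_ident smooth_on_nth smooth_on_fst smooth_on_snd smooth_on_Pair

lemma smooth_on_cnj: "open S \<Longrightarrow> smooth_on f S \<Longrightarrow> smooth_on (\<lambda>x. cnj (f x)) S"
  using smooth_on_compose_bounded_linear[OF _ _ bounded_linear_cnj] .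

lemma smooth_on_Re: "open S \<Longrightarrow> smooth_on f S \<Longrightarrow> smooth_on (\<lambda>x. Re (f x)) S"
  using smooth_on_compose_bounded_linear[OF _ _ bounded_linear_Re] .

lemma smooth_on_Im: "open S \<Longrightarrow> smooth_on f S \<Longrightarrow> smooth_on (\<lambda>x. Im (f x)) S"
  using smooth_on_compose_bounded_linear[OF _ _ bounded_linear_Im] .

lemma smooth_on_of_real:
  "open S \<Longrightarrow> smooth_on f S \<Longrightarrow> smooth_on (\<lambda>x. complex_of_real (f x)) S"
  using smooth_on_compose_bounded_linear[OF _ _ bounded_linear_of_real] .

lemma smooth_on_Complex:
  assumes "open S" "smooth_on f S" "smooth_on g S"
  shows "smooth_on (\<lambda>x. Complex (f x) (g x)) S"
proof -
  have "smooth_on (\<lambda>x. complex_of_real (f x) + \<i> * complex_of_real (g x)) S"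
    using assms by (intro smooth_on_add smooth_on_mult smooth_on_const smooth_on_of_real)
  then show ?thesis by (simp only: Complex_eq)
qed

section \<open>Inverse functions, parameter integrals and primitives\<close>

lemma Ck_on_divide:
  fixes f :: "'a::real_normed_vector \<Rightarrow> 'b::real_normed_field"
  assumes "open S" "Ck_on k f S" "Ck_on k g S" "\<And>x. x \<in> S \<Longrightarrow> g x \<noteq> 0"
  shows "Ck_on k (\<lambda>x. f x / g x) S"
  unfolding divide_inverse
  using Ck_on_bilinear[OF assms(1) bounded_bilinear_mult assms(2) Ck_on_inverse[OF assms(1,4,3)]] .

lemma Ck_on_nth: "open S \<Longrightarrow> Ck_on k f S \<Longrightarrow> Ck_on k (\<lambda>x. f x $ i) S"
  using Ck_on_compose_bounded_linear[OF _ bounded_linear_vec_nth] .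

lemma Ck_on_vec:
  fixes f :: "'a::real_normed_vector \<Rightarrow> real ^ 'n"
  assumes "open S" "\<And>i. Ck_on k (\<lambda>x. f x $ i) S"
  shows "Ck_on k f S"
  using assms by (intro Ck_on_euclidean[of S k f]) (auto simp: Basis_vec_def inner_axis)

lemma Ck_on_det:
  fixes M :: "'a::real_normed_vector \<Rightarrow> real ^ 'n ^ 'n"
  assumes "open S" "\<And>i j. Ck_on k (\<lambda>x. M x $ i $ j) S"
  shows "Ck_on k (\<lambda>x. det (M x)) S"
proof -
  have "Ck_on k (\<lambda>x. \<Sum>p\<in>{p. p permutes UNIV}. of_int (sign p) * (\<Prod>i\<in>UNIV. M x $ i $ p i)) S"
  proof (rule Ck_on_sum[OF assms(1)])
    fix p :: "'n \<Rightarrow> 'n"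
    have "Ck_on k (\<lambda>x. \<Prod>i\<in>UNIV. M x $ i $ p i) S"
      by (rule Ck_on_prod[OF assms(1)]) (rule assms(2))
    then show "Ck_on k (\<lambda>x. of_int (sign p) * (\<Prod>i\<in>UNIV. M x $ i $ p i)) S"
      using Ck_on_bilinear[OF assms(1) bounded_bilinear_mult Ck_on_const[OF assms(1)]] by blast
  qed
  then show ?thesis by (simp add: det_def)
qed

text \<open>Cramer's rule.\<close>

lemma Ck_on_linear_inverse:
  fixes L :: "'a::real_normed_vector \<Rightarrow> real ^ 'n \<Rightarrow> real ^ 'n"
  assumes S: "open S" and lin: "\<And>x. x \<in> S \<Longrightarrow> linear (L x)" and inj: "\<And>x. x \<in> S \<Longrightarrow> inj (L x)"
    and Ck: "\<And>v. Ck_on k (\<lambda>x. L x v) S"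
  shows "Ck_on k (\<lambda>x. inv (L x) v) S"
proof -
  define M where "M x = matrix (L x)" for x
  have MCk: "Ck_on k (\<lambda>x. M x $ i $ j) S" for i j
    unfolding M_def matrix_def using Ck_on_nth[OF S Ck[of "axis j 1"], of i] by simp
  have det: "det (M x) \<noteq> 0" if "x \<in> S" for x
    using inj[OF that] lin[OF that] unfolding M_def
    by (simp add: det_nz_iff_inj)
  have *: "Ck_on k (\<lambda>x. \<chi> l. det (\<chi> i j. if j = l then v $ i else M x $ i $ j) / det (M x)) S"
  proof (rule Ck_on_vec[OF S])
    fix l
    have "Ck_on k (\<lambda>x. det (\<chi> i j. if j = l then v $ i else M x $ i $ j)) S"
    proof (rule Ck_on_det[OF S])
      show "Ck_on k (\<lambda>x. (\<chi> i j. if j = l then v $ i else M x $ i $ j) $ i $ j) S" for i j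
        using MCk[of i j] Ck_on_const[OF S] by (cases "j = l") auto
    qed
    then show "Ck_on k (\<lambda>x. (\<chi> l. det (\<chi> i j. if j = l then v $ i else M x $ i $ j) / det (M x)) $ l) S"
      using Ck_on_divide[OF S _ Ck_on_det[OF S MCk]] det by simp
  qed
  show ?thesis
  proof (rule Ck_on_cong[OF S _ *])
    fix x assume x: "x \<in> S"
    have "M x *v inv (L x) v = v"
      unfolding M_def fun_cong[OF matrix_vector_mul(2)[OF lin[OF x]]]
      using linear_injective_imp_surjective[OF lin[OF x] inj[OF x]] by (simp add: surj_f_inv_f)
    from iffD1[OF cramer[OF det[OF x]] this]
    show "(\<chi> l. det (\<chi> i j. if j = l then v $ i else M x $ i $ j) / det (M x)) = inv (L x) v"
      by (rule sym)
  qed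
qed

text \<open>In finite dimension, continuity of an operator-valued map can be tested on basis
  vectors. This translates directional C^1 regularity into the operator form that the inverse
  function theorem expects.\<close>

lemma continuous_on_Blinfun_frechet_derivative:
  fixes f :: "'a::euclidean_space \<Rightarrow> 'b::real_normed_vector"
  assumes "Ck_on (Suc 0) f S"
  shows "continuous_on S (\<lambda>x. Blinfun (frechet_derivative f (at x)))"
proof (rule continuous_on_blinfun_componentwise)
  fix i :: 'a assume "i \<in> Basis"
  have "continuous_on S (\<lambda>x. frechet_derivative f (at x) i)" using assms by simp
  moreover have "blinfun_apply (Blinfun (frechet_derivative f (at x))) i = frechet_derivative f (at x) i"
    if "x \<in> S" for x
    using Ck_on_has_derivative[OF assms that] has_derivative_bounded_linear
    by (auto simp: bounded_linear_Blinfun_apply)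
  ultimately show "continuous_on S (\<lambda>x. blinfun_apply (Blinfun (frechet_derivative f (at x))) i)"
    by (simp cong: continuous_on_cong)
qed

text \<open>Kept at C^1 regularity because the twist function at the end is only C^1 at the origin.
  Bijectivity of the derivative on the whole of \<open>U'\<close> is recorded for the smooth
  bootstrap.\<close>

lemma C1_inverse_function:
  fixes f :: "'a::euclidean_space \<Rightarrow> 'a"
  assumes "open U" "Ck_on (Suc 0) f U" "x0 \<in> U" "inj (frechet_derivative f (at x0))"
  obtains U' V g where "open U'" "U' \<subseteq> U" "x0 \<in> U'" "open V" "homeomorphism U' V f g"
    "\<And>y. y \<in> V \<Longrightarrow> (g has_derivative inv (frechet_derivative f (at (g y)))) (at y)"
    "\<And>x. x \<in> U' \<Longrightarrow> bij (frechet_derivative f (at x))"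
proof -
  let ?f' = "\<lambda>x. Blinfun (frechet_derivative f (at x))"
  have d: "(f has_derivative frechet_derivative f (at x)) (at x)" if "x \<in> U" for x
    using Ck_on_has_derivative[OF assms(2) that] .
  have ap: "blinfun_apply (?f' x) = frechet_derivative f (at x)" if "x \<in> U" for x
    using d[OF that] has_derivative_bounded_linear by (auto simp: bounded_linear_Blinfun_apply)
  obtain h where h: "linear h" "h \<circ> frechet_derivative f (at x0) = id"
    using linear_injective_left_inverse[OF has_derivative_linear[OF d[OF assms(3)]] assms(4)] by blast
  have "Blinfun h o\<^sub>L ?f' x0 = id_blinfun"
    using h by (intro blinfun_eqI)
      (simp add: ap[OF assms(3)] bounded_linear_Blinfun_apply linear_conv_bounded_linear[symmetric] o_def fun_eq_iff)
  from inverse_function_theorem[OF assms(1) _ continuous_on_Blinfun_frechet_derivative[OF assms(2)] assms(3) this]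
  obtain U' V g g' where *: "open U'" "U' \<subseteq> U" "x0 \<in> U'" "open V" "f x0 \<in> V" "homeomorphism U' V f g"
    "\<And>y. y \<in> V \<Longrightarrow> (g has_derivative g' y) (at y)"
    "\<And>y. y \<in> V \<Longrightarrow> g' y = inv (blinfun_apply (?f' (g y)))"
    "\<And>y. y \<in> V \<Longrightarrow> bij (blinfun_apply (?f' (g y)))"
    using d ap by (metis (no_types, lifting))
  have gU: "g y \<in> U'" if "y \<in> V" for y using *(6) that by (auto simp: homeomorphism_def)
  show thesis
  proof (rule that[OF *(1-4) *(6)])
    show "(g has_derivative inv (frechet_derivative f (at (g y)))) (at y)" if "y \<in> V" for y
      using *(7)[OF that] *(8)[OF that] ap[of "g y"] gU[OF that] *(2) by auto
    show "bij (frechet_derivative f (at x))" if "x \<in> U'" for x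
    proof -
      have "f x \<in> V" "g (f x) = x" using *(6) that by (auto simp: homeomorphism_def)
      then show ?thesis using *(9)[of "f x"] ap[of x] that *(2) by auto
    qed
  qed
qed

text \<open>Bootstrap on the formula Dg y = (Df (g y))^(-1): if g is C^k, then so is the right hand
  side, since inversion of matrices is rational, and g is C^(k+1).\<close>

lemma smooth_inverse_function:
  fixes f :: "real ^ 'n \<Rightarrow> real ^ 'n"
  assumes U: "open U" and f: "smooth_on f U" and "x0 \<in> U" "inj (frechet_derivative f (at x0))"
  obtains U' where "U' \<subseteq> U" "x0 \<in> U'" "smooth_diffeo f U'"
    "\<And>x. x \<in> U' \<Longrightarrow> inj (frechet_derivative f (at x))"
proof -
  obtain U' V g where *: "open U'" "U' \<subseteq> U" "x0 \<in> U'" "open V" "homeomorphism U' V f g"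
    "\<And>y. y \<in> V \<Longrightarrow> (g has_derivative inv (frechet_derivative f (at (g y)))) (at y)"
    "\<And>x. x \<in> U' \<Longrightarrow> bij (frechet_derivative f (at x))"
    using C1_inverse_function[OF U smooth_on_Ck[OF f] assms(3,4)] by metis
  have V: "f ` U' = V" and gf: "\<And>x. x \<in> U' \<Longrightarrow> g (f x) = x" and gV: "g ` V = U'"
    using *(5) by (auto simp: homeomorphism_def)
  have Ckg: "Ck_on k g V" for k
  proof (induction k)
    case 0
    then show ?case using *(5) by (simp add: homeomorphism_def)
  next
    case (Suc k)
    show ?case
    proof (rule Ck_on_SucI[OF *(4,6)])
      fix v
      have "Ck_on k (\<lambda>y. frechet_derivative f (at (g y)) w) V" for w
        using Ck_on_compose[OF *(4) *(1) _ Suc, of "\<lambda>x. frechet_derivative f (at x) w"]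
          smooth_on_Ck[OF smooth_on_frechet_derivative[OF smooth_on_subset[OF f *(2)]]] gV by simp
      then show "Ck_on k (\<lambda>y. inv (frechet_derivative f (at (g y))) v) V"
        using gV *(2) bij_is_inj[OF *(7)] has_derivative_linear[OF smooth_on_has_derivative[OF f]]
        by (intro Ck_on_linear_inverse[OF *(4)]) (auto dest: imageI[of _ V g])
    qed
  qed
  have inj: "inj_on f U'" using gf by (metis inj_onI)
  have eq: "g y = inv_into U' f y" if "y \<in> V" for y
    using that V gf inj by (auto simp: inv_into_f_f)
  have "smooth_on (inv_into U' f) V"
    by (rule smooth_on_cong[OF *(4) eq]) (simp_all add: Ckg smooth_on_def)
  then have "smooth_diffeo f U'"
    using *(1,4) V inj smooth_on_subset[OF f *(2)] by (simp add: smooth_diffeo_def)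
  then show thesis using that[OF *(2,3)] bij_is_inj[OF *(7)] by blast
qed

lemma smooth_diffeo_subset:
  assumes "smooth_diffeo f S" "open T" "T \<subseteq> S"
  shows "smooth_diffeo f T"
proof -
  have S: "open S" "open (f ` S)" "inj_on f S" "smooth_on f S" "smooth_on (inv_into S f) (f ` S)"
    using assms by (auto simp: smooth_diffeo_def)
  have "f ` T = f ` S \<inter> inv_into S f -` T"
    using assms(3) S(3) by (auto simp: inv_into_f_f subset_iff f_inv_into_f image_iff)
  then have o: "open (f ` T)"
    using continuous_open_preimage[OF smooth_on_continuous[OF S(5)] S(2) assms(2)] by simp
  have "smooth_on (inv_into T f) (f ` T)"
  proof (rule smooth_on_cong[OF o])
    show "smooth_on (inv_into S f) (f ` T)" using smooth_on_subset[OF S(5)] assms(3) by blast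
    fix y assume "y \<in> f ` T"
    then show "inv_into S f y = inv_into T f y"
      using assms(3) S(3) inj_on_subset[OF S(3) assms(3)] by (auto simp: inv_into_f_f subset_iff)
  qed
  then show ?thesis
    using o assms S smooth_on_subset[OF S(4) assms(3)] inj_on_subset[OF S(3) assms(3)]
    by (simp add: smooth_diffeo_def)
qed

text \<open>Derivatives in \<open>Ck_on\<close> are two-sided, so at s = 0 and s = 1 the integrand
  has to be defined beyond the strip; the set \<open>Q\<close> provides this room.\<close>

lemma has_derivative_parameter_integral:
  fixes f :: "real \<times> 'a::euclidean_space \<Rightarrow> real"
  assumes S: "open S" and sub: "{0..1} \<times> S \<subseteq> Q" and f: "Ck_on (Suc 0) f Q" and x: "x \<in> S"
  shows "((\<lambda>x. integral {0..1} (\<lambda>s. f (s, x))) has_derivative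
      (\<lambda>v. integral {0..1} (\<lambda>s. frechet_derivative f (at (s, x)) (0, v)))) (at x)"
proof -
  obtain r where r: "r > 0" "ball x r \<subseteq> S" using S x open_contains_ball by blast
  define fx where "fx y s = Blinfun (\<lambda>v. frechet_derivative f (at (s, y)) (0, v))" for y s
  have bl: "bounded_linear (\<lambda>v::'a. (0::real, v))"
    by (intro bounded_linear_Pair bounded_linear_ident bounded_linear_zero)
  have d: "(f has_derivative frechet_derivative f (at (s, y))) (at (s, y))"
    if "y \<in> ball x r" "s \<in> cbox 0 1" for s y
    by (rule Ck_on_has_derivative[OF f subsetD[OF sub]]) (use that r in auto)
  have bl2: "bounded_linear (\<lambda>v. frechet_derivative f (at (s, y)) (0, v))"
    if "y \<in> ball x r" "s \<in> cbox 0 1" for s y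
    using bounded_linear_compose[OF has_derivative_bounded_linear[OF d[OF that]] bl] .
  have ap: "blinfun_apply (fx y s) v = frechet_derivative f (at (s, y)) (0, v)"
    if "y \<in> ball x r" "s \<in> cbox 0 1" for s y v
    unfolding fx_def using bl2[OF that] by (simp add: bounded_linear_Blinfun_apply)
  have fcont: "continuous_on Q f" using f Ck_on_continuous by blast
  have cont: "continuous_on (ball x r \<times> cbox 0 1) (\<lambda>(y, s). fx y s)"
  proof (rule continuous_on_blinfun_componentwise)
    fix i :: 'a assume "i \<in> Basis"
    have c1: "continuous_on Q (\<lambda>z. frechet_derivative f (at z) (0, i))" using f by simp
    have "continuous_on (ball x r \<times> cbox 0 1) (\<lambda>p. frechet_derivative f (at (snd p, fst p)) (0, i))"
    proof (rule continuous_on_compose2[OF c1])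
      show "(\<lambda>p. (snd p, fst p)) ` (ball x r \<times> cbox 0 1) \<subseteq> Q"
        using r by (force intro!: subsetD[OF sub])
    qed (intro continuous_intros)
    then show "continuous_on (ball x r \<times> cbox 0 1) (\<lambda>p. blinfun_apply (case p of (y, s) \<Rightarrow> fx y s) i)"
      by (rule continuous_on_eq) (auto simp: ap)
  qed
  have "((\<lambda>y. integral (cbox 0 1) (\<lambda>s. f (s, y))) has_derivative
      blinfun_apply (integral (cbox 0 1) (fx x))) (at x within ball x r)"
  proof (rule leibniz_rule[OF _ _ cont])
    fix y s assume ys: "y \<in> ball x r" "s \<in> cbox (0::real) 1"
    have i: "((\<lambda>y::'a. (s, y)) has_derivative (\<lambda>v. (0, v))) (at y)"
      by (intro has_derivative_Pair has_derivative_const has_derivative_ident)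
    have "((\<lambda>y. f (s, y)) has_derivative (\<lambda>v. frechet_derivative f (at (s, y)) (0, v))) (at y)"
      by (rule has_derivative_compose[OF i d[OF ys]])
    then show "((\<lambda>y. f (s, y)) has_derivative blinfun_apply (fx y s)) (at y within ball x r)"
      using ap[OF ys] has_derivative_at_withinI by (metis (no_types, lifting) ext)
  next
    fix y assume y: "y \<in> ball x r"
    have "continuous_on (cbox 0 1) (\<lambda>s. f (s, y))"
    proof (rule continuous_on_compose2[OF fcont])
      show "(\<lambda>s. (s, y)) ` cbox 0 1 \<subseteq> Q"
        using r y by (force intro!: subsetD[OF sub])
    qed (intro continuous_intros)
    then show "(\<lambda>s. f (s, y)) integrable_on cbox 0 1" by (rule integrable_continuous)
  qed (use r in auto)
  then have 1: "((\<lambda>y. integral {0..1} (\<lambda>s. f (s, y))) has_derivative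
      blinfun_apply (integral (cbox 0 1) (fx x))) (at x)"
    unfolding at_within_open[OF centre_in_ball[THEN iffD2, OF r(1)] open_ball] cbox_interval .
  have "continuous_on (cbox 0 1) (\<lambda>s::real. (x, s))" by (intro continuous_intros)
  from continuous_on_compose2[OF cont this] have "continuous_on (cbox 0 1) (fx x)"
    using r by (simp add: image_subset_iff)
  then have int: "fx x integrable_on cbox 0 1" by (rule integrable_continuous)
  have "blinfun_apply (integral (cbox 0 1) (fx x)) v = integral {0..1} (\<lambda>s. frechet_derivative f (at (s, x)) (0, v))" for v
  proof -
    have "integral (cbox 0 1) ((\<lambda>h. blinfun_apply h v) \<circ> fx x) = blinfun_apply (integral (cbox 0 1) (fx x)) v"
      by (rule integral_linear[OF int bounded_bilinear.bounded_linear_left[OF bounded_bilinear_blinfun_apply]])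
    moreover have "integral (cbox 0 1) ((\<lambda>h. blinfun_apply h v) \<circ> fx x) =
        integral (cbox 0 1) (\<lambda>s. frechet_derivative f (at (s, x)) (0, v))"
      by (rule Henstock_Kurzweil_Integration.integral_cong) (use ap r in auto)
    ultimately show ?thesis by simp
  qed
  then have eq: "blinfun_apply (integral (cbox 0 1) (fx x)) =
      (\<lambda>v. integral {0..1} (\<lambda>s. frechet_derivative f (at (s, x)) (0, v)))" by blast
  show ?thesis using 1 unfolding eq .
qed

lemma Ck_on_parameter_integral:
  fixes f :: "real \<times> 'a::euclidean_space \<Rightarrow> real"
  assumes S: "open S" and sub: "{0..1} \<times> S \<subseteq> Q" and f: "smooth_on f Q"
  shows "Ck_on k (\<lambda>x. integral {0..1} (\<lambda>s. f (s, x))) S"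
  using f
proof (induction k arbitrary: f)
  case 0
  have "((\<lambda>x. integral {0..1} (\<lambda>s. f (s, x))) has_derivative
      (\<lambda>v. integral {0..1} (\<lambda>s. frechet_derivative f (at (s, x)) (0, v)))) (at x)" if "x \<in> S" for x
    using has_derivative_parameter_integral[OF S sub smooth_on_Ck[OF 0] that] .
  then show ?case using has_derivative_continuous by (force intro!: continuous_at_imp_continuous_on)
next
  case (Suc k)
  show ?case
  proof (rule Ck_on_SucI[OF S])
    show "((\<lambda>x. integral {0..1} (\<lambda>s. f (s, x))) has_derivative
      (\<lambda>v. integral {0..1} (\<lambda>s. frechet_derivative f (at (s, x)) (0, v)))) (at x)" if "x \<in> S" for x
      using has_derivative_parameter_integral[OF S sub smooth_on_Ck[OF Suc.prems] that] .
    show "Ck_on k (\<lambda>x. integral {0..1} (\<lambda>s. frechet_derivative f (at (s, x)) (0, v))) S" for v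
      using Suc.IH[OF smooth_on_frechet_derivative[OF Suc.prems]] .
  qed
qed

text \<open>Poincare's lemma for 1-forms, in the directions of the range of a projection \<open>p\<close>; the
  remaining directions are parameters.\<close>

lemma primitive_along:
  fixes \<eta> :: "'a::euclidean_space \<Rightarrow> 'a" and p :: "'a \<Rightarrow> 'a"
  assumes S: "open S" and p: "linear p" "\<And>x. p (p x) = p x"
    and star: "\<And>x s. x \<in> S \<Longrightarrow> 0 \<le> s \<Longrightarrow> s \<le> 1 \<Longrightarrow> x - (1 - s) *\<^sub>R p (x - c) \<in> S"
    and \<eta>: "smooth_on \<eta> S"
    and closed: "\<And>x u v. x \<in> S \<Longrightarrow>
      frechet_derivative \<eta> (at x) (p u) \<bullet> p v = frechet_derivative \<eta> (at x) (p v) \<bullet> p u"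
  obtains T where "smooth_on T S" "\<And>x v. x \<in> S \<Longrightarrow> frechet_derivative T (at x) (p v) = \<eta> x \<bullet> p v"
proof -
  have blp: "bounded_linear p" using p(1) by (simp add: linear_conv_bounded_linear)
  \<comment> \<open>\<open>X (s, x)\<close> shrinks the \<open>p\<close>-component of x - c by the
    factor s and leaves the other components alone; \<open>f\<close> is the integrand of the
    homotopy formula of Poincare along these segments.\<close>
  define X where "X z = snd z - (1 - fst z) *\<^sub>R p (snd z - c)" for z :: "real \<times> 'a"
  define Q where "Q = X -` S"
  define f where "f z = \<eta> (X z) \<bullet> p (snd z - c)" for z
  have sm_p: "smooth_on (\<lambda>z::real \<times> 'a. p (snd z - c)) UNIV"
    by (intro smooth_on_compose_bounded_linear[OF open_UNIV _ blp] smooth_intros open_UNIV)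
  have sm_X: "smooth_on X UNIV"
    unfolding X_def by (intro smooth_intros open_UNIV sm_p)
  have Q: "open Q"
    unfolding Q_def using smooth_on_continuous[OF sm_X] S continuous_on_open_vimage[OF open_UNIV, of X] by simp
  have sm_f: "smooth_on f Q"
    unfolding f_def
    by (intro smooth_on_inner[OF Q] smooth_on_compose[OF Q S _ \<eta>] smooth_on_subset[OF sm_X] smooth_on_subset[OF sm_p])
      (auto simp: Q_def)
  have sub: "{0..1} \<times> S \<subseteq> Q" using star by (auto simp: Q_def X_def)
  define T where "T x = integral {0..1} (\<lambda>s. f (s, x))" for x
  have "smooth_on T S"
    unfolding T_def smooth_on_def using Ck_on_parameter_integral[OF S sub sm_f] by blast
  moreover have "frechet_derivative T (at x) (p v) = \<eta> x \<bullet> p v" if x: "x \<in> S" for x v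
  proof -
    let ?D = "\<lambda>s. frechet_derivative \<eta> (at (X (s, x)))"
    have XS: "X (s, x) \<in> S" if "s \<in> {0..1}" for s using star[OF x] that by (simp add: X_def)
    have d\<eta>: "(\<eta> has_derivative ?D s) (at (X (s, x)))" if "s \<in> {0..1}" for s
      using smooth_on_has_derivative[OF \<eta> XS[OF that]] .
    have pd: "(p has_derivative p) F" for F using bounded_linear_imp_has_derivative[OF blp] .
    have pdiff: "((\<lambda>z::real \<times> 'a. p (snd z - c)) has_derivative (\<lambda>v. p (snd v))) (at z)" for z
      by (rule has_derivative_compose[OF _ pd]) (auto intro!: derivative_eq_intros)
    have Xd: "(X has_derivative (\<lambda>(t, u). u - (1 - s) *\<^sub>R p u + t *\<^sub>R p (x - c))) (at (s, x))" for s
      unfolding X_def by (auto intro!: derivative_eq_intros pdiff simp: case_prod_unfold algebra_simps)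
    have fd: "frechet_derivative f (at (s, x)) (0, p v) = s * (?D s (p (x - c)) \<bullet> p v) + \<eta> (X (s, x)) \<bullet> p v"
      if s: "s \<in> {0..1}" for s
    proof -
      have "((\<lambda>z. \<eta> (X z)) has_derivative
          (\<lambda>z. ?D s ((\<lambda>(t, u). u - (1 - s) *\<^sub>R p u + t *\<^sub>R p (x - c)) z))) (at (s, x))"
        by (rule has_derivative_compose[OF Xd d\<eta>[OF s]])
      from has_derivative_inner[OF this pdiff[of "(s, x)"]]
      have "(f has_derivative (\<lambda>z. \<eta> (X (s, x)) \<bullet> p (snd z) +
          ?D s ((\<lambda>(t, u). u - (1 - s) *\<^sub>R p u + t *\<^sub>R p (x - c)) z) \<bullet> p (x - c))) (at (s, x))"
        unfolding f_def by simp
      from frechet_derivative_at[OF this]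
      have "frechet_derivative f (at (s, x)) (0, p v) = \<eta> (X (s, x)) \<bullet> p v + ?D s (p v - (1 - s) *\<^sub>R p v) \<bullet> p (x - c)"
        by (metis (no_types, lifting) add.right_neutral case_prod_conv p(2) scaleR_zero_left snd_conv)
      moreover have "p v - (1 - s) *\<^sub>R p v = s *\<^sub>R p v" by (simp add: algebra_simps)
      moreover have "?D s (s *\<^sub>R p v) \<bullet> p (x - c) = s * (?D s (p v) \<bullet> p (x - c))"
        using linear_scale[OF has_derivative_linear[OF d\<eta>[OF s]]] by simp
      ultimately show ?thesis using closed[OF XS[OF s], of v "x - c"] by simp
    qed
    \<comment> \<open>Closedness has turned the differentiated integrand into an exact derivative in
      s, so that only the boundary term at s = 1 survives.\<close>
    have "((\<lambda>s. s * (\<eta> (X (s, x)) \<bullet> p v)) has_vector_derivative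
        (s * (?D s (p (x - c)) \<bullet> p v) + \<eta> (X (s, x)) \<bullet> p v)) (at s within {0..1})" if s: "s \<in> {0..1}" for s
    proof -
      have 0: "((\<lambda>s. (s, x)) has_derivative (\<lambda>t. (t, 0))) (at s)" by (auto intro!: derivative_eq_intros)
      have "((\<lambda>s. X (s, x)) has_derivative (\<lambda>t. t *\<^sub>R p (x - c))) (at s)"
        using has_derivative_compose[OF 0 Xd[of s]] linear_0[OF p(1)] by simp
      from has_derivative_compose[OF this d\<eta>[OF s]]
      have "((\<lambda>s. \<eta> (X (s, x))) has_derivative (\<lambda>t. t *\<^sub>R ?D s (p (x - c)))) (at s)"
        using linear_scale[OF has_derivative_linear[OF d\<eta>[OF s]]] by simp
      then have "((\<lambda>s. \<eta> (X (s, x)) \<bullet> p v) has_derivative (\<lambda>t. (t *\<^sub>R ?D s (p (x - c))) \<bullet> p v)) (at s)"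
        by (rule has_derivative_inner_left)
      from has_derivative_mult[OF has_derivative_ident this]
      have "((\<lambda>s. s * (\<eta> (X (s, x)) \<bullet> p v)) has_derivative
        (\<lambda>t. t *\<^sub>R (s * (?D s (p (x - c)) \<bullet> p v) + \<eta> (X (s, x)) \<bullet> p v))) (at s)"
        by (simp add: algebra_simps)
      then show ?thesis unfolding has_vector_derivative_def using has_derivative_at_withinI by blast
    qed
    from fundamental_theorem_of_calculus[OF _ this]
    have "((\<lambda>s. s * (?D s (p (x - c)) \<bullet> p v) + \<eta> (X (s, x)) \<bullet> p v) has_integral \<eta> x \<bullet> p v) {0..1}"
      by (simp add: X_def)
    then have "integral {0..1} (\<lambda>s. s * (?D s (p (x - c)) \<bullet> p v) + \<eta> (X (s, x)) \<bullet> p v) = \<eta> x \<bullet> p v"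
      by (rule integral_unique)
    moreover have "integral {0..1} (\<lambda>s. frechet_derivative f (at (s, x)) (0, p v)) =
        integral {0..1} (\<lambda>s. s * (?D s (p (x - c)) \<bullet> p v) + \<eta> (X (s, x)) \<bullet> p v)"
      by (rule Henstock_Kurzweil_Integration.integral_cong) (use fd in auto)
    moreover have "frechet_derivative T (at x) (p v) = integral {0..1} (\<lambda>s. frechet_derivative f (at (s, x)) (0, p v))"
      using frechet_derivative_at[OF has_derivative_parameter_integral[OF S sub smooth_on_Ck[OF sm_f] x]]
      unfolding T_def by metis
    ultimately show ?thesis by simp
  qed
  ultimately show thesis using that by blast
qed

section \<open>Charts\<close>

lemma has_derivative_chain:
  assumes "(f has_derivative f') (at x within S)" "f x = y" "(g has_derivative g') (at y)"
  shows "((\<lambda>x. g (f x)) has_derivative (\<lambda>v. g' (f' v))) (at x within S)"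
  using has_derivative_compose[OF assms(1)] assms(2,3) by blast

lemma has_derivative_local_identity:
  assumes "(h has_derivative D) (at x)" "open S" "x \<in> S" "\<And>y. y \<in> S \<Longrightarrow> h y = y"
  shows "D v = v"
proof -
  have "((\<lambda>y. y) has_derivative D) (at x)"
    by (rule has_derivative_transform_within_open[OF assms(1-3)]) (rule assms(4))
  from has_derivative_unique[OF this has_derivative_ident] show ?thesis by simp
qed

lemma smooth_diffeoD:
  assumes "smooth_diffeo f S"
  shows "open S" "open (f ` S)" "inj_on f S" "smooth_on f S" "smooth_on (inv_into S f) (f ` S)"
  using assms by (simp_all add: smooth_diffeo_def)

lemma smooth_diffeo_frechet_derivative:
  assumes "smooth_diffeo f S" "x \<in> S"
  shows "frechet_derivative (inv_into S f) (at (f x)) (frechet_derivative f (at x) v) = v"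
    and "frechet_derivative f (at x) (frechet_derivative (inv_into S f) (at (f x)) w) = w"
proof -
  note * = smooth_diffeoD[OF assms(1)]
  have f: "(f has_derivative frechet_derivative f (at x)) (at x)"
    using smooth_on_has_derivative[OF *(4) assms(2)] .
  have fx: "f x \<in> f ` S" using assms(2) by blast
  have g: "(inv_into S f has_derivative frechet_derivative (inv_into S f) (at (f x))) (at (f x))"
    using smooth_on_has_derivative[OF *(5) fx] .
  have inv: "inv_into S f (f y) = y" if "y \<in> S" for y using *(3) that by simp
  have "((\<lambda>y. inv_into S f (f y)) has_derivative
      (\<lambda>v. frechet_derivative (inv_into S f) (at (f x)) (frechet_derivative f (at x) v))) (at x)"
    by (rule has_derivative_compose[OF f g])
  then show "frechet_derivative (inv_into S f) (at (f x)) (frechet_derivative f (at x) v) = v"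
    using has_derivative_local_identity[OF _ *(1) assms(2) inv] by blast
  have f': "(f has_derivative frechet_derivative f (at x)) (at (inv_into S f (f x)))"
    using f inv[OF assms(2)] by simp
  have "((\<lambda>y. f (inv_into S f y)) has_derivative
      (\<lambda>v. frechet_derivative f (at x) (frechet_derivative (inv_into S f) (at (f x)) v))) (at (f x))"
    by (rule has_derivative_compose[OF g f'])
  then show "frechet_derivative f (at x) (frechet_derivative (inv_into S f) (at (f x)) w) = w"
    by (rule has_derivative_local_identity[OF _ *(2) fx]) (simp add: f_inv_into_f)
qed

lemma homeomorphism_inv_into:
  assumes "inj_on f S" "continuous_on S f" "continuous_on (f ` S) (inv_into S f)"
  shows "homeomorphism S (f ` S) f (inv_into S f)"
  using assms by (auto simp: homeomorphism_def)

lemma is_chartD: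
  assumes "is_chart c"
  shows "open (fst c)" "open (snd c ` fst c)" "inj_on (snd c) (fst c)" "continuous_on (fst c) (snd c)"
    "continuous_on (snd c ` fst c) (inv_into (fst c) (snd c))"
  using assms unfolding is_chart_def homeomorphism_def
  by (auto intro: inj_on_inverseI)

lemma chart_open_preimage:
  assumes "is_chart c" "open S"
  shows "open {p \<in> fst c. snd c p \<in> S}"
proof -
  have "{p \<in> fst c. snd c p \<in> S} = fst c \<inter> snd c -` S" by auto
  then show ?thesis using continuous_open_preimage[OF is_chartD(4,1)[OF assms(1)] assms(2)] by simp
qed

lemma chart_open_image:
  assumes "is_chart c" "open W" "W \<subseteq> fst c"
  shows "open (snd c ` W)"
proof -
  have "snd c ` W = snd c ` fst c \<inter> inv_into (fst c) (snd c) -` W"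
    using assms(3) is_chartD(3)[OF assms(1)] by (auto simp: subset_iff)
  then show ?thesis using continuous_open_preimage[OF is_chartD(5,2)[OF assms(1)] assms(2)] by simp
qed

lemma in_chart_apply: "is_chart c \<Longrightarrow> p \<in> fst c \<Longrightarrow> in_chart c f (snd c p) = f p"
  using is_chartD(3) by (fastforce simp: in_chart_def)

text \<open>The atlas is maximal, so a chart compatible with all its members belongs to it. All
  charts built later, the adapted ones and the flow charts, enter the atlas through this
  lemma.\<close>

lemma add_chart:
  fixes A :: "'m::topological_space chart set"
  assumes A: "smooth_structure A" and c: "c \<in> A" and SU: "S \<subseteq> snd c ` fst c" and \<psi>: "smooth_diffeo \<psi> S"
  shows "({p \<in> fst c. snd c p \<in> S}, \<psi> \<circ> snd c) \<in> A" (is "?d \<in> A")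
proof -
  have ch: "is_chart e" if "e \<in> A" for e using A that by (auto simp: smooth_structure_def)
  have cmp: "compatible e e'" if "e \<in> A" "e' \<in> A" for e e' using A that by (auto simp: smooth_structure_def)
  note \<psi>D = smooth_diffeoD[OF \<psi>]
  note cD = is_chartD[OF ch[OF c]]
  let ?ic = "inv_into (fst c) (snd c)"
  have img: "snd ?d ` fst ?d = \<psi> ` S" using SU by (auto simp: image_iff subset_iff)
  have ic: "?ic x \<in> fst c" "snd c (?ic x) = x" if "x \<in> S" for x
    using SU that by (auto simp: inv_into_into f_inv_into_f subset_iff)
  have injd: "inj_on (snd ?d) (fst ?d)"
    using cD(3) \<psi>D(3) by (auto simp: inj_on_def)
  have inv: "?ic (inv_into S \<psi> y) = inv_into (fst ?d) (snd ?d) y" if y: "y \<in> \<psi> ` S" for y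
  proof -
    have s: "inv_into S \<psi> y \<in> S" "\<psi> (inv_into S \<psi> y) = y"
      using y by (auto simp: inv_into_into f_inv_into_f)
    have "snd ?d (?ic (inv_into S \<psi> y)) = y" "?ic (inv_into S \<psi> y) \<in> fst ?d"
      using ic[OF s(1)] s by auto
    with inv_into_f_f[OF injd this(2)] show ?thesis by simp
  qed
  have d: "is_chart ?d"
    unfolding is_chart_def
  proof (intro conjI)
    show "open (fst ?d)" using chart_open_preimage[OF ch[OF c] \<psi>D(1)] by simp
    show "open (snd ?d ` fst ?d)" using \<psi>D(2) unfolding img .
    show "homeomorphism (fst ?d) (snd ?d ` fst ?d) (snd ?d) (inv_into (fst ?d) (snd ?d))"
    proof (rule homeomorphism_inv_into[OF injd])
      show "continuous_on (fst ?d) (snd ?d)"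
        using continuous_on_compose[OF continuous_on_subset[OF cD(4)]
            continuous_on_subset[OF smooth_on_continuous[OF \<psi>D(4)]], of "fst ?d"] by auto
      have "continuous_on (\<psi> ` S) (\<lambda>y. ?ic (inv_into S \<psi> y))"
        by (rule continuous_on_compose2[OF cD(5) smooth_on_continuous[OF \<psi>D(5)]])
          (use SU in \<open>auto simp: inv_into_into subset_iff\<close>)
      then show "continuous_on (snd ?d ` fst ?d) (inv_into (fst ?d) (snd ?d))"
        unfolding img by (rule continuous_on_eq) (use inv in auto)
    qed
  qed
  have "compatible ?d e" if e: "e \<in> A" for e
    unfolding compatible_def
  proof (intro conjI)
    note eD = is_chartD[OF ch[OF e]]
    let ?W = "fst ?d \<inter> fst e"
    have W: "open ?W" "?W \<subseteq> fst ?d" "?W \<subseteq> fst e" using is_chartD(1)[OF d] eD(1) by auto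
    have o1: "open (snd ?d ` ?W)" using chart_open_image[OF d W(1,2)] .
    have o2: "open (snd e ` (fst e \<inter> fst ?d))" using chart_open_image[OF ch[OF e] W(1,3)] by (simp only: Int_commute)
    have oc: "open (snd c ` (fst c \<inter> fst e))" using chart_open_image[OF ch[OF c]] cD(1) eD(1) by blast
    have s1: "smooth_on (in_chart c (snd e)) (snd c ` (fst c \<inter> fst e))"
      and s2: "smooth_on (in_chart e (snd c)) (snd e ` (fst e \<inter> fst c))"
      using cmp[OF c e] cmp[OF e c] by (auto simp: compatible_def)
    have sub: "snd ?d ` ?W \<subseteq> \<psi> ` S" using img by auto
    have "smooth_on (\<lambda>y. in_chart c (snd e) (inv_into S \<psi> y)) (snd ?d ` ?W)"
    proof (rule smooth_on_compose[OF o1 oc smooth_on_subset[OF \<psi>D(5) sub] s1])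
      show "inv_into S \<psi> ` snd ?d ` ?W \<subseteq> snd c ` (fst c \<inter> fst e)"
        using \<psi>D(3) by auto
    qed
    then show "smooth_on (in_chart ?d (snd e)) (snd ?d ` ?W)"
      by (rule smooth_on_cong[OF o1, rotated]) (use inv sub in \<open>auto simp: in_chart_def subset_iff\<close>)
    have "smooth_on (\<lambda>y. \<psi> (in_chart e (snd c) y)) (snd e ` (fst e \<inter> fst ?d))"
    proof (rule smooth_on_compose[OF o2 \<psi>D(1) smooth_on_subset[OF s2] \<psi>D(4)])
      show "in_chart e (snd c) ` snd e ` (fst e \<inter> fst ?d) \<subseteq> S"
        using eD(3) by (auto simp: in_chart_def)
    qed auto
    then have "smooth_on (in_chart e (snd ?d)) (snd e ` (fst e \<inter> fst ?d))"
      by (rule smooth_on_cong[OF o2, rotated]) (auto simp: in_chart_def)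
    then show "smooth_on (in_chart e (snd ?d)) (snd e ` (fst ?d \<inter> fst e))"
      by (simp only: Int_commute)
  qed
  moreover have "compatible e ?d" if "e \<in> A" for e
    using calculation[OF that] unfolding compatible_def by (simp only: Int_commute[of "fst e"])
  ultimately show ?thesis using A d unfolding smooth_structure_def by blast
qed

locale smooth_atlas =
  fixes A :: "'m::topological_space chart set"
  assumes smooth_structure: "smooth_structure A"
begin

lemma is_chart: "c \<in> A \<Longrightarrow> is_chart c"
  using smooth_structure by (auto simp: smooth_structure_def)

lemmas chartD = is_chartD[OF is_chart]
lemmas in_chart_apply' = in_chart_apply[OF is_chart]

lemma chart_inv:
  assumes "c \<in> A" "x \<in> snd c ` fst c"
  shows "inv_into (fst c) (snd c) x \<in> fst c" "snd c (inv_into (fst c) (snd c) x) = x"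
  using assms by (auto simp: inv_into_into f_inv_into_f)

lemma ex_chart: "\<exists>c\<in>A. p \<in> fst c"
proof -
  have "(\<Union>c\<in>A. fst c) = UNIV" using smooth_structure unfolding smooth_structure_def by (elim conjE)
  then show ?thesis by blast
qed

lemma open_overlap: "c \<in> A \<Longrightarrow> d \<in> A \<Longrightarrow> open (snd c ` (fst c \<inter> fst d))"
  using chart_open_image[OF is_chart] chartD(1) by blast

lemma smooth_transition:
  "c \<in> A \<Longrightarrow> d \<in> A \<Longrightarrow> smooth_on (in_chart c (snd d)) (snd c ` (fst c \<inter> fst d))"
  using smooth_structure unfolding smooth_structure_def compatible_def by blast

abbreviation transition :: "'m chart \<Rightarrow> 'm chart \<Rightarrow> 'm \<Rightarrow> real^4 \<Rightarrow> real^4" where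
  "transition c d p \<equiv> frechet_derivative (in_chart c (snd d)) (at (snd c p))"

lemma has_derivative_transition:
  assumes "c \<in> A" "d \<in> A" "p \<in> fst c" "p \<in> fst d"
  shows "(in_chart c (snd d) has_derivative transition c d p) (at (snd c p))"
  using smooth_on_has_derivative[OF smooth_transition[OF assms(1,2)]] assms(3,4) by blast

lemma transition_inverse:
  assumes "c \<in> A" "d \<in> A" "p \<in> fst c" "p \<in> fst d"
  shows "transition d c p (transition c d p v) = v"
proof -
  have x: "snd c p \<in> snd c ` (fst c \<inter> fst d)" using assms by auto
  have e: "in_chart c (snd d) (snd c p) = snd d p" using assms in_chart_apply' by blast
  have "((\<lambda>y. in_chart d (snd c) (in_chart c (snd d) y)) has_derivative
      (\<lambda>v. transition d c p (transition c d p v))) (at (snd c p))"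
    by (rule has_derivative_chain[OF has_derivative_transition[OF assms] e has_derivative_transition[OF assms(2,1,4,3)]])
  then show ?thesis
    by (rule has_derivative_local_identity[OF _ open_overlap[OF assms(1,2)] x])
      (auto simp: in_chart_apply' assms(1,2))
qed

lemma surj_transition:
  assumes "c \<in> A" "d \<in> A" "p \<in> fst c" "p \<in> fst d"
  shows "surj (transition c d p)"
  by (rule surjI[of _ "transition d c p"]) (rule transition_inverse[OF assms(2,1,4,3)])

lemma has_derivative_in_chart_change:
  assumes "c \<in> A" "d \<in> A" "p \<in> fst c" "p \<in> fst d"
    and "(in_chart d f has_derivative D) (at (snd d p))"
  shows "(in_chart c f has_derivative (\<lambda>v. D (transition c d p v))) (at (snd c p))"
proof -
  have x: "snd c p \<in> snd c ` (fst c \<inter> fst d)" using assms by auto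
  have e: "in_chart c (snd d) (snd c p) = snd d p" using assms in_chart_apply' by blast
  have "((\<lambda>y. in_chart d f (in_chart c (snd d) y)) has_derivative (\<lambda>v. D (transition c d p v))) (at (snd c p))"
    by (rule has_derivative_chain[OF has_derivative_transition[OF assms(1-4)] e assms(5)])
  then show ?thesis
    by (rule has_derivative_transform_within_open[OF _ open_overlap[OF assms(1,2)] x])
      (auto simp: in_chart_apply' assms(1,2))
qed

lemma has_derivative_curve_change:
  assumes "c \<in> A" "d \<in> A" "\<gamma> t \<in> fst c" "\<gamma> t \<in> fst d" and t: "t \<in> T" and ev: "eventually (\<lambda>s. \<gamma> s \<in> fst c) (at t within T)"
    and "((\<lambda>s. snd c (\<gamma> s)) has_derivative D) (at t within T)"
  shows "((\<lambda>s. snd d (\<gamma> s)) has_derivative (\<lambda>v. transition c d (\<gamma> t) (D v))) (at t within T)"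
proof -
  have "((\<lambda>s. in_chart c (snd d) (snd c (\<gamma> s))) has_derivative (\<lambda>v. transition c d (\<gamma> t) (D v))) (at t within T)"
    by (rule has_derivative_chain[OF assms(7) refl has_derivative_transition[OF assms(1-4)]])
  then show ?thesis
  proof (rule has_derivative_transform_eventually)
    show "\<forall>\<^sub>F s in at t within T. in_chart c (snd d) (snd c (\<gamma> s)) = snd d (\<gamma> s)"
      using ev by eventually_elim (use in_chart_apply' assms(1) in blast)
  qed (use t in_chart_apply'[OF assms(1,3)] in auto)
qed

end

section \<open>Linear algebra of the symplectic pairing\<close>

lemma Basis_expand_4: "v = v$1 *\<^sub>R axis 1 1 + v$2 *\<^sub>R axis 2 1 + v$3 *\<^sub>R axis 3 1 + v$4 *\<^sub>R axis 4 (1::real)"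
  for v :: "real^4"
  by (simp add: vec_eq_iff forall_4 axis_def)

lemma linear_expand_4:
  fixes L :: "real^4 \<Rightarrow> 'b::real_vector"
  assumes "linear L"
  shows "L v = v$1 *\<^sub>R L (axis 1 1) + v$2 *\<^sub>R L (axis 2 1) + v$3 *\<^sub>R L (axis 3 1) + v$4 *\<^sub>R L (axis 4 1)"
  by (subst Basis_expand_4[of v]) (simp only: linear_add[OF assms] linear_scale[OF assms])

lemma pairing_expand:
  "pairing G u v = (\<Sum>i\<in>UNIV. \<Sum>j\<in>UNIV. u$i * G$i$j * v$j)"
  by (simp add: pairing_def inner_vec_def matrix_vector_mult_def sum_distrib_left mult.assoc)

lemma bounded_bilinear_pairing: "bounded_bilinear (pairing G)"
  unfolding pairing_def
  by (rule bounded_bilinear.comp[OF bounded_bilinear_inner bounded_linear_ident matrix_vector_mul_bounded_linear])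

lemmas pairing_simps = bounded_bilinear.add_left[OF bounded_bilinear_pairing]
  bounded_bilinear.add_right[OF bounded_bilinear_pairing]
  bounded_bilinear.scaleR_left[OF bounded_bilinear_pairing]
  bounded_bilinear.scaleR_right[OF bounded_bilinear_pairing]
  bounded_bilinear.diff_left[OF bounded_bilinear_pairing]
  bounded_bilinear.diff_right[OF bounded_bilinear_pairing]
  bounded_bilinear.zero_left[OF bounded_bilinear_pairing]
  bounded_bilinear.zero_right[OF bounded_bilinear_pairing]
  bounded_bilinear.minus_left[OF bounded_bilinear_pairing]
  bounded_bilinear.minus_right[OF bounded_bilinear_pairing]

lemma pairing_antisym:
  assumes "transpose G = - G"
  shows "pairing G u v = - pairing G v u"
proof -
  have "pairing G u v = (\<Sum>i\<in>UNIV. \<Sum>j\<in>UNIV. u$i * G$i$j * v$j)" by (rule pairing_expand)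
  also have "\<dots> = (\<Sum>j\<in>UNIV. \<Sum>i\<in>UNIV. u$i * G$i$j * v$j)" by (rule sum.swap)
  also have "\<dots> = (\<Sum>j\<in>UNIV. \<Sum>i\<in>UNIV. - (v$j * G$j$i * u$i))"
  proof (intro sum.cong refl)
    fix i j
    have "(transpose G)$j$i = (- G)$j$i" by (simp only: assms)
    then have "G$i$j = - (G$j$i)" by (simp add: transpose_def)
    then show "u$i * G$i$j * v$j = - (v$j * G$j$i * u$i)" by simp
  qed
  also have "\<dots> = - pairing G v u" by (simp add: pairing_expand sum_negf)
  finally show ?thesis .
qed

lemma pairing_std: "pairing std_form u v = u$1 * v$3 + u$2 * v$4 - u$3 * v$1 - u$4 * v$2"
  by (simp add: pairing_def std_form_def inner_vec_def sum_4 matrix_vector_mult_def)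

lemma pairing_nondegenerate:
  assumes "invertible G" "\<And>v. pairing G u v = 0"
  shows "u = 0"
proof -
  obtain B where "G ** B = mat 1" using assms(1) by (auto simp: invertible_def)
  then have "G *v (B *v u) = u" by (simp add: matrix_vector_mul_assoc)
  then have "u \<bullet> u = 0" using assms(2)[of "B *v u"] by (simp add: pairing_def)
  then show ?thesis by simp
qed

lemma pairing_eqD:
  assumes "invertible G" "\<And>v. pairing G u v = pairing G u' v"
  shows "u = u'"
  using pairing_nondegenerate[OF assms(1), of "u - u'"] assms(2) by (simp add: pairing_simps)

text \<open>Nondegeneracy makes the description inside \<open>ham_vf\<close> definite: with n the
  gradient of the function and B an inverse of the Gram matrix, the transpose of B applied to n is
  the only solution.\<close>

lemma ham_vf_pairing:
  assumes inv: "invertible (Om c x)" and lin: "linear (frechet_derivative (in_chart c f) (at x))"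
  shows "pairing (Om c x) (ham_vf Om c f x) v = frechet_derivative (in_chart c f) (at x) v"
proof -
  let ?G = "Om c x" and ?D = "frechet_derivative (in_chart c f) (at x)"
  define n where "n = (\<Sum>b\<in>Basis. ?D b *\<^sub>R b)"
  have D: "?D v = n \<bullet> v" for v
    using linear_Basis_expand[OF lin, of v] by (simp add: n_def inner_sum_left inner_sum_right inner_commute mult.commute)
  obtain B where B: "B ** ?G = mat 1" using inv by (auto simp: invertible_def)
  have "pairing ?G (transpose B *v n) v = ?D v" for v
  proof -
    have "pairing ?G (transpose B *v n) v = n \<bullet> (B *v (?G *v v))"
      unfolding pairing_def by (metis dot_lmul_matrix transpose_matrix_vector transpose_transpose)
    then show ?thesis using B D by (simp add: matrix_vector_mul_assoc)
  qed
  then have "\<exists>!X. \<forall>v. pairing ?G X v = ?D v"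
    using pairing_eqD[OF inv] by (metis (full_types))
  from theI'[OF this] show ?thesis unfolding ham_vf_def by blast
qed

lemma Om_change:
  assumes "is_2form A Om" "c \<in> A" "d \<in> A" "p \<in> fst c" "p \<in> fst d"
  shows "pairing (Om d (snd d p)) (frechet_derivative (in_chart c (snd d)) (at (snd c p)) u)
      (frechet_derivative (in_chart c (snd d)) (at (snd c p)) v) = pairing (Om c (snd c p)) u v"
  using assms unfolding is_2form_def Let_def by blast

text \<open>Two independent rows leave room for two further covectors, each chosen orthogonal to all
  preceding ones. With them the two components of the integral map are completed to local
  coordinates.\<close>

lemma complement_of_covectors:
  fixes L :: "real^4 \<Rightarrow> real \<times> real"
  assumes lin: "linear L" and surj: "surj L"
  obtains e1 e2 :: "real^4" where "\<And>v. L v = 0 \<Longrightarrow> e1 \<bullet> v = 0 \<Longrightarrow> e2 \<bullet> v = 0 \<Longrightarrow> v = 0"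
proof -
  define n1 where "n1 = (\<Sum>b\<in>Basis. fst (L b) *\<^sub>R b)"
  define n2 where "n2 = (\<Sum>b\<in>Basis. snd (L b) *\<^sub>R b)"
  have l1: "linear (\<lambda>v. fst (L v))" and l2: "linear (\<lambda>v. snd (L v))"
    using linear_compose[OF lin linear_fst] linear_compose[OF lin linear_snd] by (simp_all add: o_def)
  have L: "L v = (n1 \<bullet> v, n2 \<bullet> v)" for v
    using linear_Basis_expand[OF l1, of v] linear_Basis_expand[OF l2, of v]
    by (simp add: n1_def n2_def prod_eq_iff inner_sum_left inner_sum_right inner_commute mult.commute)
  obtain u1 u2 where u: "L u1 = (1, 0)" "L u2 = (0, 1)" using surj by (metis surjD)
  have n2: "n2 \<noteq> 0" and n1: "n1 \<notin> span {n2}"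
    using u by (auto simp: L span_singleton)
  have i2: "independent {n1, n2}" "n1 \<noteq> n2"
    using n1 n2 span_base by (auto simp: independent_insert)
  have lt: "dim X < DIM(real^4)" if "finite X" "card X < 4" for X :: "(real^4) set"
    using dim_le_card'[OF that(1)] that(2) by simp
  have "dim {n1, n2} < DIM(real^4)" using card_insert_le_m1 by (intro lt) (auto simp: card_insert_if)
  then obtain e1 where e1: "e1 \<noteq> 0" "\<And>y. y \<in> span {n1, n2} \<Longrightarrow> orthogonal e1 y"
    using orthogonal_to_subspace_exists by blast
  have "dim {e1, n1, n2} < DIM(real^4)" by (intro lt) (auto simp: card_insert_if)
  then obtain e2 where e2: "e2 \<noteq> 0" "\<And>y. y \<in> span {e1, n1, n2} \<Longrightarrow> orthogonal e2 y"
    using orthogonal_to_subspace_exists by blast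
  have n: "e1 \<notin> span {n1, n2}" "e2 \<notin> span {e1, n1, n2}"
    using e1(1) e1(2)[of e1] e2(1) e2(2)[of e2] by (auto simp: orthogonal_def)
  have ni: "e1 \<notin> {n1, n2}" "e2 \<notin> {e1, n1, n2}"
    using subsetD[OF span_superset[of "{n1, n2}"]] subsetD[OF span_superset[of "{e1, n1, n2}"]] n by metis+
  have ind: "independent {e2, e1, n1, n2}"
    by (intro independent_insertI n i2(1))
  have "card {e2, e1, n1, n2} = 4" using i2(2) ni by simp
  then have "dim {e2, e1, n1, n2} = 4" using dim_eq_card_independent[OF ind] by simp
  then have sp: "span {e2, e1, n1, n2} = UNIV" using dim_eq_full[of "{e2, e1, n1, n2}"] by simp
  show thesis
  proof (rule that)
    fix v assume v: "L v = 0" "e1 \<bullet> v = 0" "e2 \<bullet> v = 0"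
    have "orthogonal v y" if "y \<in> {e2, e1, n1, n2}" for y
      using v L[of v] that by (auto simp: orthogonal_def inner_commute zero_prod_def)
    then have "orthogonal v v" using orthogonal_to_span[of v "{e2, e1, n1, n2}" v] sp by blast
    then show "v = 0" by (simp add: orthogonal_def)
  qed
qed

section \<open>Darboux charts adapted to the integrals\<close>

locale integrable_system = smooth_atlas A
  for A :: "'m::t2_space chart set" +
  fixes Om :: "'m form2" and H L :: "'m \<Rightarrow> real"
    and g :: "real \<times> real \<Rightarrow> real \<times> real" and V :: "(real \<times> real) set"
  assumes two_form: "is_2form A Om" and closed: "closed_2form A Om" and nondeg: "nondegenerate A Om"
    and integrable: "liouville_integrable A Om H L"
    and g: "smooth_diffeo g V"
begin

text \<open>Inverting \<open>g\<close> extends the integrals of the normal form from the Eliasson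
  chart to all points whose energy-momentum value lies in the image of \<open>g\<close>. There
  \<open>J\<close> and the energy-momentum map have the same fibres.\<close>

definition U :: "'m set" where "U = {p. em_map H L p \<in> g ` V}"

definition J :: "'m \<Rightarrow> real \<times> real" where "J p = inv_into V g (em_map H L p)"

lemmas gD = smooth_diffeoD[OF g]

lemma in_chart_em: "in_chart c (em_map H L) x = (in_chart c H x, in_chart c L x)"
  by (simp add: in_chart_def em_map_def)

lemma smooth_H: "c \<in> A \<Longrightarrow> smooth_on (in_chart c H) (snd c ` fst c)"
  and smooth_L: "c \<in> A \<Longrightarrow> smooth_on (in_chart c L) (snd c ` fst c)"
  using integrable unfolding liouville_integrable_def smooth_fun_def by blast+

lemma smooth_em:
  assumes "c \<in> A"
  shows "smooth_on (in_chart c (em_map H L)) (snd c ` fst c)"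
proof -
  have "in_chart c (em_map H L) = (\<lambda>x. (in_chart c H x, in_chart c L x))"
    by (rule ext) (rule in_chart_em)
  then show ?thesis using smooth_on_Pair[OF chartD(2)[OF assms] smooth_H[OF assms] smooth_L[OF assms]] by simp
qed

lemma continuous_em: "continuous_on UNIV (em_map H L)"
proof -
  have "isCont (em_map H L) p" for p
  proof -
    obtain c where c: "c \<in> A" "p \<in> fst c" using ex_chart by blast
    have "continuous_on (fst c) (\<lambda>p. in_chart c (em_map H L) (snd c p))"
      by (rule continuous_on_compose2[OF smooth_on_continuous[OF smooth_em[OF c(1)]] chartD(4)[OF c(1)]]) simp
    then have "continuous_on (fst c) (em_map H L)"
      by (rule continuous_on_eq) (simp add: in_chart_apply' c(1))
    then show ?thesis using continuous_on_eq_continuous_at[OF chartD(1)[OF c(1)]] c(2) by blast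
  qed
  then show ?thesis by (simp add: continuous_at_imp_continuous_on)
qed

lemma open_U: "open U"
  using continuous_open_vimage[of "g ` V" "em_map H L"] gD(2) continuous_em
  unfolding U_def vimage_def by (simp add: continuous_on_eq_continuous_at)

lemma J_in: "p \<in> U \<Longrightarrow> J p \<in> V" "p \<in> U \<Longrightarrow> g (J p) = em_map H L p"
  unfolding U_def J_def by (auto intro: inv_into_into f_inv_into_f)

lemma J_eqI: "em_map H L p = g w \<Longrightarrow> w \<in> V \<Longrightarrow> p \<in> U" "em_map H L p = g w \<Longrightarrow> w \<in> V \<Longrightarrow> J p = w"
  using gD(3) unfolding U_def J_def by (auto simp: inv_into_f_f)

lemma smooth_J:
  assumes "c \<in> A"
  shows "open (snd c ` (fst c \<inter> U))" "smooth_on (in_chart c J) (snd c ` (fst c \<inter> U))"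
proof -
  show o: "open (snd c ` (fst c \<inter> U))"
    by (rule chart_open_image[OF is_chart[OF assms]]) (use chartD(1)[OF assms] open_U in auto)
  have "smooth_on (\<lambda>x. inv_into V g (in_chart c (em_map H L) x)) (snd c ` (fst c \<inter> U))"
  proof (rule smooth_on_compose[OF o gD(2) smooth_on_subset[OF smooth_em[OF assms]] gD(5)])
    show "in_chart c (em_map H L) ` snd c ` (fst c \<inter> U) \<subseteq> g ` V"
      by (auto simp: U_def in_chart_apply'[OF assms])
  qed auto
  then show "smooth_on (in_chart c J) (snd c ` (fst c \<inter> U))"
    by (simp add: in_chart_def J_def o_def)
qed

lemma has_derivative_J:
  assumes "c \<in> A" "p \<in> fst c" "p \<in> U"
  shows "(in_chart c J has_derivative frechet_derivative (in_chart c J) (at (snd c p))) (at (snd c p))"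
  by (rule smooth_on_has_derivative[OF smooth_J(2)[OF assms(1)]]) (use assms in auto)

lemma derivative_em_J:
  assumes "c \<in> A" "p \<in> fst c" "p \<in> U"
  shows "frechet_derivative (in_chart c (em_map H L)) (at (snd c p)) v =
    frechet_derivative g (at (J p)) (frechet_derivative (in_chart c J) (at (snd c p)) v)"
proof -
  have e: "in_chart c J (snd c p) = J p" by (rule in_chart_apply'[OF assms(1,2)])
  have dg: "(g has_derivative frechet_derivative g (at (J p))) (at (J p))"
    by (rule smooth_on_has_derivative[OF gD(4) J_in(1)[OF assms(3)]])
  have "((\<lambda>x. g (in_chart c J x)) has_derivative
      (\<lambda>v. frechet_derivative g (at (J p)) (frechet_derivative (in_chart c J) (at (snd c p)) v))) (at (snd c p))"
    by (rule has_derivative_chain[OF has_derivative_J[OF assms] e dg])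
  then have "(in_chart c (em_map H L) has_derivative
      (\<lambda>v. frechet_derivative g (at (J p)) (frechet_derivative (in_chart c J) (at (snd c p)) v))) (at (snd c p))"
  proof (rule has_derivative_transform_within_open[OF _ smooth_J(1)[OF assms(1)]])
    show "g (in_chart c J x) = in_chart c (em_map H L) x" if "x \<in> snd c ` (fst c \<inter> U)" for x
      using that J_in(2) by (auto simp: in_chart_apply'[OF assms(1)])
  qed (use assms in auto)
  from frechet_derivative_at[OF this] show ?thesis by (simp add: fun_eq_iff)
qed

text \<open>Since dg is invertible, the ranks of d(H, L) and dJ agree. Surjectivity passes between
  charts by the chain rule, so the quantifier over charts in \<open>regular_point\<close> reduces to
  a single chart.\<close>

lemma regular_point_iff:
  assumes "c \<in> A" "p \<in> fst c" "p \<in> U"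
  shows "regular_point A H L p \<longleftrightarrow> surj (frechet_derivative (in_chart c J) (at (snd c p)))"
proof -
  have *: "surj (frechet_derivative (in_chart d (em_map H L)) (at (snd d p))) \<longleftrightarrow>
      surj (frechet_derivative (in_chart d J) (at (snd d p)))" if d: "d \<in> A" "p \<in> fst d" for d
  proof -
    let ?G = "frechet_derivative g (at (J p))" and ?D = "frechet_derivative (in_chart d J) (at (snd d p))"
    have inv: "frechet_derivative (inv_into V g) (at (g (J p))) (?G v) = v"
      "?G (frechet_derivative (inv_into V g) (at (g (J p))) v) = v" for v
      using smooth_diffeo_frechet_derivative[OF g J_in(1)[OF assms(3)]] by blast+
    have eq: "frechet_derivative (in_chart d (em_map H L)) (at (snd d p)) = (\<lambda>v. ?G (?D v))"
      by (rule ext) (rule derivative_em_J[OF d assms(3)])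
    show ?thesis unfolding eq surj_def by (metis inv)
  qed
  have "surj (frechet_derivative (in_chart d J) (at (snd d p)))"
    if d: "d \<in> A" "p \<in> fst d" and s: "surj (frechet_derivative (in_chart c J) (at (snd c p)))" for d
  proof -
    have "(in_chart c J has_derivative
        (\<lambda>v. frechet_derivative (in_chart d J) (at (snd d p)) (transition c d p v))) (at (snd c p))"
      by (rule has_derivative_in_chart_change[OF assms(1) d(1) assms(2) d(2) has_derivative_J[OF d assms(3)]])
    then have "frechet_derivative (in_chart c J) (at (snd c p)) =
        (\<lambda>v. frechet_derivative (in_chart d J) (at (snd d p)) (transition c d p v))"
      by (rule frechet_derivative_at[symmetric])
    then show ?thesis using s unfolding surj_def by metis
  qed
  then show ?thesis using * assms unfolding regular_point_def by blast
qed

lemma Om_antisym: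
  assumes "c \<in> A" "x \<in> snd c ` fst c"
  shows "transpose (Om c x) = - Om c x"
  using two_form assms unfolding is_2form_def by blast

lemma Om_entry_antisym:
  assumes "c \<in> A" "x \<in> snd c ` fst c"
  shows "Om c x $ i $ j = - (Om c x $ j $ i)"
proof -
  have "transpose (Om c x) $ j $ i = (- Om c x) $ j $ i" by (simp only: Om_antisym[OF assms])
  then show ?thesis by (simp add: transpose_def)
qed

lemma Om_invertible: "c \<in> A \<Longrightarrow> x \<in> snd c ` fst c \<Longrightarrow> invertible (Om c x)"
  using nondeg unfolding nondegenerate_def by blast

lemma smooth_Om: "c \<in> A \<Longrightarrow> smooth_on (Om c) (snd c ` fst c)"
  using two_form unfolding is_2form_def by blast

lemma smooth_Om_entry: "c \<in> A \<Longrightarrow> smooth_on (\<lambda>x. Om c x $ i $ j) (snd c ` fst c)"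
  by (intro smooth_on_nth smooth_Om chartD(2))

definition adapted :: "'m chart \<Rightarrow> bool" where
  "adapted d \<longleftrightarrow> d \<in> A \<and> (\<forall>q\<in>fst d. q \<in> U \<and> J q = (snd d q $ 3, snd d q $ 4))"

lemma ex_adapted:
  assumes p: "p \<in> U" "regular_point A H L p"
  obtains d where "adapted d" "p \<in> fst d"
proof -
  obtain c where c: "c \<in> A" "p \<in> fst c" using ex_chart by blast
  let ?D = "frechet_derivative (in_chart c J) (at (snd c p))"
  let ?S = "snd c ` (fst c \<inter> U)"
  note dJ = has_derivative_J[OF c p(1)]
  have surj: "surj ?D" using regular_point_iff[OF c p(1)] p(2) by blast
  obtain e1 e2 :: "real^4" where e: "\<And>v. ?D v = 0 \<Longrightarrow> e1 \<bullet> v = 0 \<Longrightarrow> e2 \<bullet> v = 0 \<Longrightarrow> v = 0"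
    using complement_of_covectors[OF has_derivative_linear[OF dJ] surj] by blast
  define f :: "real^4 \<Rightarrow> real^4" where
    "f x = (e1 \<bullet> x) *\<^sub>R axis 1 1 + (e2 \<bullet> x) *\<^sub>R axis 2 1 +
       fst (in_chart c J x) *\<^sub>R axis 3 1 + snd (in_chart c J x) *\<^sub>R axis 4 1" for x
  have S: "open ?S" and sJ: "smooth_on (in_chart c J) ?S" using smooth_J[OF c(1)] by blast+
  have sf: "smooth_on f ?S"
    unfolding f_def
    by (intro smooth_on_add smooth_on_scaleR smooth_on_inner smooth_on_const smooth_on_ident
        smooth_on_fst smooth_on_snd S sJ)
  have df: "(f has_derivative (\<lambda>v. (e1 \<bullet> v) *\<^sub>R axis 1 1 + (e2 \<bullet> v) *\<^sub>R axis 2 1 +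
       fst (?D v) *\<^sub>R axis 3 1 + snd (?D v) *\<^sub>R axis 4 1)) (at (snd c p))"
    unfolding f_def
    by (intro has_derivative_add has_derivative_scaleR_left has_derivative_inner_right has_derivative_ident
        has_derivative_fst has_derivative_snd dJ)
  have fd: "frechet_derivative f (at (snd c p)) = (\<lambda>v. (e1 \<bullet> v) *\<^sub>R axis 1 1 + (e2 \<bullet> v) *\<^sub>R axis 2 1 +
       fst (?D v) *\<^sub>R axis 3 1 + snd (?D v) *\<^sub>R axis 4 1)"
    by (rule frechet_derivative_at[OF df, symmetric])
  have "inj (frechet_derivative f (at (snd c p)))"
  proof -
    have "v = 0" if "frechet_derivative f (at (snd c p)) v = 0" for v
      using that e[of v] by (auto simp: fd vec_eq_iff forall_4 axis_def prod_eq_iff)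
    then show ?thesis
      using linear_injective_0[OF has_derivative_linear[OF df[folded fd]]] by blast
  qed
  from smooth_inverse_function[OF S sf _ this]
  obtain S' where S': "S' \<subseteq> ?S" "snd c p \<in> S'" "smooth_diffeo f S'"
    using c(2) p(1) by (metis (no_types, lifting) IntI image_eqI)
  let ?d = "({q \<in> fst c. snd c q \<in> S'}, f \<circ> snd c)"
  have d: "?d \<in> A" by (rule add_chart[OF smooth_structure c(1) _ S'(3)]) (use S'(1) in auto)
  show thesis
  proof (rule that)
    show "adapted ?d"
      unfolding adapted_def
    proof (intro conjI ballI d)
      fix q assume q: "q \<in> fst ?d"
      then obtain q' where "q' \<in> fst c \<inter> U" "snd c q = snd c q'" using S'(1) by auto
      then show qU: "q \<in> U" using inj_onD[OF chartD(3)[OF c(1)]] q by auto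
      show "J q = (snd ?d q $ 3, snd ?d q $ 4)"
        using q by (simp add: f_def axis_def in_chart_apply'[OF c(1)])
    qed
    show "p \<in> fst ?d" using c S' by simp
  qed
qed

lemma adaptedD:
  assumes "adapted d"
  shows "d \<in> A" "q \<in> fst d \<Longrightarrow> q \<in> U" "q \<in> fst d \<Longrightarrow> J q = (snd d q $ 3, snd d q $ 4)"
  using assms by (auto simp: adapted_def)

lemma adapted_derivative_J:
  assumes "adapted d" "p \<in> fst d"
  shows "frechet_derivative (in_chart d J) (at (snd d p)) v = (v $ 3, v $ 4)"
proof -
  have "((\<lambda>x::real^4. (x $ 3, x $ 4)) has_derivative (\<lambda>v. (v $ 3, v $ 4))) (at (snd d p))"
    by (intro has_derivative_Pair bounded_linear_imp_has_derivative bounded_linear_vec_nth)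
  then have "(in_chart d J has_derivative (\<lambda>v. (v $ 3, v $ 4))) (at (snd d p))"
  proof (rule has_derivative_transform_within_open[OF _ chartD(2)[OF adaptedD(1)[OF assms(1)]]])
    show "(x $ 3, x $ 4) = in_chart d J x" if "x \<in> snd d ` fst d" for x
      using that adaptedD(3)[OF assms(1)] by (auto simp: in_chart_apply'[OF adaptedD(1)[OF assms(1)]])
  qed (use assms in auto)
  from frechet_derivative_at[OF this] show ?thesis by (simp add: fun_eq_iff)
qed

text \<open>The fibres of \<open>J\<close> are isotropic, since both Hamiltonian vector fields are tangent to them.\<close>

lemma adapted_isotropic:
  assumes d: "adapted d" and p: "p \<in> fst d"
  shows "Om d (snd d p) $ 1 $ 2 = 0"
proof -
  note dA = adaptedD(1)[OF d]
  let ?x = "snd d p" and ?G = "Om d (snd d p)" and ?g = "frechet_derivative g (at (J p))"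
  have x: "?x \<in> snd d ` fst d" using p by blast
  have pU: "p \<in> U" using adaptedD(2)[OF d p] .
  have dem: "frechet_derivative (in_chart d (em_map H L)) (at ?x) v = ?g (v $ 3, v $ 4)" for v
    using derivative_em_J[OF dA p pU] adapted_derivative_J[OF d p] by simp
  have dH: "(in_chart d H has_derivative frechet_derivative (in_chart d H) (at ?x)) (at ?x)"
    and dL: "(in_chart d L has_derivative frechet_derivative (in_chart d L) (at ?x)) (at ?x)"
    using smooth_on_has_derivative[OF smooth_H[OF dA] x] smooth_on_has_derivative[OF smooth_L[OF dA] x] .
  have "in_chart d (em_map H L) = (\<lambda>x. (in_chart d H x, in_chart d L x))"
    by (rule ext) (rule in_chart_em)
  then have "frechet_derivative (in_chart d (em_map H L)) (at ?x) =
      (\<lambda>v. (frechet_derivative (in_chart d H) (at ?x) v, frechet_derivative (in_chart d L) (at ?x) v))"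
    using frechet_derivative_at[OF has_derivative_Pair[OF dH dL]] by simp
  then have DH: "frechet_derivative (in_chart d H) (at ?x) v = fst (?g (v $ 3, v $ 4))"
    and DL: "frechet_derivative (in_chart d L) (at ?x) v = snd (?g (v $ 3, v $ 4))" for v
    using dem[of v] by (simp_all add: prod_eq_iff)
  define X where "X = ham_vf Om d H ?x"
  define Y where "Y = ham_vf Om d L ?x"
  have PX: "pairing ?G X v = fst (?g (v $ 3, v $ 4))" for v
    using ham_vf_pairing[of Om d ?x H, OF Om_invertible[OF dA x] has_derivative_linear[OF dH]] DH by (simp add: X_def)
  have PY: "pairing ?G Y v = snd (?g (v $ 3, v $ 4))" for v
    using ham_vf_pairing[of Om d ?x L, OF Om_invertible[OF dA x] has_derivative_linear[OF dL]] DL by (simp add: Y_def)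
  have anti: "pairing ?G u v = - pairing ?G v u" for u v
    by (rule pairing_antisym[OF Om_antisym[OF dA x]])
  have "pairing ?G X Y = 0"
    using integrable x dA unfolding liouville_integrable_def poisson_def X_def Y_def by blast
  then have "fst (?g (Y $ 3, Y $ 4)) = 0" "snd (?g (X $ 3, X $ 4)) = 0"
    "fst (?g (X $ 3, X $ 4)) = 0" "snd (?g (Y $ 3, Y $ 4)) = 0"
    using PX[of Y] PY[of X] anti[of Y X] anti[of X X] anti[of Y Y] PX[of X] PY[of Y] by simp_all
  then have gX: "?g (X $ 3, X $ 4) = 0" and gY: "?g (Y $ 3, Y $ 4) = 0" by (simp_all add: prod_eq_iff)
  note ginv = smooth_diffeo_frechet_derivative[OF g J_in(1)[OF pU]]
  let ?gi = "frechet_derivative (inv_into V g) (at (g (J p)))"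
  have gi0: "?gi 0 = 0"
    by (rule linear_0[OF has_derivative_linear[OF smooth_on_has_derivative[OF gD(5)]]]) (use J_in(1)[OF pU] in blast)
  \<comment> \<open>dg is injective, and dg sends the last two components of \<open>X\<close> to
    zero.\<close>
  have X34: "(X $ 3, X $ 4) = 0" using ginv(1)[of "(X $ 3, X $ 4)"] gX gi0 by simp
  have "X \<noteq> 0"
  proof
    assume "X = 0"
    then have z: "fst (?g (v $ 3, v $ 4)) = 0" for v :: "real^4" using PX[of v] by (simp add: pairing_simps)
    have "fst (?g w) = 0" for w
      using z[of "fst w *\<^sub>R axis 3 1 + snd w *\<^sub>R axis 4 1"] by (simp add: axis_def)
    then have "fst (?g (?gi (1, 0))) = 0" by blast
    then show False using ginv(2)[of "(1, 0)"] by simp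
  qed
  then have X12: "X $ 1 \<noteq> 0 \<or> X $ 2 \<noteq> 0" using X34 by (auto simp: vec_eq_iff forall_4 zero_prod_def)
  have g0: "?g (0, 0) = 0"
    using linear_0[OF has_derivative_linear[OF smooth_on_has_derivative[OF gD(4) J_in(1)[OF pU]]]]
    by (simp add: zero_prod_def)
  \<comment> \<open>\<open>X\<close> is a non-zero combination of the first two axes, and its
    pairing with both vanishes because these axes are tangent to the fibre. Only the entry (1, 2) of
    the form occurs in these pairings, so it must be zero.\<close>
  have "pairing ?G X (axis 1 1) = 0" "pairing ?G X (axis 2 1) = 0"
    unfolding PX by (simp_all add: axis_def g0)
  then have "X $ 2 * ?G $ 2 $ 1 = 0" "X $ 1 * ?G $ 1 $ 2 = 0"
    using X34 Om_entry_antisym[OF dA x, of 1 1] Om_entry_antisym[OF dA x, of 2 2]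
    by (auto simp: pairing_expand sum_4 axis_def zero_prod_def)
  then show ?thesis using X12 Om_entry_antisym[OF dA x, of 1 2] by auto
qed

end

lemma UNIV4_cases: "i = 1 \<or> i = 2 \<or> i = 3 \<or> i = 4" for i :: 4
  using exhaust_4[of i] by blast

lemma partial_eq_0:
  assumes "open S" "x \<in> S" "\<And>y. y \<in> S \<Longrightarrow> f y = c"
  shows "partial i f x = 0"
proof -
  have "(f has_derivative (\<lambda>v. 0)) (at x)"
    by (rule has_derivative_transform_within_open[OF has_derivative_const assms(1,2)]) (simp add: assms(3))
  from frechet_derivative_at[OF this] show ?thesis by (simp add: partial_def fun_eq_iff)
qed

context integrable_system
begin

text \<open>In a \<open>flow_chart\<close> the Hamiltonian vector fields of the components of \<open>J\<close> are the first two
  coordinate fields, and the symplectic form is invariant under them.\<close>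

definition flow_chart :: "'m chart \<Rightarrow> bool" where
  "flow_chart d \<longleftrightarrow> adapted d \<and> convex (snd d ` fst d) \<and>
     (\<forall>x\<in>snd d ` fst d. \<forall>v. pairing (Om d x) (axis 1 1) v = v $ 3 \<and> pairing (Om d x) (axis 2 1) v = v $ 4) \<and>
     (\<forall>x\<in>snd d ` fst d. \<forall>y\<in>snd d ` fst d. x $ 3 = y $ 3 \<longrightarrow> x $ 4 = y $ 4 \<longrightarrow> Om d x = Om d y)"

lemma adapted_pairing:
  assumes d: "adapted d" and x: "x \<in> snd d ` fst d" and u: "u $ 3 = 0" "u $ 4 = 0"
  shows "pairing (Om d x) u v = (u $ 1 * Om d x $ 1 $ 3 + u $ 2 * Om d x $ 2 $ 3) * v $ 3
    + (u $ 1 * Om d x $ 1 $ 4 + u $ 2 * Om d x $ 2 $ 4) * v $ 4"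
proof -
  note dA = adaptedD(1)[OF d]
  have z: "Om d x $ 1 $ 2 = 0" using adapted_isotropic[OF d] x by blast
  then have "Om d x $ 2 $ 1 = 0" "Om d x $ 1 $ 1 = 0" "Om d x $ 2 $ 2 = 0"
    using Om_entry_antisym[OF dA x, of 2 1] Om_entry_antisym[OF dA x, of 1 1]
      Om_entry_antisym[OF dA x, of 2 2] by linarith+
  with z u show ?thesis by (simp add: pairing_expand sum_4 algebra_simps)
qed

lemma closed_Om:
  assumes "c \<in> A" "x \<in> snd c ` fst c"
  shows "partial i (\<lambda>y. Om c y $ j $ k) x + partial j (\<lambda>y. Om c y $ k $ i) x + partial k (\<lambda>y. Om c y $ i $ j) x = 0"
  using closed assms unfolding closed_2form_def by blast

lemma partial_Om_swap:
  assumes "c \<in> A" "x \<in> snd c ` fst c"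
  shows "partial i (\<lambda>y. Om c y $ k $ j) x = - partial i (\<lambda>y. Om c y $ j $ k) x"
proof -
  have "((\<lambda>y. Om c y $ j $ k) has_derivative frechet_derivative (\<lambda>y. Om c y $ j $ k) (at x)) (at x)"
    by (rule smooth_on_has_derivative[OF smooth_Om_entry[OF assms(1)] assms(2)])
  then have "((\<lambda>y. - (Om c y $ j $ k)) has_derivative (\<lambda>v. - frechet_derivative (\<lambda>y. Om c y $ j $ k) (at x) v)) (at x)"
    by (rule has_derivative_minus)
  then have "((\<lambda>y. Om c y $ k $ j) has_derivative (\<lambda>v. - frechet_derivative (\<lambda>y. Om c y $ j $ k) (at x) v)) (at x)"
    by (rule has_derivative_transform_within_open[OF _ chartD(2)[OF assms(1)] assms(2)])
      (simp add: Om_entry_antisym[OF assms(1), of _ k j])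
  from frechet_derivative_at[OF this] show ?thesis by (simp add: partial_def fun_eq_iff)
qed

definition proj12 :: "real^4 \<Rightarrow> real^4" where
  "proj12 x = x $ 1 *\<^sub>R axis 1 1 + x $ 2 *\<^sub>R axis 2 1"

lemma linear_proj12: "linear proj12"
  by (rule linearI) (simp_all add: proj12_def algebra_simps)

lemma proj12_nth [simp]: "proj12 x $ 1 = x $ 1" "proj12 x $ 2 = x $ 2" "proj12 x $ 3 = 0" "proj12 x $ 4 = 0"
  by (simp_all add: proj12_def axis_def)

text \<open>Shrinking two of the four coordinates towards the centre does not increase the distance
  to it, so balls are admissible domains for \<open>primitive_along\<close>.\<close>

lemma proj12_ball:
  assumes x: "x \<in> ball c r" and s: "0 \<le> s" "s \<le> 1"
  shows "x - (1 - s) *\<^sub>R proj12 (x - c) \<in> ball c r"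
proof -
  let ?y = "x - c"
  have s2: "s\<^sup>2 \<le> 1" using s by (simp add: power_le_one)
  have "(norm (x - (1 - s) *\<^sub>R proj12 ?y - c))\<^sup>2 \<le> (norm ?y)\<^sup>2"
  proof -
    have e: "x - (1 - s) *\<^sub>R proj12 ?y - c = ?y - (1 - s) *\<^sub>R proj12 ?y" by simp
    have n: "(?y - (1 - s) *\<^sub>R proj12 ?y) $ 1 = s * ?y $ 1" "(?y - (1 - s) *\<^sub>R proj12 ?y) $ 2 = s * ?y $ 2"
      "(?y - (1 - s) *\<^sub>R proj12 ?y) $ 3 = ?y $ 3" "(?y - (1 - s) *\<^sub>R proj12 ?y) $ 4 = ?y $ 4"
      by (simp_all add: algebra_simps)
    have le: "(s * a) * (s * a) \<le> a * a" for a :: real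
      using mult_right_mono[OF s2 zero_le_square[of a]] by (simp add: power2_eq_square algebra_simps)
    show ?thesis
      unfolding e power2_norm_eq_inner inner_vec_def sum_4 n inner_real_def
      using le[of "?y $ 1"] le[of "?y $ 2"] by simp
  qed
  then have "norm (x - (1 - s) *\<^sub>R proj12 ?y - c) \<le> norm ?y" by (simp add: power2_le_iff_abs_le)
  then show ?thesis using x by (simp add: dist_norm norm_minus_commute)
qed

text \<open>The times along the flows are primitives of the 1-forms \<open>G\<^sub>1\<^sub>j dx\<^sub>1 + G\<^sub>2\<^sub>j dx\<^sub>2\<close>, which are
  closed along the fibres because \<open>\<Omega>\<close> is closed and the fibres are isotropic.\<close>

lemma ex_flow_time:
  assumes d: "adapted d" and ball: "ball c r \<subseteq> snd d ` fst d" and j: "j = 3 \<or> j = 4"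
  obtains T where "smooth_on T (ball c r)"
    "\<And>x v. x \<in> ball c r \<Longrightarrow> v $ 3 = 0 \<Longrightarrow> v $ 4 = 0 \<Longrightarrow>
       frechet_derivative T (at x) v = v $ 1 * Om d x $ 1 $ j + v $ 2 * Om d x $ 2 $ j"
proof -
  note dA = adaptedD(1)[OF d]
  define \<eta> :: "real^4 \<Rightarrow> real^4" where "\<eta> x = Om d x $ 1 $ j *\<^sub>R axis 1 1 + Om d x $ 2 $ j *\<^sub>R axis 2 1" for x
  note sO = smooth_on_subset[OF smooth_Om_entry[OF dA] ball]
  have s\<eta>: "smooth_on \<eta> (ball c r)"
    unfolding \<eta>_def by (intro smooth_on_add smooth_on_scaleR smooth_on_const open_ball sO)
  have cl: "frechet_derivative \<eta> (at x) (proj12 u) \<bullet> proj12 v = frechet_derivative \<eta> (at x) (proj12 v) \<bullet> proj12 u"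
    if x: "x \<in> ball c r" for x u v
  proof -
    have xd: "x \<in> snd d ` fst d" using x ball by blast
    let ?D = "\<lambda>i. frechet_derivative (\<lambda>y. Om d y $ i $ j) (at x)"
    have dO: "((\<lambda>y. Om d y $ i $ j) has_derivative ?D i) (at x)" for i
      by (rule smooth_on_has_derivative[OF smooth_Om_entry[OF dA] xd])
    have "(\<eta> has_derivative (\<lambda>v. ?D 1 v *\<^sub>R axis 1 1 + ?D 2 v *\<^sub>R axis 2 1)) (at x)"
      unfolding \<eta>_def by (intro has_derivative_add has_derivative_scaleR_left dO)
    from frechet_derivative_at[OF this]
    have D\<eta>: "frechet_derivative \<eta> (at x) w = ?D 1 w *\<^sub>R axis 1 1 + ?D 2 w *\<^sub>R axis 2 1" for w by (simp add: fun_eq_iff)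
    have Dp: "?D i (proj12 w) = w $ 1 * ?D i (axis 1 1) + w $ 2 * ?D i (axis 2 1)" for i w
      using linear_expand_4[OF has_derivative_linear[OF dO[of i]], of "proj12 w"] by simp
    \<comment> \<open>In the closedness relation for the indices 1, 2, j this is the term to be
      removed: the entry (1, 2) vanishes on the whole chart by isotropy. What remains says that the
      1-form is closed along the fibres.\<close>
    have z: "partial j (\<lambda>y. Om d y $ 1 $ 2) x = 0"
      by (rule partial_eq_0[OF chartD(2)[OF dA] xd]) (use adapted_isotropic[OF d] in auto)
    have "partial 1 (\<lambda>y. Om d y $ 2 $ j) x = partial 2 (\<lambda>y. Om d y $ 1 $ j) x"
      using closed_Om[OF dA xd, of 1 2 j] partial_Om_swap[OF dA xd, of 2 j 1] z by simp
    then have "?D 2 (axis 1 1) = ?D 1 (axis 2 1)" by (simp add: partial_def)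
    then show ?thesis
      by (simp add: D\<eta> Dp inner_add_left inner_axis' algebra_simps)
  qed
  obtain T where T: "smooth_on T (ball c r)"
    "\<And>x v. x \<in> ball c r \<Longrightarrow> frechet_derivative T (at x) (proj12 v) = \<eta> x \<bullet> proj12 v"
    using primitive_along[OF open_ball linear_proj12 _ proj12_ball s\<eta> cl] by (auto simp: proj12_def axis_def)
  show thesis
  proof (rule that[OF T(1)])
    fix x v :: "real^4" assume x: "x \<in> ball c r" and v: "v $ 3 = 0" "v $ 4 = 0"
    have "proj12 v = v" using v by (simp add: vec_eq_iff forall_4)
    then show "frechet_derivative T (at x) v = v $ 1 * Om d x $ 1 $ j + v $ 2 * Om d x $ 2 $ j"
      using T(2)[OF x, of v] by (simp add: \<eta>_def inner_add_left inner_axis' algebra_simps)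
  qed
qed

text \<open>The flow times replace the first two coordinates. The new coordinate fields then pair
  with the form to dJ1 and dJ2, that is, they are the Hamiltonian fields. The entry (3, 4) is not
  normalized to zero: its constancy along the fibres follows from closedness, and only this
  invariance is used later.\<close>

lemma ex_flow_chart:
  assumes p: "p \<in> U" "regular_point A H L p"
  obtains e where "flow_chart e" "p \<in> fst e"
proof -
  obtain d where d: "adapted d" "p \<in> fst d" using ex_adapted[OF p] by blast
  note dA = adaptedD(1)[OF d(1)]
  let ?x = "snd d p"
  obtain r where r: "r > 0" "ball ?x r \<subseteq> snd d ` fst d"
    using chartD(2)[OF dA] d(2) open_contains_ball by blast
  obtain T1 where T1: "smooth_on T1 (ball ?x r)"
    "\<And>x v. x \<in> ball ?x r \<Longrightarrow> v $ 3 = 0 \<Longrightarrow> v $ 4 = 0 \<Longrightarrow>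
       frechet_derivative T1 (at x) v = v $ 1 * Om d x $ 1 $ 3 + v $ 2 * Om d x $ 2 $ 3"
    using ex_flow_time[OF d(1) r(2)] by (metis (no_types, lifting))
  obtain T2 where T2: "smooth_on T2 (ball ?x r)"
    "\<And>x v. x \<in> ball ?x r \<Longrightarrow> v $ 3 = 0 \<Longrightarrow> v $ 4 = 0 \<Longrightarrow>
       frechet_derivative T2 (at x) v = v $ 1 * Om d x $ 1 $ 4 + v $ 2 * Om d x $ 2 $ 4"
    using ex_flow_time[OF d(1) r(2)] by (metis (no_types, lifting))
  define f :: "real^4 \<Rightarrow> real^4" where
    "f x = T1 x *\<^sub>R axis 1 1 + T2 x *\<^sub>R axis 2 1 + x $ 3 *\<^sub>R axis 3 1 + x $ 4 *\<^sub>R axis 4 1" for x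
  let ?D1 = "\<lambda>x. frechet_derivative T1 (at x)" and ?D2 = "\<lambda>x. frechet_derivative T2 (at x)"
  have sf: "smooth_on f (ball ?x r)"
    unfolding f_def
    by (intro smooth_on_add smooth_on_scaleR smooth_on_const smooth_on_nth smooth_on_ident open_ball T1(1) T2(1))
  have df: "(f has_derivative (\<lambda>v. ?D1 x v *\<^sub>R axis 1 1 + ?D2 x v *\<^sub>R axis 2 1 + v $ 3 *\<^sub>R axis 3 1 + v $ 4 *\<^sub>R axis 4 1)) (at x)"
    if "x \<in> ball ?x r" for x
    unfolding f_def
    by (intro has_derivative_add has_derivative_scaleR_left smooth_on_has_derivative[OF T1(1) that]
        smooth_on_has_derivative[OF T2(1) that] bounded_linear_imp_has_derivative bounded_linear_vec_nth)
  have fd: "frechet_derivative f (at x) = (\<lambda>v. ?D1 x v *\<^sub>R axis 1 1 + ?D2 x v *\<^sub>R axis 2 1 + v $ 3 *\<^sub>R axis 3 1 + v $ 4 *\<^sub>R axis 4 1)"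
    if "x \<in> ball ?x r" for x by (rule frechet_derivative_at[OF df[OF that], symmetric])
  have key: "pairing (Om d x) u v = ?D1 x u * v $ 3 + ?D2 x u * v $ 4"
    if x: "x \<in> ball ?x r" and u: "u $ 3 = 0" "u $ 4 = 0" for x u v
    using adapted_pairing[OF d(1) subsetD[OF r(2) x] u] T1(2)[OF x u] T2(2)[OF x u] by simp
  have x0: "?x \<in> ball ?x r" using r(1) by simp
  have "inj (frechet_derivative f (at ?x))"
  proof -
    have "v = 0" if "frechet_derivative f (at ?x) v = 0" for v
    proof -
      have v: "v $ 3 = 0" "v $ 4 = 0" "?D1 ?x v = 0" "?D2 ?x v = 0"
        using that unfolding fd[OF x0] by (auto simp: vec_eq_iff forall_4 axis_def)
      show ?thesis
        by (rule pairing_nondegenerate[OF Om_invertible[OF dA]]) (use d(2) key[OF x0 v(1,2)] v in auto)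
    qed
    then show ?thesis
      using linear_injective_0[OF has_derivative_linear[OF df[OF x0, folded fd[OF x0]]]] by blast
  qed
  from smooth_inverse_function[OF open_ball sf x0 this]
  obtain S' where S': "S' \<subseteq> ball ?x r" "?x \<in> S'" "smooth_diffeo f S'"
    and inj: "\<And>x. x \<in> S' \<Longrightarrow> inj (frechet_derivative f (at x))" by metis
  note S'D = smooth_diffeoD[OF S'(3)]
  \<comment> \<open>The chart is cut down so that its image is a ball: flow charts must be convex in
    order that points of a common fibre can be joined by a segment.\<close>
  obtain \<rho> where \<rho>: "\<rho> > 0" "ball (f ?x) \<rho> \<subseteq> f ` S'"
    using S'D(2) S'(2) open_contains_ball by (metis image_eqI)
  define S where "S = S' \<inter> f -` ball (f ?x) \<rho>"
  have "open S" unfolding S_def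
    by (rule continuous_open_preimage[OF smooth_on_continuous[OF S'D(4)] S'D(1) open_ball])
  then have S: "smooth_diffeo f S" by (rule smooth_diffeo_subset[OF S'(3)]) (simp add: S_def)
  have fS: "f ` S = ball (f ?x) \<rho>" using \<rho>(2) unfolding S_def by auto
  have Sr: "S \<subseteq> ball ?x r" and SS': "S \<subseteq> S'" using S'(1) unfolding S_def by auto
  let ?e = "({q \<in> fst d. snd d q \<in> S}, f \<circ> snd d)"
  have Sd: "S \<subseteq> snd d ` fst d" using Sr r(2) by blast
  have eA: "?e \<in> A" by (rule add_chart[OF smooth_structure dA Sd S])
  have img: "snd ?e ` fst ?e = ball (f ?x) \<rho>"
  proof -
    have "snd d ` {q \<in> fst d. snd d q \<in> S} = S" using Sd by auto
    then show ?thesis using fS by (metis image_comp fst_conv snd_conv)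
  qed
  have ade: "adapted ?e"
    unfolding adapted_def
  proof (intro conjI eA ballI)
    fix q assume q: "q \<in> fst ?e"
    show "q \<in> U" using adaptedD(2)[OF d(1)] q by simp
    show "J q = (snd ?e q $ 3, snd ?e q $ 4)" using adaptedD(3)[OF d(1), of q] q by (simp add: f_def axis_def)
  qed
  have tr: "frechet_derivative (in_chart d (snd ?e)) (at (snd d q)) = frechet_derivative f (at (snd d q))"
    if q: "q \<in> fst ?e" for q
  proof -
    have "(in_chart d (snd ?e) has_derivative frechet_derivative f (at (snd d q))) (at (snd d q))"
    proof (rule has_derivative_transform_within_open[OF _ smooth_diffeoD(1)[OF S]])
      show "(f has_derivative frechet_derivative f (at (snd d q))) (at (snd d q))"
        using q smooth_on_has_derivative[OF smooth_diffeoD(4)[OF S], of "snd d q"] by simp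
      show "f y = in_chart d (snd ?e) y" if "y \<in> S" for y
        using that Sd by (auto simp: in_chart_apply'[OF dA] subset_iff)
    qed (use q in simp)
    then show ?thesis by (rule frechet_derivative_at[symmetric])
  qed
  have pair: "pairing (Om ?e (f x)) (frechet_derivative f (at x) u) (frechet_derivative f (at x) v) = pairing (Om d x) u v"
    if x: "x \<in> S" for x u v
  proof -
    obtain q where q: "q \<in> fst d" "x = snd d q" using x Sd by blast
    then have qe: "q \<in> fst ?e" using x by simp
    show ?thesis using Om_change[OF two_form dA eA q(1) qe, of u v] unfolding tr[OF qe] q(2) by simp
  qed
  have coord: "pairing (Om ?e y) (axis 1 1) v = v $ 3 \<and> pairing (Om ?e y) (axis 2 1) v = v $ 4"
    if "y \<in> ball (f ?x) \<rho>" for y v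
  proof -
    obtain x where x: "x \<in> S" "y = f x" using fS \<open>y \<in> ball (f ?x) \<rho>\<close> by blast
    have xb: "x \<in> ball ?x r" using x Sr by blast
    have "surj (frechet_derivative f (at x))"
      using linear_injective_imp_surjective[OF has_derivative_linear[OF df[OF xb, folded fd[OF xb]]] inj] x SS' by blast
    then obtain u1 u2 w where u: "frechet_derivative f (at x) u1 = axis 1 1" "frechet_derivative f (at x) u2 = axis 2 1"
      "frechet_derivative f (at x) w = v" by (metis surjD)
    have c1: "u1 $ 3 = 0" "u1 $ 4 = 0" "?D1 x u1 = 1" "?D2 x u1 = 0"
      using u(1) unfolding fd[OF xb] by (auto simp: vec_eq_iff forall_4 axis_def)
    have c2: "u2 $ 3 = 0" "u2 $ 4 = 0" "?D1 x u2 = 0" "?D2 x u2 = 1"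
      using u(2) unfolding fd[OF xb] by (auto simp: vec_eq_iff forall_4 axis_def)
    have cv: "v $ 3 = w $ 3" "v $ 4 = w $ 4"
      using u(3) unfolding fd[OF xb] by (auto simp: vec_eq_iff forall_4 axis_def)
    show ?thesis
      using pair[OF x(1), of u1 w] pair[OF x(1), of u2 w] key[OF xb c1(1,2), of w] key[OF xb c2(1,2), of w]
      by (simp add: u c1 c2 cv x(2))
  qed
  have inv: "Om ?e y = Om ?e z"
    if y: "y \<in> ball (f ?x) \<rho>" and z: "z \<in> ball (f ?x) \<rho>" and eq: "y $ 3 = z $ 3" "y $ 4 = z $ 4" for y z
  proof -
    let ?G = "Om ?e"
    have row: "?G x $ 1 $ k = (if k = 3 then 1 else 0)" "?G x $ 2 $ k = (if k = 4 then 1 else 0)"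
      if "x \<in> ball (f ?x) \<rho>" for x k
      using coord[OF that, of "axis k 1"] UNIV4_cases[of k] by (auto simp: pairing_expand sum_4 axis_def)
    have ie: "x \<in> snd ?e ` fst ?e" if "x \<in> ball (f ?x) \<rho>" for x using that img by metis
    note anti = Om_entry_antisym[OF eA ie]
    \<comment> \<open>The closedness relation for i, 3, 4 contains besides this term only
      derivatives of entries in the first two rows and columns, which are constant.\<close>
    have d34: "partial i (\<lambda>y. ?G y $ 3 $ 4) x = 0" if x: "x \<in> ball (f ?x) \<rho>" and i: "i = 1 \<or> i = 2" for x i
    proof -
      have "partial 3 (\<lambda>y. ?G y $ 4 $ i) x = 0"
        by (rule partial_eq_0[OF open_ball x, of _ "- (if i = 2 then 1 else 0)"])
          (use i row anti[of _ 4 i] in auto)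
      moreover have "partial 4 (\<lambda>y. ?G y $ i $ 3) x = 0"
        by (rule partial_eq_0[OF open_ball x, of _ "(if i = 1 then 1 else 0)"])
          (use i row in auto)
      ultimately show ?thesis using closed_Om[OF eA ie[OF x], of i 3 4] by simp
    qed
    let ?F = "\<lambda>x. ?G x $ 3 $ 4"
    have dF: "(?F has_derivative frechet_derivative ?F (at x)) (at x)" if "x \<in> ball (f ?x) \<rho>" for x
      by (rule smooth_on_has_derivative[OF smooth_Om_entry[OF eA] ie[OF that]])
    have seg: "y + s *\<^sub>R (z - y) \<in> ball (f ?x) \<rho>" if "s \<in> {0..1}" for s
      using convexD_alt[OF convex_ball[of "f ?x" \<rho>] y z, of s] that by (simp add: algebra_simps)
    have "((\<lambda>s. ?F (y + s *\<^sub>R (z - y))) has_derivative (\<lambda>h. 0)) (at s within {0..1})" if s: "s \<in> {0..1}" for s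
    proof -
      have l: "((\<lambda>s. y + s *\<^sub>R (z - y)) has_derivative (\<lambda>h. h *\<^sub>R (z - y))) (at s within {0..1})"
        by (auto intro!: derivative_eq_intros)
      have "frechet_derivative ?F (at (y + s *\<^sub>R (z - y))) (h *\<^sub>R (z - y)) = 0" for h
        using linear_expand_4[OF has_derivative_linear[OF dF[OF seg[OF s]]], of "h *\<^sub>R (z - y)"]
          d34[OF seg[OF s], of 1] d34[OF seg[OF s], of 2] eq by (simp add: partial_def)
      then show ?thesis using has_derivative_compose[OF l dF[OF seg[OF s]]] by simp
    qed
    from has_derivative_zero_unique[OF convex_real_interval(5) this, of 1 0]
    have F: "?F y = ?F z" by simp
    show ?thesis
    proof (subst vec_eq_iff, subst vec_eq_iff, intro allI)
      fix i j :: 4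
      have s: "?G y $ i $ j = - (?G y $ j $ i)" "?G z $ i $ j = - (?G z $ j $ i)"
        "?G y $ i $ i = - (?G y $ i $ i)" "?G z $ i $ i = - (?G z $ i $ i)"
        using anti[OF y] anti[OF z] by blast+
      show "?G y $ i $ j = ?G z $ i $ j"
        using UNIV4_cases[of i] UNIV4_cases[of j] s row[OF y] row[OF z] F by (elim disjE) simp_all
    qed
  qed
  show thesis
  proof (rule that)
    show "flow_chart ?e"
      unfolding flow_chart_def img
      by (intro conjI ballI allI impI ade convex_ball coord[THEN conjunct1] coord[THEN conjunct2] inv)
    show "p \<in> fst ?e" using d(2) S'(2) \<rho>(1) by (simp add: S_def)
  qed
qed

end

section \<open>Orbit maps and the flow\<close>

text \<open>The map \<open>l\<close> sends a time parameter to a displacement along the fibre in a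
  flow chart. Leaving the parameter space open treats the flow of J1 (\<open>l1\<close>), the joint
  flow (\<open>l2\<close>) and linear reparametrizations at once.\<close>

definition tangential :: "('a::real_normed_vector \<Rightarrow> real^4) \<Rightarrow> bool" where
  "tangential l \<longleftrightarrow> bounded_linear l \<and> (\<forall>a. l a $ 3 = 0 \<and> l a $ 4 = 0)"

context integrable_system
begin

lemma flow_chartD:
  assumes "flow_chart d"
  shows "adapted d" "d \<in> A" "convex (snd d ` fst d)"
    "x \<in> snd d ` fst d \<Longrightarrow> y \<in> snd d ` fst d \<Longrightarrow> x $ 3 = y $ 3 \<Longrightarrow> x $ 4 = y $ 4 \<Longrightarrow> Om d x = Om d y"
  using assms adaptedD(1) unfolding flow_chart_def by blast+

lemma flow_chart_pairing:
  assumes "flow_chart d" "x \<in> snd d ` fst d" "u $ 3 = 0" "u $ 4 = 0"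
  shows "pairing (Om d x) u v = u $ 1 * v $ 3 + u $ 2 * v $ 4"
proof -
  have u: "u = u $ 1 *\<^sub>R axis 1 1 + u $ 2 *\<^sub>R axis 2 1"
    using assms(3,4) by (simp add: vec_eq_iff forall_4 axis_def)
  have "pairing (Om d x) (axis 1 1) v = v $ 3" "pairing (Om d x) (axis 2 1) v = v $ 4"
    using assms(1,2) unfolding flow_chart_def by blast+
  then show ?thesis by (subst u) (simp only: pairing_simps real_scaleR_def)
qed

lemma regular_adapted:
  assumes "adapted d" "p \<in> fst d"
  shows "regular_point A H L p"
proof -
  have "surj (\<lambda>v::real^4. (v $ 3, v $ 4))"
  proof (rule surjI)
    fix w :: "real \<times> real"
    show "((\<lambda>w. fst w *\<^sub>R axis 3 1 + snd w *\<^sub>R axis 4 1) w $ (3::4),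
      (\<lambda>w. fst w *\<^sub>R axis 3 1 + snd w *\<^sub>R axis 4 (1::real)) w $ (4::4)) = w" by (simp add: axis_def)
  qed
  moreover have "frechet_derivative (in_chart d J) (at (snd d p)) = (\<lambda>v. (v $ 3, v $ 4))"
    by (rule ext) (rule adapted_derivative_J[OF assms])
  ultimately show ?thesis
    using regular_point_iff[OF adaptedD(1)[OF assms(1)] assms(2) adaptedD(2)[OF assms]] by simp
qed

text \<open>A Hamiltonian vector is characterized by its pairing with all others, which does not
  depend on the chart. In a flow chart the vector with the required pairing is \<open>l\<close>
  itself, and nondegeneracy leaves no other.\<close>

lemma transition_to_flow_chart:
  assumes c: "c \<in> A" "p \<in> fst c" and d: "flow_chart d" "p \<in> fst d" and l: "l $ 3 = 0" "l $ 4 = 0"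
    and D: "\<And>b. pairing (Om c (snd c p)) D b =
      l $ 1 * fst (frechet_derivative (in_chart c J) (at (snd c p)) b) +
      l $ 2 * snd (frechet_derivative (in_chart c J) (at (snd c p)) b)"
  shows "transition c d p D = l"
proof (rule pairing_eqD)
  note dA = flow_chartD(2)[OF d(1)]
  show "invertible (Om d (snd d p))" using Om_invertible[OF dA] d(2) by blast
  fix y
  have pU: "p \<in> U" using adaptedD(2)[OF flow_chartD(1)[OF d(1)] d(2)] .
  obtain b where b: "transition c d p b = y" using surj_transition[OF c(1) dA c(2) d(2)] by (metis surjD)
  have dJ: "frechet_derivative (in_chart c J) (at (snd c p)) b = (y $ 3, y $ 4)"
    using frechet_derivative_at[OF has_derivative_in_chart_change[OF c(1) dA c(2) d(2) has_derivative_J[OF dA d(2) pU]], symmetric]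
    by (simp add: adapted_derivative_J[OF flow_chartD(1)[OF d(1)] d(2)] b)
  have "pairing (Om d (snd d p)) (transition c d p D) y = pairing (Om c (snd c p)) D b"
    using Om_change[OF two_form c(1) dA c(2) d(2), of D b] b by simp
  also have "\<dots> = l $ 1 * y $ 3 + l $ 2 * y $ 4" using D[of b] dJ by simp
  also have "\<dots> = pairing (Om d (snd d p)) l y"
    using flow_chart_pairing[OF d(1) _ l] d(2) by simp
  finally show "pairing (Om d (snd d p)) (transition c d p D) y = pairing (Om d (snd d p)) l y" .
qed

lemma flow_chart_transition:
  assumes c: "flow_chart c" "p \<in> fst c" and d: "flow_chart d" "p \<in> fst d" and l: "l $ 3 = 0" "l $ 4 = 0"
  shows "transition c d p l = l"
proof (rule transition_to_flow_chart[OF flow_chartD(2)[OF c(1)] c(2) d l])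
  fix b show "pairing (Om c (snd c p)) l b = l $ 1 * fst (frechet_derivative (in_chart c J) (at (snd c p)) b) +
      l $ 2 * snd (frechet_derivative (in_chart c J) (at (snd c p)) b)"
    using flow_chart_pairing[OF c(1) _ l] c(2) adapted_derivative_J[OF flow_chartD(1)[OF c(1)] c(2)] by simp
qed

text \<open>The derivative of a transition between flow charts is the identity on fibre directions.
  Along a segment in the fibre the transition minus the displacement therefore has derivative
  zero.\<close>

lemma flow_chart_translation:
  assumes c: "flow_chart c" "p \<in> fst c" and d: "flow_chart d" "p \<in> fst d"
  obtains e where "e > 0"
    "\<And>q v. q \<in> fst c \<Longrightarrow> snd c q = snd c p + v \<Longrightarrow> v $ 3 = 0 \<Longrightarrow> v $ 4 = 0 \<Longrightarrow> norm v < e \<Longrightarrow>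
       q \<in> fst d \<and> snd d q = snd d p + v"
proof -
  note cA = flow_chartD(2)[OF c(1)] and dA = flow_chartD(2)[OF d(1)]
  let ?W = "snd c ` (fst c \<inter> fst d)" and ?x = "snd c p" and ?\<tau> = "in_chart c (snd d)"
  obtain e where e: "e > 0" "ball ?x e \<subseteq> ?W"
    using open_overlap[OF cA dA] c(2) d(2) open_contains_ball by (metis IntI image_eqI)
  show thesis
  proof (rule that[OF e(1)])
    fix q v assume q: "q \<in> fst c" "snd c q = ?x + v" and v: "v $ 3 = 0" "v $ 4 = 0" "norm v < e"
    have seg: "?x + s *\<^sub>R v \<in> ball ?x e" if "s \<in> {0..1}" for s
    proof -
      have "\<bar>s\<bar> * norm v \<le> 1 * norm v" using that by (intro mult_right_mono) auto
      then show ?thesis using v(3) by (simp add: dist_norm)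
    qed
    have "((\<lambda>s. ?\<tau> (?x + s *\<^sub>R v) - s *\<^sub>R v) has_derivative (\<lambda>h. 0)) (at s within {0..1})" if s: "s \<in> {0..1}" for s
    proof -
      obtain q' where q': "q' \<in> fst c" "q' \<in> fst d" "?x + s *\<^sub>R v = snd c q'" using seg[OF s] e(2) by blast
      have l: "((\<lambda>s. ?x + s *\<^sub>R v) has_derivative (\<lambda>h. h *\<^sub>R v)) (at s within {0..1})"
        by (auto intro!: derivative_eq_intros)
      have h: "transition c d q' (h *\<^sub>R v) = h *\<^sub>R v" for h
        by (rule flow_chart_transition[OF c(1) q'(1) d(1) q'(2)]) (simp_all add: v)
      have "((\<lambda>s. ?\<tau> (?x + s *\<^sub>R v)) has_derivative (\<lambda>h. transition c d q' (h *\<^sub>R v))) (at s within {0..1})"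
        by (rule has_derivative_chain[OF l q'(3) has_derivative_transition[OF cA dA q'(1,2)]])
      then have 1: "((\<lambda>s. ?\<tau> (?x + s *\<^sub>R v)) has_derivative (\<lambda>h. h *\<^sub>R v)) (at s within {0..1})"
        unfolding h .
      have 2: "((\<lambda>s. s *\<^sub>R v) has_derivative (\<lambda>h. h *\<^sub>R v)) (at s within {0..1})"
        by (auto intro!: derivative_eq_intros)
      from has_derivative_diff[OF 1 2] show ?thesis by simp
    qed
    from has_derivative_zero_unique[OF convex_real_interval(5) this, of 1 0]
    have "?\<tau> (?x + v) = ?\<tau> ?x + v" by (simp add: algebra_simps)
    moreover have "q \<in> fst d"
    proof -
      have "?x + v \<in> ?W" using seg[of 1] e(2) by auto
      then obtain q' where q': "q' \<in> fst c" "q' \<in> fst d" "?x + v = snd c q'" by blast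
      have "q = q'" by (rule inj_onD[OF chartD(3)[OF cA] _ q(1) q'(1)]) (simp add: q(2) q'(3))
      then show ?thesis using q'(2) by simp
    qed
    moreover have "?\<tau> (?x + v) = snd d q" "?\<tau> ?x = snd d p"
      using in_chart_apply'[OF cA q(1)] in_chart_apply'[OF cA c(2)] by (simp_all add: q(2)[symmetric])
    ultimately show "q \<in> fst d \<and> snd d q = snd d p + v" by simp
  qed
qed

text \<open>A notion of solution of Hamilton's equations without a differential equation: near each
  parameter the curve or surface is affine, with linear part \<open>l\<close>, in some flow chart.
  Only parameters in \<open>T\<close> are compared, so \<open>T\<close> may be a point, a segment or
  the whole space.\<close>

definition orbit_map :: "('a::real_normed_vector \<Rightarrow> real^4) \<Rightarrow> ('a \<Rightarrow> 'm) \<Rightarrow> 'a set \<Rightarrow> bool" where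
  "orbit_map l \<gamma> T \<longleftrightarrow> (\<forall>t\<in>T. \<exists>c. flow_chart c \<and> \<gamma> t \<in> fst c \<and>
     (\<exists>e>0. \<forall>s\<in>T. dist s t < e \<longrightarrow> \<gamma> s \<in> fst c \<and> snd c (\<gamma> s) = snd c (\<gamma> t) + l (s - t)))"

lemma tangentialD:
  assumes "tangential l"
  shows "bounded_linear l" "l a $ 3 = 0" "l a $ 4 = 0" "isCont l x" "l 0 = 0"
  using assms by (auto simp: tangential_def linear_continuous_at linear_simps)

text \<open>Flow charts differ by translations along the fibres, so the chart provided by
  \<open>orbit_map\<close> can be exchanged for any other flow chart at the same point.\<close>

lemma orbit_map_chart:
  assumes l: "tangential l" and \<gamma>: "orbit_map l \<gamma> T" and t: "t \<in> T" and d: "flow_chart d" "\<gamma> t \<in> fst d"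
  obtains e where "e > 0"
    "\<And>s. s \<in> T \<Longrightarrow> dist s t < e \<Longrightarrow> \<gamma> s \<in> fst d \<and> snd d (\<gamma> s) = snd d (\<gamma> t) + l (s - t)"
proof -
  obtain c e1 where c: "flow_chart c" "\<gamma> t \<in> fst c" "e1 > 0"
    "\<And>s. s \<in> T \<Longrightarrow> dist s t < e1 \<Longrightarrow> \<gamma> s \<in> fst c \<and> snd c (\<gamma> s) = snd c (\<gamma> t) + l (s - t)"
    using \<gamma> t unfolding orbit_map_def by blast
  obtain e2 where e2: "e2 > 0"
    "\<And>q v. q \<in> fst c \<Longrightarrow> snd c q = snd c (\<gamma> t) + v \<Longrightarrow> v $ 3 = 0 \<Longrightarrow> v $ 4 = 0 \<Longrightarrow> norm v < e2 \<Longrightarrow>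
       q \<in> fst d \<and> snd d q = snd d (\<gamma> t) + v"
    using flow_chart_translation[OF c(1,2) d] by blast
  obtain K where K: "K > 0" "\<And>a. norm (l a) \<le> norm a * K"
    using bounded_linear.pos_bounded[OF tangentialD(1)[OF l]] by blast
  show thesis
  proof (rule that)
    show "min e1 (e2 / K) > 0" using c(3) e2(1) K(1) by simp
    fix s assume s: "s \<in> T" "dist s t < min e1 (e2 / K)"
    have "norm (s - t) * K < e2" using s(2) K(1) by (simp add: dist_norm pos_less_divide_eq)
    then have "norm (l (s - t)) < e2" using K(2)[of "s - t"] by linarith
    moreover have "\<gamma> s \<in> fst c" "snd c (\<gamma> s) = snd c (\<gamma> t) + l (s - t)" using c(4)[OF s(1)] s(2) by auto
    ultimately show "\<gamma> s \<in> fst d \<and> snd d (\<gamma> s) = snd d (\<gamma> t) + l (s - t)"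
      using e2(2) tangentialD(2,3)[OF l] by blast
  qed
qed

lemma orbit_map_regular:
  assumes "orbit_map l \<gamma> T" "t \<in> T"
  shows "\<gamma> t \<in> U" "regular_point A H L (\<gamma> t)"
proof -
  obtain c where "flow_chart c" "\<gamma> t \<in> fst c" using assms unfolding orbit_map_def by blast
  then show "\<gamma> t \<in> U" "regular_point A H L (\<gamma> t)"
    using adaptedD(2) regular_adapted flow_chartD(1) by blast+
qed

lemma orbit_map_continuous:
  assumes l: "tangential l" and \<gamma>: "orbit_map l \<gamma> T"
  shows "continuous_on T \<gamma>"
  unfolding continuous_on_eq_continuous_within
proof
  fix t assume t: "t \<in> T"
  obtain c e where c: "flow_chart c" "\<gamma> t \<in> fst c" "e > 0"
    "\<And>s. s \<in> T \<Longrightarrow> dist s t < e \<Longrightarrow> \<gamma> s \<in> fst c \<and> snd c (\<gamma> s) = snd c (\<gamma> t) + l (s - t)"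
    using \<gamma> t unfolding orbit_map_def by blast
  note cA = flow_chartD(2)[OF c(1)]
  let ?i = "inv_into (fst c) (snd c)"
  have "isCont ?i (snd c (\<gamma> t))"
    using chartD(2,5)[OF cA] c(2) by (simp add: continuous_on_eq_continuous_at)
  moreover have "((\<lambda>s. snd c (\<gamma> t) + l (s - t)) \<longlongrightarrow> snd c (\<gamma> t) + l (t - t)) (at t within T)"
    by (intro tendsto_intros isCont_tendsto_compose[OF tangentialD(4)[OF l]])
  ultimately have "((\<lambda>s. ?i (snd c (\<gamma> t) + l (s - t))) \<longlongrightarrow> ?i (snd c (\<gamma> t))) (at t within T)"
    using isCont_tendsto_compose tangentialD(5)[OF l] by fastforce
  moreover have "?i (snd c (\<gamma> t)) = \<gamma> t" using chartD(3)[OF cA] c(2) by simp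
  moreover have "\<forall>\<^sub>F s in at t within T. ?i (snd c (\<gamma> t) + l (s - t)) = \<gamma> s"
    unfolding eventually_at
  proof (intro exI conjI ballI impI)
    show "e > 0" by (rule c(3))
    fix s assume s: "s \<in> T" "s \<noteq> t \<and> dist s t < e"
    then have "\<gamma> s \<in> fst c" "snd c (\<gamma> s) = snd c (\<gamma> t) + l (s - t)" using c(4) by auto
    then show "?i (snd c (\<gamma> t) + l (s - t)) = \<gamma> s" using inv_into_f_f[OF chartD(3)[OF cA]] by metis
  qed
  ultimately show "continuous (at t within T) \<gamma>"
    unfolding continuous_within using Lim_transform_eventually by fastforce
qed

text \<open>The set of agreement is open in \<open>T\<close> by the affine form in a common flow
  chart, and closed because the manifold is Hausdorff.\<close>

lemma orbit_map_unique:
  assumes l: "tangential l" and \<gamma>: "orbit_map l \<gamma> T" and \<gamma>': "orbit_map l \<gamma>' T" and T: "connected T"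
    and t0: "t0 \<in> T" "\<gamma> t0 = \<gamma>' t0" and t: "t \<in> T"
  shows "\<gamma> t = \<gamma>' t"
proof -
  let ?E = "{t \<in> T. \<gamma> t = \<gamma>' t}"
  have "openin (top_of_set T) ?E"
    unfolding openin_euclidean_subtopology_iff
  proof (intro conjI ballI)
    fix x assume "x \<in> ?E"
    then have x: "x \<in> T" "\<gamma> x = \<gamma>' x" by auto
    obtain c where c: "flow_chart c" "\<gamma> x \<in> fst c" using \<gamma> x(1) unfolding orbit_map_def by blast
    obtain e1 where e1: "e1 > 0" "\<And>s. s \<in> T \<Longrightarrow> dist s x < e1 \<Longrightarrow> \<gamma> s \<in> fst c \<and> snd c (\<gamma> s) = snd c (\<gamma> x) + l (s - x)"
      using orbit_map_chart[OF l \<gamma> x(1) c] by blast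
    obtain e2 where e2: "e2 > 0" "\<And>s. s \<in> T \<Longrightarrow> dist s x < e2 \<Longrightarrow> \<gamma>' s \<in> fst c \<and> snd c (\<gamma>' s) = snd c (\<gamma>' x) + l (s - x)"
      using orbit_map_chart[OF l \<gamma>' x(1) c(1) c(2)[unfolded x(2)]] by blast
    show "\<exists>e>0. \<forall>s\<in>T. dist s x < e \<longrightarrow> s \<in> ?E"
    proof (intro exI[of _ "min e1 e2"] conjI ballI impI)
      show "min e1 e2 > 0" using e1(1) e2(1) by simp
      fix s assume s: "s \<in> T" "dist s x < min e1 e2"
      then have "\<gamma> s \<in> fst c" "\<gamma>' s \<in> fst c" "snd c (\<gamma> s) = snd c (\<gamma>' s)"
        using e1(2)[of s] e2(2)[of s] x(2) by auto
      then show "s \<in> ?E" using inj_onD[OF chartD(3)[OF flow_chartD(2)[OF c(1)]]] s(1) by blast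
    qed
  qed auto
  moreover have "closedin (top_of_set T) ?E"
  proof -
    have "continuous_on T (\<lambda>t. (\<gamma> t, \<gamma>' t))"
      by (intro continuous_on_Pair orbit_map_continuous[OF l] \<gamma> \<gamma>')
    from continuous_closedin_preimage[OF this closed_diagonal]
    have "closedin (top_of_set T) (T \<inter> (\<lambda>t. (\<gamma> t, \<gamma>' t)) -` {y. \<exists>x. y = (x, x)})" .
    moreover have "T \<inter> (\<lambda>t. (\<gamma> t, \<gamma>' t)) -` {y. \<exists>x. y = (x, x)} = ?E" by auto
    ultimately show ?thesis by simp
  qed
  ultimately have "?E = {} \<or> ?E = T" using T unfolding connected_clopen by blast
  then show ?thesis using t0 t by blast
qed

lemma orbit_map_subset: "orbit_map l \<gamma> T \<Longrightarrow> S \<subseteq> T \<Longrightarrow> orbit_map l \<gamma> S"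
  unfolding orbit_map_def by (meson subsetD)

lemma orbit_map_cong: "(\<And>t. t \<in> T \<Longrightarrow> \<gamma> t = \<gamma>' t) \<Longrightarrow> orbit_map l \<gamma> T \<Longrightarrow> orbit_map l \<gamma>' T"
  unfolding orbit_map_def by simp

lemma orbit_map_shift:
  assumes "orbit_map l \<gamma> T"
  shows "orbit_map l (\<lambda>t. \<gamma> (a + t)) {t. a + t \<in> T}"
  unfolding orbit_map_def
proof
  fix t assume "t \<in> {t. a + t \<in> T}"
  then obtain c e where c: "flow_chart c" "\<gamma> (a + t) \<in> fst c" "e > 0"
    "\<And>s. s \<in> T \<Longrightarrow> dist s (a + t) < e \<Longrightarrow> \<gamma> s \<in> fst c \<and> snd c (\<gamma> s) = snd c (\<gamma> (a + t)) + l (s - (a + t))"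
    using assms unfolding orbit_map_def by blast
  have "\<gamma> (a + s) \<in> fst c \<and> snd c (\<gamma> (a + s)) = snd c (\<gamma> (a + t)) + l (s - t)"
    if "s \<in> {t. a + t \<in> T}" "dist s t < e" for s
    using c(4)[of "a + s"] that by (simp add: dist_norm algebra_simps)
  then show "\<exists>c. flow_chart c \<and> \<gamma> (a + t) \<in> fst c \<and> (\<exists>e>0. \<forall>s\<in>{t. a + t \<in> T}. dist s t < e \<longrightarrow>
      \<gamma> (a + s) \<in> fst c \<and> snd c (\<gamma> (a + s)) = snd c (\<gamma> (a + t)) + l (s - t))"
    using c(1-3) by blast
qed

lemma orbit_map_closed_chart:
  assumes l: "tangential l" and S: "orbit_map l \<gamma> S" "closed S" and c: "flow_chart c" "\<gamma> t \<in> fst c"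
  shows "\<exists>e>0. \<forall>s\<in>S. dist s t < e \<longrightarrow> \<gamma> s \<in> fst c \<and> snd c (\<gamma> s) = snd c (\<gamma> t) + l (s - t)"
proof (cases "t \<in> S")
  case True
  obtain e where "e > 0" "\<And>s. s \<in> S \<Longrightarrow> dist s t < e \<Longrightarrow> \<gamma> s \<in> fst c \<and> snd c (\<gamma> s) = snd c (\<gamma> t) + l (s - t)"
    using orbit_map_chart[OF l S(1) True c] by blast
  then show ?thesis by blast
next
  case False
  then obtain e where e: "e > 0" "ball t e \<subseteq> - S"
    using S(2) open_contains_ball[of "- S"] by (auto simp: open_Compl)
  have "\<not> dist s t < e" if "s \<in> S" for s using that e(2) by (auto simp: subset_iff dist_commute)
  then show ?thesis using e(1) by blast
qed

text \<open>Closedness of the two sets makes the gluing local: a parameter that lies in only one of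
  them has a neighbourhood missing the other, and a parameter in both sees both pieces in one chart
  with the same base point.\<close>

lemma orbit_map_glue:
  assumes l: "tangential l" and \<gamma>: "orbit_map l \<gamma> T" "closed T" and \<gamma>': "orbit_map l \<gamma>' T'" "closed T'"
    and eq: "\<And>t. t \<in> T \<Longrightarrow> t \<in> T' \<Longrightarrow> \<gamma> t = \<gamma>' t"
  shows "orbit_map l (\<lambda>t. if t \<in> T then \<gamma> t else \<gamma>' t) (T \<union> T')"
proof -
  define \<delta> where "\<delta> = (\<lambda>t. if t \<in> T then \<gamma> t else \<gamma>' t)"
  have o1: "orbit_map l \<delta> T" by (rule orbit_map_cong[OF _ \<gamma>(1)]) (simp add: \<delta>_def)
  have o2: "orbit_map l \<delta> T'" by (rule orbit_map_cong[OF _ \<gamma>'(1)]) (simp add: \<delta>_def eq)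
  have "orbit_map l \<delta> (T \<union> T')"
    unfolding orbit_map_def
  proof
    fix t assume "t \<in> T \<union> T'"
    then obtain c where c: "flow_chart c" "\<delta> t \<in> fst c"
      using o1 o2 unfolding orbit_map_def by blast
    obtain e1 where e1: "e1 > 0" "\<forall>s\<in>T. dist s t < e1 \<longrightarrow> \<delta> s \<in> fst c \<and> snd c (\<delta> s) = snd c (\<delta> t) + l (s - t)"
      using orbit_map_closed_chart[OF l o1 \<gamma>(2) c] by blast
    obtain e2 where e2: "e2 > 0" "\<forall>s\<in>T'. dist s t < e2 \<longrightarrow> \<delta> s \<in> fst c \<and> snd c (\<delta> s) = snd c (\<delta> t) + l (s - t)"
      using orbit_map_closed_chart[OF l o2 \<gamma>'(2) c] by blast
    have "min e1 e2 > 0" "\<forall>s\<in>T \<union> T'. dist s t < min e1 e2 \<longrightarrow>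
        \<delta> s \<in> fst c \<and> snd c (\<delta> s) = snd c (\<delta> t) + l (s - t)"
      using e1 e2 by (simp, metis UnE min_less_iff_conj)
    then show "\<exists>c. flow_chart c \<and> \<delta> t \<in> fst c \<and> (\<exists>e>0. \<forall>s\<in>T \<union> T'. dist s t < e \<longrightarrow>
        \<delta> s \<in> fst c \<and> snd c (\<delta> s) = snd c (\<delta> t) + l (s - t))"
      using c by blast
  qed
  then show ?thesis unfolding \<delta>_def .
qed

text \<open>The infinitesimal criterion: Hamilton's equation may be checked at each parameter in any
  convenient chart. In a flow chart it says that the derivative is the constant map
  \<open>l\<close>, and convexity of the domain allows it to be integrated.\<close>

lemma orbit_mapI_derivative:
  fixes T :: "'a::real_normed_vector set"
  assumes l: "tangential l" and T: "convex T" and cont: "continuous_on T \<gamma>"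
    and reg: "\<And>t. t \<in> T \<Longrightarrow> \<gamma> t \<in> U \<and> regular_point A H L (\<gamma> t)"
    and der: "\<And>t. t \<in> T \<Longrightarrow> \<exists>c D. c \<in> A \<and> \<gamma> t \<in> fst c \<and> ((\<lambda>s. snd c (\<gamma> s)) has_derivative D) (at t within T) \<and>
      (\<forall>a b. pairing (Om c (snd c (\<gamma> t))) (D a) b =
        l a $ 1 * fst (frechet_derivative (in_chart c J) (at (snd c (\<gamma> t))) b) +
        l a $ 2 * snd (frechet_derivative (in_chart c J) (at (snd c (\<gamma> t))) b))"
  shows "orbit_map l \<gamma> T"
  unfolding orbit_map_def
proof
  fix t assume t: "t \<in> T"
  obtain d where d: "flow_chart d" "\<gamma> t \<in> fst d" using ex_flow_chart reg[OF t] by blast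
  note dA = flow_chartD(2)[OF d(1)]
  have ev: "\<forall>\<^sub>F s in at t within T. \<gamma> s \<in> fst c" if "c \<in> A" "t \<in> T" "\<gamma> t \<in> fst c" for t c
    using cont that topological_tendstoD[OF _ chartD(1)[OF that(1)] that(3)]
    unfolding continuous_on_def by blast
  obtain e where e: "e > 0" "\<And>s. s \<in> T \<Longrightarrow> dist s t < e \<Longrightarrow> \<gamma> s \<in> fst d"
    using ev[OF dA t d(2)] d(2) unfolding eventually_at by (metis dist_self)
  have dd: "((\<lambda>s. snd d (\<gamma> s)) has_derivative l) (at s within T)" if s: "s \<in> T" "dist s t < e" for s
  proof -
    obtain c D where c: "c \<in> A" "\<gamma> s \<in> fst c" "((\<lambda>s. snd c (\<gamma> s)) has_derivative D) (at s within T)"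
      and D: "\<And>a b. pairing (Om c (snd c (\<gamma> s))) (D a) b =
        l a $ 1 * fst (frechet_derivative (in_chart c J) (at (snd c (\<gamma> s))) b) +
        l a $ 2 * snd (frechet_derivative (in_chart c J) (at (snd c (\<gamma> s))) b)"
      using der[OF s(1)] by blast
    note ds = e(2)[OF s]
    have "((\<lambda>s. snd d (\<gamma> s)) has_derivative (\<lambda>v. transition c d (\<gamma> s) (D v))) (at s within T)"
      by (rule has_derivative_curve_change[OF c(1) dA c(2) ds s(1) ev[OF c(1) s(1) c(2)] c(3)])
    moreover have "transition c d (\<gamma> s) (D v) = l v" for v
      by (rule transition_to_flow_chart[OF c(1,2) d(1) ds tangentialD(2,3)[OF l] D])
    ultimately show ?thesis by simp
  qed
  let ?S = "T \<inter> ball t e"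
  have tS: "t \<in> ?S" using t e(1) centre_in_ball by blast
  have 0: "((\<lambda>s. snd d (\<gamma> s) - l s) has_derivative (\<lambda>h. 0)) (at s within ?S)" if s: "s \<in> ?S" for s
  proof -
    have 1: "((\<lambda>s. snd d (\<gamma> s)) has_derivative l) (at s within ?S)"
      by (rule has_derivative_subset[OF dd]) (use s in \<open>auto simp: dist_commute\<close>)
    from has_derivative_diff[OF 1 bounded_linear_imp_has_derivative[OF tangentialD(1)[OF l]]] show ?thesis by simp
  qed
  have "snd d (\<gamma> s) - l s = snd d (\<gamma> t) - l t" if "s \<in> ?S" for s
    by (rule has_derivative_zero_unique[OF convex_Int[OF T convex_ball] 0 that tS])
  then have "snd d (\<gamma> s) = snd d (\<gamma> t) + (l s - l t)" if "s \<in> T" "dist s t < e" for s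
    using that by (simp add: dist_commute algebra_simps)
  then have "snd d (\<gamma> s) = snd d (\<gamma> t) + l (s - t)" if "s \<in> T" "dist s t < e" for s
    using that linear_diff[OF bounded_linear.linear[OF tangentialD(1)[OF l]], of s t] by simp
  then show "\<exists>c. flow_chart c \<and> \<gamma> t \<in> fst c \<and> (\<exists>e>0. \<forall>s\<in>T. dist s t < e \<longrightarrow>
      \<gamma> s \<in> fst c \<and> snd c (\<gamma> s) = snd c (\<gamma> t) + l (s - t))"
    using d e by blast
qed

definition l1 :: "real \<Rightarrow> real^4" where "l1 s = s *\<^sub>R axis 1 1"

lemma tangential_l1: "tangential l1"
  unfolding tangential_def l1_def
  by (auto simp: axis_def intro: bounded_linear_scaleR_left)

text \<open>A relation, because the flow of J1 may be incomplete; it presupposes that the whole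
  piece of orbit is regular. Connectedness of \<open>T\<close> gives uniqueness, closedness allows
  gluing.\<close>

definition flows :: "'m \<Rightarrow> real \<Rightarrow> 'm \<Rightarrow> bool" where
  "flows p s q \<longleftrightarrow> (\<exists>\<gamma> T. closed T \<and> connected T \<and> 0 \<in> T \<and> s \<in> T \<and> orbit_map l1 \<gamma> T \<and> \<gamma> 0 = p \<and> \<gamma> s = q)"

lemma connected_Int_real: "connected S \<Longrightarrow> connected T \<Longrightarrow> connected (S \<inter> T)" for S T :: "real set"
  by (simp add: is_interval_connected_1[symmetric] is_interval_Int)

lemma connected_translation_real: "connected T \<Longrightarrow> connected ((+) a ` T)" for T :: "real set"
  by (rule connected_continuous_image) (auto intro: continuous_intros)

lemma flowsI: "orbit_map l1 \<gamma> T \<Longrightarrow> closed T \<Longrightarrow> connected T \<Longrightarrow> 0 \<in> T \<Longrightarrow> s \<in> T \<Longrightarrow> flows (\<gamma> 0) s (\<gamma> s)"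
  unfolding flows_def by blast

lemma flows_unique:
  assumes "flows p s q" "flows p s q'"
  shows "q = q'"
proof -
  obtain \<gamma> T where 1: "closed T" "connected T" "0 \<in> T" "s \<in> T" "orbit_map l1 \<gamma> T" "\<gamma> 0 = p" "\<gamma> s = q"
    using assms(1) unfolding flows_def by blast
  obtain \<gamma>' T' where 2: "closed T'" "connected T'" "0 \<in> T'" "s \<in> T'" "orbit_map l1 \<gamma>' T'" "\<gamma>' 0 = p" "\<gamma>' s = q'"
    using assms(2) unfolding flows_def by blast
  have "\<gamma> s = \<gamma>' s"
    by (rule orbit_map_unique[OF tangential_l1 orbit_map_subset[OF 1(5)] orbit_map_subset[OF 2(5)]
        connected_Int_real[OF 1(2) 2(2)], of 0]) (use 1 2 in auto)
  then show ?thesis using 1 2 by simp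
qed

lemma flows_trans:
  assumes "flows p s q" "flows q s' q'"
  shows "flows p (s + s') q'"
proof -
  obtain \<gamma> T where 1: "closed T" "connected T" "0 \<in> T" "s \<in> T" "orbit_map l1 \<gamma> T" "\<gamma> 0 = p" "\<gamma> s = q"
    using assms(1) unfolding flows_def by blast
  obtain \<gamma>' T' where 2: "closed T'" "connected T'" "0 \<in> T'" "s' \<in> T'" "orbit_map l1 \<gamma>' T'" "\<gamma>' 0 = q" "\<gamma>' s' = q'"
    using assms(2) unfolding flows_def by blast
  let ?T = "{t. - s + t \<in> T'}" and ?\<gamma> = "\<lambda>t. \<gamma>' (- s + t)"
  have T: "?T = (+) s ` T'" by force
  have 3: "orbit_map l1 ?\<gamma> ?T" by (rule orbit_map_shift[OF 2(5)])
  have 4: "closed ?T" "connected ?T" "s \<in> ?T" "s + s' \<in> ?T"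
    unfolding T using 2 closed_translation[of T' s] connected_translation_real[of T' s] by auto
  have eq: "\<gamma> t = ?\<gamma> t" if "t \<in> T" "t \<in> ?T" for t
    by (rule orbit_map_unique[OF tangential_l1 orbit_map_subset[OF 1(5)] orbit_map_subset[OF 3]
        connected_Int_real[OF 1(2) 4(2)], of s]) (use 1 2 4 that in auto)
  from orbit_map_glue[OF tangential_l1 1(5,1) 3 4(1) eq]
  have g: "orbit_map l1 (\<lambda>t. if t \<in> T then \<gamma> t else ?\<gamma> t) (T \<union> ?T)" .
  have "connected (T \<union> ?T)" using 1 4 by (intro connected_Un) auto
  from flowsI[OF g closed_Un[OF 1(1) 4(1)] this, of "s + s'"]
  have "flows (\<gamma> 0) (s + s') (if s + s' \<in> T then \<gamma> (s + s') else ?\<gamma> (s + s'))" using 1 4 by auto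
  moreover have "(if s + s' \<in> T then \<gamma> (s + s') else ?\<gamma> (s + s')) = ?\<gamma> (s + s')" using eq 4(4) by auto
  ultimately show ?thesis using 1 2 by simp
qed

lemma flows_sym:
  assumes "flows p s q"
  shows "flows q (- s) p"
proof -
  obtain \<gamma> T where 1: "closed T" "connected T" "0 \<in> T" "s \<in> T" "orbit_map l1 \<gamma> T" "\<gamma> 0 = p" "\<gamma> s = q"
    using assms(1) unfolding flows_def by blast
  let ?T = "{t. s + t \<in> T}"
  have T: "?T = (+) (- s) ` T" by force
  have "closed ?T" "connected ?T" "0 \<in> ?T" "- s \<in> ?T"
    unfolding T using 1 closed_translation[of T "- s"] connected_translation_real[of T "- s"] by auto
  from flowsI[OF orbit_map_shift[OF 1(5), of s] this] show ?thesis using 1 by simp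
qed

lemma flows_between:
  assumes "flows p s q" "r \<in> closed_segment 0 s"
  obtains q' where "flows p r q'"
proof -
  obtain \<gamma> T where 1: "closed T" "connected T" "0 \<in> T" "s \<in> T" "orbit_map l1 \<gamma> T" "\<gamma> 0 = p" "\<gamma> s = q"
    using assms(1) unfolding flows_def by blast
  have "convex T" using 1(2) is_interval_connected_1 is_interval_convex by blast
  then have "r \<in> T" using closed_segment_subset[OF 1(3,4)] assms(2) by blast
  then show thesis using flowsI[OF 1(5,1,2,3)] 1(6) that by blast
qed

lemma flows_regular:
  assumes "flows p s q"
  shows "p \<in> U" "regular_point A H L p" "q \<in> U" "regular_point A H L q"
  using assms orbit_map_regular unfolding flows_def by blast+

end

section \<open>The flow near the focus-focus point\<close>

context integrable_system
begin

lemma orbit_map_affine: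
  fixes h :: "'b::real_normed_vector \<Rightarrow> 'a::real_normed_vector"
  assumes \<gamma>: "orbit_map l \<gamma> T" and h: "bounded_linear h"
  shows "orbit_map (\<lambda>x. l (h x)) (\<lambda>s. \<gamma> (a + h s)) {s. a + h s \<in> T}"
  unfolding orbit_map_def
proof
  fix t assume "t \<in> {s. a + h s \<in> T}"
  then obtain c e where c: "flow_chart c" "\<gamma> (a + h t) \<in> fst c" "e > 0"
    "\<And>s. s \<in> T \<Longrightarrow> dist s (a + h t) < e \<Longrightarrow> \<gamma> s \<in> fst c \<and> snd c (\<gamma> s) = snd c (\<gamma> (a + h t)) + l (s - (a + h t))"
    using \<gamma> unfolding orbit_map_def by blast
  obtain K where K: "K > 0" "\<And>x. norm (h x) \<le> norm x * K" using bounded_linear.pos_bounded[OF h] by blast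
  have "\<gamma> (a + h s) \<in> fst c \<and> snd c (\<gamma> (a + h s)) = snd c (\<gamma> (a + h t)) + l (h (s - t))"
    if s: "s \<in> {s. a + h s \<in> T}" "dist s t < e / K" for s
  proof -
    have hd: "h s - h t = h (s - t)" by (rule linear_diff[OF bounded_linear.linear[OF h], symmetric])
    have "norm (s - t) * K < e" using s(2) K(1) by (simp add: dist_norm pos_less_divide_eq)
    then have "norm (h (s - t)) < e" using K(2)[of "s - t"] by linarith
    then show ?thesis using c(4)[of "a + h s"] s(1) by (simp add: dist_norm hd)
  qed
  then have "\<forall>s\<in>{s. a + h s \<in> T}. dist s t < e / K \<longrightarrow>
      \<gamma> (a + h s) \<in> fst c \<and> snd c (\<gamma> (a + h s)) = snd c (\<gamma> (a + h t)) + l (h (s - t))" by blast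
  moreover have "e / K > 0" using c(3) K(1) by simp
  ultimately show "\<exists>c. flow_chart c \<and> \<gamma> (a + h t) \<in> fst c \<and> (\<exists>e>0. \<forall>s\<in>{s. a + h s \<in> T}. dist s t < e \<longrightarrow>
      \<gamma> (a + h s) \<in> fst c \<and> snd c (\<gamma> (a + h s)) = snd c (\<gamma> (a + h t)) + l (h (s - t)))"
    using c(1,2) by blast
qed

definition l2 :: "real \<times> real \<Rightarrow> real^4" where "l2 t = fst t *\<^sub>R axis 1 1 + snd t *\<^sub>R axis 2 1"

lemma l2_nth [simp]: "l2 t $ 1 = fst t" "l2 t $ 2 = snd t" "l2 t $ 3 = 0" "l2 t $ 4 = 0"
  by (simp_all add: l2_def axis_def)

lemma tangential_l2: "tangential l2"
  unfolding tangential_def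
proof (intro conjI allI)
  show "bounded_linear l2"
    unfolding l2_def
    by (intro bounded_linear_add bounded_linear_scaleR_const bounded_linear_fst bounded_linear_snd)
qed simp_all

lemma l1_eq_l2: "l1 s = l2 (s, 0)"
  by (simp add: l1_def l2_def)

lemma orbit_map_l1:
  assumes "orbit_map l2 \<gamma> T"
  shows "orbit_map l1 (\<lambda>s. \<gamma> (fst a + s, snd a)) {s. (fst a + s, snd a) \<in> T}"
proof -
  have h: "bounded_linear (\<lambda>s::real. (s, 0::real))"
    by (intro bounded_linear_Pair bounded_linear_ident bounded_linear_zero)
  have "(\<lambda>x. l2 (x, 0)) = l1" by (rule ext) (simp add: l1_eq_l2)
  moreover have "(\<lambda>s. \<gamma> (a + (s, 0))) = (\<lambda>s. \<gamma> (fst a + s, snd a))" by (rule ext) (simp add: prod_eq_iff plus_prod_def)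
  moreover have "{s. a + (s, 0) \<in> T} = {s. (fst a + s, snd a) \<in> T}" by (simp add: plus_prod_def)
  ultimately show ?thesis using orbit_map_affine[OF assms h, of a] by simp
qed

lemma orbit_map_J:
  assumes l: "tangential l" and \<gamma>: "orbit_map l \<gamma> T" and T: "connected T" "s \<in> T" "t \<in> T"
  shows "J (\<gamma> s) = J (\<gamma> t)"
proof (rule connected_local_const[OF T(1,2,3)], rule ballI)
  fix a assume a: "a \<in> T"
  obtain c e where c: "flow_chart c" "\<gamma> a \<in> fst c" "e > 0"
    "\<And>s. s \<in> T \<Longrightarrow> dist s a < e \<Longrightarrow> \<gamma> s \<in> fst c \<and> snd c (\<gamma> s) = snd c (\<gamma> a) + l (s - a)"
    using \<gamma> a unfolding orbit_map_def by blast
  note aD = adaptedD(3)[OF flow_chartD(1)[OF c(1)]]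
  have "J (\<gamma> a) = J (\<gamma> b)" if "b \<in> T" "dist b a < e" for b
    using c(4)[OF that] aD[OF c(2)] aD[of "\<gamma> b"] tangentialD(2,3)[OF l] by simp
  then show "\<forall>\<^sub>F b in at a within T. J (\<gamma> a) = J (\<gamma> b)"
    unfolding eventually_at using c(3) by blast
qed

lemma flows_J: "flows p s q \<Longrightarrow> J q = J p"
  unfolding flows_def using orbit_map_J[OF tangential_l1] by metis

text \<open>The condition is tested in one chart only. Preservation of a nondegenerate form already
  makes such a map a local diffeomorphism.\<close>

definition local_symp :: "(real^4 \<Rightarrow> 'm) \<Rightarrow> (real^4) set \<Rightarrow> 'm chart \<Rightarrow> bool" where
  "local_symp F Q d \<longleftrightarrow> d \<in> A \<and> open Q \<and> F ` Q \<subseteq> fst d \<and> smooth_on (\<lambda>z. snd d (F z)) Q \<and>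
     (\<forall>z\<in>Q. \<forall>u v. pairing (Om d (snd d (F z))) (frechet_derivative (\<lambda>z. snd d (F z)) (at z) u)
        (frechet_derivative (\<lambda>z. snd d (F z)) (at z) v) = pairing std_form u v)"

lemma local_sympD:
  assumes "local_symp F Q d"
  shows "d \<in> A" "open Q" "z \<in> Q \<Longrightarrow> F z \<in> fst d" "smooth_on (\<lambda>z. snd d (F z)) Q"
    "z \<in> Q \<Longrightarrow> pairing (Om d (snd d (F z))) (frechet_derivative (\<lambda>z. snd d (F z)) (at z) u)
        (frechet_derivative (\<lambda>z. snd d (F z)) (at z) v) = pairing std_form u v"
    "z \<in> Q \<Longrightarrow> ((\<lambda>z. snd d (F z)) has_derivative frechet_derivative (\<lambda>z. snd d (F z)) (at z)) (at z)"
  using assms smooth_on_has_derivative[of "\<lambda>z. snd d (F z)" Q z] unfolding local_symp_def by blast+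

lemma local_symp_continuous:
  assumes "local_symp F Q d"
  shows "continuous_on Q F"
proof -
  note D = local_sympD[OF assms]
  have "continuous_on Q (\<lambda>z. inv_into (fst d) (snd d) (snd d (F z)))"
    by (rule continuous_on_compose2[OF chartD(5)[OF D(1)] smooth_on_continuous[OF D(4)]]) (use D(3) in auto)
  then show ?thesis
    by (rule continuous_on_eq) (use D(3) chartD(3)[OF D(1)] in simp)
qed

lemma local_symp_subset: "local_symp F Q d \<Longrightarrow> open Q' \<Longrightarrow> Q' \<subseteq> Q \<Longrightarrow> local_symp F Q' d"
  unfolding local_symp_def using smooth_on_subset by blast

lemma local_symp_chart:
  assumes s: "local_symp F Q d" and e: "e \<in> A"
  shows "local_symp F (Q \<inter> F -` fst e) e"
proof -
  note D = local_sympD[OF s]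
  let ?Q = "Q \<inter> F -` fst e"
  have Q: "open ?Q"
    by (rule continuous_open_preimage[OF local_symp_continuous[OF s] D(2) chartD(1)[OF e]])
  have eq: "in_chart d (snd e) (snd d (F z)) = snd e (F z)" if "z \<in> ?Q" for z
    using in_chart_apply'[OF D(1) D(3)] that by blast
  have sm0: "smooth_on (\<lambda>z. in_chart d (snd e) (snd d (F z))) ?Q"
    by (rule smooth_on_compose[OF Q open_overlap[OF D(1) e] smooth_on_subset[OF D(4)] smooth_transition[OF D(1) e]])
      (use D(3) in auto)
  have sm: "smooth_on (\<lambda>z. snd e (F z)) ?Q" by (rule smooth_on_cong[OF Q _ sm0]) (rule eq)
  have "pairing (Om e (snd e (F z))) (frechet_derivative (\<lambda>z. snd e (F z)) (at z) u)
        (frechet_derivative (\<lambda>z. snd e (F z)) (at z) v) = pairing std_form u v" if z: "z \<in> ?Q" for z u v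
  proof -
    have zQ: "z \<in> Q" and ze: "F z \<in> fst e" using z by auto
    note zd = D(3)[OF zQ]
    have ev: "\<forall>\<^sub>F y in at z. F y \<in> fst d"
      using D(2) zQ D(3) by (auto simp: eventually_at_topological)
    have "((\<lambda>y. snd e (F y)) has_derivative
        (\<lambda>v. transition d e (F z) (frechet_derivative (\<lambda>z. snd d (F z)) (at z) v))) (at z within UNIV)"
      by (rule has_derivative_curve_change[OF D(1) e zd ze UNIV_I ev D(6)[OF zQ]])
    from frechet_derivative_at[OF this]
    have "frechet_derivative (\<lambda>y. snd e (F y)) (at z) =
        (\<lambda>v. transition d e (F z) (frechet_derivative (\<lambda>z. snd d (F z)) (at z) v))" by simp
    then show ?thesis using Om_change[OF two_form D(1) e zd ze] D(5)[OF zQ] by simp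
  qed
  then show ?thesis unfolding local_symp_def using e Q sm by blast
qed

end

section \<open>Complex coordinates in the canonical chart\<close>

lemma Complex_add_i: "Complex a b = of_real a + \<i> * of_real b"
  by (simp add: Complex_eq)

text \<open>With u = x + i y and v = p_x + i p_y the two integrals of the normal form combine to J1
  + i J2 = cnj u * v.\<close>

definition pt :: "complex \<Rightarrow> complex \<Rightarrow> real^4" where
  "pt u v = Re u *\<^sub>R axis 1 1 + Im u *\<^sub>R axis 2 1 + Re v *\<^sub>R axis 3 1 + Im v *\<^sub>R axis 4 1"

lemma pt_nth [simp]: "pt u v $ 1 = Re u" "pt u v $ 2 = Im u" "pt u v $ 3 = Re v" "pt u v $ 4 = Im v"
  by (simp_all add: pt_def axis_def)

lemma pt_eq_iff [simp]: "pt u v = pt u' v' \<longleftrightarrow> u = u' \<and> v = v'"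
  by (auto simp: vec_eq_iff forall_4 complex_eq_iff)

lemma pt_surj: "\<exists>u v. x = pt u v"
  by (rule exI[of _ "Complex (x$1) (x$2)"], rule exI[of _ "Complex (x$3) (x$4)"])
    (simp add: vec_eq_iff forall_4)

lemma pt_0: "pt 0 0 = 0" by (simp add: vec_eq_iff forall_4)

lemma bounded_linear_pt: "bounded_linear (\<lambda>p. pt (fst p) (snd p))"
  unfolding pt_def
  by (intro bounded_linear_add bounded_linear_scaleR_const bounded_linear_compose[OF bounded_linear_Re]
      bounded_linear_compose[OF bounded_linear_Im] bounded_linear_fst bounded_linear_snd)

lemma has_derivative_pt:
  assumes "(f has_derivative f') (at x within S)" "(g has_derivative g') (at x within S)"
  shows "((\<lambda>x. pt (f x) (g x)) has_derivative (\<lambda>h. pt (f' h) (g' h))) (at x within S)"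
  using bounded_linear.has_derivative[OF bounded_linear_pt has_derivative_Pair[OF assms]] by simp

lemma smooth_on_pt:
  assumes "open S" "smooth_on f S" "smooth_on g S"
  shows "smooth_on (\<lambda>x. pt (f x) (g x)) S"
  using smooth_on_compose_bounded_linear[OF assms(1) smooth_on_Pair[OF assms] bounded_linear_pt] by simp

lemma J_pt: "J1 (pt u v) = Re (cnj u * v)" "J2 (pt u v) = Im (cnj u * v)"
  by (simp_all add: J1_def J2_def)

lemma norm_pt: "norm (pt u v) \<le> norm u + norm v"
proof -
  have "(norm (pt u v))\<^sup>2 = (norm u)\<^sup>2 + (norm v)\<^sup>2"
    by (simp add: power2_norm_eq_inner[of "pt u v"] inner_vec_def sum_4 cmod_power2) (simp add: power2_eq_square)
  also have "\<dots> \<le> (norm u + norm v)\<^sup>2" by (simp add: power2_sum)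
  finally show ?thesis by (rule power2_le_imp_le) simp
qed

lemma pairing_std_pt: "pairing std_form (pt u v) (pt u' v') = Re (cnj u * v') - Re (cnj v * u')"
  by (simp add: pairing_std)

text \<open>The right hand side is the differential of a1 J1 + a2 J2 at (u, v). Its Hamiltonian
  field is thus the linear field with rates a1 + i a2 on u and - a1 + i a2 on v, which explains the
  explicit flow used below.\<close>

lemma pairing_std_J:
  "pairing std_form (pt ((of_real a1 + \<i> * of_real a2) * u) ((- of_real a1 + \<i> * of_real a2) * v)) b =
    a1 * (b$1 * Re v + Re u * b$3 + b$2 * Im v + Im u * b$4) +
    a2 * (b$1 * Im v + Re u * b$4 - b$2 * Re v - Im u * b$3)"
  by (simp add: pairing_std algebra_simps)

locale focus_focus_system = integrable_system A Om H L g V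
  for A :: "'m::t2_space chart set" and Om H L g V +
  fixes m :: 'm and c0 :: "'m chart"
  assumes c0: "canonical_chart A Om c0" and m: "m \<in> fst c0" "snd c0 m = 0"
    and V0: "(0, 0) \<in> V"
    and normal_form: "\<And>p. p \<in> fst c0 \<Longrightarrow> (J1 (snd c0 p), J2 (snd c0 p)) \<in> V \<and>
      em_map H L p = g (J1 (snd c0 p), J2 (snd c0 p))"
    and compact_K: "compact (singular_fibre H L m)"
    and regular_K: "\<And>p. p \<in> singular_fibre H L m \<Longrightarrow> p \<noteq> m \<Longrightarrow> regular_point A H L p"
begin

lemma c0A: "c0 \<in> A" and Om_c0: "x \<in> snd c0 ` fst c0 \<Longrightarrow> Om c0 x = std_form"
  using c0 unfolding canonical_chart_def by blast+

text \<open>Any radius whose double still fits into the chart would do. The factor 2 leaves room on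
  both sides of the sections |u| = \<open>dl\<close> and |v| = \<open>dl\<close>.\<close>

definition dl :: real where
  "dl = (SOME d. d > 0 \<and> (\<forall>u v. norm u \<le> 2 * d \<longrightarrow> norm v \<le> 2 * d \<longrightarrow> pt u v \<in> snd c0 ` fst c0))"

lemma dl: "dl > 0" "norm u \<le> 2 * dl \<Longrightarrow> norm v \<le> 2 * dl \<Longrightarrow> pt u v \<in> snd c0 ` fst c0"
proof -
  obtain r where r: "r > 0" "ball 0 r \<subseteq> snd c0 ` fst c0"
    using chartD(2)[OF c0A] m open_contains_ball by (metis image_eqI)
  \<comment> \<open>Two coordinates of modulus at most 2 r / 5 give a point of norm at most 4 r / 5,
    which is less than r.\<close>
  have "r / 5 > 0 \<and> (\<forall>u v. norm u \<le> 2 * (r / 5) \<longrightarrow> norm v \<le> 2 * (r / 5) \<longrightarrow> pt u v \<in> snd c0 ` fst c0)"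
  proof (intro conjI allI impI)
    fix u v :: complex assume "norm u \<le> 2 * (r / 5)" "norm v \<le> 2 * (r / 5)"
    then have "norm (pt u v) < r" using norm_pt[of u v] r(1) by linarith
    then show "pt u v \<in> snd c0 ` fst c0" using r(2) by (auto simp: subset_iff)
  qed (use r in simp)
  from someI[of "\<lambda>d. d > 0 \<and> (\<forall>u v. norm u \<le> 2 * d \<longrightarrow> norm v \<le> 2 * d \<longrightarrow> pt u v \<in> snd c0 ` fst c0)", OF this]
  show "dl > 0" "norm u \<le> 2 * dl \<Longrightarrow> norm v \<le> 2 * dl \<Longrightarrow> pt u v \<in> snd c0 ` fst c0"
    unfolding dl_def by blast+
qed

definition P :: "complex \<Rightarrow> complex \<Rightarrow> 'm" where
  "P u v = inv_into (fst c0) (snd c0) (pt u v)"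

definition bidisc :: "complex \<Rightarrow> complex \<Rightarrow> bool" where
  "bidisc u v \<longleftrightarrow> norm u \<le> 2 * dl \<and> norm v \<le> 2 * dl"

lemma P_chart: "bidisc u v \<Longrightarrow> P u v \<in> fst c0" "bidisc u v \<Longrightarrow> snd c0 (P u v) = pt u v"
  unfolding P_def bidisc_def using chart_inv[OF c0A dl(2)] by blast+

lemma P_inj: "bidisc u v \<Longrightarrow> bidisc u' v' \<Longrightarrow> P u v = P u' v' \<longleftrightarrow> u = u' \<and> v = v'"
  using P_chart(2) pt_eq_iff by metis

lemma c0_U: "p \<in> fst c0 \<Longrightarrow> p \<in> U" "p \<in> fst c0 \<Longrightarrow> J p = (J1 (snd c0 p), J2 (snd c0 p))"
  using J_eqI normal_form by blast+

lemma J_P: "bidisc u v \<Longrightarrow> J (P u v) = (Re (cnj u * v), Im (cnj u * v))"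
  using c0_U(2)[OF P_chart(1)] P_chart(2) J_pt by metis

lemma P_0: "P 0 0 = m"
  using inv_into_f_f[OF chartD(3)[OF c0A] m(1)] m(2) by (simp add: P_def pt_0)

lemma c0_derivative_J:
  assumes "bidisc u v"
  shows "frechet_derivative (in_chart c0 J) (at (pt u v)) b =
    (b$1 * Re v + Re u * b$3 + b$2 * Im v + Im u * b$4, b$1 * Im v + Re u * b$4 - b$2 * Re v - Im u * b$3)"
proof -
  have nth: "((\<lambda>x. x $ i) has_derivative (\<lambda>b. b $ i)) (at x)" for i :: 4 and x :: "real^4"
    by (rule bounded_linear_imp_has_derivative[OF bounded_linear_vec_nth])
  have "((\<lambda>x. (J1 x, J2 x)) has_derivative (\<lambda>b. (b$1 * Re v + Re u * b$3 + b$2 * Im v + Im u * b$4,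
      b$1 * Im v + Re u * b$4 - b$2 * Re v - Im u * b$3))) (at (pt u v))"
    unfolding J1_def J2_def by (auto intro!: derivative_eq_intros nth simp: algebra_simps)
  then have "(in_chart c0 J has_derivative (\<lambda>b. (b$1 * Re v + Re u * b$3 + b$2 * Im v + Im u * b$4,
      b$1 * Im v + Re u * b$4 - b$2 * Re v - Im u * b$3))) (at (pt u v))"
  proof (rule has_derivative_transform_within_open[OF _ chartD(2)[OF c0A]])
    show "pt u v \<in> snd c0 ` fst c0" using assms dl(2) by (simp add: bidisc_def)
    show "(J1 x, J2 x) = in_chart c0 J x" if "x \<in> snd c0 ` fst c0" for x
      using that c0_U(2) by (auto simp: in_chart_apply'[OF c0A])
  qed
  from frechet_derivative_at[OF this] show ?thesis by (simp add: fun_eq_iff)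
qed

lemma regular_P:
  assumes "bidisc u v" "u \<noteq> 0 \<or> v \<noteq> 0"
  shows "regular_point A H L (P u v)"
proof -
  let ?D = "frechet_derivative (in_chart c0 J) (at (pt u v))"
  have "surj ?D"
  proof (cases "u = 0")
    case False
    have "\<exists>x. ?D x = (a, b)" for a b
    proof -
      obtain z where z: "cnj u * z = Complex a b"
        using False by (metis complex_cnj_zero_iff nonzero_mult_div_cancel_left times_divide_eq_right)
      have "Re (cnj u * z) = a" "Im (cnj u * z) = b" unfolding z by simp_all
      then have "?D (pt 0 z) = (a, b)" unfolding c0_derivative_J[OF assms(1)] by (simp add: algebra_simps)
      then show ?thesis by blast
    qed
    then show ?thesis unfolding surj_def by (metis surj_pair)
  next
    case True
    then have v: "v \<noteq> 0" using assms(2) by simp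
    have "\<exists>x. ?D x = (a, b)" for a b
    proof -
      obtain z where z: "cnj z * v = Complex a b"
        using v by (metis complex_cnj_cnj nonzero_mult_div_cancel_right times_divide_eq_left)
      have "Re (cnj z * v) = a" "Im (cnj z * v) = b" unfolding z by simp_all
      then have "?D (pt z 0) = (a, b)" unfolding c0_derivative_J[OF assms(1)] by (simp add: algebra_simps)
      then show ?thesis by blast
    qed
    then show ?thesis unfolding surj_def by (metis surj_pair)
  qed
  then show ?thesis
    using regular_point_iff[OF c0A P_chart(1)[OF assms(1)] c0_U(1)[OF P_chart(1)[OF assms(1)]]]
    by (simp add: P_chart(2)[OF assms(1)])
qed

text \<open>The multipliers of u and v under the joint flow for the times (s, a). The product of cnj
  \<open>ez\<close> and \<open>ez'\<close> is 1, which is the conservation of cnj u * v.\<close>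

definition ez :: "real \<times> real \<Rightarrow> complex" where "ez t = exp (Complex (fst t) (snd t))"
definition ez' :: "real \<times> real \<Rightarrow> complex" where "ez' t = exp (Complex (- fst t) (snd t))"

lemma norm_ez [simp]: "norm (ez t) = exp (fst t)" "norm (ez' t) = exp (- fst t)"
  by (simp_all add: ez_def ez'_def)

lemma ez_mult: "cnj (ez t) * ez' t = 1"
proof -
  have "cnj (ez t) * ez' t = exp (cnj (Complex (fst t) (snd t)) + Complex (- fst t) (snd t))"
    by (simp add: ez_def ez'_def exp_cnj exp_add)
  also have "cnj (Complex (fst t) (snd t)) + Complex (- fst t) (snd t) = 0" by (simp add: complex_eq_iff)
  finally show ?thesis by simp
qed

lemma ez_nz [simp]: "ez t \<noteq> 0" "ez' t \<noteq> 0" by (simp_all add: ez_def ez'_def)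

lemma ez_0 [simp]: "ez (0, 0) = 1" "ez' (0, 0) = 1"
  by (simp_all add: ez_def ez'_def zero_complex.code[symmetric])

lemma has_derivative_ez:
  "(ez has_derivative (\<lambda>a. (of_real (fst a) + \<i> * of_real (snd a)) * ez t)) (at t within T)"
  "(ez' has_derivative (\<lambda>a. (- of_real (fst a) + \<i> * of_real (snd a)) * ez' t)) (at t within T)"
proof -
  have 1: "((\<lambda>t. Complex (fst t) (snd t)) has_derivative (\<lambda>a. of_real (fst a) + \<i> * of_real (snd a))) (at t within T)"
    unfolding Complex_add_i by (auto intro!: derivative_eq_intros)
  have 2: "((\<lambda>t. Complex (- fst t) (snd t)) has_derivative (\<lambda>a. - of_real (fst a) + \<i> * of_real (snd a))) (at t within T)"
    unfolding Complex_add_i by (auto intro!: derivative_eq_intros)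
  have e: "(exp has_derivative (\<lambda>v. exp x * v)) (at x)" for x :: complex
    using DERIV_exp[of x] by (simp add: has_field_derivative_def)
  show "(ez has_derivative (\<lambda>a. (of_real (fst a) + \<i> * of_real (snd a)) * ez t)) (at t within T)"
    using has_derivative_compose[OF 1 e] by (simp add: ez_def[abs_def] mult.commute)
  show "(ez' has_derivative (\<lambda>a. (- of_real (fst a) + \<i> * of_real (snd a)) * ez' t)) (at t within T)"
    using has_derivative_compose[OF 2 e] by (simp add: ez'_def[abs_def] mult.commute)
qed

lemma orbit_map_P:
  assumes nz: "u \<noteq> 0 \<or> v \<noteq> 0" and T: "convex T" and b: "\<And>t. t \<in> T \<Longrightarrow> bidisc (ez t * u) (ez' t * v)"
  shows "orbit_map l2 (\<lambda>t. P (ez t * u) (ez' t * v)) T"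
proof (rule orbit_mapI_derivative[OF tangential_l2 T])
  have ptd: "((\<lambda>t. pt (ez t * u) (ez' t * v)) has_derivative
      (\<lambda>a. pt ((of_real (fst a) + \<i> * of_real (snd a)) * (ez t * u)) ((- of_real (fst a) + \<i> * of_real (snd a)) * (ez' t * v))))
      (at t within T)" for t
    using has_derivative_pt[OF has_derivative_mult_left[OF has_derivative_ez(1), of u t T]
        has_derivative_mult_left[OF has_derivative_ez(2), of v t T]] by (simp add: mult.assoc)
  have "continuous_on T (\<lambda>t. pt (ez t * u) (ez' t * v))"
    unfolding continuous_on_eq_continuous_within using has_derivative_continuous[OF ptd] by blast
  then show "continuous_on T (\<lambda>t. P (ez t * u) (ez' t * v))"
    unfolding P_def
    by (rule continuous_on_compose2[OF chartD(5)[OF c0A]]) (use b dl(2) in \<open>auto simp: bidisc_def\<close>)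
  show "P (ez t * u) (ez' t * v) \<in> U \<and> regular_point A H L (P (ez t * u) (ez' t * v))" if "t \<in> T" for t
    using c0_U(1)[OF P_chart(1)[OF b[OF that]]] regular_P[OF b[OF that]] nz by simp
  fix t assume t: "t \<in> T"
  note bt = b[OF t]
  let ?D = "\<lambda>a. pt ((of_real (fst a) + \<i> * of_real (snd a)) * (ez t * u)) ((- of_real (fst a) + \<i> * of_real (snd a)) * (ez' t * v))"
  have der: "((\<lambda>s. snd c0 (P (ez s * u) (ez' s * v))) has_derivative ?D) (at t within T)"
    by (rule has_derivative_transform[OF t _ ptd]) (simp add: P_chart(2)[OF b])
  have Om: "Om c0 (pt (ez t * u) (ez' t * v)) = std_form"
    using P_chart[OF bt] Om_c0 by (metis image_eqI)
  show "\<exists>c D. c \<in> A \<and> P (ez t * u) (ez' t * v) \<in> fst c \<and>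
      ((\<lambda>s. snd c (P (ez s * u) (ez' s * v))) has_derivative D) (at t within T) \<and>
      (\<forall>a b. pairing (Om c (snd c (P (ez t * u) (ez' t * v)))) (D a) b =
        l2 a $ 1 * fst (frechet_derivative (in_chart c J) (at (snd c (P (ez t * u) (ez' t * v)))) b) +
        l2 a $ 2 * snd (frechet_derivative (in_chart c J) (at (snd c (P (ez t * u) (ez' t * v)))) b))"
    by (rule exI[of _ c0], rule exI[of _ ?D], intro conjI allI c0A P_chart(1)[OF bt] der)
      (simp only: P_chart(2)[OF bt] c0_derivative_J[OF bt] Om pairing_std_J l2_nth fst_conv snd_conv)
qed

lemma flows_P:
  assumes nz: "u \<noteq> 0 \<or> v \<noteq> 0" and b: "bidisc u v" "bidisc (of_real (exp s) * u) (of_real (exp (- s)) * v)"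
  shows "flows (P u v) s (P (of_real (exp s) * u) (of_real (exp (- s)) * v))"
proof -
  have e: "ez (r, 0) = of_real (exp r)" "ez' (r, 0) = of_real (exp (- r))" for r
  proof -
    have "Complex r 0 = of_real r" "Complex (- r) 0 = of_real (- r)" by (simp_all add: complex_eq_iff)
    then show "ez (r, 0) = of_real (exp r)" "ez' (r, 0) = of_real (exp (- r))"
      by (simp_all only: ez_def ez'_def fst_conv snd_conv exp_of_real)
  qed
  \<comment> \<open>Since the exponential is monotone, the moduli at intermediate times are bounded
    by those at the two ends of the orbit segment; this is why only the end points occur in the
    hypotheses.\<close>
  have "bidisc (of_real (exp r) * u) (of_real (exp (- r)) * v)" if r: "r \<in> closed_segment 0 s" for r
  proof -
    have "exp r \<le> 1 \<or> exp r \<le> exp s" "exp (- r) \<le> 1 \<or> exp (- r) \<le> exp (- s)"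
      using r by (auto simp: closed_segment_eq_real_ivl split: if_splits)
    then have "exp r * norm u \<le> 1 * norm u \<or> exp r * norm u \<le> exp s * norm u"
      "exp (- r) * norm v \<le> 1 * norm v \<or> exp (- r) * norm v \<le> exp (- s) * norm v"
      by (meson mult_right_mono norm_ge_zero)+
    then show ?thesis using b by (auto simp: bidisc_def norm_mult)
  qed
  then have bT: "bidisc (ez t * u) (ez' t * v)" if "t \<in> closed_segment 0 s \<times> {0}" for t
    using that e by auto
  have "orbit_map l2 (\<lambda>t. P (ez t * u) (ez' t * v)) (closed_segment 0 s \<times> {0})"
    by (rule orbit_map_P[OF nz _ bT]) (auto intro: convex_Times)
  from orbit_map_l1[OF this, of "(0, 0)"]
  have "orbit_map l1 (\<lambda>s. P (ez (s, 0) * u) (ez' (s, 0) * v)) (closed_segment 0 s)" by simp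
  from flowsI[OF this, of s] show ?thesis by (simp add: e)
qed

end

section \<open>The space of flow times and values\<close>

definition zz :: "real \<times> real \<Rightarrow> real \<times> real \<Rightarrow> real^4" where
  "zz t w = fst t *\<^sub>R axis 1 1 + snd t *\<^sub>R axis 2 1 + fst w *\<^sub>R axis 3 1 + snd w *\<^sub>R axis 4 1"

lemma zz_nth [simp]: "zz t w $ 1 = fst t" "zz t w $ 2 = snd t" "zz t w $ 3 = fst w" "zz t w $ 4 = snd w"
  by (simp_all add: zz_def axis_def)

lemma zz_surj: "z = zz (z$1, z$2) (z$3, z$4)"
  by (simp add: vec_eq_iff forall_4)

lemma bounded_linear_zz: "bounded_linear (\<lambda>p. zz (fst p) (snd p))"
  unfolding zz_def
  by (intro bounded_linear_add bounded_linear_scaleR_const bounded_linear_fst bounded_linear_snd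
      bounded_linear_compose[OF bounded_linear_fst] bounded_linear_compose[OF bounded_linear_snd])

definition cw :: "real \<times> real \<Rightarrow> complex" where "cw w = Complex (fst w) (snd w)"

definition wz :: "real^4 \<Rightarrow> complex" where "wz z = Complex (z$3) (z$4)"

lemma wz_zz [simp]: "wz (zz t w) = cw w" by (simp add: wz_def cw_def)

lemma cw_simps [simp]: "Re (cw w) = fst w" "Im (cw w) = snd w" "cw 0 = 0" "cw (0, 0) = 0" "cw w = 0 \<longleftrightarrow> w = 0"
  by (auto simp: cw_def complex_eq_iff prod_eq_iff)

lemma norm_cw: "norm (cw w) = norm w"
  by (cases w) (simp add: cw_def cmod_def norm_Pair)

lemma pairing_std_nondegenerate:
  assumes "\<And>u. pairing std_form v u = 0"
  shows "v = 0"
  using assms[of "axis 1 1"] assms[of "axis 2 1"] assms[of "axis 3 1"] assms[of "axis 4 1"]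
  by (simp add: pairing_std axis_def vec_eq_iff forall_4)

lemma bounded_linear_wz: "bounded_linear wz"
proof -
  have "bounded_linear (\<lambda>z::real^4. complex_of_real (z$3) + \<i> * complex_of_real (z$4))"
    by (intro bounded_linear_add bounded_linear_const_mult bounded_linear_compose[OF bounded_linear_of_real]
        bounded_linear_vec_nth)
  moreover have "(\<lambda>z::real^4. complex_of_real (z$3) + \<i> * complex_of_real (z$4)) = wz"
    by (rule ext) (simp add: wz_def Complex_eq)
  ultimately show ?thesis by simp
qed

context integrable_system
begin

lemma local_symp_inj:
  assumes s: "local_symp F Q d" and z: "z \<in> Q"
  shows "inj (frechet_derivative (\<lambda>z. snd d (F z)) (at z))"
    and "surj (frechet_derivative (\<lambda>z. snd d (F z)) (at z))"
proof -
  let ?D = "frechet_derivative (\<lambda>z. snd d (F z)) (at z)"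
  note lin = has_derivative_linear[OF local_sympD(6)[OF s z]]
  have "v = 0" if "?D v = 0" for v
  proof (rule pairing_std_nondegenerate)
    fix u show "pairing std_form v u = 0"
      using local_sympD(5)[OF s z, of v u] that by (simp add: pairing_simps)
  qed
  then show inj: "inj ?D" using linear_injective_0[OF lin] by blast
  show "surj ?D" using linear_injective_imp_surjective[OF lin inj] by simp
qed

text \<open>A symplectic map that intertwines \<open>J\<close> with the last two coordinates carries
  their Hamiltonian fields, the two time directions, to those of \<open>J\<close>. In a flow chart
  the latter are again the first two axes.\<close>

lemma local_symp_vertical:
  assumes s: "local_symp F Q d" and d: "flow_chart d" and J: "\<And>z. z \<in> Q \<Longrightarrow> J (F z) = (z$3, z$4)"
    and z: "z \<in> Q" and l: "l$3 = 0" "l$4 = 0"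
  shows "frechet_derivative (\<lambda>z. snd d (F z)) (at z) l = l"
proof -
  let ?D = "frechet_derivative (\<lambda>z. snd d (F z)) (at z)"
  note S = local_sympD[OF s]
  have dF: "d \<in> A" using S(1) .
  have comp: "(?D v) $ i = v $ i" if i: "i = 3 \<or> i = 4" for v i
  proof -
    have 1: "((\<lambda>z. snd d (F z) $ i) has_derivative (\<lambda>v. ?D v $ i)) (at z)"
      by (rule bounded_linear.has_derivative[OF bounded_linear_vec_nth S(6)[OF z]])
    have "((\<lambda>z. z $ i) has_derivative (\<lambda>v. ?D v $ i)) (at z)"
    proof (rule has_derivative_transform_within_open[OF 1 S(2) z])
      show "snd d (F y) $ i = y $ i" if "y \<in> Q" for y
        using J[OF that] adaptedD(3)[OF flow_chartD(1)[OF d] S(3)[OF that]] i by auto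
    qed
    from has_derivative_unique[OF this bounded_linear_imp_has_derivative[OF bounded_linear_vec_nth]]
    show ?thesis by (simp add: fun_eq_iff)
  qed
  have zi: "snd d (F z) \<in> snd d ` fst d" using S(3)[OF z] by blast
  show ?thesis
  proof (rule pairing_eqD[OF Om_invertible[OF dF zi]])
    fix y
    obtain v where v: "?D v = y" using local_symp_inj(2)[OF s z] by (metis surjD)
    have "pairing (Om d (snd d (F z))) (?D l) y = l$1 * v$3 + l$2 * v$4"
      using S(5)[OF z, of l v] l by (simp add: v pairing_std)
    also have "\<dots> = l$1 * y$3 + l$2 * y$4" using comp[of 3 v] comp[of 4 v] v by simp
    also have "\<dots> = pairing (Om d (snd d (F z))) l y"
      using flow_chart_pairing[OF d zi l] by simp
    finally show "pairing (Om d (snd d (F z))) (?D l) y = pairing (Om d (snd d (F z))) l y" .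
  qed
qed

lemma local_symp_orbit_map:
  assumes good: "\<And>t. t \<in> T \<Longrightarrow> \<exists>Q d. zz t w \<in> Q \<and> local_symp F Q d \<and> (\<forall>z\<in>Q. J (F z) = (z$3, z$4))"
    and reg: "\<And>t. t \<in> T \<Longrightarrow> F (zz t w) \<in> U \<and> regular_point A H L (F (zz t w))"
  shows "orbit_map l2 (\<lambda>t. F (zz t w)) T"
  unfolding orbit_map_def
proof
  fix t assume t: "t \<in> T"
  obtain Q0 d0 where Q0: "zz t w \<in> Q0" "local_symp F Q0 d0" "\<And>z. z \<in> Q0 \<Longrightarrow> J (F z) = (z$3, z$4)"
    using good[OF t] by blast
  obtain d where d: "flow_chart d" "F (zz t w) \<in> fst d" using ex_flow_chart reg[OF t] by blast
  define Q where "Q = Q0 \<inter> F -` fst d"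
  have s: "local_symp F Q d" unfolding Q_def by (rule local_symp_chart[OF Q0(2) flow_chartD(2)[OF d(1)]])
  note S = local_sympD[OF s]
  have zQ: "zz t w \<in> Q" using Q0(1) d(2) by (simp add: Q_def)
  have JQ: "J (F z) = (z$3, z$4)" if "z \<in> Q" for z using Q0(3) that by (simp add: Q_def)
  obtain e where e: "e > 0" "ball (zz t w) e \<subseteq> Q" using S(2) zQ open_contains_ball by blast
  define K :: real where "K = 2"
  have zd: "zz s w = zz t w + l2 (s - t)" for s by (simp add: vec_eq_iff forall_4)
  have nl: "norm (l2 a) \<le> K * norm a" for a
  proof -
    have "norm (l2 a) \<le> norm (fst a *\<^sub>R axis 1 (1::real) :: real^4) + norm (snd a *\<^sub>R axis 2 (1::real) :: real^4)"
      unfolding l2_def by (rule norm_triangle_ineq)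
    also have "\<dots> \<le> norm (fst a) + norm (snd a)" by (simp add: norm_axis_1)
    also have "\<dots> \<le> K * norm a" using norm_fst_le[of "fst a" "snd a"] norm_snd_le[of "snd a" "fst a"] by (simp add: K_def)
    finally show ?thesis .
  qed
  have "F (zz s w) \<in> fst d \<and> snd d (F (zz s w)) = snd d (F (zz t w)) + l2 (s - t)"
    if s: "s \<in> T" "dist s t < e / K" for s
  proof
    have n: "norm (l2 (s - t)) < e" using nl[of "s - t"] s(2) by (simp add: dist_norm K_def)
    have seg: "zz t w + r *\<^sub>R l2 (s - t) \<in> ball (zz t w) e" if "r \<in> {0..1}" for r
    proof -
      have "\<bar>r\<bar> * norm (l2 (s - t)) \<le> 1 * norm (l2 (s - t))" using that by (intro mult_right_mono) auto
      then show ?thesis using n by (simp add: dist_norm)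
    qed
    show "F (zz s w) \<in> fst d" using S(3)[of "zz s w"] seg[of 1] e(2) zd[of s] by auto
    have 0: "((\<lambda>r. snd d (F (zz t w + r *\<^sub>R l2 (s - t))) - r *\<^sub>R l2 (s - t)) has_derivative (\<lambda>h. 0)) (at r within {0..1})"
      if r: "r \<in> {0..1}" for r
    proof -
      let ?z = "zz t w + r *\<^sub>R l2 (s - t)"
      have zr: "?z \<in> Q" using seg[OF r] e(2) by blast
      have 1: "((\<lambda>r. zz t w + r *\<^sub>R l2 (s - t)) has_derivative (\<lambda>h. h *\<^sub>R l2 (s - t))) (at r within {0..1})"
        by (auto intro!: derivative_eq_intros)
      have 2: "frechet_derivative (\<lambda>z. snd d (F z)) (at ?z) (h *\<^sub>R l2 (s - t)) = h *\<^sub>R l2 (s - t)" for h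
        by (rule local_symp_vertical[OF \<open>local_symp F Q d\<close> d(1) JQ zr]) simp_all
      have 3: "((\<lambda>r. snd d (F (zz t w + r *\<^sub>R l2 (s - t)))) has_derivative (\<lambda>h. h *\<^sub>R l2 (s - t))) (at r within {0..1})"
        using has_derivative_chain[OF 1 refl S(6)[OF zr]] unfolding 2 .
      have 4: "((\<lambda>r. r *\<^sub>R l2 (s - t)) has_derivative (\<lambda>h. h *\<^sub>R l2 (s - t))) (at r within {0..1})"
        by (auto intro!: derivative_eq_intros)
      from has_derivative_diff[OF 3 4] show ?thesis by simp
    qed
    have "snd d (F (zz t w + 1 *\<^sub>R l2 (s - t))) - 1 *\<^sub>R l2 (s - t) = snd d (F (zz t w + 0 *\<^sub>R l2 (s - t))) - 0 *\<^sub>R l2 (s - t)"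
      by (rule has_derivative_zero_unique[OF convex_real_interval(5) 0]) auto
    then show "snd d (F (zz s w)) = snd d (F (zz t w)) + l2 (s - t)"
      by (simp add: zd[of s] algebra_simps)
  qed
  then have "\<forall>s\<in>T. dist s t < e / K \<longrightarrow> F (zz s w) \<in> fst d \<and> snd d (F (zz s w)) = snd d (F (zz t w)) + l2 (s - t)"
    by blast
  moreover have "e / K > 0" using e(1) by (simp add: K_def)
  ultimately show "\<exists>c. flow_chart c \<and> F (zz t w) \<in> fst c \<and> (\<exists>e>0. \<forall>s\<in>T. dist s t < e \<longrightarrow>
      F (zz s w) \<in> fst c \<and> snd c (F (zz s w)) = snd c (F (zz t w)) + l2 (s - t))"
    using d by blast
qed

lemma flow_chart_flows:
  assumes d: "flow_chart d" "p \<in> fst d" and b: "ball (snd d p) \<rho> \<subseteq> snd d ` fst d" and s: "\<bar>s\<bar> < \<rho>"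
  obtains q where "q \<in> fst d" "snd d q = snd d p + s *\<^sub>R axis 1 1" "flows p s q"
proof -
  let ?\<gamma> = "\<lambda>r. inv_into (fst d) (snd d) (snd d p + r *\<^sub>R axis 1 1)"
  note dA = flow_chartD(2)[OF d(1)]
  have *: "?\<gamma> r \<in> fst d" "snd d (?\<gamma> r) = snd d p + r *\<^sub>R axis 1 1" if "r \<in> closed_segment 0 s" for r
  proof -
    have "\<bar>r\<bar> < \<rho>" using that s by (auto simp: closed_segment_eq_real_ivl split: if_splits)
    then have "snd d p + r *\<^sub>R axis 1 1 \<in> snd d ` fst d" using b by (auto simp: subset_iff dist_norm norm_axis_1)
    then show "?\<gamma> r \<in> fst d" "snd d (?\<gamma> r) = snd d p + r *\<^sub>R axis 1 1" using chart_inv[OF dA] by blast+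
  qed
  have "orbit_map l1 ?\<gamma> (closed_segment 0 s)"
    unfolding orbit_map_def
  proof
    fix t assume t: "t \<in> closed_segment 0 s"
    have "\<forall>r\<in>closed_segment 0 s. dist r t < 1 \<longrightarrow> ?\<gamma> r \<in> fst d \<and> snd d (?\<gamma> r) = snd d (?\<gamma> t) + l1 (r - t)"
      using *[OF t] * by (simp add: l1_def algebra_simps)
    then show "\<exists>c. flow_chart c \<and> ?\<gamma> t \<in> fst c \<and> (\<exists>e>0. \<forall>r\<in>closed_segment 0 s. dist r t < e \<longrightarrow>
        ?\<gamma> r \<in> fst c \<and> snd c (?\<gamma> r) = snd c (?\<gamma> t) + l1 (r - t))"
      using d(1) *(1)[OF t] zero_less_one by blast
  qed
  from flowsI[OF this, of s] have "flows (?\<gamma> 0) s (?\<gamma> s)" by simp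
  moreover have "?\<gamma> 0 = p" using chartD(3)[OF dA] d(2) by simp
  ultimately show thesis using that *[of s] by simp
qed

end

section \<open>The flow-out of a section of the unstable manifold\<close>

context focus_focus_system
begin

text \<open>The section |u| = \<open>dl\<close>, parametrized by the angle \<open>z$2\<close> and
  the value w = \<open>wz z\<close>; the v-coordinate is forced by cnj u * v = w. The time
  \<open>z$1\<close> does not enter.\<close>

definition E :: "real^4 \<Rightarrow> 'm" where
  "E z = P (of_real dl * ez (0, z$2)) (wz z / of_real dl * ez' (0, z$2))"

text \<open>The maximal domain of the flow-out \<open>Phi\<close> over small values. The bound on w
  keeps the v-coordinate of the section below \<open>dl\<close>.\<close>

definition dom :: "(real^4) set" where
  "dom = {z. norm (wz z) < dl\<^sup>2 \<and> (\<exists>q. flows (E z) (z$1) q)}"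

definition Phi :: "real^4 \<Rightarrow> 'm" where
  "Phi z = (THE q. flows (E z) (z$1) q)"

lemma Phi_flows: "z \<in> dom \<Longrightarrow> flows (E z) (z$1) (Phi z)"
  unfolding dom_def Phi_def using theI[of "\<lambda>q. flows (E z) (z$1) q"] flows_unique by blast

lemma PhiI:
  assumes "norm (wz z) < dl\<^sup>2" "flows (E z) (z$1) q"
  shows "z \<in> dom" "Phi z = q"
proof -
  show "z \<in> dom" using assms by (auto simp: dom_def)
  from Phi_flows[OF this] show "Phi z = q" using flows_unique assms(2) by blast
qed

lemma E_shift [simp]: "E (z + s *\<^sub>R axis 1 1) = E z" "wz (z + s *\<^sub>R axis 1 1) = wz z"
  by (simp_all add: E_def wz_def axis_def)

lemma w_div_dl: "norm w < dl\<^sup>2 \<Longrightarrow> norm (w / of_real dl) < dl" for w :: complex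
  using dl(1) by (simp add: norm_divide power2_eq_square pos_divide_less_eq)

definition EE :: "real^4 \<Rightarrow> real^4" where
  "EE z = pt (of_real dl * ez (z$1, z$2)) (wz z / of_real dl * ez' (z$1, z$2))"

text \<open>In a time of modulus below ln 2 neither |u| nor |v| can double, so starting from the
  section, where both are at most \<open>dl\<close>, the linear flow stays in the bidisc.\<close>

definition near :: "(real^4) set" where "near = {z. \<bar>z$1\<bar> < ln 2 \<and> norm (wz z) < dl\<^sup>2}"

lemma bidisc_near:
  assumes "z \<in> near"
  shows "bidisc (of_real dl * ez (z$1, z$2)) (wz z / of_real dl * ez' (z$1, z$2))"
proof -
  have "exp (z$1) < 2" "exp (- (z$1)) < 2"
    using assms exp_less_mono[of "z$1" "ln 2"] exp_less_mono[of "- (z$1)" "ln 2"] by (auto simp: near_def)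
  moreover have "norm (wz z / of_real dl) < dl" using assms w_div_dl by (simp add: near_def)
  ultimately have "dl * exp (z$1) \<le> dl * 2" "norm (wz z / of_real dl) * exp (- (z$1)) \<le> dl * 2"
    using dl(1) by (intro mult_mono; simp)+
  then show ?thesis using dl(1)
    by (simp add: bidisc_def norm_mult del: times_divide_eq_left times_divide_eq_right)
qed

lemma ez_shift: "of_real (exp s) * ez (r, a) = ez (r + s, a)" "of_real (exp (- s)) * ez' (r, a) = ez' (r + s, a)"
proof -
  have "Complex (r + s) a = of_real s + Complex r a" "Complex (- (r + s)) a = of_real (- s) + Complex (- r) a"
    by (simp_all add: complex_eq_iff)
  then show "of_real (exp s) * ez (r, a) = ez (r + s, a)" "of_real (exp (- s)) * ez' (r, a) = ez' (r + s, a)"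
    by (simp_all only: ez_def ez'_def fst_conv snd_conv exp_add exp_of_real)
qed

lemma Phi_explicit:
  assumes w: "norm (wz z) < dl\<^sup>2"
    and b: "bidisc (of_real dl * ez (z$1, z$2)) (wz z / of_real dl * ez' (z$1, z$2))"
  shows "z \<in> dom" "Phi z = P (of_real dl * ez (z$1, z$2)) (wz z / of_real dl * ez' (z$1, z$2))"
proof -
  let ?u = "of_real dl * ez (0, z$2)" and ?v = "wz z / of_real dl * ez' (0, z$2)"
  have "zz (0, z$2) (z$3, z$4) \<in> near" using w by (simp add: near_def cw_def wz_def)
  from bidisc_near[OF this] have b0: "bidisc ?u ?v" by (simp add: cw_def wz_def)
  have e: "of_real (exp (z$1)) * ?u = of_real dl * ez (z$1, z$2)"
    "of_real (exp (- (z$1))) * ?v = wz z / of_real dl * ez' (z$1, z$2)"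
    by (simp_all only: mult.left_commute[of "of_real (exp (z$1))"] mult.left_commute[of "of_real (exp (- (z$1)))"] ez_shift add_0)
  have "flows (P ?u ?v) (z$1) (P (of_real (exp (z$1)) * ?u) (of_real (exp (- (z$1))) * ?v))"
  proof (rule flows_P[OF _ b0])
    show "?u \<noteq> 0 \<or> ?v \<noteq> 0" using dl(1) by simp
    show "bidisc (of_real (exp (z$1)) * ?u) (of_real (exp (- (z$1))) * ?v)"
      unfolding e by (rule b)
  qed
  then have "flows (E z) (z$1) (P (of_real dl * ez (z$1, z$2)) (wz z / of_real dl * ez' (z$1, z$2)))"
    unfolding e E_def .
  from PhiI[OF w this] show "z \<in> dom" "Phi z = P (of_real dl * ez (z$1, z$2)) (wz z / of_real dl * ez' (z$1, z$2))" .
qed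

lemma near_dom:
  assumes "z \<in> near"
  shows "z \<in> dom" "Phi z = P (of_real dl * ez (z$1, z$2)) (wz z / of_real dl * ez' (z$1, z$2))"
  using Phi_explicit[OF _ bidisc_near[OF assms]] assms by (simp_all add: near_def)

lemma open_near: "open near"
proof -
  have "open {z::real^4. \<bar>z$1\<bar> < ln 2}" by (intro open_Collect_less continuous_intros)
  moreover have "open {z. norm (wz z) < dl\<^sup>2}"
    by (intro open_Collect_less continuous_intros linear_continuous_on bounded_linear_wz)
  ultimately show ?thesis unfolding near_def by (simp add: open_Int Collect_conj_eq)
qed

lemma smooth_on_ez:
  fixes p q :: "'a::real_normed_vector \<Rightarrow> real"
  assumes "open S" "smooth_on p S" "smooth_on q S"
  shows "smooth_on (\<lambda>x. ez (p x, q x)) S" "smooth_on (\<lambda>x. ez' (p x, q x)) S"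
  unfolding ez_def ez'_def fst_conv snd_conv
  by (intro smooth_on_exp smooth_on_Complex smooth_on_minus assms)+

lemma smooth_EE: "smooth_on EE UNIV"
proof -
  have n: "smooth_on (\<lambda>z::real^4. z $ i) UNIV" for i by (intro smooth_on_nth smooth_on_ident open_UNIV)
  have w: "smooth_on wz UNIV" by (rule smooth_on_bounded_linear[OF open_UNIV bounded_linear_wz])
  have "smooth_on (\<lambda>z. wz z * inverse (of_real dl)) UNIV"
    by (intro smooth_on_mult smooth_on_const open_UNIV w)
  then have w': "smooth_on (\<lambda>z. wz z / of_real dl) UNIV" by (simp add: divide_inverse)
  show ?thesis
    unfolding EE_def
    by (intro smooth_on_pt smooth_on_mult smooth_on_const open_UNIV smooth_on_ez n w')
qed

lemma has_derivative_EE: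
  "(EE has_derivative (\<lambda>a. pt (of_real dl * ((of_real (a$1) + \<i> * of_real (a$2)) * ez (z$1, z$2)))
      ((wz a + wz z * (- of_real (a$1) + \<i> * of_real (a$2))) / of_real dl * ez' (z$1, z$2)))) (at z)"
proof -
  have n: "((\<lambda>z::real^4. (z$1, z$2)) has_derivative (\<lambda>a. (a$1, a$2))) (at z)"
    by (intro has_derivative_Pair bounded_linear_imp_has_derivative bounded_linear_vec_nth)
  have e: "((\<lambda>z::real^4. ez (z$1, z$2)) has_derivative (\<lambda>a. (of_real (a$1) + \<i> * of_real (a$2)) * ez (z$1, z$2))) (at z)"
    using has_derivative_chain[OF n refl has_derivative_ez(1)] by simp
  have e': "((\<lambda>z::real^4. ez' (z$1, z$2)) has_derivative (\<lambda>a. (- of_real (a$1) + \<i> * of_real (a$2)) * ez' (z$1, z$2))) (at z)"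
    using has_derivative_chain[OF n refl has_derivative_ez(2)] by simp
  have w: "(wz has_derivative wz) (at z)" by (rule bounded_linear_imp_has_derivative[OF bounded_linear_wz])
  have u: "((\<lambda>z. of_real dl * ez (z$1, z$2)) has_derivative
      (\<lambda>a. of_real dl * ((of_real (a$1) + \<i> * of_real (a$2)) * ez (z$1, z$2)))) (at z)"
    by (rule has_derivative_mult_right[OF e])
  have v: "((\<lambda>z. inverse (of_real dl) * (wz z * ez' (z$1, z$2))) has_derivative
      (\<lambda>a. inverse (of_real dl) * (wz z * ((- of_real (a$1) + \<i> * of_real (a$2)) * ez' (z$1, z$2)) + wz a * ez' (z$1, z$2)))) (at z)"
    by (rule has_derivative_mult_right[OF has_derivative_mult[OF w e']])
  have eq1: "EE = (\<lambda>z. pt (of_real dl * ez (z$1, z$2)) (inverse (of_real dl) * (wz z * ez' (z$1, z$2))))"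
    by (rule ext) (simp add: EE_def field_simps)
  have eq2: "(\<lambda>a. pt (of_real dl * ((of_real (a$1) + \<i> * of_real (a$2)) * ez (z$1, z$2)))
      ((wz a + wz z * (- of_real (a$1) + \<i> * of_real (a$2))) / of_real dl * ez' (z$1, z$2))) =
    (\<lambda>a. pt (of_real dl * ((of_real (a$1) + \<i> * of_real (a$2)) * ez (z$1, z$2)))
      (inverse (of_real dl) * (wz z * ((- of_real (a$1) + \<i> * of_real (a$2)) * ez' (z$1, z$2)) + wz a * ez' (z$1, z$2))))"
    by (rule ext) (simp add: divide_inverse algebra_simps)
  show ?thesis unfolding eq1 eq2 by (rule has_derivative_pt[OF u v])
qed

lemma EE_symplectic:
  "pairing std_form (frechet_derivative EE (at z) a) (frechet_derivative EE (at z) b) = pairing std_form a b"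
proof -
  let ?e = "ez (z$1, z$2)" and ?e' = "ez' (z$1, z$2)"
  define al where "al x = of_real (x$1) + \<i> * of_real (x$2)" for x :: "real^4"
  define be where "be x = wz x + wz z * (- of_real (x$1) + \<i> * of_real (x$2))" for x :: "real^4"
  have D: "frechet_derivative EE (at z) x = pt (of_real dl * (al x * ?e)) (be x / of_real dl * ?e')" for x
    using frechet_derivative_at[OF has_derivative_EE[of z]] by (simp add: al_def be_def fun_eq_iff)
  have e1: "cnj ?e * ?e' = 1" by (rule ez_mult)
  then have e2: "cnj ?e' * ?e = 1" by (metis complex_cnj_cnj complex_cnj_mult complex_cnj_one mult.commute)
  have "cnj (of_real dl * (al a * ?e)) * (be b / of_real dl * ?e') = cnj (al a) * be b * (cnj ?e * ?e')"
    "cnj (be a / of_real dl * ?e') * (of_real dl * (al b * ?e)) = cnj (be a) * al b * (cnj ?e' * ?e)"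
    using dl(1) by (simp_all add: field_simps)
  then have "pairing std_form (frechet_derivative EE (at z) a) (frechet_derivative EE (at z) b) =
      Re (cnj (al a) * be b) - Re (cnj (be a) * al b)"
    unfolding D pairing_std_pt e1 e2 by simp
  also have "\<dots> = pairing std_form a b"
    by (simp add: al_def be_def pairing_std wz_def algebra_simps)
  finally show ?thesis .
qed

lemma local_symp_near: "local_symp Phi near c0"
  unfolding local_symp_def
proof (intro conjI ballI allI c0A open_near)
  show "Phi ` near \<subseteq> fst c0" using near_dom(2) P_chart(1)[OF bidisc_near] by auto
  have eq: "snd c0 (Phi z) = EE z" if "z \<in> near" for z
    using near_dom(2)[OF that] P_chart(2)[OF bidisc_near[OF that]] by (simp add: EE_def)
  show "smooth_on (\<lambda>z. snd c0 (Phi z)) near"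
    by (rule smooth_on_cong[OF open_near _ smooth_on_subset[OF smooth_EE subset_UNIV]]) (simp add: eq)
  fix z u v assume z: "z \<in> near"
  have "(EE has_derivative frechet_derivative EE (at z)) (at z)"
    by (rule smooth_on_has_derivative[OF smooth_EE UNIV_I])
  then have "((\<lambda>z. snd c0 (Phi z)) has_derivative frechet_derivative EE (at z)) (at z)"
    by (rule has_derivative_transform_within_open[OF _ open_near z]) (simp add: eq)
  then have "frechet_derivative (\<lambda>z. snd c0 (Phi z)) (at z) = frechet_derivative EE (at z)"
    by (rule frechet_derivative_at[symmetric])
  moreover have "Om c0 (snd c0 (Phi z)) = std_form"
    using Om_c0 near_dom(2)[OF z] P_chart(1)[OF bidisc_near[OF z]] by simp
  ultimately show "pairing (Om c0 (snd c0 (Phi z))) (frechet_derivative (\<lambda>z. snd c0 (Phi z)) (at z) u)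
        (frechet_derivative (\<lambda>z. snd c0 (Phi z)) (at z) v) = pairing std_form u v"
    using EE_symplectic by simp
qed

definition good :: "real^4 \<Rightarrow> bool" where
  "good z \<longleftrightarrow> (\<exists>Q d. z \<in> Q \<and> Q \<subseteq> dom \<and> local_symp Phi Q d)"

text \<open>Advancing by a short time inside a flow chart composes \<open>Phi\<close> with a
  translation along the fibre. The form is invariant under it, so smoothness and symplecticity are
  carried over.\<close>

lemma good_translate:
  assumes z: "good z" and d: "flow_chart d" "Phi z \<in> fst d" and b: "ball (snd d (Phi z)) \<rho> \<subseteq> snd d ` fst d"
    and s: "\<bar>s\<bar> < \<rho> / 2"
  shows "good (z + s *\<^sub>R axis 1 1)"
proof -
  note dA = flow_chartD(2)[OF d(1)]
  let ?e = "s *\<^sub>R axis 1 1 :: real^4"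
  obtain Q0 d0 where Q0: "z \<in> Q0" "Q0 \<subseteq> dom" "local_symp Phi Q0 d0" using z unfolding good_def by blast
  define Q1 where "Q1 = Q0 \<inter> Phi -` fst d"
  have s1: "local_symp Phi Q1 d" unfolding Q1_def by (rule local_symp_chart[OF Q0(3) dA])
  define Q2 where "Q2 = Q1 \<inter> (\<lambda>y. snd d (Phi y)) -` ball (snd d (Phi z)) (\<rho> / 2)"
  have "open Q2" unfolding Q2_def
    by (rule continuous_open_preimage[OF smooth_on_continuous[OF local_sympD(4)[OF s1]] local_sympD(2)[OF s1] open_ball])
  then have s2: "local_symp Phi Q2 d" by (rule local_symp_subset[OF s1]) (simp add: Q2_def)
  note S = local_sympD[OF s2]
  have \<rho>: "\<rho> > 0" using s by linarith
  have zQ2: "z \<in> Q2" using Q0(1) d(2) \<rho> by (simp add: Q2_def Q1_def)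
  have fl: "y + ?e \<in> dom \<and> Phi (y + ?e) \<in> fst d \<and> snd d (Phi (y + ?e)) = snd d (Phi y) + ?e" if y: "y \<in> Q2" for y
  proof -
    have yd: "y \<in> dom" using y Q0(2) by (auto simp: Q2_def Q1_def)
    have dd: "dist (snd d (Phi z)) (snd d (Phi y)) < \<rho> / 2" using y by (simp add: Q2_def)
    have "ball (snd d (Phi y)) (\<rho> / 2) \<subseteq> snd d ` fst d"
    proof
      fix x assume "x \<in> ball (snd d (Phi y)) (\<rho> / 2)"
      then have "x \<in> ball (snd d (Phi z)) \<rho>"
        using dd dist_triangle[of "snd d (Phi z)" x "snd d (Phi y)"] by simp
      then show "x \<in> snd d ` fst d" using b by blast
    qed
    then obtain q where q: "q \<in> fst d" "snd d q = snd d (Phi y) + ?e" "flows (Phi y) s q"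
      using flow_chart_flows[OF d(1) S(3)[OF y] _ s] by blast
    have "flows (E y) (y$1 + s) q" by (rule flows_trans[OF Phi_flows[OF yd] q(3)])
    moreover have "(y + ?e)$1 = y$1 + s" by (simp add: axis_def)
    ultimately have f: "flows (E (y + ?e)) ((y + ?e)$1) q" by simp
    have w: "norm (wz (y + ?e)) < dl\<^sup>2" using yd by (simp add: dom_def)
    show ?thesis using PhiI[OF w f] q by simp
  qed
  let ?Q = "(+) ?e ` Q2"
  have Q: "open ?Q" using S(2) by (rule open_translation)
  have Qi: "y - ?e \<in> Q2" if "y \<in> ?Q" for y using that by auto
  have eq: "snd d (Phi (y - ?e)) + ?e = snd d (Phi y)" "y \<in> dom" "Phi y \<in> fst d" if "y \<in> ?Q" for y
    using fl[OF Qi[OF that]] by simp_all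
  have sub: "((\<lambda>y. y - ?e) has_derivative (\<lambda>v. v)) (at y)" for y :: "real^4"
    by (auto intro!: derivative_eq_intros)
  have der: "frechet_derivative (\<lambda>y. snd d (Phi y)) (at y) = frechet_derivative (\<lambda>y. snd d (Phi y)) (at (y - ?e))"
    if y: "y \<in> ?Q" for y
  proof -
    have "((\<lambda>y. snd d (Phi (y - ?e)) + ?e) has_derivative frechet_derivative (\<lambda>y. snd d (Phi y)) (at (y - ?e))) (at y)"
      using has_derivative_add_const[OF has_derivative_chain[OF sub refl S(6)[OF Qi[OF y]]]] by simp
    then have "((\<lambda>y. snd d (Phi y)) has_derivative frechet_derivative (\<lambda>y. snd d (Phi y)) (at (y - ?e))) (at y)"
      by (rule has_derivative_transform_within_open[OF _ Q y]) (rule eq(1))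
    then show ?thesis by (rule frechet_derivative_at[symmetric])
  qed
  have "local_symp Phi ?Q d"
    unfolding local_symp_def
  proof (intro conjI ballI allI dA Q)
    show "Phi ` ?Q \<subseteq> fst d" using eq(3) by blast
    have m: "smooth_on (\<lambda>y::real^4. y - ?e) ?Q" by (intro smooth_on_diff smooth_on_ident smooth_on_const Q)
    have 1: "smooth_on (\<lambda>y. snd d (Phi (y - ?e))) ?Q"
      by (rule smooth_on_compose[OF Q S(2) m S(4)]) (use Qi in blast)
    have 2: "smooth_on (\<lambda>y. snd d (Phi (y - ?e)) + ?e) ?Q"
      by (rule smooth_on_add[OF Q 1 smooth_on_const[OF Q]])
    show "smooth_on (\<lambda>y. snd d (Phi y)) ?Q"
      by (rule smooth_on_cong[OF Q _ 2]) (rule eq(1))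
    fix y u v assume y: "y \<in> ?Q"
    have "Om d (snd d (Phi y)) = Om d (snd d (Phi (y - ?e)))"
    proof (rule flow_chartD(4)[OF d(1)])
      show "snd d (Phi y) \<in> snd d ` fst d" "snd d (Phi (y - ?e)) \<in> snd d ` fst d"
        using eq(3)[OF y] S(3)[OF Qi[OF y]] by blast+
      show "snd d (Phi y) $ 3 = snd d (Phi (y - ?e)) $ 3" "snd d (Phi y) $ 4 = snd d (Phi (y - ?e)) $ 4"
        unfolding eq(1)[OF y, symmetric] by (simp_all add: axis_def)
    qed
    then show "pairing (Om d (snd d (Phi y))) (frechet_derivative (\<lambda>z. snd d (Phi z)) (at y) u)
        (frechet_derivative (\<lambda>z. snd d (Phi z)) (at y) v) = pairing std_form u v"
      using S(5)[OF Qi[OF y]] der[OF y] by simp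
  qed
  moreover have "z + ?e \<in> ?Q" using zQ2 by (auto simp: add.commute)
  moreover have "?Q \<subseteq> dom" using eq(2) by blast
  ultimately show ?thesis unfolding good_def by blast
qed

text \<open>At time 0 the explicit formula shows \<open>good\<close>. Along an orbit the property is
  locally constant by short translations in flow charts, hence constant on the connected set of
  times.\<close>

lemma good_dom:
  assumes z: "z \<in> dom"
  shows "good z"
proof -
  obtain \<gamma> T where T: "closed T" "connected T" "0 \<in> T" "z$1 \<in> T" "orbit_map l1 \<gamma> T" "\<gamma> 0 = E z"
    using Phi_flows[OF z] unfolding flows_def by blast
  have w: "norm (wz z) < dl\<^sup>2" using z by (simp add: dom_def)
  define zs where "zs s = z + (s - z$1) *\<^sub>R axis 1 1" for s
  have zs: "zs s \<in> dom" "Phi (zs s) = \<gamma> s" if "s \<in> T" for s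
  proof -
    have "E (zs s) = E z" "(zs s)$1 = s" by (simp add: zs_def, simp add: zs_def axis_def)
    then have "flows (E (zs s)) ((zs s)$1) (\<gamma> s)"
      using flowsI[OF T(5,1,2,3) that] T(6) by simp
    from PhiI[OF _ this] w show "zs s \<in> dom" "Phi (zs s) = \<gamma> s" by (simp_all add: zs_def)
  qed
  have "good (zs 0) = good (zs (z$1))"
  proof (rule connected_local_const[OF T(2,3,4)], rule ballI)
    fix a assume a: "a \<in> T"
    obtain c e where c: "flow_chart c" "\<gamma> a \<in> fst c" "e > 0"
      "\<And>s. s \<in> T \<Longrightarrow> dist s a < e \<Longrightarrow> \<gamma> s \<in> fst c \<and> snd c (\<gamma> s) = snd c (\<gamma> a) + l1 (s - a)"
      using T(5) a unfolding orbit_map_def by blast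
    obtain \<rho> where \<rho>: "\<rho> > 0" "ball (snd c (\<gamma> a)) \<rho> \<subseteq> snd c ` fst c"
      using chartD(2)[OF flow_chartD(2)[OF c(1)]] c(2) open_contains_ball by (metis image_eqI)
    \<comment> \<open>Goodness has to be moved from a to b and back again, so a ball of radius
      \<rho> / 2 must fit around each of the two points; this dictates the bound \<rho> / 4.\<close>
    have "good (zs a) = good (zs b)" if b: "b \<in> T" "dist b a < min e (\<rho> / 4)" for b
    proof -
      have cb: "\<gamma> b \<in> fst c" "snd c (\<gamma> b) = snd c (\<gamma> a) + l1 (b - a)" using c(4)[OF b(1)] b(2) by auto
      have d: "dist (snd c (\<gamma> a)) (snd c (\<gamma> b)) < \<rho> / 4"
        using b(2) by (simp add: cb(2) l1_def dist_norm norm_axis_1)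
      have bb: "ball (snd c (\<gamma> b)) (\<rho> / 2) \<subseteq> snd c ` fst c"
      proof
        fix x assume "x \<in> ball (snd c (\<gamma> b)) (\<rho> / 2)"
        then have "dist (snd c (\<gamma> a)) x < \<rho>"
          using d \<rho>(1) dist_triangle[of "snd c (\<gamma> a)" x "snd c (\<gamma> b)"] by simp
        then show "x \<in> snd c ` fst c" using \<rho>(2) by auto
      qed
      have ba: "ball (snd c (\<gamma> a)) (\<rho> / 2) \<subseteq> snd c ` fst c" using \<rho> subset_ball[of "\<rho> / 2" \<rho>] by auto
      have s: "\<bar>b - a\<bar> < \<rho> / 2 / 2" "\<bar>a - b\<bar> < \<rho> / 2 / 2" using b(2) by (auto simp: dist_real_def abs_minus_commute)
      have e: "zs a + (b - a) *\<^sub>R axis 1 1 = zs b" "zs b + (a - b) *\<^sub>R axis 1 1 = zs a"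
        by (simp_all add: zs_def algebra_simps)
      show ?thesis
        using good_translate[of "zs a" c "\<rho> / 2" "b - a"] good_translate[of "zs b" c "\<rho> / 2" "a - b"]
          c(1,2) cb(1) ba bb s unfolding zs(2)[OF a] zs(2)[OF b(1)] e by blast
    qed
    moreover have "min e (\<rho> / 4) > 0" using c(3) \<rho>(1) by simp
    ultimately show "\<forall>\<^sub>F b in at a within T. good (zs a) = good (zs b)"
      unfolding eventually_at by blast
  qed
  moreover have "zs 0 \<in> near" using w by (simp add: near_def zs_def wz_def axis_def)
  then have "good (zs 0)"
    unfolding good_def using local_symp_near near_dom(1) by blast
  moreover have "zs (z$1) = z" by (simp add: zs_def)
  ultimately show ?thesis by simp
qed

lemma open_dom: "open dom"
  unfolding open_subopen[of dom]
proof
  fix z assume "z \<in> dom"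
  then obtain Q d where "z \<in> Q" "Q \<subseteq> dom" "local_symp Phi Q d" using good_dom unfolding good_def by blast
  then show "\<exists>T. open T \<and> z \<in> T \<and> T \<subseteq> dom" using local_sympD(2) by blast
qed

lemma J_Phi: "z \<in> dom \<Longrightarrow> J (Phi z) = (z$3, z$4)"
proof -
  assume z: "z \<in> dom"
  let ?y = "zz (0, z$2) (z$3, z$4)"
  have y: "?y \<in> near" using z by (simp add: near_def dom_def wz_def cw_def)
  have "J (Phi z) = J (E z)" by (rule flows_J[OF Phi_flows[OF z]])
  also have "E z = P (of_real dl * ez (0, z$2)) (wz z / of_real dl * ez' (0, z$2))" by (simp add: E_def)
  also have "J \<dots> = (Re (wz z), Im (wz z))"
  proof -
    have "bidisc (of_real dl * ez (0, z$2)) (wz z / of_real dl * ez' (0, z$2))"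
      using bidisc_near[OF y] by (simp add: cw_def wz_def)
    moreover have "cnj (of_real dl * ez (0, z$2)) * (wz z / of_real dl * ez' (0, z$2)) = wz z * (cnj (ez (0, z$2)) * ez' (0, z$2))"
      using dl(1) by (simp add: field_simps)
    ultimately show ?thesis unfolding ez_mult by (simp add: J_P)
  qed
  finally show ?thesis by (simp add: wz_def)
qed

lemma Phi_regular: "z \<in> dom \<Longrightarrow> Phi z \<in> U \<and> regular_point A H L (Phi z)"
  using flows_regular[OF Phi_flows] by blast

lemma Phi_orbit_map:
  assumes "\<And>t. t \<in> T \<Longrightarrow> zz t w \<in> dom"
  shows "orbit_map l2 (\<lambda>t. Phi (zz t w)) T"
proof (rule local_symp_orbit_map)
  fix t assume t: "t \<in> T"
  obtain Q d where "zz t w \<in> Q" "Q \<subseteq> dom" "local_symp Phi Q d" using good_dom[OF assms[OF t]] unfolding good_def by blast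
  then show "\<exists>Q d. zz t w \<in> Q \<and> local_symp Phi Q d \<and> (\<forall>z\<in>Q. J (Phi z) = (z$3, z$4))"
    using J_Phi by blast
  show "Phi (zz t w) \<in> U \<and> regular_point A H L (Phi (zz t w))" by (rule Phi_regular[OF assms[OF t]])
qed

lemma continuous_Phi: "continuous_on dom Phi"
proof (rule continuous_at_imp_continuous_on, rule ballI)
  fix z assume "z \<in> dom"
  then obtain Q d where "z \<in> Q" "local_symp Phi Q d" using good_dom unfolding good_def by blast
  then show "isCont Phi z"
    using local_symp_continuous local_sympD(2) continuous_on_eq_continuous_at by blast
qed

end

section \<open>Completeness of the flow on the singular fibre\<close>

context integrable_system
begin

lemma orbit_map_shift':
  assumes "orbit_map l2 \<gamma> T" "\<And>r. r \<in> S \<Longrightarrow> a + r \<in> T"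
  shows "orbit_map l2 (\<lambda>r. \<gamma> (a + r)) S"
  by (rule orbit_map_subset[OF orbit_map_shift[OF assms(1)]]) (use assms(2) in blast)

lemma orbit_map_inverse_chart:
  assumes d: "flow_chart d" and T: "convex T" and b: "\<And>r. r \<in> T \<Longrightarrow> x + l2 r \<in> snd d ` fst d"
  shows "orbit_map l2 (\<lambda>r. inv_into (fst d) (snd d) (x + l2 r)) T"
  unfolding orbit_map_def
proof
  fix t assume t: "t \<in> T"
  note * = chart_inv[OF flow_chartD(2)[OF d] b]
  have "\<forall>s\<in>T. dist s t < 1 \<longrightarrow> inv_into (fst d) (snd d) (x + l2 s) \<in> fst d \<and>
      snd d (inv_into (fst d) (snd d) (x + l2 s)) = snd d (inv_into (fst d) (snd d) (x + l2 t)) + l2 (s - t)"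
    using * t by (simp add: l2_def algebra_simps)
  then show "\<exists>c. flow_chart c \<and> inv_into (fst d) (snd d) (x + l2 t) \<in> fst c \<and> (\<exists>e>0. \<forall>s\<in>T. dist s t < e \<longrightarrow>
      inv_into (fst d) (snd d) (x + l2 s) \<in> fst c \<and>
      snd c (inv_into (fst d) (snd d) (x + l2 s)) = snd c (inv_into (fst d) (snd d) (x + l2 t)) + l2 (s - t))"
    using d *(1)[OF t] zero_less_one by blast
qed

text \<open>Convexity of the chart: the segment between two points of the same fibre is itself an
  orbit map, so by uniqueness it is part of the complete orbit that passes through one of
  them.\<close>

lemma orbit_meets_chart:
  assumes \<gamma>: "orbit_map l2 \<gamma> UNIV" and d: "flow_chart d" and p: "\<gamma> t \<in> fst d" "q \<in> fst d" and J: "J q = J (\<gamma> t)"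
  shows "q = \<gamma> (t + (snd d q $ 1 - snd d (\<gamma> t) $ 1, snd d q $ 2 - snd d (\<gamma> t) $ 2))"
proof -
  let ?a = "(snd d q $ 1 - snd d (\<gamma> t) $ 1, snd d q $ 2 - snd d (\<gamma> t) $ 2)" and ?x = "snd d (\<gamma> t)"
  note dA = flow_chartD(2)[OF d]
  have "snd d q $ 3 = ?x $ 3" "snd d q $ 4 = ?x $ 4"
    using J adaptedD(3)[OF flow_chartD(1)[OF d] p(1)] adaptedD(3)[OF flow_chartD(1)[OF d] p(2)] by simp_all
  then have q: "?x + l2 ?a = snd d q" by (simp add: vec_eq_iff forall_4)
  have im: "?x \<in> snd d ` fst d" "?x + l2 ?a \<in> snd d ` fst d" using p q by auto
  let ?T = "closed_segment 0 ?a"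
  have seg: "?x + l2 r \<in> snd d ` fst d" if r: "r \<in> ?T" for r
  proof -
    obtain u where u: "0 \<le> u" "u \<le> 1" "r = u *\<^sub>R ?a" using r by (auto simp: closed_segment_def)
    have "?x + l2 r = (1 - u) *\<^sub>R ?x + u *\<^sub>R (?x + l2 ?a)"
      unfolding u(3) by (simp add: l2_def algebra_simps)
    then show ?thesis using convexD_alt[OF flow_chartD(3)[OF d] im u(1,2)] by simp
  qed
  have 1: "orbit_map l2 (\<lambda>r. inv_into (fst d) (snd d) (?x + l2 r)) ?T"
    by (rule orbit_map_inverse_chart[OF d convex_closed_segment seg])
  have 2: "orbit_map l2 (\<lambda>r. \<gamma> (t + r)) ?T" by (rule orbit_map_shift'[OF \<gamma>]) simp
  have "inv_into (fst d) (snd d) (?x + l2 ?a) = \<gamma> (t + ?a)"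
  proof (rule orbit_map_unique[OF tangential_l2 1 2 connected_segment(1)])
    show "inv_into (fst d) (snd d) (?x + l2 0) = \<gamma> (t + 0)"
      using inv_into_f_f[OF chartD(3)[OF dA] p(1)] by (simp add: l2_def)
  qed auto
  then show ?thesis using inv_into_f_f[OF chartD(3)[OF dA] p(2)] q by simp
qed

end

context focus_focus_system
begin

abbreviation "K \<equiv> singular_fibre H L m"

lemma em_m: "em_map H L m = g (0, 0)"
  using normal_form[OF m(1)] by (simp add: m(2) J1_def J2_def)

lemma K_J: "p \<in> K \<Longrightarrow> p \<in> U" "p \<in> K \<Longrightarrow> J p = (0, 0)"
proof -
  assume "p \<in> K"
  then have "em_map H L p = g (0, 0)"
    using connected_component_subset[of "em_map H L -` {em_map H L m}" m] em_m by (auto simp: singular_fibre_def)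
  from J_eqI[OF this V0] show "p \<in> U" "J p = (0, 0)" .
qed

lemma K_maximal:
  assumes "connected C" "m \<in> C" "\<And>p. p \<in> C \<Longrightarrow> p \<in> U \<and> J p = (0, 0)"
  shows "C \<subseteq> K"
  unfolding singular_fibre_def
proof (rule connected_component_maximal[OF assms(2,1)])
  show "C \<subseteq> em_map H L -` {em_map H L m}"
    using assms(3) J_in(2) em_m by (metis singletonI subsetI vimageI)
qed

lemma m_not_regular: "\<not> regular_point A H L m"
proof
  assume r: "regular_point A H L m"
  have b: "bidisc 0 0" using dl(1) by (simp add: bidisc_def)
  have "frechet_derivative (in_chart c0 J) (at (snd c0 m)) v = (0, 0)" for v
    using c0_derivative_J[OF b] m(2) by (simp add: pt_0)
  then have "\<not> surj (frechet_derivative (in_chart c0 J) (at (snd c0 m)))"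
    unfolding surj_def by (metis zero_neq_one prod.inject)
  then show False using regular_point_iff[OF c0A m(1) c0_U(1)[OF m(1)]] r by simp
qed

lemma continuous_P: "continuous_on {p. bidisc (fst p) (snd p)} (\<lambda>p. P (fst p) (snd p))"
  unfolding P_def
proof (rule continuous_on_compose2[OF chartD(5)[OF c0A]])
  show "continuous_on {p. bidisc (fst p) (snd p)} (\<lambda>p. pt (fst p) (snd p))"
    by (rule linear_continuous_on[OF bounded_linear_pt])
qed (auto simp: bidisc_def dl(2))

text \<open>The radius of the unstable disc from m to the section, followed by the orbit, is a
  connected set in the level J = (0, 0) that contains m.\<close>

lemma Phi_in_K:
  assumes z: "z \<in> dom" "wz z = 0"
  shows "Phi z \<in> K"
proof -
  let ?C0 = "(\<lambda>r. P (of_real r * (of_real dl * ez (0, z$2))) 0) ` {0..1::real}"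
  have b: "bidisc (of_real r * (of_real dl * ez (0, z$2))) 0" if "r \<in> {0..1}" for r
    using that dl(1) mult_right_mono[of r 1 dl] by (auto simp: bidisc_def norm_mult)
  have "continuous_on {0..1} (\<lambda>r. P (of_real r * (of_real dl * ez (0, z$2))) 0)"
    using continuous_on_compose2[OF continuous_P, of "{0..1}" "\<lambda>r. (of_real r * (of_real dl * ez (0, z$2)), 0)"] b
    by (force intro!: continuous_intros)
  then have c0: "connected ?C0" by (intro connected_continuous_image) auto
  have m0: "m \<in> ?C0" using P_0 by (force intro!: image_eqI[of _ _ 0])
  have E0: "E z \<in> ?C0" using z(2) by (force simp: E_def intro!: image_eqI[of _ _ 1])
  have J0: "p \<in> U \<and> J p = (0, 0)" if "p \<in> ?C0" for p
    using that J_P[OF b] c0_U(1)[OF P_chart(1)[OF b]] by auto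
  obtain \<gamma> T where T: "closed T" "connected T" "0 \<in> T" "z$1 \<in> T" "orbit_map l1 \<gamma> T" "\<gamma> 0 = E z" "\<gamma> (z$1) = Phi z"
    using Phi_flows[OF z(1)] unfolding flows_def by blast
  have c1: "connected (\<gamma> ` T)"
    by (rule connected_continuous_image[OF orbit_map_continuous[OF tangential_l1 T(5)] T(2)])
  have J1: "p \<in> U \<and> J p = (0, 0)" if pT: "p \<in> \<gamma> ` T" for p
  proof -
    obtain s where s: "s \<in> T" "p = \<gamma> s" using pT by blast
    have "J (\<gamma> s) = J (\<gamma> 0)" by (rule orbit_map_J[OF tangential_l1 T(5,2) s(1) T(3)])
    then show ?thesis using orbit_map_regular(1)[OF T(5) s(1)] J0[OF E0] T(6) s(2) by simp
  qed
  have "?C0 \<union> \<gamma> ` T \<subseteq> K"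
  proof (rule K_maximal)
    show "connected (?C0 \<union> \<gamma> ` T)"
      by (rule connected_Un[OF c0 c1]) (use E0 T(3,6) in \<open>metis IntI empty_iff imageI\<close>)
  qed (use m0 J0 J1 in blast)+
  then show ?thesis using T(4,7) by (metis UnI2 imageI subsetD)
qed

text \<open>Stated for filters, since it is applied both at a finite supremum of times and at
  infinity.\<close>

lemma accumulation:
  fixes F :: "'b filter"
  assumes F: "F \<noteq> bot" and ev: "eventually (\<lambda>s. f s \<in> K) F"
  obtains q where "q \<in> K" "\<And>W. open W \<Longrightarrow> q \<in> W \<Longrightarrow> \<exists>\<^sub>F s in F. f s \<in> W"
proof -
  have "filtermap f F \<noteq> bot" using F by (simp add: filtermap_bot_iff)
  moreover have "eventually (\<lambda>p. p \<in> K) (filtermap f F)" using ev by (simp add: eventually_filtermap)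
  ultimately obtain q where q: "q \<in> K" "inf (nhds q) (filtermap f F) \<noteq> bot"
    using compact_K unfolding compact_filter by blast
  show thesis
  proof (rule that[OF q(1)])
    fix W assume W: "open W" "q \<in> W"
    show "\<exists>\<^sub>F s in F. f s \<in> W"
    proof (rule ccontr)
      assume "\<not> (\<exists>\<^sub>F s in F. f s \<in> W)"
      then have "eventually (\<lambda>p. p \<notin> W) (filtermap f F)"
        by (simp add: not_frequently eventually_filtermap)
      moreover have "eventually (\<lambda>p. p \<in> W) (nhds q)" using W eventually_nhds by blast
      ultimately have "eventually (\<lambda>p. False) (inf (nhds q) (filtermap f F))"
        unfolding eventually_inf by (intro exI[of _ "\<lambda>p. p \<in> W"] exI[of _ "\<lambda>p. p \<notin> W"]) simp
      then show False using q(2) by (simp add: trivial_limit_def)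
    qed
  qed
qed

definition B :: "'m set" where
  "B = {p \<in> fst c0. \<exists>u v. snd c0 p = pt u v \<and> norm u < dl \<and> norm v < dl}"

lemma open_B: "open B" and m_B: "m \<in> B"
proof -
  have bu: "bounded_linear (\<lambda>x::real^4. of_real (x$1) + \<i> * of_real (x$2))"
    "bounded_linear (\<lambda>x::real^4. of_real (x$3) + \<i> * of_real (x$4))"
    by (intro bounded_linear_add bounded_linear_const_mult bounded_linear_compose[OF bounded_linear_of_real]
        bounded_linear_vec_nth)+
  have "open {x::real^4. norm (of_real (x$1) + \<i> * of_real (x$2)) < dl \<and> norm (of_real (x$3) + \<i> * of_real (x$4)) < dl}"
    (is "open ?X")
    by (intro open_Collect_conj open_Collect_less continuous_intros linear_continuous_on bu)
  from chart_open_preimage[OF is_chart[OF c0A] this] have "open {p \<in> fst c0. snd c0 p \<in> ?X}" .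
  moreover have "{p \<in> fst c0. snd c0 p \<in> ?X} = B"
  proof -
    have "x \<in> ?X \<longleftrightarrow> (\<exists>u v. x = pt u v \<and> norm u < dl \<and> norm v < dl)" for x
    proof -
      obtain u v where x: "x = pt u v" using pt_surj by blast
      have "of_real (x$1) + \<i> * of_real (x$2) = u" "of_real (x$3) + \<i> * of_real (x$4) = v"
        unfolding x by (simp_all add: complex_eq_iff)
      then show ?thesis using x by auto
    qed
    then show ?thesis unfolding B_def by simp
  qed
  ultimately show "open B" by simp
  show "m \<in> B" unfolding B_def using m dl(1) pt_0 by (force intro!: exI[of _ 0])
qed

lemma B_bidisc:
  assumes "p \<in> B"
  obtains u v where "p = P u v" "norm u < dl" "norm v < dl" "bidisc u v"
proof -
  obtain u v where uv: "p \<in> fst c0" "snd c0 p = pt u v" "norm u < dl" "norm v < dl" using assms unfolding B_def by blast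
  have "P u v = p" unfolding P_def uv(2)[symmetric] by (rule inv_into_f_f[OF chartD(3)[OF c0A] uv(1)])
  moreover have "bidisc u v" using uv(3,4) dl(1) by (simp add: bidisc_def)
  ultimately show thesis using that uv(3,4) by blast
qed

lemma zero_lt_dl2: "0 < dl\<^sup>2" using dl(1) by simp

lemma bidisc_unstable: "s \<le> 0 \<Longrightarrow> bidisc (of_real dl * ez (s, a)) 0"
proof -
  assume "s \<le> 0"
  then have "exp s \<le> 1" by simp
  then have "exp s \<le> 2" by linarith
  then have "dl * exp s \<le> dl * 2" by (rule mult_left_mono) (use dl(1) in simp)
  then show ?thesis using dl(1) by (simp add: bidisc_def norm_mult)
qed

lemma Phi_unstable:
  assumes "s \<le> 0"
  shows "zz (s, a) 0 \<in> dom" "Phi (zz (s, a) 0) = P (of_real dl * ez (s, a)) 0"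
  using Phi_explicit[of "zz (s, a) 0"] zero_lt_dl2 bidisc_unstable[OF assms] by simp_all

lemma E_unstable: "E (zz (s, a) 0) = P (of_real dl * ez (0, a)) 0"
  by (simp add: E_def)

text \<open>On the unstable disc backward time shrinks |u|. If the orbit came back to a point with 0
  < |u| < \<open>dl\<close>, some further time r > 0 would lead to the circle |u| =
  \<open>dl\<close>; going back from there for the total time gives |u| = \<open>dl\<close> exp (-
  (s + r)), but the orbit started with |u| = \<open>dl\<close>.\<close>

lemma no_return:
  assumes f: "flows (P (of_real dl * ez (0, a)) 0) s (P u 0)" and s: "s \<ge> 0" and u: "u \<noteq> 0" "norm u < dl"
  shows False
proof -
  define r where "r = ln (dl / norm u)"
  have r: "r > 0" "exp r = dl / norm u" using u dl(1) by (simp_all add: r_def)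
  have "of_real (exp r) * u = of_real dl * ez (0, Arg u)"
  proof -
    have "ez (0, Arg u) = sgn u"
      using u(1) by (simp add: ez_def cis_Arg[symmetric] cis_conv_exp Complex_eq mult.commute)
    then have u': "of_real (norm u) * ez (0, Arg u) = u"
      using u(1) by (simp add: sgn_div_norm scaleR_conv_of_real)
    have "of_real (exp r) * (of_real (norm u) * ez (0, Arg u)) = of_real (exp r * norm u) * ez (0, Arg u)"
      by simp
    then show ?thesis using u(1) unfolding u' r(2) by simp
  qed
  moreover have b: "bidisc u 0" "bidisc (of_real dl * ez (0, b)) 0" for b
    using u dl(1) by (simp_all add: bidisc_def norm_mult)
  ultimately have "flows (P u 0) r (P (of_real dl * ez (0, Arg u)) 0)"
    using flows_P[of u 0 r] u(1) by simp
  from flows_sym[OF flows_trans[OF f this]]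
  have 1: "flows (P (of_real dl * ez (0, Arg u)) 0) (- (s + r)) (P (of_real dl * ez (0, a)) 0)" .
  have "flows (E (zz (- (s + r), Arg u) 0)) (- (s + r)) (Phi (zz (- (s + r), Arg u) 0))"
    using Phi_flows[OF Phi_unstable(1)[of "- (s + r)" "Arg u"]] s r(1) by simp
  then have 2: "flows (P (of_real dl * ez (0, Arg u)) 0) (- (s + r)) (P (of_real dl * ez (- (s + r), Arg u)) 0)"
    using Phi_unstable(2)[of "- (s + r)" "Arg u"] s r(1) by (simp add: E_unstable)
  have "bidisc (of_real dl * ez (- (s + r), Arg u)) 0" using s r(1) by (intro bidisc_unstable) simp
  then have "of_real dl * ez (0, a) = of_real dl * ez (- (s + r), Arg u)"
    using flows_unique[OF 1 2] P_inj b(2) by blast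
  then have "norm (ez (0, a)) = norm (ez (- (s + r), Arg u))" using dl(1) by simp
  then show False using s r(1) by simp
qed

text \<open>Over w = 0 one of u and v vanishes. Both cannot, because orbit points are regular and m
  is not; the unstable disc is excluded by \<open>no_return\<close>. Only the stable disc is
  left.\<close>

lemma Phi_in_B:
  assumes z: "zz (s, a) 0 \<in> dom" "s \<ge> 0" "Phi (zz (s, a) 0) \<in> B"
  obtains v where "v \<noteq> 0" "norm v < dl" "Phi (zz (s, a) 0) = P 0 v"
proof -
  obtain u v where uv: "Phi (zz (s, a) 0) = P u v" "norm u < dl" "norm v < dl" "bidisc u v"
    using B_bidisc[OF z(3)] by blast
  have "cnj u * v = 0" using J_Phi[OF z(1)] J_P[OF uv(4)] uv(1) by (simp add: complex_eq_iff)
  moreover have "P u v \<noteq> P 0 0" using Phi_regular[OF z(1)] m_not_regular P_0 uv(1) by auto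
  moreover have "\<not> (v = 0 \<and> u \<noteq> 0)"
    using no_return[of a s u] Phi_flows[OF z(1)] uv z(2) by (auto simp: E_unstable)
  ultimately have "u = 0" "v \<noteq> 0" by auto
  then show thesis using that uv by blast
qed

lemma Phi_stable:
  assumes z: "zz (s, a) 0 \<in> dom" "Phi (zz (s, a) 0) = P 0 v" and v: "v \<noteq> 0" "norm v \<le> 2 * dl" "norm (of_real (exp (- r)) * v) \<le> 2 * dl"
  shows "zz (s + r, a) 0 \<in> dom" "Phi (zz (s + r, a) 0) = P 0 (of_real (exp (- r)) * v)"
proof -
  have "bidisc 0 v" "bidisc (of_real (exp r) * 0) (of_real (exp (- r)) * v)"
    using v(2,3) dl(1) by (simp_all add: bidisc_def)
  from flows_P[OF _ this] v(1) have "flows (P 0 v) r (P 0 (of_real (exp (- r)) * v))" by simp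
  from flows_trans[OF Phi_flows[OF z(1), unfolded z(2)] this]
  have f: "flows (E (zz (s + r, a) 0)) (zz (s + r, a) 0 $ 1) (P 0 (of_real (exp (- r)) * v))"
    by (simp add: E_unstable)
  have w: "norm (wz (zz (s + r, a) 0)) < dl\<^sup>2" using zero_lt_dl2 by simp
  show "zz (s + r, a) 0 \<in> dom" "Phi (zz (s + r, a) 0) = P 0 (of_real (exp (- r)) * v)" using PhiI[OF w f] .
qed

lemma dom_between: "zz (s, a) w \<in> dom \<Longrightarrow> r \<in> closed_segment 0 s \<Longrightarrow> zz (r, a) w \<in> dom"
  using flows_between[OF Phi_flows, of "zz (s, a) w" r] unfolding dom_def by (auto simp: E_def)

text \<open>For negative times the unstable disc suffices. If the forward times had a finite
  supremum T, the orbit would have a cluster point in the singular fibre as time tends to T. At m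
  the orbit has entered the stable disc and continues forever; at a regular point a flow chart of
  fixed size carries it beyond T.\<close>

lemma complete_K: "zz t 0 \<in> dom"
proof -
  have "zz (s, a) 0 \<in> dom" for s a
  proof (rule ccontr)
    assume n: "zz (s, a) 0 \<notin> dom"
    define S where "S = {r. 0 \<le> r \<and> zz (r, a) 0 \<in> dom}"
    have s0: "s > 0" using n Phi_unstable(1)[of s a] by force
    have lt: "r < s" if "r \<in> S" for r
    proof (rule ccontr)
      assume "\<not> r < s"
      then have "s \<in> closed_segment 0 r" using s0 by (simp add: closed_segment_eq_real_ivl)
      then show False using dom_between[of r a 0 s] that n by (simp add: S_def)
    qed
    have "0 \<in> S" using Phi_unstable(1)[of 0 a] by (simp add: S_def)
    have bdd: "bdd_above S" using lt by (intro bdd_aboveI[of _ s]) (auto simp: less_imp_le)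
    define T where "T = Sup S"
    have T: "r \<le> T" if "r \<in> S" for r unfolding T_def using cSup_upper[OF that bdd] .
    have T0: "T > 0"
    proof -
      have "zz (ln 2 / 2, a) 0 \<in> near" using zero_lt_dl2 by (simp add: near_def)
      then have "ln 2 / 2 \<in> S" using near_dom(1) by (simp add: S_def)
      then have "ln 2 / 2 \<le> T" by (rule T)
      then show ?thesis by (smt (verit) divide_pos_pos ln_gt_zero)
    qed
    have below: "r \<in> S" if r: "0 \<le> r" "r < T" for r
    proof -
      obtain r' where r': "r' \<in> S" "r < r'" using r(2) \<open>0 \<in> S\<close> unfolding T_def by (metis empty_iff less_cSupE)
      then have "r \<in> closed_segment 0 r'" using r(1) by (simp add: closed_segment_eq_real_ivl)
      then show ?thesis using dom_between[of r' a 0 r] r'(1) r(1) by (simp add: S_def)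
    qed
    have evl: "eventually (\<lambda>r. max 0 (T - e) < r \<and> r < T) (at_left T)" if "e > 0" for e
      using eventually_at_left_real[of "max 0 (T - e)" T] T0 that by (auto elim: eventually_mono)
    have evS: "eventually (\<lambda>r. r \<in> S) (at_left T)"
      by (rule eventually_mono[OF evl[OF zero_less_one]]) (use below in auto)
    have "eventually (\<lambda>r. Phi (zz (r, a) 0) \<in> K) (at_left T)"
      using evS by (rule eventually_mono) (use Phi_in_K in \<open>auto simp: S_def\<close>)
    from accumulation[OF trivial_limit_at_left_real this]
    obtain q where q: "q \<in> K" "\<And>W. open W \<Longrightarrow> q \<in> W \<Longrightarrow> \<exists>\<^sub>F r in at_left T. Phi (zz (r, a) 0) \<in> W" by blast
    show False
    proof (cases "q = m")
      case True
      have "\<exists>\<^sub>F r in at_left T. Phi (zz (r, a) 0) \<in> B" using q(2)[OF open_B] m_B True by simp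
      from frequently_ex[OF frequently_eventually_frequently[OF this evS]]
      obtain r where r: "r \<in> S" "Phi (zz (r, a) 0) \<in> B" by blast
      obtain v where v: "v \<noteq> 0" "norm v < dl" "Phi (zz (r, a) 0) = P 0 v"
        using Phi_in_B[of r a] r by (auto simp: S_def)
      have "norm (of_real (exp (- (s - r))) * v) \<le> 1 * dl"
        unfolding norm_mult using lt[OF r(1)] v(2) by (intro mult_mono) auto
      then have "zz (r + (s - r), a) 0 \<in> dom"
        using r(1) v dl(1) by (intro Phi_stable(1)[of r a v "s - r"]) (auto simp: S_def)
      then show False using n by simp
    next
      case False
      obtain d where d: "flow_chart d" "q \<in> fst d"
        using ex_flow_chart[OF K_J(1)[OF q(1)] regular_K[OF q(1) False]] by blast
      note dA = flow_chartD(2)[OF d(1)]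
      obtain \<rho> where \<rho>: "\<rho> > 0" "ball (snd d q) \<rho> \<subseteq> snd d ` fst d"
        using chartD(2)[OF dA] d(2) open_contains_ball by (metis image_eqI)
      define W where "W = {p \<in> fst d. snd d p \<in> ball (snd d q) (\<rho> / 2)}"
      have "\<exists>\<^sub>F r in at_left T. Phi (zz (r, a) 0) \<in> W"
      proof (rule q(2))
        show "open W" unfolding W_def by (rule chart_open_preimage[OF is_chart[OF dA] open_ball])
        show "q \<in> W" using d(2) \<rho>(1) by (simp add: W_def)
      qed
      moreover have "eventually (\<lambda>r. max 0 (T - \<rho> / 4) < r \<and> r < T) (at_left T)" using evl \<rho>(1) by simp
      ultimately have "\<exists>\<^sub>F r in at_left T. Phi (zz (r, a) 0) \<in> W \<and> max 0 (T - \<rho> / 4) < r \<and> r < T"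
        by (rule frequently_eventually_frequently)
      then obtain r where r: "Phi (zz (r, a) 0) \<in> W" "max 0 (T - \<rho> / 4) < r" "r < T"
        using frequently_ex by blast
      have rS: "r \<in> S" using below r by auto
      have "ball (snd d (Phi (zz (r, a) 0))) (\<rho> / 2) \<subseteq> snd d ` fst d"
      proof
        fix x assume "x \<in> ball (snd d (Phi (zz (r, a) 0))) (\<rho> / 2)"
        then have "x \<in> ball (snd d q) \<rho>"
          using r(1) dist_triangle[of "snd d q" x "snd d (Phi (zz (r, a) 0))"] by (simp add: W_def)
        then show "x \<in> snd d ` fst d" using \<rho>(2) by blast
      qed
      \<comment> \<open>The extension time \<rho> / 3 fits into the ball of radius \<rho> / 2 that
        remains around the orbit point, and it exceeds the distance to T, which is less than \<rho>
        / 4.\<close>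
      moreover have "\<bar>\<rho> / 3\<bar> < \<rho> / 2" using \<rho>(1) by simp
      ultimately obtain p where p: "flows (Phi (zz (r, a) 0)) (\<rho> / 3) p"
        using flow_chart_flows[OF d(1)] r(1) unfolding W_def by blast
      have "zz (r, a) 0 \<in> dom" using rS by (simp add: S_def)
      from flows_trans[OF Phi_flows[OF this] p]
      have "zz (r + \<rho> / 3, a) 0 \<in> dom" using zero_lt_dl2 by (auto simp: dom_def E_unstable)
      then have "r + \<rho> / 3 \<in> S" using r(2) \<rho>(1) by (simp add: S_def)
      then have "r + \<rho> / 3 \<le> T" by (rule T)
      then show False using r(2) \<rho>(1) by simp
    qed
  qed
  then show ?thesis by (metis surj_pair)
qed

lemma Phi_translate:
  assumes dom: "\<And>r. zz r w \<in> dom" and eq: "Phi (zz s w) = Phi (zz t w)"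
  shows "Phi (zz (s + r) w) = Phi (zz (t + r) w)"
proof -
  have 1: "orbit_map l2 (\<lambda>t. Phi (zz t w)) UNIV" by (rule Phi_orbit_map) (rule dom)
  have "Phi (zz (s + r) w) = Phi (zz (t + r) w)"
    by (rule orbit_map_unique[OF tangential_l2 orbit_map_shift'[OF 1, of UNIV s] orbit_map_shift'[OF 1, of UNIV t]
        connected_UNIV UNIV_I, of 0]) (use eq in auto)
  then show ?thesis .
qed

text \<open>The unstable manifold of \<open>m\<close> returns along the stable manifold: otherwise the orbit would
  accumulate at a regular point of the singular fibre and hence be periodic.\<close>

lemma ex_return: "\<exists>s v. norm v = dl \<and> Phi (zz (s, 0) 0) = P 0 v"
proof -
  have "eventually (\<lambda>s. Phi (zz (s, 0) 0) \<in> K) (at_top :: real filter)"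
    using Phi_in_K[OF complete_K] by simp
  from accumulation[OF trivial_limit_at_top_linorder this]
  obtain q where q: "q \<in> K" "\<And>W. open W \<Longrightarrow> q \<in> W \<Longrightarrow> \<exists>\<^sub>F r in at_top. Phi (zz (r, 0) 0) \<in> W" by blast
  have pick: "\<exists>r\<ge>r0. Phi (zz (r, 0) 0) \<in> W" if "open W" "q \<in> W" for W r0
    using frequently_ex[OF frequently_eventually_frequently[OF q(2)[OF that] eventually_ge_at_top[of r0]]] by blast
  show ?thesis
  proof (cases "q = m")
    case True
    obtain r where r: "r \<ge> 0" "Phi (zz (r, 0) 0) \<in> B" using pick[OF open_B, of 0] m_B True by auto
    obtain v where v: "v \<noteq> 0" "norm v < dl" "Phi (zz (r, 0) 0) = P 0 v"
      using Phi_in_B[OF complete_K r] by blast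
    let ?r = "- ln (dl / norm v)"
    have e: "exp (- ?r) = dl / norm v" using v dl(1) by simp
    have n: "norm (of_real (exp (- ?r)) * v) = dl" 
    proof -
      have "norm (of_real (exp (- ?r)) * v) = exp (- ?r) * norm v"
        by (simp only: norm_mult norm_of_real abs_exp_cancel)
      then show ?thesis unfolding e using v(1) by simp
    qed
    have "Phi (zz (r + ?r, 0) 0) = P 0 (of_real (exp (- ?r)) * v)"
      by (rule Phi_stable(2)[OF complete_K v(3,1)]) (use v(2) dl(1) n in linarith)+
    then show ?thesis using n by blast
  next
    case False
    obtain d where d: "flow_chart d" "q \<in> fst d"
      using ex_flow_chart[OF K_J(1)[OF q(1)] regular_K[OF q(1) False]] by blast
    note dA = flow_chartD(2)[OF d(1)]
    define W where "W = {p \<in> fst d. snd d p \<in> ball (snd d q) 1}"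
    have W: "open W" "q \<in> W"
      unfolding W_def using chart_open_preimage[OF is_chart[OF dA] open_ball] d(2) by auto
    obtain r1 where r1: "Phi (zz (r1, 0) 0) \<in> W" using pick[OF W] by blast
    \<comment> \<open>The gap of 3 in time cannot be compensated by chart coordinates, which differ
      by less than 2 inside \<open>W\<close>. The coincidence found below is therefore not the
      trivial one.\<close>
    obtain r2 where r2: "r2 \<ge> r1 + 3" "Phi (zz (r2, 0) 0) \<in> W" using pick[OF W] by blast
    let ?x1 = "snd d (Phi (zz (r1, 0) 0))" and ?x2 = "snd d (Phi (zz (r2, 0) 0))"
    define b where "b = ?x2 $ 2 - ?x1 $ 2"
    have 1: "orbit_map l2 (\<lambda>t. Phi (zz t 0)) UNIV" by (rule Phi_orbit_map) (rule complete_K)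
    have eq: "Phi (zz (r2, 0) 0) = Phi (zz ((r1, 0) + (?x2 $ 1 - ?x1 $ 1, b)) 0)"
      unfolding b_def
      by (rule orbit_meets_chart[OF 1 d(1)]) (use r1 r2 J_Phi[OF complete_K] in \<open>auto simp: W_def\<close>)
    have "dist ?x1 ?x2 < 2"
      using r1 r2(2) dist_triangle[of ?x1 ?x2 "snd d q"] by (simp add: W_def dist_commute)
    then have "\<bar>(?x2 - ?x1) $ 1\<bar> < 2"
      using component_le_norm_cart[of "?x2 - ?x1" 1] by (simp add: dist_norm norm_minus_commute)
    then have s: "r1 + (?x2 $ 1 - ?x1 $ 1) - r2 < 0" using r2(1) by simp
    let ?s = "r1 + (?x2 $ 1 - ?x1 $ 1) - r2"
    \<comment> \<open>After translation by - r2 the starting point coincides with a point at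
      negative time. Both lie on the unstable disc, where the moduli of u tell them apart.\<close>
    have "Phi (zz ((r2, 0) + (- r2, 0)) 0) = Phi (zz ((r1, 0) + (?x2 $ 1 - ?x1 $ 1, b) + (- r2, 0)) 0)"
      by (rule Phi_translate[OF complete_K eq])
    then have "Phi (zz (0, 0) 0) = Phi (zz (?s, b) 0)" by (simp add: plus_prod_def)
    then have "P (of_real dl * ez (0, 0)) 0 = P (of_real dl * ez (?s, b)) 0"
      using Phi_unstable(2)[of 0 0] Phi_unstable(2)[of ?s b] s by simp
    moreover have "bidisc (of_real dl * ez (?s, b)) 0" "bidisc (of_real dl * ez (0, 0)) 0"
      using s by (intro bidisc_unstable; simp)+
    ultimately have "of_real dl * ez (0, 0) = of_real dl * ez (?s, b)" using P_inj by blast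
    then have "norm (ez (0, 0)) = norm (ez (?s, b))" using dl(1) by simp
    then show ?thesis using s by simp
  qed
qed

end

section \<open>The period lattice\<close>

lemma norm_zz_diff: "dist (zz t w) (zz t w') = dist w w'"
proof -
  have "zz t w - zz t w' = fst (w - w') *\<^sub>R axis 3 1 + snd (w - w') *\<^sub>R axis 4 1"
    by (simp add: zz_def algebra_simps)
  then have "(dist (zz t w) (zz t w'))\<^sup>2 = (fst (w - w'))\<^sup>2 + (snd (w - w'))\<^sup>2"
    by (simp add: dist_norm power2_norm_eq_inner[of "_ :: real^4"] inner_vec_def sum_4 axis_def) (simp add: power2_eq_square)
  also have "\<dots> = (dist w w')\<^sup>2"
    by (cases "w - w'") (simp add: dist_norm norm_Pair)
  finally show ?thesis by simp
qed

lemma frac_reduce: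
  assumes "(a::real) > 0"
  obtains n :: int where "0 \<le> x - of_int n * a" "x - of_int n * a < a"
proof -
  have 1: "of_int \<lfloor>x / a\<rfloor> \<le> x / a" and 2: "x / a < of_int \<lfloor>x / a\<rfloor> + 1" by linarith+
  have "of_int \<lfloor>x / a\<rfloor> * a \<le> x" using 1 unfolding pos_le_divide_eq[OF assms] .
  moreover have "x < (of_int \<lfloor>x / a\<rfloor> + 1) * a" using 2 unfolding pos_divide_less_eq[OF assms] .
  ultimately show thesis using that[of "\<lfloor>x / a\<rfloor>"] by (simp add: algebra_simps)
qed

context focus_focus_system
begin

lemma ez_add: "ez (s + t) = ez s * ez t" "ez' (s + t) = ez' s * ez' t"
proof -
  have "Complex (fst (s + t)) (snd (s + t)) = Complex (fst s) (snd s) + Complex (fst t) (snd t)"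
    "Complex (- fst (s + t)) (snd (s + t)) = Complex (- fst s) (snd s) + Complex (- fst t) (snd t)"
    by (simp_all add: complex_eq_iff)
  then show "ez (s + t) = ez s * ez t" "ez' (s + t) = ez' s * ez' t"
    by (simp_all only: ez_def ez'_def exp_add)
qed

lemma ez_eq_1_iff: "ez t = 1 \<longleftrightarrow> fst t = 0 \<and> (\<exists>k::int. snd t = 2 * pi * of_int k)"
  unfolding ez_def exp_eq_1 by (auto simp: algebra_simps)

lemma ez'_eq: "fst t = 0 \<Longrightarrow> ez' t = ez t" by (simp add: ez_def ez'_def)

lemma E_periodic: "E (zz (s, a + 2 * pi * of_int k) w) = E (zz (s', a) w)"
proof -
  have e: "ez (0, 2 * pi * of_int k) = 1" by (simp add: ez_eq_1_iff)
  have "ez (0, a + 2 * pi * of_int k) = ez (0, a)" "ez' (0, a + 2 * pi * of_int k) = ez' (0, a)"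
    using ez_add[of "(0, a)" "(0, 2 * pi * of_int k)"] e ez'_eq[of "(0, 2 * pi * of_int k)"] by simp_all
  then show ?thesis by (simp add: E_def)
qed

lemma Phi_periodic: "Phi (zz (s, a + 2 * pi * of_int k) w) = Phi (zz (s, a) w)"
  "zz (s, a + 2 * pi * of_int k) w \<in> dom \<longleftrightarrow> zz (s, a) w \<in> dom"
  using E_periodic[of s a k w s] by (simp_all add: Phi_def dom_def)

text \<open>The time at which the unstable orbit of angle 0 meets the circle |v| = \<open>dl\<close>
  of the stable disc, and the point \<open>v0\<close> where it does so. Other angles arise by
  rotation.\<close>

definition t0 :: real where "t0 = (SOME s. \<exists>v. norm v = dl \<and> Phi (zz (s, 0) 0) = P 0 v)"
definition v0 :: complex where "v0 = (SOME v. norm v = dl \<and> Phi (zz (t0, 0) 0) = P 0 v)"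

lemma v0: "norm v0 = dl" "Phi (zz (t0, 0) 0) = P 0 v0"
proof -
  have "\<exists>v. norm v = dl \<and> Phi (zz (t0, 0) 0) = P 0 v"
    unfolding t0_def by (rule someI_ex[OF ex_return])
  from someI_ex[OF this] show "norm v0 = dl" "Phi (zz (t0, 0) 0) = P 0 v0" unfolding v0_def by blast+
qed

lemma t0_pos: "t0 > 0"
proof (rule ccontr)
  assume n: "\<not> t0 > 0"
  then have "P (of_real dl * ez (t0, 0)) 0 = P 0 v0" using Phi_unstable(2)[of t0 0] v0(2) by simp
  moreover have "bidisc (of_real dl * ez (t0, 0)) 0" using n by (intro bidisc_unstable) simp
  moreover have "bidisc 0 v0" using v0(1) dl(1) by (simp add: bidisc_def)
  ultimately have "of_real dl * ez (t0, 0) = 0" using P_inj by blast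
  then show False using dl(1) by simp
qed

definition B2 :: "'m set" where
  "B2 = {p \<in> fst c0. \<exists>u v. snd c0 p = pt u v \<and> norm u < 2 * dl \<and> norm v < 2 * dl \<and> dl / 2 < norm v}"

lemma open_B2: "open B2"
proof -
  have bu: "bounded_linear (\<lambda>x::real^4. of_real (x$1) + \<i> * of_real (x$2))"
    "bounded_linear (\<lambda>x::real^4. of_real (x$3) + \<i> * of_real (x$4))"
    by (intro bounded_linear_add bounded_linear_const_mult bounded_linear_compose[OF bounded_linear_of_real]
        bounded_linear_vec_nth)+
  have "open {x::real^4. norm (of_real (x$1) + \<i> * of_real (x$2)) < 2 * dl \<and>
      norm (of_real (x$3) + \<i> * of_real (x$4)) < 2 * dl \<and> dl / 2 < norm (of_real (x$3) + \<i> * of_real (x$4))}"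
    (is "open ?X")
    by (intro open_Collect_conj open_Collect_less continuous_intros linear_continuous_on bu)
  from chart_open_preimage[OF is_chart[OF c0A] this] have "open {p \<in> fst c0. snd c0 p \<in> ?X}" .
  moreover have "{p \<in> fst c0. snd c0 p \<in> ?X} = B2"
  proof -
    have "x \<in> ?X \<longleftrightarrow> (\<exists>u v. x = pt u v \<and> norm u < 2 * dl \<and> norm v < 2 * dl \<and> dl / 2 < norm v)" for x
    proof -
      obtain u v where x: "x = pt u v" using pt_surj by blast
      have "of_real (x$1) + \<i> * of_real (x$2) = u" "of_real (x$3) + \<i> * of_real (x$4) = v"
        unfolding x by (simp_all add: complex_eq_iff)
      then show ?thesis using x by auto
    qed
    then show ?thesis unfolding B2_def by simp
  qed
  ultimately show "open B2" by simp
qed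

lemma B2_bidisc:
  assumes "p \<in> B2"
  obtains u v where "p = P u v" "norm u < 2 * dl" "norm v < 2 * dl" "dl / 2 < norm v" "bidisc u v"
proof -
  obtain u v where uv: "p \<in> fst c0" "snd c0 p = pt u v" "norm u < 2 * dl" "norm v < 2 * dl" "dl / 2 < norm v"
    using assms unfolding B2_def by blast
  have "P u v = p" unfolding P_def uv(2)[symmetric] by (rule inv_into_f_f[OF chartD(3)[OF c0A] uv(1)])
  moreover have "bidisc u v" using uv(3,4) by (simp add: bidisc_def)
  ultimately show thesis using that uv(3-5) by blast
qed

text \<open>Translation by - s would identify two points of the unstable disc with |u| equal to
  \<open>dl\<close> and to \<open>dl\<close> exp (- s).\<close>

lemma not_recurrent_K:
  assumes "s > 0"
  shows "Phi (zz (s, a) 0) \<noteq> Phi (zz (0, 0) 0)"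
proof
  assume "Phi (zz (s, a) 0) = Phi (zz (0, 0) 0)"
  from Phi_translate[OF complete_K this, of "(- s, 0)"]
  have "Phi (zz (0, a) 0) = Phi (zz (- s, 0) 0)" by (simp add: plus_prod_def)
  then have "P (of_real dl * ez (0, a)) 0 = P (of_real dl * ez (- s, 0)) 0"
    using Phi_unstable(2)[of 0 a] Phi_unstable(2)[of "- s" 0] assms by simp
  moreover have "bidisc (of_real dl * ez (0, a)) 0" "bidisc (of_real dl * ez (- s, 0)) 0"
    using assms by (intro bidisc_unstable; simp)+
  ultimately have "of_real dl * ez (0, a) = of_real dl * ez (- s, 0)" using P_inj by blast
  then have "norm (ez (0, a)) = norm (ez (- s, 0))" using dl(1) by simp
  then show False using assms by simp
qed

text \<open>Everything that is used about the passage outside the Eliasson chart holds near the singular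
  fibre, by compactness of \<open>[0, t\<^sub>0] \<times> [0, 2\<pi>]\<close>.\<close>

lemma compact_strip: "compact ((\<lambda>t. zz t 0) ` ({a..b} \<times> {c..d}))"
proof (rule compact_continuous_image)
  have "bounded_linear (\<lambda>t. zz (fst (t, 0::real \<times> real)) (snd (t, 0::real \<times> real)))"
    by (rule bounded_linear_compose[OF bounded_linear_zz, of "\<lambda>t. (t, 0)"])
      (intro bounded_linear_Pair bounded_linear_ident bounded_linear_zero)
  then show "continuous_on ({a..b} \<times> {c..d}) (\<lambda>t. zz t 0)" using linear_continuous_on by simp
qed (intro compact_Times compact_Icc)

lemma strip_near:
  assumes "open X" "\<And>s a. s \<in> {s1..s2} \<Longrightarrow> zz (s, a) 0 \<in> X"
  obtains e where "e > 0" "\<And>s a w. s \<in> {s1..s2} \<Longrightarrow> a \<in> {0..2 * pi} \<Longrightarrow> norm (w :: real \<times> real) < e \<Longrightarrow> zz (s, a) w \<in> X"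
proof -
  have "(\<lambda>t. zz t 0) ` ({s1..s2} \<times> {0..2 * pi}) \<subseteq> X" using assms(2) by auto
  from compact_subset_open_imp_ball_epsilon_subset[OF compact_strip assms(1) this]
  obtain e where e: "e > 0" "(\<Union>x\<in>(\<lambda>t. zz t 0) ` ({s1..s2} \<times> {0..2 * pi}). ball x e) \<subseteq> X" by blast
  show thesis
  proof (rule that[OF e(1)])
    fix s a and w :: "real \<times> real" assume sa: "s \<in> {s1..s2}" "a \<in> {0..2 * pi}" and w: "norm w < e"
    have "zz (s, a) w \<in> ball (zz (s, a) 0) e" using w by (simp add: norm_zz_diff)
    then show "zz (s, a) w \<in> X" using e(2) sa by blast
  qed
qed

lemma reduce_angle: obtains k :: int where "0 \<le> a - 2 * pi * of_int k" "a - 2 * pi * of_int k \<le> 2 * pi"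
  using frac_reduce[of "2 * pi" a] by (metis less_imp_le mult.commute pi_gt_zero zero_less_mult_iff zero_less_numeral)

text \<open>The time range starts at ln 2 / 2 because recurrence before ln 2 is settled by the
  explicit flow, with an overlap. The bound \<open>dl\<close>^2 / 2 together with |v| >
  \<open>dl\<close> / 2 on \<open>B2\<close> makes the passage time through the bidisc
  positive.\<close>

definition small :: "real \<Rightarrow> bool" where
  "small e \<longleftrightarrow> e > 0 \<and> e < dl\<^sup>2 / 2 \<and>
     (\<forall>s\<in>{- 1..t0 + 1}. \<forall>a w. norm w < e \<longrightarrow> zz (s, a) w \<in> dom) \<and>
     (\<forall>w. norm w < e \<longrightarrow> Phi (zz (t0, 0) w) \<in> B2) \<and>
     (\<forall>s\<in>{ln 2 / 2..t0}. \<forall>a w. norm w < e \<longrightarrow> Phi (zz (s, a) w) \<noteq> Phi (zz (0, 0) w))"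

lemma ex_small: "\<exists>e. small e"
proof -
  have per: "zz (s, a - 2 * pi * of_int k) w \<in> dom \<longleftrightarrow> zz (s, a) w \<in> dom"
    "Phi (zz (s, a - 2 * pi * of_int k) w) = Phi (zz (s, a) w)" for s a k w
    using Phi_periodic(2)[of s "a - 2 * pi * of_int k" k w] Phi_periodic(1)[of s "a - 2 * pi * of_int k" k w] by simp_all
  obtain e1 where e1: "e1 > 0" "\<And>s a w. s \<in> {- 1..t0 + 1} \<Longrightarrow> a \<in> {0..2 * pi} \<Longrightarrow> norm w < e1 \<Longrightarrow> zz (s, a) w \<in> dom"
    using strip_near[OF open_dom complete_K] by blast
  have 1: "zz (s, a) w \<in> dom" if "s \<in> {- 1..t0 + 1}" "norm w < e1" for s a w
  proof -
    obtain k :: int where "0 \<le> a - 2 * pi * of_int k" "a - 2 * pi * of_int k \<le> 2 * pi" using reduce_angle by blast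
    then show ?thesis using e1(2)[OF that(1) _ that(2), of "a - 2 * pi * of_int k"] per(1) by simp
  qed
  have oB: "open (dom \<inter> Phi -` B2)" by (rule continuous_open_preimage[OF continuous_Phi open_dom open_B2])
  have "P 0 v0 \<in> B2"
  proof -
    have "bidisc 0 v0" using v0(1) dl(1) by (simp add: bidisc_def)
    from P_chart[OF this] show ?thesis using v0(1) dl(1) unfolding B2_def by auto
  qed
  then have "zz (t0, 0) 0 \<in> dom \<inter> Phi -` B2" using v0(2) complete_K by simp
  then obtain e2 where e2: "e2 > 0" "ball (zz (t0, 0) 0) e2 \<subseteq> dom \<inter> Phi -` B2" using oB open_contains_ball by blast
  have 2: "Phi (zz (t0, 0) w) \<in> B2" if "norm w < e2" for w
  proof -
    have "zz (t0, 0) w \<in> ball (zz (t0, 0) 0) e2" using that by (simp add: norm_zz_diff)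
    then show ?thesis using e2(2) by blast
  qed
  define pr where "pr z = zz (0, 0) (z$3, z$4)" for z :: "real^4"
  \<comment> \<open>The set where the flow-out differs from its starting point over the same value.
    It is open because the diagonal of a Hausdorff space is closed, so compactness of the strip
    applies to it.\<close>
  define X where "X = (dom \<inter> pr -` dom) \<inter> (\<lambda>z. (Phi z, Phi (pr z))) -` (- {y. \<exists>x. y = (x, x)})"
  have cpr: "continuous_on UNIV pr"
    unfolding pr_def zz_def by (intro continuous_intros)
  have oD: "open (dom \<inter> pr -` dom)"
    using open_dom continuous_open_preimage[OF cpr open_UNIV open_dom] by auto
  have "continuous_on (dom \<inter> pr -` dom) (\<lambda>z. (Phi z, Phi (pr z)))"
    by (intro continuous_on_Pair continuous_on_subset[OF continuous_Phi]
        continuous_on_compose2[OF continuous_Phi continuous_on_subset[OF cpr]]) auto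
  then have "open X"
    unfolding X_def by (rule continuous_open_preimage[OF _ oD]) (rule open_Compl[OF closed_diagonal])
  moreover have "zz (s, a) 0 \<in> X" if "s \<in> {ln 2 / 2..t0}" for s a
  proof -
    have "ln 2 / 2 > (0::real)" by simp
    then have "s > 0" using that by (meson atLeastAtMost_iff less_le_trans)
    then show ?thesis using not_recurrent_K[of s a] complete_K by (simp add: X_def pr_def zero_prod_def)
  qed
  ultimately obtain e3 where e3: "e3 > 0" "\<And>s a w. s \<in> {ln 2 / 2..t0} \<Longrightarrow> a \<in> {0..2 * pi} \<Longrightarrow> norm w < e3 \<Longrightarrow> zz (s, a) w \<in> X"
    using strip_near by blast
  have 3: "Phi (zz (s, a) w) \<noteq> Phi (zz (0, 0) w)" if "s \<in> {ln 2 / 2..t0}" "norm w < e3" for s a w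
  proof -
    obtain k :: int where "0 \<le> a - 2 * pi * of_int k" "a - 2 * pi * of_int k \<le> 2 * pi" using reduce_angle by blast
    then have "zz (s, a - 2 * pi * of_int k) w \<in> X" using e3(2)[OF that(1) _ that(2)] by simp
    then show ?thesis using per(2)[of s a k w] by (auto simp: X_def pr_def)
  qed
  define e where "e = min (min e1 e2) (min e3 (dl\<^sup>2 / 4))"
  have "e > 0" "e \<le> e1" "e \<le> e2" "e \<le> e3" "e \<le> dl\<^sup>2 / 4"
    using e1(1) e2(1) e3(1) zero_lt_dl2 by (auto simp: e_def)
  moreover have "dl\<^sup>2 / 4 < dl\<^sup>2 / 2" using zero_lt_dl2 by simp
  ultimately have "small e" unfolding small_def
    using 1 2 3 by (intro conjI ballI allI impI) (assumption | linarith | force)+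
  then show ?thesis by blast
qed

definition eps :: real where "eps = (SOME e. small e)"

lemma eps: "eps > 0" "eps < dl\<^sup>2 / 2"
  "s \<in> {- 1..t0 + 1} \<Longrightarrow> norm w < eps \<Longrightarrow> zz (s, a) w \<in> dom"
  "norm w < eps \<Longrightarrow> Phi (zz (t0, 0) w) \<in> B2"
  "s \<in> {ln 2 / 2..t0} \<Longrightarrow> norm w < eps \<Longrightarrow> Phi (zz (s, a) w) \<noteq> Phi (zz (0, 0) w)"
proof -
  have "small eps" unfolding eps_def by (rule someI_ex[OF ex_small])
  then show "eps > 0" "eps < dl\<^sup>2 / 2" "s \<in> {- 1..t0 + 1} \<Longrightarrow> norm w < eps \<Longrightarrow> zz (s, a) w \<in> dom"
    "norm w < eps \<Longrightarrow> Phi (zz (t0, 0) w) \<in> B2"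
    "s \<in> {ln 2 / 2..t0} \<Longrightarrow> norm w < eps \<Longrightarrow> Phi (zz (s, a) w) \<noteq> Phi (zz (0, 0) w)"
    unfolding small_def by blast+
qed

lemma less_eps: "norm w < eps \<Longrightarrow> norm w < dl\<^sup>2" for w :: "real \<times> real"
  using eps(2) zero_lt_dl2 by linarith

text \<open>The v-coordinate b of the point where the flow-out re-enters the Eliasson chart at time
  \<open>t0\<close>. Conservation of the value forces its u-coordinate to be cnj (w / b).\<close>

definition bv :: "real \<times> real \<Rightarrow> complex" where
  "bv w = Complex (snd c0 (Phi (zz (t0, 0) w)) $ 3) (snd c0 (Phi (zz (t0, 0) w)) $ 4)"

lemma Phi_t0:
  assumes "norm w < eps"
  shows "bv w \<noteq> 0" "dl / 2 < norm (bv w)" "norm (bv w) < 2 * dl"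
    "bidisc (cnj (cw w / bv w)) (bv w)" "Phi (zz (t0, 0) w) = P (cnj (cw w / bv w)) (bv w)"
proof -
  have d: "zz (t0, 0) w \<in> dom" using eps(3)[of t0 w 0] t0_pos assms by simp
  obtain u v where uv: "Phi (zz (t0, 0) w) = P u v" "norm v < 2 * dl" "dl / 2 < norm v" "bidisc u v"
    using B2_bidisc[OF eps(4)[OF assms]] by metis
  have b: "bv w = v" unfolding bv_def uv(1) P_chart(2)[OF uv(4)] by (simp add: complex_eq_iff)
  then show nz: "bv w \<noteq> 0" and "dl / 2 < norm (bv w)" "norm (bv w) < 2 * dl" using uv dl(1) by auto
  have e: "(Re (cnj u * v), Im (cnj u * v)) = w" using J_Phi[OF d] unfolding uv(1) J_P[OF uv(4)] by simp
  have "cnj u * v = cw w" using arg_cong[OF e, of fst] arg_cong[OF e, of snd] by (simp add: complex_eq_iff)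
  then have "cnj (cw w / bv w) = u" using nz b by (metis complex_cnj_cnj nonzero_mult_div_cancel_right)
  then show "bidisc (cnj (cw w / bv w)) (bv w)" "Phi (zz (t0, 0) w) = P (cnj (cw w / bv w)) (bv w)"
    using uv b by simp_all
qed

lemma Phi_t0_angle:
  assumes w: "norm w < eps"
  shows "Phi (zz (t0, a) w) = P (ez (0, a) * cnj (cw w / bv w)) (ez' (0, a) * bv w)"
proof -
  let ?T = "{0} \<times> UNIV :: (real \<times> real) set"
  have T: "convex ?T" "connected ?T"
    by (intro convex_Times convex_singleton convex_UNIV, intro connected_Times connected_sing connected_UNIV)
  have b: "bidisc (ez t * cnj (cw w / bv w)) (ez' t * bv w)" if "t \<in> ?T" for t
    using Phi_t0(4)[OF w] that by (auto simp: bidisc_def norm_mult norm_divide)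
  have 1: "orbit_map l2 (\<lambda>t. P (ez t * cnj (cw w / bv w)) (ez' t * bv w)) ?T"
    by (rule orbit_map_P[OF _ T(1) b]) (use Phi_t0(1)[OF w] in auto)
  have "orbit_map l2 (\<lambda>t. Phi (zz t w)) ({t0} \<times> UNIV)"
    by (rule Phi_orbit_map) (use eps(3)[OF _ w, of t0] t0_pos in auto)
  then have 2: "orbit_map l2 (\<lambda>t. Phi (zz ((t0, 0) + t) w)) ?T" by (rule orbit_map_shift') auto
  have "Phi (zz ((t0, 0) + (0, a)) w) = P (ez (0, a) * cnj (cw w / bv w)) (ez' (0, a) * bv w)"
    by (rule orbit_map_unique[OF tangential_l2 2 1 T(2), of "(0, 0)"])
      (use Phi_t0(5)[OF w] in \<open>auto simp: plus_prod_def\<close>)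
  then show ?thesis by (simp add: plus_prod_def)
qed

text \<open>The passage time through the Eliasson chart from the section \<open>{(cnj (w/b), b)}\<close> back to
  \<open>{(\<delta>, w/\<delta>)}\<close> is the complex logarithm of \<open>qf w\<close>; this is where the logarithmic singularity of the
  periods comes from.\<close>

definition qf :: "real \<times> real \<Rightarrow> complex" where
  "qf w = of_real dl * cnj (bv w) / cnj (cw w)"

text \<open>A relation because the logarithm is multivalued: the first component is t0 + ln
  |\<open>qf w\<close>|, the second any argument of \<open>qf w\<close>. Single branches are chosen
  only locally, where smoothness is needed.\<close>

definition period :: "real \<times> real \<Rightarrow> real \<times> real \<Rightarrow> bool" where
  "period w \<tau> \<longleftrightarrow> ez (fst \<tau> - t0, snd \<tau>) = qf w"

lemma qf_norm:
  assumes "norm w < eps" "w \<noteq> 0"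
  shows "qf w \<noteq> 0" "norm (qf w) > 1" "norm (qf w) * norm (cw w / bv w) = dl" "qf w * cnj (cw w / bv w) = of_real dl"
proof -
  note b = Phi_t0(1,2)[OF assms(1)]
  have c: "cw w \<noteq> 0" using assms(2) by simp
  show "qf w \<noteq> 0" using b(1) c dl(1) by (simp add: qf_def)
  show e: "qf w * cnj (cw w / bv w) = of_real dl" using b(1) c by (simp add: qf_def field_simps)
  have "norm (qf w * cnj (cw w / bv w)) = dl" unfolding e using dl(1) by simp
  then show "norm (qf w) * norm (cw w / bv w) = dl" by (simp only: norm_mult complex_mod_cnj)
  have "norm (cw w) < dl * (dl / 2)" using assms(1) eps(2) by (simp add: norm_cw power2_eq_square)
  also have "\<dots> < dl * norm (bv w)" using b(2) dl(1) by (intro mult_strict_left_mono)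
  finally show "norm (qf w) > 1" using c dl(1) by (simp add: qf_def norm_divide norm_mult)
qed

lemma period_time:
  assumes "norm w < eps" "w \<noteq> 0" "period w \<tau>"
  shows "exp (fst \<tau> - t0) = norm (qf w)" "fst \<tau> > t0"
proof -
  show e: "exp (fst \<tau> - t0) = norm (qf w)"
    using arg_cong[OF assms(3)[unfolded period_def], of norm] by simp
  then have "exp (fst \<tau> - t0) > exp 0" using qf_norm(2)[OF assms(1,2)] by simp
  then show "fst \<tau> > t0" using exp_less_cancel by fastforce
qed

lemma ex_period: "norm w < eps \<Longrightarrow> w \<noteq> 0 \<Longrightarrow> \<exists>\<tau>. period w \<tau>"
proof -
  assume "norm w < eps" "w \<noteq> 0"
  then have "qf w \<noteq> 0" by (rule qf_norm(1))
  from exp_Ln[OF this] have "ez (Re (Ln (qf w)), Im (Ln (qf w))) = qf w"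
    by (simp only: ez_def fst_conv snd_conv complex.collapse)
  then have "period w (t0 + Re (Ln (qf w)), Im (Ln (qf w)))" by (simp only: period_def fst_conv snd_conv add_diff_cancel_left')
  then show ?thesis by blast
qed

text \<open>During the passage |u| grows from |w / b| to at most |\<open>qf w\<close>| |w / b| =
  \<open>dl\<close>, while |v| only decreases. The linear flow is thus valid for the whole
  passage.\<close>

lemma bidisc_passage:
  assumes w: "norm w < eps" "w \<noteq> 0" and r: "0 \<le> fst r" "exp (fst r) \<le> norm (qf w)"
  shows "bidisc (ez r * cnj (cw w / bv w)) (ez' r * bv w)"
proof -
  have "exp (fst r) * norm (cw w / bv w) \<le> norm (qf w) * norm (cw w / bv w)"
    using r(2) by (rule mult_right_mono) simp
  then have "exp (fst r) * norm (cw w / bv w) \<le> 2 * dl" using qf_norm(3)[OF w] dl(1) by linarith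
  moreover have "exp (- fst r) * norm (bv w) \<le> 1 * norm (bv w)" using r(1) by (intro mult_right_mono) auto
  then have "exp (- fst r) * norm (bv w) \<le> 2 * dl" using Phi_t0(3)[OF w(1)] by linarith
  ultimately show ?thesis
    by (simp only: bidisc_def norm_mult norm_ez complex_mod_cnj)
qed

lemma Phi_passage:
  assumes w: "norm w < eps" "w \<noteq> 0" and s: "0 \<le> s" "exp s \<le> norm (qf w)"
  shows "zz (t0 + s, a) w \<in> dom" "Phi (zz (t0 + s, a) w) = P (ez (s, a) * cnj (cw w / bv w)) (ez' (s, a) * bv w)"
proof -
  let ?u = "ez (0, a) * cnj (cw w / bv w)" and ?v = "ez' (0, a) * bv w"
  have d: "zz (t0, a) w \<in> dom" using eps(3)[of t0 w a] t0_pos w(1) by simp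
  have e: "of_real (exp s) * ?u = ez (s, a) * cnj (cw w / bv w)" "of_real (exp (- s)) * ?v = ez' (s, a) * bv w"
    using ez_shift(1)[of s 0 a] ez_shift(2)[of s 0 a] by (simp_all only: mult.assoc[symmetric] add_0)
  have b0: "bidisc ?u ?v" by (rule bidisc_passage[OF w]) (use qf_norm(2)[OF w] in simp_all)
  have b1: "bidisc (ez (s, a) * cnj (cw w / bv w)) (ez' (s, a) * bv w)" by (rule bidisc_passage[OF w]) (use s in simp_all)
  have nz: "?u \<noteq> 0 \<or> ?v \<noteq> 0" using Phi_t0(1)[OF w(1)] by simp
  have "flows (P ?u ?v) s (P (ez (s, a) * cnj (cw w / bv w)) (ez' (s, a) * bv w))"
    using flows_P[OF nz b0, of s] b1 unfolding e by blast
  from flows_trans[OF Phi_flows[OF d, unfolded Phi_t0_angle[OF w(1)]] this]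
  have f: "flows (E (zz (t0 + s, a) w)) (zz (t0 + s, a) w $ 1) (P (ez (s, a) * cnj (cw w / bv w)) (ez' (s, a) * bv w))"
    by (simp add: E_def)
  have wl: "norm (wz (zz (t0 + s, a) w)) < dl\<^sup>2"
    using less_eps[OF w(1)] by (simp add: norm_cw)
  show "zz (t0 + s, a) w \<in> dom" "Phi (zz (t0 + s, a) w) = P (ez (s, a) * cnj (cw w / bv w)) (ez' (s, a) * bv w)"
    using PhiI[OF wl f] .
qed

lemma ez'_eq_inverse: "ez' t = inverse (cnj (ez t))"
  using ez_mult[of t] by (metis inverse_unique)

text \<open>After the passage the u-coordinate is multiplied by \<open>qf w\<close>, which returns
  |u| to \<open>dl\<close> and leaves the angle a - \<tau>_2; the v-coordinate follows from the
  value. The return time is the same for every starting angle.\<close>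

lemma one_period:
  assumes w: "norm w < eps" "w \<noteq> 0" and \<tau>: "period w \<tau>"
  shows "zz (fst \<tau>, a) w \<in> dom" "Phi (zz (fst \<tau>, a) w) = E (zz (s, a - snd \<tau>) w)"
proof -
  let ?s = "fst \<tau> - t0"
  note e = period_time[OF w \<tau>]
  have s: "0 \<le> ?s" "exp ?s \<le> norm (qf w)" using e by simp_all
  show "zz (fst \<tau>, a) w \<in> dom" using Phi_passage(1)[OF w s, of a] by simp
  have "ez (?s, a) = ez (0, a - snd \<tau>) * ez (?s, snd \<tau>)" using ez_add(1)[of "(0, a - snd \<tau>)" "(?s, snd \<tau>)"] by simp
  also have "ez (?s, snd \<tau>) = qf w" using \<tau> by (simp add: period_def)
  finally have ez: "ez (?s, a) = ez (0, a - snd \<tau>) * qf w" .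
  have u: "ez (?s, a) * cnj (cw w / bv w) = of_real dl * ez (0, a - snd \<tau>)"
    unfolding ez mult.assoc qf_norm(4)[OF w] by (rule mult.commute)
  have "ez' (?s, a) * bv w = cw w / of_real dl * ez' (0, a - snd \<tau>)"
  proof -
    have "inverse (cnj (qf w)) * bv w = cw w / of_real dl"
      using Phi_t0(1)[OF w(1)] w(2) dl(1) by (simp add: qf_def field_simps)
    then show ?thesis unfolding ez'_eq_inverse ez by (simp add: mult.commute mult.left_commute)
  qed
  then show "Phi (zz (fst \<tau>, a) w) = E (zz (s, a - snd \<tau>) w)"
    using Phi_passage(2)[OF w s, of a] u by (simp add: E_def)
qed

text \<open>The return map to the section is a rotation by - \<tau>_2 with constant positive return
  time. Its iterates in both directions cover all times.\<close>

lemma complete: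
  assumes w: "norm w < eps"
  shows "zz t w \<in> dom"
proof (cases "w = 0")
  case True
  then show ?thesis using complete_K by simp
next
  case False
  obtain \<tau> where \<tau>: "period w \<tau>" using ex_period[OF w False] by blast
  let ?e = "\<lambda>a. E (zz (0, a) w)"
  have step: "flows (?e a) (fst \<tau>) (?e (a - snd \<tau>))" for a
    using Phi_flows[OF one_period(1)[OF w False \<tau>, of a]] one_period(2)[OF w False \<tau>, of a 0]
    by (simp add: E_def)
  have fwd: "flows (?e a) (of_nat n * fst \<tau>) (?e (a - of_nat n * snd \<tau>))" for n a
  proof (induction n)
    case 0
    have "zz (0, a) w \<in> dom" using eps(3)[OF _ w, of 0 a] t0_pos by simp
    from Phi_flows[OF this] show ?case
      using near_dom(2)[of "zz (0, a) w"] less_eps[OF w] by (simp add: near_def norm_cw E_def)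
  next
    case (Suc n)
    from flows_trans[OF Suc step] show ?case by (simp add: algebra_simps)
  qed
  have bwd: "flows (?e a) (- (of_nat n * fst \<tau>)) (?e (a + of_nat n * snd \<tau>))" for n a
    using flows_sym[OF fwd[of "a + of_nat n * snd \<tau>" n]] by simp
  have pos: "fst \<tau> > 0" using period_time(2)[OF w False \<tau>] t0_pos by simp
  have wl: "norm (wz (zz t w)) < dl\<^sup>2" using less_eps[OF w] by (simp add: norm_cw)
  obtain n :: nat where n: "\<bar>fst t\<bar> < of_nat n * fst \<tau>" using reals_Archimedean3[OF pos] by blast
  have "\<exists>q. flows (?e (snd t)) (fst t) q"
  proof (cases "fst t \<ge> 0")
    case True
    then have "fst t \<in> closed_segment 0 (of_nat n * fst \<tau>)" using n by (simp add: closed_segment_eq_real_ivl)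
    then show ?thesis using flows_between[OF fwd] by blast
  next
    case False
    then have "fst t \<in> closed_segment 0 (- (of_nat n * fst \<tau>))" using n by (simp add: closed_segment_eq_real_ivl)
    then show ?thesis using flows_between[OF bwd] by blast
  qed
  then show ?thesis using wl by (simp add: dom_def E_def)
qed

lemma Phi_0: "norm w < eps \<Longrightarrow> Phi (zz (0, a) w) = E (zz (s, a) w)"
  using near_dom(2)[of "zz (0, a) w"] less_eps[of w] by (simp add: near_def norm_cw E_def)

lemma Phi_period:
  assumes w: "norm w < eps" "w \<noteq> 0" and \<tau>: "period w \<tau>"
  shows "Phi (zz (\<tau> + t) w) = Phi (zz t w)"
proof -
  have "Phi (zz \<tau> w) = Phi (zz (0, 0) w)"
    using one_period(2)[OF w \<tau>, of "snd \<tau>" 0] Phi_0[OF w(1), of 0 0] by simp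
  from Phi_translate[OF complete[OF w(1)] this, of t] show ?thesis by (simp add: plus_prod_def)
qed

lemma Phi_lattice:
  assumes w: "norm w < eps" "w \<noteq> 0" and \<tau>: "period w \<tau>"
  shows "Phi (zz (of_int n *\<^sub>R \<tau> + (0, 2 * pi * of_int k) + t) w) = Phi (zz t w)"
proof -
  have 1: "Phi (zz (of_nat n *\<^sub>R \<tau> + t) w) = Phi (zz t w)" for n :: nat and t
  proof (induction n)
    case (Suc n)
    have "of_nat (Suc n) *\<^sub>R \<tau> + t = \<tau> + (of_nat n *\<^sub>R \<tau> + t)" by (simp add: algebra_simps)
    then show ?case by (simp only: Phi_period[OF w \<tau>] Suc)
  qed simp
  have 2: "Phi (zz (of_int n *\<^sub>R \<tau> + t) w) = Phi (zz t w)" for t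
  proof (cases "n \<ge> 0")
    case True
    then show ?thesis using 1[of "nat n" t] by simp
  next
    case False
    then have e: "of_nat (nat (- n)) *\<^sub>R \<tau> + (of_int n *\<^sub>R \<tau> + t) = t" by (simp add: algebra_simps)
    show ?thesis using 1[of "nat (- n)" "of_int n *\<^sub>R \<tau> + t"] unfolding e by (rule sym)
  qed
  have "Phi (zz ((0, 2 * pi * of_int k) + t) w) = Phi (zz t w)"
    using Phi_periodic(1)[of "fst t" "snd t" k w] by (simp add: plus_prod_def add.commute)
  then show ?thesis using 2[of "(0, 2 * pi * of_int k) + t"] by (simp add: add.assoc)
qed

text \<open>Multiples of \<tau> reduce the difference to a time in [0, \<tau>_1). Below ln 2 the
  explicit flow only allows a full rotation; up to \<open>t0\<close> recurrence was excluded by the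
  choice of \<open>eps\<close>; during the passage |u| is strictly smaller than
  \<open>dl\<close>.\<close>

lemma Phi_isotropy:
  assumes w: "norm w < eps" "w \<noteq> 0" and \<tau>: "period w \<tau>" and eq: "Phi (zz s w) = Phi (zz t w)"
  shows "\<exists>n k::int. s - t = of_int n *\<^sub>R \<tau> + (0, 2 * pi * of_int k)"
proof -
  have pos: "fst \<tau> > 0" using period_time(2)[OF w \<tau>] t0_pos by simp
  obtain n :: int where n: "0 \<le> fst (s - t) - of_int n * fst \<tau>" "fst (s - t) - of_int n * fst \<tau> < fst \<tau>"
    using frac_reduce[OF pos] by blast
  define d where "d = s - t - of_int n *\<^sub>R \<tau>"
  have dn: "0 \<le> fst d" "fst d < fst \<tau>" using n by (simp_all add: d_def)
  have "Phi (zz (s + - t) w) = Phi (zz (t + - t) w)" by (rule Phi_translate[OF complete[OF w(1)] eq])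
  then have "Phi (zz (s - t) w) = Phi (zz (0, 0) w)" by (simp add: zero_prod_def)
  moreover have "Phi (zz d w) = Phi (zz (s - t) w)"
    using Phi_lattice[OF w \<tau>, of n 0 d] by (simp add: d_def zero_prod_def[symmetric])
  ultimately have P0: "Phi (zz d w) = Phi (zz (0, 0) w)" by simp
  have E0: "Phi (zz (0, 0) w) = P (of_real dl) (cw w / of_real dl)" using Phi_0[OF w(1), of 0 0] by (simp add: E_def)
  have b0: "bidisc (of_real dl) (cw w / of_real dl)"
    using bidisc_near[of "zz (0, 0) w"] less_eps[OF w(1)] by (simp add: near_def norm_cw)
  have ln2: "ln 2 / 2 < ln (2::real)" by simp
  have "ez d = 1"
  proof (cases "fst d < ln 2")
    case True
    then have z: "zz d w \<in> near" using dn(1) less_eps[OF w(1)] by (simp add: near_def norm_cw)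
    have "P (of_real dl * ez d) (cw w / of_real dl * ez' d) = P (of_real dl) (cw w / of_real dl)"
      using near_dom(2)[OF z] P0 E0 by simp
    then have "of_real dl * ez d = of_real dl" using P_inj b0 bidisc_near[OF z] by simp
    then show ?thesis using dl(1) by simp
  next
    case False
    have "\<not> fst d \<le> t0"
      using eps(5)[of "fst d" w "snd d"] P0 w(1) False ln2 by force
    then have t: "0 \<le> fst d - t0" by simp
    have lt: "exp (fst d - t0) < norm (qf w)" using dn(2) period_time(1)[OF w \<tau>] by (metis diff_strict_right_mono exp_less_mono)
    have e: "Phi (zz d w) = P (ez (fst d - t0, snd d) * cnj (cw w / bv w)) (ez' (fst d - t0, snd d) * bv w)"
      using Phi_passage(2)[OF w t less_imp_le[OF lt], of "snd d"] by simp
    have "bidisc (ez (fst d - t0, snd d) * cnj (cw w / bv w)) (ez' (fst d - t0, snd d) * bv w)"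
      by (rule bidisc_passage[OF w]) (use t lt in simp_all)
    then have "ez (fst d - t0, snd d) * cnj (cw w / bv w) = of_real dl"
      using e P0 E0 P_inj b0 by metis
    from arg_cong[OF this, of norm] have "exp (fst d - t0) * norm (cw w / bv w) = dl"
      using dl(1) by (simp only: norm_mult norm_ez complex_mod_cnj norm_of_real fst_conv)
    moreover have "norm (cw w / bv w) > 0" using w(2) Phi_t0(1)[OF w(1)] by simp
    then have "exp (fst d - t0) * norm (cw w / bv w) < norm (qf w) * norm (cw w / bv w)"
      by (rule mult_strict_right_mono[OF lt])
    ultimately show ?thesis using qf_norm(3)[OF w] by simp
  qed
  then obtain k :: int where "fst d = 0" "snd d = 2 * pi * of_int k" unfolding ez_eq_1_iff by blast
  then have "d = (0, 2 * pi * of_int k)" by (simp add: prod_eq_iff)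
  then have "s - t = of_int n *\<^sub>R \<tau> + (0, 2 * pi * of_int k)" by (simp add: d_def algebra_simps)
  then show ?thesis by blast
qed

end

section \<open>The regular tori near the singular fibre\<close>

text \<open>The trace of X on C is closed, and it is open because it equals the trace of N.
  Connected parts of fibres can so be controlled by what is known inside the neighbourhood N
  alone.\<close>

lemma connected_subset_compact:
  fixes C :: "'a::t2_space set"
  assumes "connected C" "compact X" "open N" "X \<subseteq> N" "C \<inter> N \<subseteq> X" "C \<inter> X \<noteq> {}"
  shows "C \<subseteq> X"
proof -
  have "open (- X)" using compact_imp_closed[OF assms(2)] by (rule open_Compl)
  then have "N \<inter> C = {} \<or> - X \<inter> C = {}"
    using connectedD[OF assms(1,3)] assms(4,5) by blast
  then show ?thesis using assms(4,6) by blast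
qed

context focus_focus_system
begin

definition torus :: "real \<times> real \<Rightarrow> 'm set" where "torus w = range (\<lambda>t. Phi (zz t w))"

definition B3 :: "'m set" where
  "B3 = {p \<in> fst c0. \<exists>u v. snd c0 p = pt u v \<and> norm u < 2 * dl \<and> norm v < 2 * dl \<and> norm (cnj u * v) < eps}"

definition Z :: "(real^4) set" where
  "Z = {z. - 1 < z$1 \<and> z$1 < t0 + 1 \<and> norm (wz z) < eps}"

text \<open>A neighbourhood of the singular fibre composed of the Eliasson bidisc over small values
  and the flow-out that leaves it and returns. The extra unit of time at both ends of
  \<open>Z\<close> makes it open around the times from 0 to \<open>t0\<close>.\<close>

definition N :: "'m set" where "N = B3 \<union> Phi ` Z"

lemma Z_dom: "z \<in> Z \<Longrightarrow> z \<in> dom"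
  using complete[of "(z$3, z$4)" "(z$1, z$2)"] zz_surj[of z] norm_cw[of "(z$3, z$4)"]
  by (auto simp: Z_def cw_def wz_def)

lemma open_B3: "open B3"
proof -
  let ?u = "\<lambda>x::real^4. of_real (x$1) + \<i> * of_real (x$2)" and ?v = "\<lambda>x::real^4. of_real (x$3) + \<i> * of_real (x$4)"
  have bu: "bounded_linear ?u" "bounded_linear ?v"
    by (intro bounded_linear_add bounded_linear_const_mult bounded_linear_compose[OF bounded_linear_of_real]
        bounded_linear_vec_nth)+
  have "open {x. norm (?u x) < 2 * dl \<and> norm (?v x) < 2 * dl \<and> norm (cnj (?u x) * ?v x) < eps}"
    (is "open ?X")
    by (intro open_Collect_conj open_Collect_less continuous_on_norm continuous_on_mult continuous_on_cnj
        continuous_on_const linear_continuous_on bu)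
  from chart_open_preimage[OF is_chart[OF c0A] this] have "open {p \<in> fst c0. snd c0 p \<in> ?X}" .
  moreover have "{p \<in> fst c0. snd c0 p \<in> ?X} = B3"
  proof -
    have "x \<in> ?X \<longleftrightarrow> (\<exists>u v. x = pt u v \<and> norm u < 2 * dl \<and> norm v < 2 * dl \<and> norm (cnj u * v) < eps)" for x
    proof -
      obtain u v where x: "x = pt u v" using pt_surj by blast
      have e: "?u x = u" "?v x = v" unfolding x by (simp_all add: complex_eq_iff)
      have "x \<in> ?X \<longleftrightarrow> norm u < 2 * dl \<and> norm v < 2 * dl \<and> norm (cnj u * v) < eps" unfolding mem_Collect_eq e ..
      then show ?thesis unfolding x by auto
    qed
    then show ?thesis unfolding B3_def by simp
  qed
  ultimately show "open B3" by simp
qed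

lemma open_Z: "open Z"
  unfolding Z_def
  by (intro open_Collect_conj open_Collect_less continuous_intros linear_continuous_on bounded_linear_wz)

text \<open>\<open>Phi\<close> has surjective derivative at every point, since it is symplectic in
  charts, so it is an open map.\<close>

lemma open_Phi_image:
  assumes "open X" "X \<subseteq> dom"
  shows "open (Phi ` X)"
  unfolding open_subopen[of "Phi ` X"]
proof
  fix p assume "p \<in> Phi ` X"
  then obtain z where z: "z \<in> X" "p = Phi z" by blast
  obtain Q d where Q: "z \<in> Q" "local_symp Phi Q d" using good_dom assms(2) z(1) unfolding good_def by blast
  note S = local_sympD[OF Q(2)]
  let ?D = "frechet_derivative (\<lambda>z. snd d (Phi z)) (at z)"
  obtain h where h: "linear h" "?D \<circ> h = id"
    using linear_surjective_right_inverse[OF has_derivative_linear[OF S(6)[OF Q(1)]] local_symp_inj(2)[OF Q(2,1)]] by blast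
  have "snd d (Phi z) \<in> interior ((\<lambda>z. snd d (Phi z)) ` (Q \<inter> X))"
  proof (rule sussmann_open_mapping[OF S(2) smooth_on_continuous[OF S(4)] Q(1) S(6)[OF Q(1)] _ h(2)])
    show "bounded_linear h" using h(1) by (simp add: linear_conv_bounded_linear)
    show "z \<in> interior (Q \<inter> X)" using S(2) assms(1) Q(1) z(1) by (simp add: interior_open open_Int)
  qed simp
  then obtain Y where Y: "open Y" "snd d (Phi z) \<in> Y" "Y \<subseteq> (\<lambda>z. snd d (Phi z)) ` (Q \<inter> X)"
    unfolding interior_def by blast
  let ?W = "{q \<in> fst d. snd d q \<in> Y}"
  have "?W \<subseteq> Phi ` X"
  proof
    fix q assume q: "q \<in> ?W"
    then obtain y where y: "y \<in> Q" "y \<in> X" "snd d q = snd d (Phi y)" using Y(3) by blast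
    then have "q = Phi y" using inj_onD[OF chartD(3)[OF S(1)]] S(3) q by blast
    then show "q \<in> Phi ` X" using y(2) by blast
  qed
  moreover have "open ?W" by (rule chart_open_preimage[OF is_chart[OF S(1)] Y(1)])
  ultimately show "\<exists>T. open T \<and> p \<in> T \<and> T \<subseteq> Phi ` X" using z(2) S(3)[OF Q(1)] Y(2) by blast
qed

lemma open_N: "open N"
  unfolding N_def using open_B3 open_Phi_image[OF open_Z] Z_dom by blast

lemma B3_bidisc:
  assumes "p \<in> B3"
  obtains u v where "p = P u v" "norm u < 2 * dl" "norm v < 2 * dl" "norm (cnj u * v) < eps" "bidisc u v"
proof -
  obtain u v where uv: "p \<in> fst c0" "snd c0 p = pt u v" "norm u < 2 * dl" "norm v < 2 * dl" "norm (cnj u * v) < eps"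
    using assms unfolding B3_def by blast
  have "P u v = p" unfolding P_def uv(2)[symmetric] by (rule inv_into_f_f[OF chartD(3)[OF c0A] uv(1)])
  moreover have "bidisc u v" using uv(3,4) by (simp add: bidisc_def)
  ultimately show thesis using that uv(3-5) by blast
qed

lemma P_B3: "norm u < 2 * dl \<Longrightarrow> norm v < 2 * dl \<Longrightarrow> norm (cnj u * v) < eps \<Longrightarrow> P u v \<in> B3"
  using P_chart[of u v] unfolding B3_def bidisc_def by auto

lemma N_J:
  assumes "p \<in> N"
  shows "p \<in> U" "norm (J p) < eps"
proof -
  have "p \<in> U \<and> norm (J p) < eps"
  proof (cases "p \<in> B3")
    case True
    then obtain u v where uv: "p = P u v" "norm (cnj u * v) < eps" "bidisc u v" using B3_bidisc by metis
    have "norm (J p) = norm (cnj u * v)"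
      unfolding uv(1) J_P[OF uv(3)] by (simp add: norm_Pair cmod_def)
    then show ?thesis using c0_U(1)[OF P_chart(1)[OF uv(3)]] uv by simp
  next
    case False
    then obtain z where z: "z \<in> Z" "p = Phi z" using assms by (auto simp: N_def)
    have "J p = (z$3, z$4)" using J_Phi[OF Z_dom[OF z(1)]] z(2) by simp
    then have "norm (J p) = norm (wz z)" by (simp add: wz_def norm_Pair cmod_def)
    then show ?thesis using Phi_regular[OF Z_dom[OF z(1)]] z by (simp add: Z_def)
  qed
  then show "p \<in> U" "norm (J p) < eps" by blast+
qed

lemma J_torus:
  assumes "norm w < eps" "p \<in> torus w"
  shows "J p = w"
proof -
  obtain t where "p = Phi (zz t w)" using assms(2) unfolding torus_def by blast
  then show ?thesis using J_Phi[OF complete[OF assms(1)], of t] by simp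
qed

lemma ez_Arg: "z \<noteq> 0 \<Longrightarrow> ez (0, Arg z) = sgn z"
  by (simp add: ez_def cis_Arg[symmetric] cis_conv_exp Complex_eq mult.commute)

text \<open>A point of the bidisc with \<open>u \<noteq> 0\<close> is moved along the flow to \<open>|u| = \<delta>\<close>, that is, to the
  section \<open>E\<close>; for \<open>u = 0\<close> it is moved to \<open>|v| = \<delta>\<close>.\<close>

lemma P_in_torus:
  assumes b: "bidisc u v" and u: "u \<noteq> 0" and w: "cnj u * v = cw w" "norm w < eps"
  shows "P u v \<in> torus w"
proof -
  define s where "s = ln (dl / norm u)"
  have es: "exp s = dl / norm u" "exp (- s) = norm u / dl" using u dl(1) by (simp_all add: s_def exp_minus)
  have "ez (0, Arg u) = sgn u" by (rule ez_Arg[OF u])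
  then have u': "u = of_real (norm u) * ez (0, Arg u)"
    using u by (simp add: sgn_div_norm scaleR_conv_of_real)
  have eu: "of_real (exp s) * u = of_real dl * ez (0, Arg u)"
  proof -
    have "of_real (exp s) * (of_real (norm u) * ez (0, Arg u)) = of_real (exp s * norm u) * ez (0, Arg u)" by simp
    also have "exp s * norm u = dl" using u by (simp add: es)
    finally show ?thesis using u' by simp
  qed
  have ev: "of_real (exp (- s)) * v = cw w / of_real dl * ez' (0, Arg u)"
  proof -
    have c: "cnj u = of_real (norm u) * cnj (ez (0, Arg u))" by (metis complex_cnj_complex_of_real complex_cnj_mult u')
    have "cw w * ez' (0, Arg u) = of_real (norm u) * (cnj (ez (0, Arg u)) * ez' (0, Arg u)) * v"
      unfolding w(1)[symmetric] c by simp
    then have "cw w * ez' (0, Arg u) = of_real (norm u) * v" unfolding ez_mult by simp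
    then show ?thesis unfolding es using dl(1) by (simp add: field_simps)
  qed
  have nz: "u \<noteq> 0 \<or> v \<noteq> 0" using u by simp
  have b1: "bidisc (of_real dl * ez (0, Arg u)) (cw w / of_real dl * ez' (0, Arg u))"
    using bidisc_near[of "zz (0, Arg u) w"] less_eps[OF w(2)] by (simp add: near_def norm_cw)
  have "flows (P u v) s (P (of_real dl * ez (0, Arg u)) (cw w / of_real dl * ez' (0, Arg u)))"
    using flows_P[OF nz b, of s] b1 unfolding eu ev by blast
  from flows_sym[OF this] have f: "flows (E (zz (- s, Arg u) w)) (zz (- s, Arg u) w $ 1) (P u v)"
    by (simp add: E_def)
  have "norm (wz (zz (- s, Arg u) w)) < dl\<^sup>2" using less_eps[OF w(2)] by (simp add: norm_cw)
  from PhiI(2)[OF this f] show ?thesis unfolding torus_def by (metis rangeI)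
qed

lemma zero_eps: "norm (0 :: real \<times> real) < eps" using eps(1) by simp

lemma Phi_stable_t0:
  assumes "norm (of_real (exp (- r)) * v0) \<le> 2 * dl"
  shows "Phi (zz (t0 + r, a) 0) = P 0 (of_real (exp (- r)) * (ez' (0, a) * v0))"
proof -
  have b: "bv 0 = v0"
  proof -
    have "P (cnj (cw 0 / bv 0)) (bv 0) = P 0 v0" using Phi_t0(5)[OF zero_eps] v0(2) by simp
    moreover have "bidisc 0 v0" using v0(1) dl(1) by (simp add: bidisc_def)
    ultimately show ?thesis using P_inj Phi_t0(4)[OF zero_eps] by blast
  qed
  have "Phi (zz (t0, a) 0) = P 0 (ez' (0, a) * v0)" using Phi_t0_angle[OF zero_eps, of a] b by simp
  moreover have "v0 \<noteq> 0" using v0(1) dl(1) by auto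
  ultimately show ?thesis
    using assms v0(1) dl(1) by (intro Phi_stable(2)[OF complete_K]) (simp_all add: norm_mult)
qed

text \<open>The points with u = 0 never reach the section in forward time. They are reached from it
  instead: the flow-out passes through \<open>v0\<close>, and shifts of time and angle sweep the
  punctured stable disc.\<close>

lemma P_stable_in_torus:
  assumes v: "v \<noteq> 0" "norm v < 2 * dl"
  shows "P 0 v \<in> torus 0"
proof -
  define r where "r = ln (dl / norm v)"
  have er: "exp (- r) = norm v / dl" using v dl(1) by (simp add: r_def exp_minus)
  have v00: "v0 \<noteq> 0" using v0(1) dl(1) by auto
  define a where "a = Arg (v / v0)"
  have "ez' (0, a) = sgn (v / v0)"
    using ez_Arg[of "v / v0"] ez'_eq[of "(0, a)"] v(1) v00 by (simp add: a_def)
  then have "ez' (0, a) = of_real (dl / norm v) * (v / v0)"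
    using v0(1) by (simp add: sgn_div_norm scaleR_conv_of_real norm_divide)
  then have "of_real (exp (- r)) * (ez' (0, a) * v0) = v" unfolding er using v v00 dl(1) by simp
  moreover have "norm (of_real (exp (- r)) * v0) \<le> 2 * dl"
  proof -
    have "norm (of_real (norm v / dl) * v0) = norm v" using v0(1) dl(1) by (simp add: norm_mult norm_divide)
    then show ?thesis unfolding er using v(2) by simp
  qed
  ultimately show ?thesis using Phi_stable_t0[of r a] unfolding torus_def by (metis rangeI)
qed

text \<open>Every point of the bidisc except m can be moved along the flow to one of the two
  sections, and the remaining part of \<open>N\<close> is a flow-out by construction. Hence over
  each value there is only one orbit in \<open>N\<close>.\<close>

lemma N_torus:
  assumes p: "p \<in> N" and w: "J p = w" and nm: "p \<noteq> m"
  shows "p \<in> torus w"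
proof (cases "p \<in> B3")
  case True
  then obtain u v where uv: "p = P u v" "norm u < 2 * dl" "norm v < 2 * dl" "bidisc u v" using B3_bidisc by metis
  have c: "cnj u * v = cw w" using w J_P[OF uv(4)] uv(1) by (auto simp: complex_eq_iff)
  have we: "norm w < eps" using N_J(2)[OF p] w by simp
  show ?thesis
  proof (cases "u = 0")
    case False
    then show ?thesis using P_in_torus[OF uv(4) _ c we] uv(1) by simp
  next
    case True
    then have "w = 0" using c by simp
    moreover have "v \<noteq> 0" using nm P_0 uv(1) True by auto
    ultimately show ?thesis using P_stable_in_torus[OF _ uv(3)] uv(1) True by simp
  qed
next
  case False
  then obtain z where z: "z \<in> Z" "p = Phi z" using p by (auto simp: N_def)
  have "J p = (z$3, z$4)" using J_Phi[OF Z_dom[OF z(1)]] z(2) by simp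
  then have "zz (z$1, z$2) w = z" using w zz_surj[of z] by simp
  then show ?thesis using z(2) unfolding torus_def by (metis rangeI)
qed

lemma Phi_strip_N:
  assumes "norm w < eps" "s \<in> {0..t0}"
  shows "Phi (zz (s, a) w) \<in> N"
proof -
  have "zz (s, a) w \<in> Z" using assms by (simp add: Z_def norm_cw)
  then show ?thesis by (simp add: N_def)
qed

lemma zz_continuous: "continuous_on T (\<lambda>t. zz t w)"
  unfolding zz_def by (intro continuous_intros)

lemma torus_eq:
  assumes w: "norm w < eps" "w \<noteq> 0" and \<tau>: "period w \<tau>"
  shows "torus w = (\<lambda>t. Phi (zz t w)) ` ({0..fst \<tau>} \<times> {0..2 * pi})"
proof
  have pos: "fst \<tau> > 0" using period_time(2)[OF w \<tau>] t0_pos by simp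
  show "torus w \<subseteq> (\<lambda>t. Phi (zz t w)) ` ({0..fst \<tau>} \<times> {0..2 * pi})"
  proof
    fix p assume "p \<in> torus w"
    then obtain t where t: "p = Phi (zz t w)" unfolding torus_def by blast
    obtain n :: int where n: "0 \<le> fst t - of_int n * fst \<tau>" "fst t - of_int n * fst \<tau> < fst \<tau>"
      using frac_reduce[OF pos] by blast
    obtain k :: int where k: "0 \<le> (snd t - of_int n * snd \<tau>) - 2 * pi * of_int k"
      "(snd t - of_int n * snd \<tau>) - 2 * pi * of_int k \<le> 2 * pi" using reduce_angle by blast
    let ?t = "t - of_int n *\<^sub>R \<tau> - (0, 2 * pi * of_int k)"
    have e: "of_int n *\<^sub>R \<tau> + (0, 2 * pi * of_int k) + ?t = t" by simp
    have 1: "?t \<in> {0..fst \<tau>} \<times> {0..2 * pi}" using n k by (auto simp: mem_Times_iff)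
    have 2: "p = Phi (zz ?t w)" using Phi_lattice[OF w \<tau>, of n k ?t] unfolding e t .
    show "p \<in> (\<lambda>t. Phi (zz t w)) ` ({0..fst \<tau>} \<times> {0..2 * pi})" 
      by (rule image_eqI[where x = ?t], rule 2, rule 1)
  qed
  show "(\<lambda>t. Phi (zz t w)) ` ({0..fst \<tau>} \<times> {0..2 * pi}) \<subseteq> torus w"
    unfolding torus_def by (rule image_mono[OF subset_UNIV])
qed

lemma Phi_zz_continuous:
  assumes "norm w < eps"
  shows "continuous_on T (\<lambda>t. Phi (zz t w))"
  by (rule continuous_on_compose2[OF continuous_Phi zz_continuous]) (use complete[OF assms] in blast)

lemma torus_compact:
  assumes "norm w < eps" "w \<noteq> 0"
  shows "compact (torus w)" "connected (torus w)" "torus w \<subseteq> N"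
proof -
  obtain \<tau> where \<tau>: "period w \<tau>" using ex_period[OF assms] by blast
  show "compact (torus w)"
    unfolding torus_eq[OF assms \<tau>]
    by (intro compact_continuous_image Phi_zz_continuous assms compact_Times compact_Icc)
  show "connected (torus w)"
    unfolding torus_def by (intro connected_continuous_image Phi_zz_continuous assms connected_UNIV)
  show "torus w \<subseteq> N"
    unfolding torus_eq[OF assms \<tau>]
  proof clarify
    fix s a assume s: "s \<in> {0..fst \<tau>}"
    \<comment> \<open>Up to \<open>t0\<close> the point lies in the outer flow-out. Afterwards it is
      on the passage through the bidisc, where the explicit formula and the constancy of cnj u * v
      place it in \<open>B3\<close>.\<close>
    show "Phi (zz (s, a) w) \<in> N"
    proof (cases "s \<le> t0")
      case True
      then show ?thesis using Phi_strip_N[OF assms(1)] s by simp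
    next
      case False
      define r where "r = s - t0"
      have r: "0 \<le> r" "exp r \<le> norm (qf w)"
        using False s period_time(1)[OF assms \<tau>] by (auto simp: r_def simp flip: period_time(1)[OF assms \<tau>])
      let ?u = "ez (r, a) * cnj (cw w / bv w)" and ?v = "ez' (r, a) * bv w"
      have e: "Phi (zz (s, a) w) = P ?u ?v" using Phi_passage(2)[OF assms r, of a] by (simp add: r_def)
      have "exp r * norm (cw w / bv w) \<le> norm (qf w) * norm (cw w / bv w)" using r(2) by (rule mult_right_mono) simp
      then have "norm ?u < 2 * dl" using qf_norm(3)[OF assms] dl(1) by (simp only: norm_mult norm_ez complex_mod_cnj fst_conv)
      moreover have "exp (- r) * norm (bv w) \<le> 1 * norm (bv w)" using r(1) by (intro mult_right_mono) auto
      then have "norm ?v < 2 * dl" using Phi_t0(3)[OF assms(1)] by (simp only: norm_mult norm_ez fst_conv)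
      moreover have "cnj ?u * ?v = (cnj (ez (r, a)) * ez' (r, a)) * cw w" using Phi_t0(1)[OF assms(1)] by simp
      then have "norm (cnj ?u * ?v) < eps" unfolding ez_mult using assms(1) by (simp add: norm_cw)
      ultimately show ?thesis using P_B3 unfolding e N_def by blast
    qed
  qed
qed

lemma V_eps:
  assumes "norm w < eps"
  shows "w \<in> V"
  using J_in(1)[of "Phi (zz (0, 0) w)"] Phi_regular[OF complete[OF assms]] J_Phi[OF complete[OF assms]] by simp

lemma torus_component:
  assumes "norm w < eps" "w \<noteq> 0" "connected C" "C \<inter> torus w \<noteq> {}" "C \<subseteq> em_map H L -` {g w}"
  shows "C \<subseteq> torus w"
proof (rule connected_subset_compact[OF assms(3) torus_compact(1)[OF assms(1,2)] open_N torus_compact(3)[OF assms(1,2)] _ assms(4)])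
  show "C \<inter> N \<subseteq> torus w"
  proof
    fix p assume p: "p \<in> C \<inter> N"
    have "J p = w" using p assms(5) J_eqI(2)[OF _ V_eps[OF assms(1)]] by blast
    moreover have "J m = 0" using J_P[of 0 0] P_0 dl(1) by (simp add: bidisc_def zero_prod_def)
    ultimately show "p \<in> torus w" using N_torus[of p w] p assms(2) by auto
  qed
qed

lemma torus_regular:
  assumes "norm w < eps" "p \<in> torus w"
  shows "p \<in> U" "regular_point A H L p"
proof -
  obtain t where "p = Phi (zz t w)" using assms(2) unfolding torus_def by blast
  then show "p \<in> U" "regular_point A H L p" using Phi_regular[OF complete[OF assms(1)], of t] by simp_all
qed

lemma torus_em:
  assumes w: "norm w < eps"
  shows "torus w \<subseteq> em_map H L -` {g w}"
proof
  fix p assume p: "p \<in> torus w"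
  have "em_map H L p = g w" using J_in(2)[OF torus_regular(1)[OF w p]] J_torus[OF w p] by simp
  then show "p \<in> em_map H L -` {g w}" by simp
qed

lemma regular_torus_torus:
  assumes w: "norm w < eps" "w \<noteq> 0"
  shows "regular_torus A H L (g w) (torus w)"
  unfolding regular_torus_def
proof (intro conjI ballI)
  let ?F = "em_map H L -` {g w}" and ?p = "Phi (zz (0, 0) w)"
  have p: "?p \<in> torus w" by (simp add: torus_def)
  have pF: "?p \<in> ?F" using torus_em[OF w(1)] p by blast
  have "connected_component_set ?F ?p \<subseteq> torus w"
  proof (rule torus_component[OF w connected_connected_component])
    have "?p \<in> connected_component_set ?F ?p" using connected_component_refl[OF pF] by simp
    then show "connected_component_set ?F ?p \<inter> torus w \<noteq> {}" using p by blast
    show "connected_component_set ?F ?p \<subseteq> ?F" by (rule connected_component_subset)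
  qed
  moreover have "torus w \<subseteq> connected_component_set ?F ?p"
    by (rule connected_component_maximal[OF p torus_compact(2)[OF w] torus_em[OF w(1)]])
  ultimately have "torus w = connected_component_set ?F ?p" by blast
  then show "torus w \<in> components ?F" using pF by (auto simp: components_def)
  show "compact (torus w)" by (rule torus_compact(1)[OF w])
  show "regular_point A H L p" if "p \<in> torus w" for p
    by (rule torus_regular(2)[OF w(1) that])
qed

text \<open>Reduces the quantifier over all regular tori near the singular fibre to the family
  \<open>torus w\<close>. Excluding the critical value keeps w away from 0, where the orbit is not a
  torus.\<close>

lemma regular_torus_in_N:
  assumes T: "regular_torus A H L c T" "T \<subseteq> N" and c: "c \<noteq> g (0, 0)"
  obtains w where "norm w < eps" "w \<noteq> 0" "c = g w" "T = torus w"
proof -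
  have T': "T \<in> components (em_map H L -` {c})" using T(1) by (simp add: regular_torus_def)
  note Tc = in_components_nonempty[OF T'] in_components_connected[OF T'] in_components_subset[OF T']
  obtain p where p: "p \<in> T" using Tc(1) by blast
  have pN: "p \<in> N" using p T(2) by blast
  define w where "w = J p"
  have w: "norm w < eps" using N_J(2)[OF pN] by (simp add: w_def)
  have cg: "c = g w" using p Tc(3) J_in(2)[OF N_J(1)[OF pN]] by (auto simp: w_def)
  then have w0: "w \<noteq> 0" using c by (auto simp: zero_prod_def)
  have "J m = 0" using J_P[of 0 0] P_0 dl(1) by (simp add: bidisc_def zero_prod_def)
  then have pt: "p \<in> torus w" using N_torus[OF pN w_def[symmetric]] w0 w_def by auto
  have "T \<subseteq> torus w" by (rule torus_component[OF w w0 Tc(2)]) (use p pt Tc(3) cg in auto)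
  moreover have "torus w \<subseteq> T"
    by (rule components_maximal[OF T' torus_compact(2)[OF w w0]]) (use torus_em[OF w] cg p pt in auto)
  ultimately show thesis using that[OF w w0 cg] by blast
qed

text \<open>The two closed discs and the outer strip over w = 0 form a compact set inside
  \<open>N\<close> that contains everything of \<open>N\<close> over w = 0. The singular fibre is
  connected and meets it, so it cannot leave it.\<close>

lemma K_N: "K \<subseteq> N"
proof -
  define X where "X = (\<lambda>p. P (fst p) (snd p)) ` ((cball 0 dl \<times> {0}) \<union> ({0} \<times> cball 0 dl)) \<union>
    (\<lambda>t. Phi (zz t 0)) ` ({0..t0} \<times> {0..2 * pi})"
  have c1: "compact ((\<lambda>p. P (fst p) (snd p)) ` ((cball 0 dl \<times> {0}) \<union> ({0} \<times> cball 0 dl)))"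
    by (intro compact_continuous_image continuous_on_subset[OF continuous_P] compact_Un compact_Times compact_cball)
      (use dl(1) in \<open>auto simp: bidisc_def\<close>)
  have cX: "compact X"
    unfolding X_def
    by (rule compact_Un[OF c1]) (intro compact_continuous_image Phi_zz_continuous zero_eps compact_Times compact_Icc)
  have XN: "X \<subseteq> N"
  proof -
    have "P u v \<in> B3" if "norm u \<le> dl" "norm v \<le> dl" "u = 0 \<or> v = 0" for u v
      using that dl(1) eps(1) by (intro P_B3) auto
    then have "(\<lambda>p. P (fst p) (snd p)) ` ((cball 0 dl \<times> {0}) \<union> ({0} \<times> cball 0 dl)) \<subseteq> B3"
      using dl(1) by auto
    moreover have "(\<lambda>t. Phi (zz t 0)) ` ({0..t0} \<times> {0..2 * pi}) \<subseteq> N" using Phi_strip_N[OF zero_eps] by auto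
    ultimately show ?thesis unfolding X_def N_def by blast
  qed
  have PX: "P u v \<in> X" if "norm u \<le> dl" "norm v \<le> dl" "u = 0 \<or> v = 0" for u v
    unfolding X_def by (rule UnI1, rule image_eqI[of _ _ "(u, v)"]) (use that in auto)
  have tX: "torus 0 \<subseteq> X"
  proof
    fix p assume "p \<in> torus 0"
    then obtain s a where p: "p = Phi (zz (s, a) 0)" unfolding torus_def by auto
    consider "s \<le> 0" | "s \<in> {0..t0}" | "s > t0" by fastforce
    then show "p \<in> X"
    proof cases
      case 1
      then have "exp s \<le> 1" by simp
      then have "dl * exp s \<le> dl * 1" using dl(1) by (intro mult_left_mono) auto
      then show ?thesis using PX[of "of_real dl * ez (s, a)" 0] Phi_unstable(2)[OF 1, of a] p dl(1) by (simp add: norm_mult)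
    next
      case 2
      obtain k :: int where k: "0 \<le> a - 2 * pi * of_int k" "a - 2 * pi * of_int k \<le> 2 * pi" using reduce_angle by blast
      have "p = Phi (zz (s, a - 2 * pi * of_int k) 0)" using Phi_periodic(1)[of s "a - 2 * pi * of_int k" k 0] p by simp
      then show ?thesis unfolding X_def using 2 k by (intro UnI2 image_eqI[of _ _ "(s, a - 2 * pi * of_int k)"]) auto
    next
      case 3
      then have "exp (- (s - t0)) \<le> 1" by simp
      then have le: "exp (- (s - t0)) * dl \<le> 1 * dl" using dl(1) by (intro mult_right_mono) auto
      then have "norm (of_real (exp (- (s - t0))) * v0) \<le> dl" unfolding norm_mult v0(1) by simp
      then have "Phi (zz (t0 + (s - t0), a) 0) = P 0 (of_real (exp (- (s - t0))) * (ez' (0, a) * v0))"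
        using dl(1) by (intro Phi_stable_t0) simp
      moreover have "norm (of_real (exp (- (s - t0))) * (ez' (0, a) * v0)) \<le> dl"
        using le v0(1) by (simp add: norm_mult)
      ultimately show ?thesis using PX p dl(1) by simp
    qed
  qed
  have "K \<subseteq> X"
  proof (rule connected_subset_compact[OF _ cX open_N XN])
    show "connected K" unfolding singular_fibre_def by (rule connected_connected_component)
    have mX: "m \<in> X" using PX[of 0 0] P_0 dl(1) by simp
    show "K \<inter> N \<subseteq> X"
      using N_torus[of _ 0] K_J(2) mX tX by (auto simp: zero_prod_def)
    have "m \<in> K" unfolding singular_fibre_def using connected_component_refl[of m] by simp
    then show "K \<inter> X \<noteq> {}" using mX by blast
  qed
  then show ?thesis using XN by blast
qed

end

section \<open>Action-angle coordinates\<close>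

lemma smooth_diffeo_inv:
  assumes "smooth_diffeo f S"
  shows "smooth_diffeo (inv_into S f) (f ` S)" "inv_into S f ` f ` S = S"
    "\<And>x. x \<in> S \<Longrightarrow> inv_into (f ` S) (inv_into S f) x = f x"
proof -
  note D = smooth_diffeoD[OF assms]
  show img: "inv_into S f ` f ` S = S" using D(3) by (auto simp: image_iff)
  have inj: "inj_on (inv_into S f) (f ` S)" by (rule inj_on_inv_into) simp
  have ii: "inv_into (f ` S) (inv_into S f) x = f x" if "x \<in> S" for x
    using inv_into_f_f[OF inj, of "f x"] that D(3) by simp
  then show "\<And>x. x \<in> S \<Longrightarrow> inv_into (f ` S) (inv_into S f) x = f x" .
  have "smooth_on (inv_into (f ` S) (inv_into S f)) S"
    by (rule smooth_on_cong[OF D(1) _ D(4)]) (simp add: ii)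
  then show "smooth_diffeo (inv_into S f) (f ` S)"
    unfolding smooth_diffeo_def img using D inj by simp
qed

lemma smooth_diffeo_compose:
  fixes f :: "'a::euclidean_space \<Rightarrow> 'b::euclidean_space" and g :: "'b \<Rightarrow> 'c::euclidean_space"
  assumes f: "smooth_diffeo f S" and g: "smooth_diffeo g T" and sub: "f ` S \<subseteq> T"
  shows "smooth_diffeo (\<lambda>x. g (f x)) S"
proof -
  note F = smooth_diffeoD[OF f] and G = smooth_diffeoD[OF smooth_diffeo_subset[OF g smooth_diffeoD(2)[OF f] sub]]
  have img: "(\<lambda>x. g (f x)) ` S = g ` f ` S" by (simp add: image_image)
  have inj: "inj_on (\<lambda>x. g (f x)) S"
    using comp_inj_on[OF F(3) G(3)] by (simp add: o_def)
  have sm: "smooth_on (\<lambda>x. g (f x)) S" by (rule smooth_on_compose[OF F(1,2,4) G(4)]) simp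
  have 1: "smooth_on (\<lambda>y. inv_into S f (inv_into (f ` S) g y)) (g ` f ` S)"
    by (rule smooth_on_compose[OF G(2) F(2) G(5) F(5)]) (auto intro: inv_into_into)
  have eq: "inv_into S f (inv_into (f ` S) g y) = inv_into S (\<lambda>x. g (f x)) y" if yg: "y \<in> g ` f ` S" for y
  proof -
    obtain x where x: "x \<in> S" "y = g (f x)" using yg by blast
    have "inv_into (f ` S) g y = f x" unfolding x(2) by (rule inv_into_f_f[OF G(3)]) (use x(1) in blast)
    then show ?thesis using inv_into_f_f[OF F(3) x(1)] inv_into_f_f[OF inj x(1)] x(2) by simp
  qed
  have "smooth_on (inv_into S (\<lambda>x. g (f x))) (g ` f ` S)"
    by (rule smooth_on_cong[OF G(2) _ 1]) (rule eq)
  then show ?thesis unfolding smooth_diffeo_def img using F(1) G(2) inj sm by simp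
qed

lemma smooth_diffeo_linear:
  fixes f :: "'a::euclidean_space \<Rightarrow> 'b::euclidean_space"
  assumes f: "bounded_linear f" and h: "bounded_linear h" and inv: "\<And>x. h (f x) = x" "\<And>y. f (h y) = y" and S: "open S"
  shows "smooth_diffeo f S"
proof -
  have inj: "inj_on f S" using inv(1) by (metis inj_onI)
  have img: "f ` S = h -` S"
  proof
    show "f ` S \<subseteq> h -` S" using inv(1) by auto
    show "h -` S \<subseteq> f ` S" using inv(2) by (metis image_eqI subsetI vimageE)
  qed
  have o: "open (f ` S)" unfolding img by (rule open_vimage[OF S linear_continuous_on[OF h]])
  have "smooth_on (inv_into S f) (f ` S)"
  proof (rule smooth_on_cong[OF o _ smooth_on_bounded_linear[OF o h]])
    fix y assume "y \<in> f ` S"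
    then show "h y = inv_into S f y" using inv(1) inv_into_f_f[OF inj] by auto
  qed
  then show ?thesis unfolding smooth_diffeo_def using S o inj smooth_on_bounded_linear[OF S f] by simp
qed

text \<open>The smooth inverse function theorem rests on matrices and determinants; it is carried
  over from \<open>real^2\<close> to pairs by linear isomorphisms.\<close>

lemma smooth_inverse_function_prod:
  fixes f :: "real \<times> real \<Rightarrow> real \<times> real"
  assumes U: "open U" and f: "smooth_on f U" and x0: "x0 \<in> U" and inj: "inj (frechet_derivative f (at x0))"
  obtains W where "W \<subseteq> U" "x0 \<in> W" "smooth_diffeo f W"
proof -
  define L :: "real \<times> real \<Rightarrow> real^2" where "L p = fst p *\<^sub>R axis 1 1 + snd p *\<^sub>R axis 2 1" for p
  define M :: "real^2 \<Rightarrow> real \<times> real" where "M x = (x$1, x$2)" for x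
  have L: "bounded_linear L" unfolding L_def
    by (intro bounded_linear_add bounded_linear_scaleR_const bounded_linear_fst bounded_linear_snd)
  have M: "bounded_linear M" unfolding M_def by (intro bounded_linear_Pair bounded_linear_vec_nth)
  have ml: "M (L p) = p" for p by (simp add: M_def L_def axis_def)
  have lm: "L (M x) = x" for x by (simp add: M_def L_def axis_def vec_eq_iff forall_2)
  define F where "F x = L (f (M x))" for x
  define Q where "Q = M -` U"
  have Q: "open Q" unfolding Q_def by (rule open_vimage[OF U linear_continuous_on[OF M]])
  have sF: "smooth_on F Q"
    unfolding F_def
    by (rule smooth_on_compose_bounded_linear[OF Q smooth_on_compose[OF Q U smooth_on_bounded_linear[OF Q M] f] L])
      (auto simp: Q_def)
  have x: "L x0 \<in> Q" using x0 ml by (simp add: Q_def)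
  have df: "(f has_derivative frechet_derivative f (at x0)) (at x0)" by (rule smooth_on_has_derivative[OF f x0])
  have "(F has_derivative (\<lambda>v. L (frechet_derivative f (at x0) (M v)))) (at (L x0))"
    unfolding F_def
    by (rule bounded_linear.has_derivative[OF L has_derivative_chain[OF bounded_linear_imp_has_derivative[OF M] ml df]])
  then have dF: "frechet_derivative F (at (L x0)) = (\<lambda>v. L (frechet_derivative f (at x0) (M v)))"
    by (rule frechet_derivative_at[symmetric])
  have "inj (frechet_derivative F (at (L x0)))"
    unfolding dF using inj ml lm unfolding inj_def by metis
  from smooth_inverse_function[OF Q sF x this]
  obtain Q' where Q': "Q' \<subseteq> Q" "L x0 \<in> Q'" "smooth_diffeo F Q'" by metis
  define W where "W = M ` Q'"
  have WL: "L ` W = Q'" unfolding W_def by (simp add: image_image lm)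
  have "smooth_diffeo M Q'"
    by (rule smooth_diffeo_linear[OF M L lm ml smooth_diffeoD(1)[OF Q'(3)]])
  then have oW: "open W" unfolding W_def by (rule smooth_diffeoD(2))
  have 1: "smooth_diffeo L W" by (rule smooth_diffeo_linear[OF L M ml lm oW])
  have 2: "smooth_diffeo (\<lambda>p. F (L p)) W" by (rule smooth_diffeo_compose[OF 1 Q'(3)]) (simp add: WL)
  have 3: "smooth_diffeo M UNIV" by (rule smooth_diffeo_linear[OF M L lm ml open_UNIV])
  have "smooth_diffeo (\<lambda>p. M (F (L p))) W" by (rule smooth_diffeo_compose[OF 2 3]) simp
  moreover have "(\<lambda>p. M (F (L p))) = f" by (rule ext) (simp add: F_def ml)
  moreover have "W \<subseteq> U" using Q'(1) unfolding W_def Q_def by auto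
  moreover have "x0 \<in> W" unfolding W_def using Q'(2) ml by (metis image_eqI)
  ultimately show thesis using that by simp
qed

lemma smooth_zz:
  assumes "open S" "smooth_on t S" "smooth_on w S"
  shows "smooth_on (\<lambda>x. zz (t x) (w x)) S"
  using smooth_on_compose_bounded_linear[OF assms(1) smooth_on_Pair[OF assms] bounded_linear_zz] by simp

lemma has_derivative_zz:
  assumes "(t has_derivative t') (at x within S)" "(w has_derivative w') (at x within S)"
  shows "((\<lambda>x. zz (t x) (w x)) has_derivative (\<lambda>h. zz (t' h) (w' h))) (at x within S)"
  using bounded_linear.has_derivative[OF bounded_linear_zz has_derivative_Pair[OF assms]] by simp

context focus_focus_system
begin

lemma local_symp_at:
  assumes "z \<in> dom" "d \<in> A" "Phi z \<in> fst d"
  obtains Q where "z \<in> Q" "local_symp Phi Q d"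
proof -
  obtain Q d' where "z \<in> Q" "local_symp Phi Q d'" using good_dom[OF assms(1)] unfolding good_def by blast
  then show thesis using that[OF _ local_symp_chart[OF _ assms(2)]] assms(3) by blast
qed

lemma smooth_bv: "smooth_on bv (ball 0 eps)"
proof (rule smooth_on_local)
  fix w0 :: "real \<times> real" assume w0: "w0 \<in> ball 0 eps"
  then have n: "norm w0 < eps" by simp
  have "Phi (zz (t0, 0) w0) \<in> fst c0" using eps(4)[OF n] by (simp add: B2_def)
  then obtain Q where Q: "zz (t0, 0) w0 \<in> Q" "local_symp Phi Q c0" using local_symp_at[OF complete[OF n] c0A] by blast
  note S = local_sympD[OF Q(2)]
  let ?h = "\<lambda>w. zz (t0, 0) w"
  have sh: "smooth_on ?h UNIV" by (intro smooth_zz smooth_on_const smooth_on_ident open_UNIV)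
  let ?T = "?h -` Q"
  have T: "open ?T" by (rule open_vimage[OF S(2) smooth_on_continuous[OF sh]])
  have 1: "smooth_on (\<lambda>w. snd c0 (Phi (?h w))) ?T"
    by (rule smooth_on_compose[OF T S(2) smooth_on_subset[OF sh subset_UNIV] S(4)]) blast
  have "smooth_on bv ?T" unfolding bv_def by (intro smooth_on_Complex T smooth_on_nth 1)
  then show "\<exists>T. open T \<and> w0 \<in> T \<and> smooth_on bv T" using T Q(1) by blast
qed

lemma bounded_linear_cw: "bounded_linear cw"
proof -
  have "bounded_linear (\<lambda>w::real \<times> real. complex_of_real (fst w) + \<i> * complex_of_real (snd w))"
    by (intro bounded_linear_add bounded_linear_const_mult bounded_linear_compose[OF bounded_linear_of_real]
        bounded_linear_fst bounded_linear_snd)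
  moreover have "(\<lambda>w::real \<times> real. complex_of_real (fst w) + \<i> * complex_of_real (snd w)) = cw"
    by (rule ext) (simp add: cw_def Complex_eq)
  ultimately show ?thesis by simp
qed

definition punctured :: "(real \<times> real) set" where "punctured = ball 0 eps - {0}"

lemma punctured: "open punctured" "w \<in> punctured \<longleftrightarrow> norm w < eps \<and> w \<noteq> 0"
  by (auto simp: punctured_def open_delete)

lemma smooth_qf: "smooth_on qf punctured"
proof -
  have b: "smooth_on bv punctured" by (rule smooth_on_subset[OF smooth_bv]) (simp add: punctured_def)
  have c: "smooth_on cw punctured" by (rule smooth_on_bounded_linear[OF punctured(1) bounded_linear_cw])
  show ?thesis
    unfolding qf_def
    by (intro smooth_on_divide smooth_on_mult smooth_on_const smooth_on_cnj punctured(1) b c) (simp add: punctured(2))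
qed

text \<open>Dividing by the value at \<open>w0\<close> brings \<open>qf\<close> close to 1, away
  from the cut of the principal logarithm. The derivative formula is that of a logarithm and does
  not depend on the branch.\<close>

lemma period_branch:
  assumes w0: "w0 \<in> punctured"
  obtains r \<tau> where "r > 0" "ball w0 r \<subseteq> punctured" "smooth_on \<tau> (ball w0 r)"
    "\<And>w. w \<in> ball w0 r \<Longrightarrow> period w (\<tau> w)"
    "\<And>w v. w \<in> ball w0 r \<Longrightarrow> frechet_derivative \<tau> (at w) v =
       (Re (frechet_derivative qf (at w) v / qf w), Im (frechet_derivative qf (at w) v / qf w))"
proof -
  have q0: "qf w \<noteq> 0" if "w \<in> punctured" for w using qf_norm(1) that punctured(2) by blast
  define h where "h w = qf w * inverse (qf w0)" for w
  have sh: "smooth_on h punctured"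
    unfolding h_def by (intro smooth_on_mult smooth_on_const punctured(1) smooth_qf)
  have "open (punctured \<inter> h -` {z. 0 < Re z})"
    by (rule continuous_open_preimage[OF smooth_on_continuous[OF sh] punctured(1) open_halfspace_Re_gt])
  moreover have "h w0 = 1" using q0[OF w0] by (simp add: h_def)
  then have "w0 \<in> punctured \<inter> h -` {z. 0 < Re z}" using w0 by simp
  ultimately obtain r where r: "r > 0" "ball w0 r \<subseteq> punctured \<inter> h -` {z. 0 < Re z}"
    using open_contains_ball by blast
  have hn: "h w \<notin> \<real>\<^sub>\<le>\<^sub>0" if "w \<in> ball w0 r" for w
  proof -
    have "Re (h w) > 0" using subsetD[OF r(2) that] by simp
    then show ?thesis by (auto simp: complex_nonpos_Reals_iff)
  qed
  have rp: "ball w0 r \<subseteq> punctured" using r(2) by blast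
  define lg where "lg w = Ln (h w) + Ln (qf w0)" for w
  have slg: "smooth_on lg (ball w0 r)"
    unfolding lg_def by (intro smooth_on_add smooth_on_const open_ball smooth_on_Ln smooth_on_subset[OF sh rp] hn)
  have elg: "exp (lg w) = qf w" if "w \<in> ball w0 r" for w
  proof -
    have "h w \<noteq> 0" using q0 subsetD[OF rp that] w0 by (simp add: h_def)
    then show ?thesis using q0[OF w0] by (simp add: lg_def exp_add h_def)
  qed
  define \<tau> where "\<tau> w = (t0 + Re (lg w), Im (lg w))" for w
  show thesis
  proof (rule that[OF r(1) rp])
    show "smooth_on \<tau> (ball w0 r)"
      unfolding \<tau>_def by (intro smooth_on_Pair smooth_on_add smooth_on_const smooth_on_Re smooth_on_Im open_ball slg)
    show "period w (\<tau> w)" if "w \<in> ball w0 r" for w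
      using elg[OF that] by (simp add: period_def \<tau>_def ez_def)
    fix w v assume w: "w \<in> ball w0 r"
    have wp: "w \<in> punctured" using w rp by blast
    have dq: "(qf has_derivative frechet_derivative qf (at w)) (at w)" by (rule smooth_on_has_derivative[OF smooth_qf wp])
    have dh: "(h has_derivative (\<lambda>v. frechet_derivative qf (at w) v * inverse (qf w0))) (at w)"
      unfolding h_def by (rule has_derivative_mult_left[OF dq])
    have "(lg has_derivative (\<lambda>v. frechet_derivative qf (at w) v * inverse (qf w0) * inverse (h w) + 0)) (at w)"
      unfolding lg_def by (rule has_derivative_add[OF has_derivative_Ln[OF dh hn[OF w]] has_derivative_const])
    moreover have "frechet_derivative qf (at w) v * inverse (qf w0) * inverse (h w) + 0 = frechet_derivative qf (at w) v / qf w" for v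
      using q0[OF wp] q0[OF w0] by (simp add: h_def field_simps)
    ultimately have dl: "(lg has_derivative (\<lambda>v. frechet_derivative qf (at w) v / qf w)) (at w)" by simp
    have dt: "(\<tau> has_derivative (\<lambda>v. (0 + Re (frechet_derivative qf (at w) v / qf w), Im (frechet_derivative qf (at w) v / qf w)))) (at w)"
      unfolding \<tau>_def
      by (intro has_derivative_Pair has_derivative_add has_derivative_const
          bounded_linear.has_derivative[OF bounded_linear_Re dl] bounded_linear.has_derivative[OF bounded_linear_Im dl])
    show "frechet_derivative \<tau> (at w) v =
       (Re (frechet_derivative qf (at w) v / qf w), Im (frechet_derivative qf (at w) v / qf w))"
      using fun_cong[OF frechet_derivative_at[OF dt], of v] by simp
  qed
qed

lemma pairing_zz: "pairing std_form (zz s w) (zz s' w') = s \<bullet> w' - w \<bullet> s'"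
  by (simp add: pairing_std inner_prod_def)

text \<open>The period form \<open>\<tau>\<^sub>1 dw\<^sub>1 + \<tau>\<^sub>2 dw\<^sub>2\<close> is closed: pull \<open>\<Omega>\<close> back by \<open>w \<mapsto> Phi (\<tau> w, w) = Phi (0, w)\<close>.\<close>

lemma period_closed:
  assumes T: "open T" "T \<subseteq> punctured" and \<tau>: "smooth_on \<tau> T" "\<And>w. w \<in> T \<Longrightarrow> period w (\<tau> w)" and w: "w \<in> T"
  shows "frechet_derivative \<tau> (at w) u \<bullet> v = frechet_derivative \<tau> (at w) v \<bullet> u"
proof -
  have wp: "norm y < eps" "y \<noteq> 0" if "y \<in> T" for y using punctured(2) T(2) that by blast+
  have eq: "Phi (zz (\<tau> y) y) = Phi (zz (0, 0) y)" if "y \<in> T" for y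
    using Phi_period[OF wp[OF that] \<tau>(2)[OF that], of "(0, 0)"] by (simp add: zero_prod_def[symmetric])
  obtain d where d: "d \<in> A" "Phi (zz (0, 0) w) \<in> fst d" using ex_chart by blast
  obtain Q1 where Q1: "zz (\<tau> w) w \<in> Q1" "local_symp Phi Q1 d"
    using local_symp_at[OF complete[OF wp(1)[OF w]] d(1)] d(2) eq[OF w] by metis
  obtain Q2 where Q2: "zz (0, 0) w \<in> Q2" "local_symp Phi Q2 d"
    using local_symp_at[OF complete[OF wp(1)[OF w]] d] by blast
  let ?D\<tau> = "frechet_derivative \<tau> (at w)"
  let ?D1 = "frechet_derivative (\<lambda>z. snd d (Phi z)) (at (zz (\<tau> w) w))"
  let ?D2 = "frechet_derivative (\<lambda>z. snd d (Phi z)) (at (zz (0, 0) w))"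
  have d1: "((\<lambda>y. zz (\<tau> y) y) has_derivative (\<lambda>v. zz (?D\<tau> v) v)) (at w)"
    by (rule has_derivative_zz[OF smooth_on_has_derivative[OF \<tau>(1) w] has_derivative_ident])
  have d2: "((\<lambda>y. zz (0, 0) y) has_derivative (\<lambda>v. zz 0 v)) (at w)"
    by (rule has_derivative_zz[OF has_derivative_const has_derivative_ident])
  have c1: "((\<lambda>y. snd d (Phi (zz (\<tau> y) y))) has_derivative (\<lambda>v. ?D1 (zz (?D\<tau> v) v))) (at w)"
    by (rule has_derivative_chain[OF d1 refl local_sympD(6)[OF Q1(2,1)]])
  have c2: "((\<lambda>y. snd d (Phi (zz (0, 0) y))) has_derivative (\<lambda>v. ?D2 (zz 0 v))) (at w)"
    by (rule has_derivative_chain[OF d2 refl local_sympD(6)[OF Q2(2,1)]])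
  have "((\<lambda>y. snd d (Phi (zz (0, 0) y))) has_derivative (\<lambda>v. ?D1 (zz (?D\<tau> v) v))) (at w)"
    by (rule has_derivative_transform_within_open[OF c1 T(1) w]) (simp add: eq)
  note un = has_derivative_unique[OF this c2]
  have e: "?D1 (zz (?D\<tau> v) v) = ?D2 (zz 0 v)" for v by (rule fun_cong[OF un])
  have "pairing std_form (zz (?D\<tau> u) u) (zz (?D\<tau> v) v) = pairing std_form (zz 0 u) (zz 0 v)"
    using local_sympD(5)[OF Q1(2,1), of "zz (?D\<tau> u) u" "zz (?D\<tau> v) v"] local_sympD(5)[OF Q2(2,1), of "zz 0 u" "zz 0 v"]
    unfolding e eq[OF w] by simp
  then show ?thesis unfolding pairing_zz by (simp add: inner_commute)
qed

text \<open>The construction of Arnold: the period (0, 2 pi) belongs to the action w_2, the period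
  \<tau> to a primitive of the closed period form divided by 2 pi, and the angles are flow times
  measured in the basis of the period lattice.\<close>

lemma ex_action_angle:
  assumes w0: "w0 \<in> punctured"
  obtains D \<Psi> f where "action_angle A Om H L (torus w0) D \<Psi> f"
proof -
  obtain r \<tau> where r: "r > 0" "ball w0 r \<subseteq> punctured" and \<tau>: "smooth_on \<tau> (ball w0 r)"
    "\<And>w. w \<in> ball w0 r \<Longrightarrow> period w (\<tau> w)"
    using period_branch[OF w0] by metis
  have wp: "norm w < eps" "w \<noteq> 0" if "w \<in> ball w0 r" for w using r(2) that punctured(2) by blast+
  have sym: "frechet_derivative \<tau> (at w) u \<bullet> v = frechet_derivative \<tau> (at w) v \<bullet> u" if "w \<in> ball w0 r" for w u v
    by (rule period_closed[OF open_ball r(2) \<tau> that])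
  have pos: "fst (\<tau> w) > 0" if "w \<in> ball w0 r" for w
    using period_time(2)[OF wp[OF that] \<tau>(2)[OF that]] t0_pos by simp
  have star: "x - (1 - s) *\<^sub>R (x - w0) \<in> ball w0 r" if "x \<in> ball w0 r" "0 \<le> s" "s \<le> 1" for x s
  proof -
    have "w0 \<in> ball w0 r" using r(1) by simp
    from convexD_alt[OF convex_ball this that(1,2,3)] show ?thesis by (simp add: algebra_simps)
  qed
  obtain S where S: "smooth_on S (ball w0 r)" "\<And>x v. x \<in> ball w0 r \<Longrightarrow> frechet_derivative S (at x) v = \<tau> x \<bullet> v"
    using primitive_along[OF open_ball linear_ident refl star \<tau>(1) sym] by blast
  \<comment> \<open>The differentials of the two actions are the two basic periods divided by 2 pi.
    They are independent because \<tau>_1 > 0.\<close>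
  define a where "a w = (snd w, inverse (2 * pi) * S w)" for w
  have sa: "smooth_on a (ball w0 r)"
    unfolding a_def by (intro smooth_on_Pair smooth_on_mult smooth_on_snd smooth_on_ident smooth_on_const open_ball S(1))
  have da: "frechet_derivative a (at w) v = (snd v, inverse (2 * pi) * (\<tau> w \<bullet> v))" if w: "w \<in> ball w0 r" for w v
  proof -
    have "(a has_derivative (\<lambda>v. (snd v, inverse (2 * pi) * frechet_derivative S (at w) v))) (at w)"
      unfolding a_def
      by (intro has_derivative_Pair has_derivative_snd has_derivative_ident has_derivative_mult_right
          smooth_on_has_derivative[OF S(1) w])
    from fun_cong[OF frechet_derivative_at[OF this], of v] show ?thesis using S(2)[OF w] by simp
  qed
  have w0b: "w0 \<in> ball w0 r" using r(1) by simp
  have "inj (frechet_derivative a (at w0))"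
  proof -
    have "v = 0" if "frechet_derivative a (at w0) v = 0" for v
      using that pos[OF w0b] unfolding da[OF w0b] by (auto simp: prod_eq_iff inner_prod_def)
    then show ?thesis
      using linear_injective_0[OF has_derivative_linear[OF smooth_on_has_derivative[OF sa w0b]]] by blast
  qed
  from smooth_inverse_function_prod[OF open_ball sa w0b this]
  obtain W where W: "W \<subseteq> ball w0 r" "w0 \<in> W" "smooth_diffeo a W" by blast
  note aD = smooth_diffeoD[OF W(3)]
  define D where "D = a ` W"
  define b where "b = inv_into W a"
  have b: "smooth_diffeo b D" "b ` D = W" using smooth_diffeo_inv[OF W(3)] unfolding b_def D_def by blast+
  note bD = smooth_diffeoD[OF b(1)]
  have ba: "b (a w) = w" if "w \<in> W" for w unfolding b_def by (rule inv_into_f_f[OF aD(3) that])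
  have ab: "a (b I) = I" "b I \<in> W" if "I \<in> D" for I
    using that unfolding b_def D_def by (simp_all add: f_inv_into_f inv_into_into)
  have WV: "W \<subseteq> V" using V_eps wp(1) W(1) by blast
  define f where "f I = g (b I)" for I
  have f: "smooth_diffeo f D" unfolding f_def by (rule smooth_diffeo_compose[OF b(1) g]) (use b(2) WV in simp)
  define X where "X = {z :: real^4. act z \<in> D}"
  have act: "bounded_linear act" unfolding act_def[abs_def] by (intro bounded_linear_Pair bounded_linear_vec_nth)
  have X: "open X" unfolding X_def using open_vimage[OF bD(1) linear_continuous_on[OF act]] by (simp add: vimage_def)
  define \<omega> where "\<omega> z = b (act z)" for z
  have s\<omega>: "smooth_on \<omega> X" unfolding \<omega>_def
    by (rule smooth_on_compose[OF X bD(1) smooth_on_bounded_linear[OF X act] bD(4)]) (auto simp: X_def)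
  have \<omega>W: "\<omega> z \<in> W" if "z \<in> X" for z using ab(2) that by (simp add: \<omega>_def X_def)
  have s\<tau>: "smooth_on (\<lambda>z. \<tau> (\<omega> z)) X"
    by (rule smooth_on_compose[OF X open_ball s\<omega> \<tau>(1)]) (use \<omega>W W(1) in blast)
  \<comment> \<open>The flow time \<theta>_1 (0, 1) + (\<theta>_2 / 2 pi) \<tau>, taken over the
    value that belongs to the actions: increasing an angle by 2 pi adds one lattice vector.\<close>
  define tt where "tt z = (inverse (2 * pi) * (z$2 * fst (\<tau> (\<omega> z))), z$1 + inverse (2 * pi) * (z$2 * snd (\<tau> (\<omega> z))))" for z :: "real^4"
  define tz where "tz z = zz (tt z) (\<omega> z)" for z
  have stt: "smooth_on tt X"
    unfolding tt_def
    by (intro smooth_on_Pair smooth_on_add smooth_on_mult smooth_on_const smooth_on_nth smooth_on_ident X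
        smooth_on_fst smooth_on_snd s\<tau>)
  have stz: "smooth_on tz X" unfolding tz_def by (rule smooth_zz[OF X stt s\<omega>])
  define \<Psi> where "\<Psi> z = Phi (tz z)" for z
  have we: "norm (\<omega> z) < eps" "\<omega> z \<noteq> 0" "period (\<omega> z) (\<tau> (\<omega> z))" if "z \<in> X" for z
    using wp \<tau>(2) \<omega>W[OF that] W(1) by blast+
  have tzd: "tz z \<in> dom" if "z \<in> X" for z unfolding tz_def by (rule complete[OF we(1)[OF that]])
  have J\<Psi>: "J (\<Psi> z) = \<omega> z" if "z \<in> X" for z using J_Phi[OF tzd[OF that]] unfolding \<Psi>_def by (simp add: tz_def)
  have cont: "continuous_on X \<Psi>" unfolding \<Psi>_def
    by (rule continuous_on_compose2[OF continuous_Phi smooth_on_continuous[OF stz]]) (use tzd in blast)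
  show thesis
  proof (rule that[of D \<Psi> f], unfold action_angle_def, intro conjI)
    show "smooth_diffeo f D" by (rule f)
    show "smooth_map_into A {z. act z \<in> D} \<Psi>"
      unfolding smooth_map_into_def X_def[symmetric]
    proof (intro conjI ballI cont)
      fix c assume c: "c \<in> A"
      show "smooth_on (snd c \<circ> \<Psi>) {z \<in> X. \<Psi> z \<in> fst c}"
      proof (rule smooth_on_local)
        fix z assume z: "z \<in> {z \<in> X. \<Psi> z \<in> fst c}"
        then have zX: "z \<in> X" by simp
        obtain Q where Q: "tz z \<in> Q" "local_symp Phi Q c"
          using local_symp_at[OF tzd[OF zX] c] z unfolding \<Psi>_def by blast
        let ?Y = "X \<inter> tz -` Q"
        have Y: "open ?Y" by (rule continuous_open_preimage[OF smooth_on_continuous[OF stz] X local_sympD(2)[OF Q(2)]])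
        have "smooth_on (\<lambda>z. snd c (Phi (tz z))) ?Y"
          by (rule smooth_on_compose[OF Y local_sympD(2)[OF Q(2)] smooth_on_subset[OF stz] local_sympD(4)[OF Q(2)]]) auto
        moreover have "(\<lambda>z. snd c (Phi (tz z))) = snd c \<circ> \<Psi>" by (rule ext) (simp add: \<Psi>_def)
        ultimately show "\<exists>T. open T \<and> z \<in> T \<and> smooth_on (snd c \<circ> \<Psi>) T" using Y zX Q(1) by auto
      qed
    qed
    show "\<forall>z z'. act z \<in> D \<and> act z' \<in> D \<longrightarrow> (\<Psi> z = \<Psi> z' \<longleftrightarrow> act z = act z' \<and> same_angles z z')"
    proof (intro allI impI iffI)
      fix z z' assume "act z \<in> D \<and> act z' \<in> D"
      then have zX: "z \<in> X" "z' \<in> X" by (simp_all add: X_def)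
      let ?\<tau> = "\<tau> (\<omega> z)"
      have tpos: "fst ?\<tau> > 0" using pos \<omega>W[OF zX(1)] W(1) by blast
      {
        assume eq: "\<Psi> z = \<Psi> z'"
        then have \<omega>: "\<omega> z' = \<omega> z" using J\<Psi> zX by metis
        then have ac: "act z = act z'" using ab(1) zX unfolding \<omega>_def X_def by (metis mem_Collect_eq)
        have "Phi (zz (tt z') (\<omega> z)) = Phi (zz (tt z) (\<omega> z))" using eq \<omega> by (simp add: \<Psi>_def tz_def)
        from Phi_isotropy[OF we[OF zX(1)] this]
        obtain n k :: int where nk: "tt z' - tt z = of_int n *\<^sub>R ?\<tau> + (0, 2 * pi * of_int k)" by blast
        have "inverse (2 * pi) * ((z'$2 - z$2) * fst ?\<tau>) = of_int n * fst ?\<tau>"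
          using arg_cong[OF nk, of fst] \<omega> by (simp add: tt_def algebra_simps)
        then have "fst ?\<tau> * (z'$2 - z$2 - 2 * pi * of_int n) = 0" by (simp add: field_simps)
        then have 2: "z'$2 = z$2 + 2 * pi * of_int n" using tpos by simp
        have "z'$1 - z$1 + inverse (2 * pi) * ((z'$2 - z$2) * snd ?\<tau>) = of_int n * snd ?\<tau> + 2 * pi * of_int k"
          using arg_cong[OF nk, of snd] \<omega> by (simp add: tt_def algebra_simps)
        then have 1: "z'$1 = z$1 + 2 * pi * of_int k" unfolding 2 by (simp add: field_simps)
        show "act z = act z' \<and> same_angles z z'" using ac 1 2 unfolding same_angles_def by blast
      next
        assume s: "act z = act z' \<and> same_angles z z'"
        then obtain k n :: int where kn: "z'$1 = z$1 + 2 * pi * of_int k" "z'$2 = z$2 + 2 * pi * of_int n"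
          unfolding same_angles_def by blast
        have \<omega>: "\<omega> z' = \<omega> z" using s by (simp add: \<omega>_def)
        have "tt z' = of_int n *\<^sub>R ?\<tau> + (0, 2 * pi * of_int k) + tt z"
          unfolding tt_def \<omega> prod_eq_iff using kn by (simp add: field_simps)
        then show "\<Psi> z = \<Psi> z'"
          using Phi_lattice[OF we[OF zX(1)], of n k "tt z"] \<omega> by (simp add: \<Psi>_def tz_def)
      }
    qed
    show "\<forall>c\<in>A. \<forall>z. act z \<in> D \<and> \<Psi> z \<in> fst c \<longrightarrow>
        (let \<delta> = frechet_derivative (snd c \<circ> \<Psi>) (at z)
         in \<forall>u v. pairing (Om c (snd c (\<Psi> z))) (\<delta> u) (\<delta> v) = pairing std_form u v)"
    proof (intro ballI allI impI, unfold Let_def, intro allI)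
      fix c z u v assume c: "c \<in> A" and z: "act z \<in> D \<and> \<Psi> z \<in> fst c"
      then have zX: "z \<in> X" by (simp add: X_def)
      obtain Q where Q: "tz z \<in> Q" "local_symp Phi Q c"
        using local_symp_at[OF tzd[OF zX] c] z unfolding \<Psi>_def by blast
      let ?w = "\<omega> z" and ?D\<omega> = "frechet_derivative \<omega> (at z)"
      have wb: "?w \<in> ball w0 r" using \<omega>W[OF zX] W(1) by blast
      let ?D\<tau> = "\<lambda>u. frechet_derivative \<tau> (at ?w) (?D\<omega> u)"
      have d\<omega>: "(\<omega> has_derivative ?D\<omega>) (at z)" by (rule smooth_on_has_derivative[OF s\<omega> zX])
      have d\<tau>: "((\<lambda>z. \<tau> (\<omega> z)) has_derivative ?D\<tau>) (at z)"
        by (rule has_derivative_chain[OF d\<omega> refl smooth_on_has_derivative[OF \<tau>(1) wb]])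
      have nth: "((\<lambda>z::real^4. z$i) has_derivative (\<lambda>u. u$i)) (at z)" for i
        by (rule bounded_linear_imp_has_derivative[OF bounded_linear_vec_nth])
      define Dt where "Dt u = (inverse (2 * pi) * (z$2 * fst (?D\<tau> u) + u$2 * fst (\<tau> ?w)),
          u$1 + inverse (2 * pi) * (z$2 * snd (?D\<tau> u) + u$2 * snd (\<tau> ?w)))" for u :: "real^4"
      have dtt: "(tt has_derivative Dt) (at z)"
        unfolding tt_def[abs_def] Dt_def[abs_def]
        by (intro has_derivative_Pair has_derivative_add has_derivative_mult_right has_derivative_mult nth
            has_derivative_fst[OF d\<tau>] has_derivative_snd[OF d\<tau>])
      have dtz: "(tz has_derivative (\<lambda>u. zz (Dt u) (?D\<omega> u))) (at z)"
        unfolding tz_def[abs_def] by (rule has_derivative_zz[OF dtt d\<omega>])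
      have "((\<lambda>z. snd c (Phi (tz z))) has_derivative
          (\<lambda>u. frechet_derivative (\<lambda>z. snd c (Phi z)) (at (tz z)) (zz (Dt u) (?D\<omega> u)))) (at z)"
        by (rule has_derivative_chain[OF dtz refl local_sympD(6)[OF Q(2,1)]])
      note d\<Psi> = frechet_derivative_at[OF this, symmetric]
      have o: "snd c \<circ> \<Psi> = (\<lambda>z. snd c (Phi (tz z)))" by (rule ext) (simp add: \<Psi>_def)
      have fd: "frechet_derivative (snd c \<circ> \<Psi>) (at z) =
          (\<lambda>u. frechet_derivative (\<lambda>z. snd c (Phi z)) (at (tz z)) (zz (Dt u) (?D\<omega> u)))"
        unfolding o by (rule d\<Psi>)
      have "pairing (Om c (snd c (\<Psi> z))) (frechet_derivative (snd c \<circ> \<Psi>) (at z) u) (frechet_derivative (snd c \<circ> \<Psi>) (at z) v)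
          = pairing std_form (zz (Dt u) (?D\<omega> u)) (zz (Dt v) (?D\<omega> v))"
        unfolding fd using local_sympD(5)[OF Q(2,1)] by (simp add: \<Psi>_def)
      also have "\<dots> = Dt u \<bullet> ?D\<omega> v - ?D\<omega> u \<bullet> Dt v" by (rule pairing_zz)
      also have "\<dots> = pairing std_form u v"
      proof -
        have q: "snd (?D\<omega> u) = u$3 \<and> \<tau> ?w \<bullet> ?D\<omega> u = 2 * pi * u$4" for u
        proof -
          have "((\<lambda>z. a (\<omega> z)) has_derivative (\<lambda>u. frechet_derivative a (at ?w) (?D\<omega> u))) (at z)"
            by (rule has_derivative_chain[OF d\<omega> refl smooth_on_has_derivative[OF sa wb]])
          then have "(act has_derivative (\<lambda>u. frechet_derivative a (at ?w) (?D\<omega> u))) (at z)"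
            by (rule has_derivative_transform_within_open[OF _ X zX]) (simp add: \<omega>_def X_def ab)
          from has_derivative_unique[OF this bounded_linear_imp_has_derivative[OF act]]
          have "frechet_derivative a (at ?w) (?D\<omega> u) = act u" by (simp add: fun_eq_iff)
          then show ?thesis unfolding da[OF wb] act_def by (auto simp: field_simps)
        qed
        \<comment> \<open>The time also depends on the actions through \<tau>. This contributes
          terms proportional to \<theta>_2, which cancel by the symmetry of the derivative of
          \<tau>.\<close>
        have s: "?D\<tau> u \<bullet> ?D\<omega> v = ?D\<tau> v \<bullet> ?D\<omega> u" by (rule sym[OF wb])
        have e: "Dt u \<bullet> y = u$1 * snd y + inverse (2 * pi) * (z$2 * (?D\<tau> u \<bullet> y) + u$2 * (\<tau> ?w \<bullet> y))" for u y
          by (simp add: Dt_def inner_prod_def algebra_simps)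
        have "Dt u \<bullet> ?D\<omega> v - Dt v \<bullet> ?D\<omega> u = u$1 * v$3 + u$2 * v$4 - (v$1 * u$3 + v$2 * u$4)"
          unfolding e using q[of u] q[of v] s by (simp add: field_simps)
        then show ?thesis by (simp add: pairing_std inner_commute algebra_simps)
      qed
      finally show "pairing (Om c (snd c (\<Psi> z))) (frechet_derivative (snd c \<circ> \<Psi>) (at z) u)
          (frechet_derivative (snd c \<circ> \<Psi>) (at z) v) = pairing std_form u v" .
    qed
    show "\<forall>z. act z \<in> D \<longrightarrow> em_map H L (\<Psi> z) = f (act z)"
    proof (intro allI impI)
      fix z assume "act z \<in> D"
      then have zX: "z \<in> X" by (simp add: X_def)
      have "\<Psi> z \<in> U" unfolding \<Psi>_def using Phi_regular[OF tzd[OF zX]] by blast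
      then show "em_map H L (\<Psi> z) = f (act z)" using J_in(2)[of "\<Psi> z"] J\<Psi>[OF zX] by (simp add: f_def \<omega>_def)
    qed
    show "\<exists>I\<in>D. torus w0 = \<Psi> ` {z. act z = I}"
    proof (rule bexI[of _ "a w0"])
      show aD0: "a w0 \<in> D" using W(2) by (simp add: D_def)
      have \<omega>0: "\<omega> z = w0" if "act z = a w0" for z using that ba[OF W(2)] by (simp add: \<omega>_def)
      show "torus w0 = \<Psi> ` {z. act z = a w0}"
      proof
        show "\<Psi> ` {z. act z = a w0} \<subseteq> torus w0"
        proof
          fix p assume "p \<in> \<Psi> ` {z. act z = a w0}"
          then obtain z where "p = Phi (zz (tt z) w0)" using \<omega>0 unfolding \<Psi>_def tz_def by auto
          then show "p \<in> torus w0" unfolding torus_def by (metis rangeI)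
        qed
        show "torus w0 \<subseteq> \<Psi> ` {z. act z = a w0}"
        proof
          fix p assume "p \<in> torus w0"
          then obtain t where t: "p = Phi (zz t w0)" unfolding torus_def by blast
          let ?z2 = "2 * pi * fst t / fst (\<tau> w0)"
          let ?z = "zz (snd t - inverse (2 * pi) * (?z2 * snd (\<tau> w0)), ?z2) (a w0)"
          have az: "act ?z = a w0" by (simp add: act_def)
          have "tt ?z = t" using pos[OF w0b] unfolding tt_def \<omega>0[OF az] by (simp add: prod_eq_iff)
          then have "\<Psi> ?z = p" using t \<omega>0[OF az] by (simp add: \<Psi>_def tz_def)
          then show "p \<in> \<Psi> ` {z. act z = a w0}" using az by (metis (mono_tags) image_eqI mem_Collect_eq)
        qed
      qed
    qed
  qed
qed

end

section \<open>Comparison with arbitrary action-angle coordinates\<close>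

lemma isCont_tendsto_nhds: "isCont f t \<Longrightarrow> (f \<longlongrightarrow> f t) (nhds t)"
  by (simp add: continuous_at tendsto_at_iff_tendsto_nhds)

text \<open>\<open>Q u s\<close> says that s is the affine coordinate of a line with slope (A2 + W
  B2) / (A1 + W B1). The derivative of this projective function of W is W' times the determinant,
  divided by the square of the denominator.\<close>

lemma slope_stationary:
  fixes W :: "real \<Rightarrow> real"
  assumes Q: "\<forall>\<^sub>F u in nhds t. \<forall>s. Q u s \<longleftrightarrow> A1 + W u * B1 \<noteq> 0 \<and> s * (A1 + W u * B1) = A2 + W u * B2"
    and W: "(W has_real_derivative W') (at t)"
  shows "(\<exists>s. Q t s) \<and> ((\<lambda>u. THE s. Q u s) has_real_derivative 0) (at t) \<longleftrightarrow>
    A1 + W t * B1 \<noteq> 0 \<and> W' * (A1 * B2 - A2 * B1) = 0"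
proof (cases "A1 + W t * B1 = 0")
  case True
  then show ?thesis using eventually_nhds_x_imp_x[OF Q] by simp
next
  case False
  define x where "x u = A1 + W u * B1" for u
  define y where "y u = A2 + W u * B2" for u
  have Qt: "Q t (y t / x t)" using eventually_nhds_x_imp_x[OF Q] False by (simp add: x_def y_def)
  have dx: "(x has_real_derivative W' * B1) (at t)" and dy: "(y has_real_derivative W' * B2) (at t)"
    unfolding x_def y_def by (auto intro!: derivative_eq_intros W)
  have x0: "x t \<noteq> 0" using False by (simp add: x_def)
  have "(x \<longlongrightarrow> x t) (nhds t)" by (rule isCont_tendsto_nhds[OF DERIV_isCont[OF dx]])
  then have "\<forall>\<^sub>F u in nhds t. x u \<noteq> 0" by (rule tendsto_imp_eventually_ne) (rule x0)
  then have ev: "\<forall>\<^sub>F u in nhds t. (THE s. Q u s) = y u / x u"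
    using Q
  proof eventually_elim
    case (elim u)
    have "s = y u / x u \<longleftrightarrow> s * x u = y u" for s using elim(1) by (auto simp: field_simps)
    then have "Q u s \<longleftrightarrow> s = y u / x u" for s using elim by (simp add: x_def y_def)
    then show ?case by simp
  qed
  have d: "((\<lambda>u. y u / x u) has_real_derivative (W' * B2 * x t - y t * (W' * B1)) / (x t * x t)) (at t)"
    by (rule DERIV_divide[OF dy dx x0])
  have num: "W' * B2 * x t - y t * (W' * B1) = W' * (A1 * B2 - A2 * B1)"
    by (simp add: x_def y_def algebra_simps)
  have "((\<lambda>u. THE s. Q u s) has_real_derivative 0) (at t) \<longleftrightarrow> ((\<lambda>u. y u / x u) has_real_derivative 0) (at t)"
    by (rule DERIV_cong_ev[OF refl ev refl])
  also have "\<dots> \<longleftrightarrow> W' * (A1 * B2 - A2 * B1) = 0"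
    using d DERIV_unique[OF d, of 0] x0 unfolding num by auto
  finally show ?thesis using Qt False by blast
qed

lemma span_singleton_slope:
  fixes k x y s :: real
  assumes "k \<noteq> 0"
  shows "(1, s) \<in> span {k *\<^sub>R (x, y)} \<longleftrightarrow> x \<noteq> 0 \<and> s * x = y"
    "(s, 1) \<in> span {k *\<^sub>R (x, y)} \<longleftrightarrow> y \<noteq> 0 \<and> s * y = x"
proof -
  have *: "(a, b) \<in> span {k *\<^sub>R (x, y)} \<longleftrightarrow> (\<exists>r. a = r * x \<and> b = r * y)" for a b
  proof
    assume "(a, b) \<in> span {k *\<^sub>R (x, y)}"
    then obtain q where q: "(a, b) = q *\<^sub>R k *\<^sub>R (x, y)" unfolding span_singleton by blast
    show "\<exists>r. a = r * x \<and> b = r * y" by (rule exI[of _ "q * k"]) (use q in simp)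
  next
    assume "\<exists>r. a = r * x \<and> b = r * y"
    then obtain r where "a = r * x" "b = r * y" by blast
    then have "(a, b) = (r / k) *\<^sub>R k *\<^sub>R (x, y)" using assms by simp
    then show "(a, b) \<in> span {k *\<^sub>R (x, y)}" unfolding span_singleton by blast
  qed
  show "(1, s) \<in> span {k *\<^sub>R (x, y)} \<longleftrightarrow> x \<noteq> 0 \<and> s * x = y"
    unfolding * by (cases "x = 0") (auto simp: field_simps intro: exI[of _ "1 / x"])
  show "(s, 1) \<in> span {k *\<^sub>R (x, y)} \<longleftrightarrow> y \<noteq> 0 \<and> s * y = x"
    unfolding * by (cases "y = 0") (auto simp: field_simps intro: exI[of _ "1 / y"])
qed

text \<open>A projective map with non-zero determinant has no critical points, and at each point at
  least one of the two affine charts sees the line. So being stationary in either chart means the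
  same.\<close>

lemma rp1_stationary_iff:
  assumes \<gamma>: "\<forall>\<^sub>F u in nhds t. \<exists>k. k \<noteq> 0 \<and> \<gamma> u = span {k *\<^sub>R (A1 + W u * B1, A2 + W u * B2)}"
    and W: "(W has_real_derivative W') (at t)" and det: "A1 * B2 - A2 * B1 \<noteq> 0"
  shows "rp1_stationary \<gamma> t \<longleftrightarrow> W' = 0"
proof -
  have 1: "\<forall>\<^sub>F u in nhds t. \<forall>s. (1, s) \<in> \<gamma> u \<longleftrightarrow> A1 + W u * B1 \<noteq> 0 \<and> s * (A1 + W u * B1) = A2 + W u * B2"
    using \<gamma> by eventually_elim (metis span_singleton_slope(1))
  have 2: "\<forall>\<^sub>F u in nhds t. \<forall>s. (s, 1) \<in> \<gamma> u \<longleftrightarrow> A2 + W u * B2 \<noteq> 0 \<and> s * (A2 + W u * B2) = A1 + W u * B1"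
    using \<gamma> by eventually_elim (metis span_singleton_slope(2))
  have "A1 + W t * B1 \<noteq> 0 \<or> A2 + W t * B2 \<noteq> 0"
  proof (rule ccontr)
    assume "\<not> ?thesis"
    then have "A1 = - W t * B1" "A2 = - W t * B2" by auto
    then show False using det by simp
  qed
  then show ?thesis
    unfolding rp1_stationary_def slope_stationary[OF 1 W] slope_stationary[OF 2 W]
    using det by (auto simp: algebra_simps)
qed

lemma continuous_Ints_eventually_const:
  fixes k :: "real \<Rightarrow> real"
  assumes c: "isCont k t" and Z: "\<forall>\<^sub>F u in nhds t. k u \<in> \<int>"
  shows "\<forall>\<^sub>F u in nhds t. k u = k t"
proof -
  have "(k \<longlongrightarrow> k t) (nhds t)" by (rule isCont_tendsto_nhds[OF c])
  then have "\<forall>\<^sub>F u in nhds t. dist (k u) (k t) < 1" by (rule tendstoD) simp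
  then show ?thesis using Z
  proof eventually_elim
    case (elim u)
    obtain z :: int where z: "k u - k t = of_int z"
      using Ints_diff[OF elim(2) eventually_nhds_x_imp_x[OF Z]] by (auto elim: Ints_cases)
    have "z = 0" using elim(1) unfolding dist_real_def z by linarith
    then show ?case using z by simp
  qed
qed

lemma bounded_linear_act: "bounded_linear act"
  unfolding act_def[abs_def] by (intro bounded_linear_Pair bounded_linear_vec_nth)

context integrable_system
begin

lemma action_angle_local_symp:
  assumes AA: "action_angle A Om H L T D \<Psi> f" and D1: "open D1" "D1 \<subseteq> D" and c: "c \<in> A"
  shows "local_symp \<Psi> {z. act z \<in> D1 \<and> \<Psi> z \<in> fst c} c"
proof -
  let ?S = "{z. act z \<in> D}"
  have fD: "smooth_diffeo f D" and sm: "smooth_map_into A ?S \<Psi>"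
    and sy: "\<And>z u v. act z \<in> D \<Longrightarrow> \<Psi> z \<in> fst c \<Longrightarrow>
      pairing (Om c (snd c (\<Psi> z))) (frechet_derivative (snd c \<circ> \<Psi>) (at z) u) (frechet_derivative (snd c \<circ> \<Psi>) (at z) v)
        = pairing std_form u v"
    using AA c unfolding action_angle_def Let_def by blast+
  have o: "(\<lambda>z. snd c (\<Psi> z)) = snd c \<circ> \<Psi>" by (rule ext) simp
  have S: "open (act -` D1)" by (rule open_vimage[OF D1(1) linear_continuous_on[OF bounded_linear_act]])
  have "continuous_on (act -` D1) \<Psi>"
    by (rule continuous_on_subset[of ?S]) (use sm D1(2) in \<open>auto simp: smooth_map_into_def\<close>)
  from continuous_open_preimage[OF this S chartD(1)[OF c]]
  have 1: "open {z. act z \<in> D1 \<and> \<Psi> z \<in> fst c}" by (simp add: vimage_def Int_def)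
  have 2: "smooth_on (snd c \<circ> \<Psi>) {z. act z \<in> D1 \<and> \<Psi> z \<in> fst c}"
    by (rule smooth_on_subset[of _ "{z \<in> ?S. \<Psi> z \<in> fst c}"]) (use sm D1(2) c in \<open>auto simp: smooth_map_into_def\<close>)
  show ?thesis
    unfolding local_symp_def o using c 1 2 sy D1(2) by auto
qed

lemma local_symp_surj:
  assumes F: "local_symp F Q d" and z: "z \<in> Q"
  shows "surj (frechet_derivative (\<lambda>z. snd d (F z)) (at z))"
proof (rule linear_injective_imp_surjective)
  note S = local_sympD[OF F]
  show lin: "linear (frechet_derivative (\<lambda>z. snd d (F z)) (at z))" by (rule has_derivative_linear[OF S(6)[OF z]])
  have "v = 0" if v: "frechet_derivative (\<lambda>z. snd d (F z)) (at z) v = 0" for v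
  proof (rule pairing_std_nondegenerate)
    fix u show "pairing std_form v u = 0" using S(5)[OF z, of v u] v by (simp add: pairing_def)
  qed
  then show "inj (frechet_derivative (\<lambda>z. snd d (F z)) (at z))" using linear_injective_0[OF lin] by blast
qed simp

text \<open>If b expresses the integrals \<open>J\<close> through the actions, the Hamiltonian t . b
  moves each angle with speed t . db/dI_i. In arbitrary action-angle coordinates the joint flow is
  therefore linear in the angles, and \<open>orbit_mapI_derivative\<close> makes this an orbit
  map.\<close>

lemma action_angle_orbit_map:
  assumes AA: "action_angle A Om H L T D \<Psi> f" and D1: "open D1" "D1 \<subseteq> D"
    and b: "smooth_on b D1" "\<And>I. I \<in> D1 \<Longrightarrow> f I = g (b I) \<and> b I \<in> V"
    and I: "I \<in> D1" and surj: "surj (frechet_derivative b (at I))"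
  shows "orbit_map l2 (\<lambda>t. \<Psi> (zz (t \<bullet> frechet_derivative b (at I) (1, 0), t \<bullet> frechet_derivative b (at I) (0, 1)) I)) UNIV"
    (is "orbit_map l2 (\<lambda>t. \<Psi> (zz (?P t) I)) UNIV")
proof (rule orbit_mapI_derivative[OF tangential_l2 convex_UNIV])
  let ?B = "frechet_derivative b (at I)"
  have em: "em_map H L (\<Psi> z) = f (act z)" if "act z \<in> D" for z using AA that unfolding action_angle_def by blast
  have U: "\<Psi> z \<in> U" "J (\<Psi> z) = b (act z)" if z: "act z \<in> D1" for z
  proof -
    have "em_map H L (\<Psi> z) = g (b (act z))" "b (act z) \<in> V" using em b(2)[OF z] z D1(2) by auto
    then show "\<Psi> z \<in> U" "J (\<Psi> z) = b (act z)" using J_eqI by blast+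
  qed
  have act: "act (zz t I) = I" for t by (simp add: act_def)
  have linB: "linear ?B" by (rule has_derivative_linear[OF smooth_on_has_derivative[OF b(1) I]])
  have linP: "((\<lambda>t. zz (?P t) I) has_derivative (\<lambda>a. zz (?P a) 0)) (at t within S)" for t S
    by (intro has_derivative_zz has_derivative_Pair has_derivative_inner_left has_derivative_ident has_derivative_const)
  have cont\<Psi>: "continuous_on {z. act z \<in> D} \<Psi>"
    using AA unfolding action_angle_def smooth_map_into_def by blast
  show "continuous_on UNIV (\<lambda>t. \<Psi> (zz (?P t) I))"
    by (rule continuous_on_compose2[OF cont\<Psi>])
      (use has_derivative_continuous[OF linP] I D1(2) in \<open>auto simp: continuous_on_eq_continuous_within act\<close>)
  have dJ: "frechet_derivative (in_chart c J) (at (snd c (\<Psi> z))) (frechet_derivative (\<lambda>z. snd c (\<Psi> z)) (at z) u) = ?B (act u)"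
    if c: "c \<in> A" "\<Psi> z \<in> fst c" and z: "act z = I" for c z u
  proof -
    let ?Q = "{z. act z \<in> D1 \<and> \<Psi> z \<in> fst c}"
    note S = local_sympD[OF action_angle_local_symp[OF AA D1 c(1)]]
    have zQ: "z \<in> ?Q" using z c I by simp
    have zU: "\<Psi> z \<in> U" using U(1) z I by simp
    have 1: "((\<lambda>z. in_chart c J (snd c (\<Psi> z))) has_derivative
        (\<lambda>u. frechet_derivative (in_chart c J) (at (snd c (\<Psi> z))) (frechet_derivative (\<lambda>z. snd c (\<Psi> z)) (at z) u))) (at z)"
      by (rule has_derivative_chain[OF S(6)[OF zQ] refl has_derivative_J[OF c(1,2) zU]])
    have 2: "((\<lambda>z. b (act z)) has_derivative (\<lambda>u. ?B (act u))) (at z)"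
      by (rule has_derivative_chain[OF bounded_linear_imp_has_derivative[OF bounded_linear_act] z
            smooth_on_has_derivative[OF b(1) I]])
    have "((\<lambda>z. b (act z)) has_derivative
        (\<lambda>u. frechet_derivative (in_chart c J) (at (snd c (\<Psi> z))) (frechet_derivative (\<lambda>z. snd c (\<Psi> z)) (at z) u))) (at z)"
      by (rule has_derivative_transform_within_open[OF 1 S(2) zQ]) (simp add: in_chart_apply' c(1) U(2))
    note un = has_derivative_unique[OF this 2]
    show ?thesis by (rule fun_cong[OF un])
  qed
  fix t :: "real \<times> real"
  let ?z = "zz (?P t) I"
  obtain c where c: "c \<in> A" "\<Psi> ?z \<in> fst c" using ex_chart by blast
  note F = action_angle_local_symp[OF AA D1 c(1)]
  note S = local_sympD[OF F]
  have zQ: "?z \<in> {z. act z \<in> D1 \<and> \<Psi> z \<in> fst c}" using c(2) I by (simp add: act)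
  let ?\<delta> = "frechet_derivative (\<lambda>z. snd c (\<Psi> z)) (at ?z)"
  let ?J = "frechet_derivative (in_chart c J) (at (snd c (\<Psi> ?z)))"
  have zU: "\<Psi> ?z \<in> U" by (rule U(1)) (simp add: act I)
  have "surj ?J"
  proof (rule surjI)
    fix y
    show "?J (?\<delta> (zz 0 (inv ?B y))) = y" unfolding dJ[OF c act] by (simp add: act_def surj_f_inv_f[OF surj])
  qed
  then show "\<Psi> ?z \<in> U \<and> regular_point A H L (\<Psi> ?z)" using zU regular_point_iff[OF c zU] by blast
  have "((\<lambda>s. snd c (\<Psi> (zz (?P s) I))) has_derivative (\<lambda>a. ?\<delta> (zz (?P a) 0))) (at t)"
    by (rule has_derivative_chain[OF linP refl S(6)[OF zQ]])
  moreover have "pairing (Om c (snd c (\<Psi> ?z))) (?\<delta> (zz (?P a) 0)) y = l2 a $ 1 * fst (?J y) + l2 a $ 2 * snd (?J y)" for a y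
  proof -
    obtain u where u: "y = ?\<delta> u" using local_symp_surj[OF F zQ] by (metis surjD)
    have act_u: "act u = u$3 *\<^sub>R (1, 0) + u$4 *\<^sub>R (0, 1)" by (simp add: act_def)
    have "?J y = ?B (act u)" unfolding u by (rule dJ[OF c act])
    then have J: "?J y = u$3 *\<^sub>R ?B (1, 0) + u$4 *\<^sub>R ?B (0, 1)"
      unfolding act_u linear_add[OF linB] linear_scale[OF linB] .
    have "pairing (Om c (snd c (\<Psi> ?z))) (?\<delta> (zz (?P a) 0)) y = pairing std_form (zz (?P a) 0) u"
      unfolding u by (rule S(5)[OF zQ])
    also have "\<dots> = (a \<bullet> ?B (1, 0)) * u$3 + (a \<bullet> ?B (0, 1)) * u$4" by (simp add: pairing_std)
    finally show ?thesis unfolding J by (simp add: inner_prod_def algebra_simps)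
  qed
  ultimately show "\<exists>c E. c \<in> A \<and> \<Psi> ?z \<in> fst c \<and> ((\<lambda>s. snd c (\<Psi> (zz (?P s) I))) has_derivative E) (at t) \<and>
      (\<forall>a y. pairing (Om c (snd c (\<Psi> ?z))) (E a) y =
        l2 a $ 1 * fst (frechet_derivative (in_chart c J) (at (snd c (\<Psi> ?z))) y) +
        l2 a $ 2 * snd (frechet_derivative (in_chart c J) (at (snd c (\<Psi> ?z))) y))"
    using c by blast
qed

end

context focus_focus_system
begin

definition h1 :: "real \<times> real \<Rightarrow> real" where "h1 w = fst (frechet_derivative g (at w) (1, 0))"
definition h2 :: "real \<times> real \<Rightarrow> real" where "h2 w = fst (frechet_derivative g (at w) (0, 1))"

lemma fst_derivative_g:
  assumes "w \<in> V"
  shows "fst (frechet_derivative g (at w) v) = fst v * h1 w + snd v * h2 w"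
proof -
  have lin: "linear (frechet_derivative g (at w))"
    by (rule has_derivative_linear[OF smooth_on_has_derivative[OF gD(4) assms]])
  have "v = fst v *\<^sub>R (1, 0) + snd v *\<^sub>R (0, 1)" by (simp add: prod_eq_iff)
  then have "frechet_derivative g (at w) v = fst v *\<^sub>R frechet_derivative g (at w) (1, 0) + snd v *\<^sub>R frechet_derivative g (at w) (0, 1)"
    using linear_add[OF lin] linear_scale[OF lin] by metis
  then show ?thesis by (simp add: h1_def h2_def)
qed

lemma smooth_h: "smooth_on h1 V" "smooth_on h2 V"
  unfolding h1_def h2_def by (intro smooth_on_fst smooth_on_frechet_derivative gD(1,4))+

text \<open>The linear flow in the angles and the flow-out \<open>Phi\<close> are the same orbit map
  by uniqueness; the base point lies in \<open>N\<close>, so it belongs to the orbit known there. A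
  period of \<open>Phi\<close> must then shift the angles by multiples of 2 pi.\<close>

lemma action_angle_lattice:
  assumes AA: "action_angle A Om H L T D \<Psi> f" and D1: "open D1" "D1 \<subseteq> D"
    and b: "smooth_on b D1" "\<And>I. I \<in> D1 \<Longrightarrow> f I = g (b I) \<and> b I \<in> punctured"
    and I: "I \<in> D1" "\<Psi> (zz 0 I) \<in> N" and surj: "surj (frechet_derivative b (at I))"
    and per: "\<And>t. Phi (zz (s + t) (b I)) = Phi (zz t (b I))"
  shows "s \<bullet> frechet_derivative b (at I) (1, 0) / (2 * pi) \<in> \<int> \<and> s \<bullet> frechet_derivative b (at I) (0, 1) / (2 * pi) \<in> \<int>"
proof -
  let ?B = "frechet_derivative b (at I)"
  let ?\<gamma> = "\<lambda>t. \<Psi> (zz (t \<bullet> ?B (1, 0), t \<bullet> ?B (0, 1)) I)"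
  have w: "norm (b I) < eps" "b I \<noteq> 0" using b(2)[OF I(1)] punctured(2) by blast+
  have bV: "f I = g (b I) \<and> b I \<in> V" if "I \<in> D1" for I
    using b(2)[OF that] V_eps punctured(2) by blast
  have act: "act (zz t I) = I" for t by (simp add: act_def)
  have ID: "I \<in> D" using I(1) D1(2) by blast
  have "em_map H L (\<Psi> (zz 0 I)) = g (b I)"
    using AA ID bV[OF I(1)] unfolding action_angle_def by (metis act)
  then have J: "J (\<Psi> (zz 0 I)) = b I" using J_eqI(2) bV[OF I(1)] by blast
  have "\<Psi> (zz 0 I) \<noteq> m"
  proof
    assume "\<Psi> (zz 0 I) = m"
    then have "em_map H L m = g (b I)" using \<open>em_map H L (\<Psi> (zz 0 I)) = g (b I)\<close> by simp
    then have "g (b I) = g (0, 0)" using em_m by simp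
    then have "b I = (0, 0)" using inj_onD[OF gD(3)] bV[OF I(1)] V0 by blast
    then show False using w(2) by (simp add: zero_prod_def)
  qed
  then obtain a where a: "\<Psi> (zz 0 I) = Phi (zz a (b I))"
    using N_torus[OF I(2) J] unfolding torus_def by blast
  have o1: "orbit_map l2 ?\<gamma> UNIV" by (rule action_angle_orbit_map[OF AA D1 b(1) bV I(1) surj])
  have o2: "orbit_map l2 (\<lambda>t. Phi (zz (a + t) (b I))) UNIV"
    by (rule orbit_map_shift'[where T = UNIV, OF Phi_orbit_map]) (simp_all add: complete[OF w(1)])
  have "?\<gamma> 0 = Phi (zz (a + 0) (b I))" using a by (simp flip: zero_prod_def)
  then have eq: "?\<gamma> t = Phi (zz (a + t) (b I))" for t
    using orbit_map_unique[OF tangential_l2 o1 o2 connected_UNIV UNIV_I _ UNIV_I] by blast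
  have "?\<gamma> s = ?\<gamma> 0" unfolding eq using per[of a] by (simp add: add.commute)
  then have "same_angles (zz (s \<bullet> ?B (1, 0), s \<bullet> ?B (0, 1)) I) (zz (0 \<bullet> ?B (1, 0), 0 \<bullet> ?B (0, 1)) I)"
    using AA ID unfolding action_angle_def by (metis act)
  then obtain i j :: int where "s \<bullet> ?B (1, 0) + 2 * pi * of_int i = 0" "s \<bullet> ?B (0, 1) + 2 * pi * of_int j = 0"
    unfolding same_angles_def by auto
  then have "s \<bullet> ?B (1, 0) = - (2 * pi * of_int i)" "s \<bullet> ?B (0, 1) = - (2 * pi * of_int j)" by linarith+
  then have "s \<bullet> ?B (1, 0) / (2 * pi) = of_int (- i)" "s \<bullet> ?B (0, 1) / (2 * pi) = of_int (- j)" by simp_all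
  then show ?thesis by (metis Ints_of_int)
qed

text \<open>Writing \<open>dH\<close> in the basis of the period lattice expresses the frequency vector through two integer
  vectors, which are locally constant; the frequency ratio moves only through the coefficient
  \<open>(h2 / h1) \<tau>\<^sub>1 - \<tau>\<^sub>2\<close>.\<close>

lemma rotation_number_stationary_iff:
  assumes w0: "w0 \<in> punctured" and AA: "action_angle A Om H L (torus w0) D \<Psi> f"
    and r: "r > 0" "ball w0 r \<subseteq> punctured" and \<tau>: "smooth_on \<tau> (ball w0 r)" "\<And>w. w \<in> ball w0 r \<Longrightarrow> period w (\<tau> w)"
    and nz: "h1 w0 \<noteq> 0"
  shows "rp1_stationary (\<lambda>l. rotation_number D f (fst (g w0), l)) (snd (g w0)) \<longleftrightarrow>
    frechet_derivative (\<lambda>w. h2 w / h1 w * fst (\<tau> w) - snd (\<tau> w)) (at w0) (- h2 w0, h1 w0) = 0"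
proof -
  have pV: "punctured \<subseteq> V" using V_eps punctured(2) by blast
  define B where "B = ball w0 r \<inter> {w \<in> V. h1 w \<noteq> 0}"
  have "open (V \<inter> h1 -` (- {0}))"
    by (rule continuous_open_preimage[OF smooth_on_continuous[OF smooth_h(1)] gD(1)]) auto
  moreover have "B = ball w0 r \<inter> (V \<inter> h1 -` (- {0}))" unfolding B_def by auto
  ultimately have oB: "open B" by auto
  have w0V: "w0 \<in> V" using w0 pV by blast
  have w0B: "w0 \<in> B" using r(1) nz w0V by (simp add: B_def)
  have BV: "B \<subseteq> V" and Bp: "B \<subseteq> punctured" using r(2) by (auto simp: B_def)
  have ogB: "open (g ` B)" by (rule smooth_diffeoD(2)[OF smooth_diffeo_subset[OF g oB BV]])
  have f: "smooth_diffeo f D" using AA unfolding action_angle_def by blast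
  note fD = smooth_diffeoD[OF f]
  define D1 where "D1 = D \<inter> f -` (g ` B)"
  have D1: "open D1" "D1 \<subseteq> D" unfolding D1_def
    by (rule continuous_open_preimage[OF smooth_on_continuous[OF fD(4)] fD(1) ogB]) blast
  define b where "b I = inv_into V g (f I)" for I
  have bd: "smooth_diffeo b D1" unfolding b_def
    by (rule smooth_diffeo_compose[OF smooth_diffeo_subset[OF f D1] smooth_diffeo_inv(1)[OF g]])
      (use BV in \<open>auto simp: D1_def\<close>)
  note bD = smooth_diffeoD[OF bd]
  have gb: "f I = g (b I)" "b I \<in> B" if I: "I \<in> D1" for I
  proof -
    obtain w where w: "w \<in> B" "f I = g w" using I unfolding D1_def by blast
    have "b I = w" unfolding b_def w(2) using inv_into_f_f[OF gD(3)] w(1) BV by blast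
    then show "f I = g (b I)" "b I \<in> B" using w by simp_all
  qed
  let ?B = "\<lambda>I. frechet_derivative b (at I)"
  have linB: "linear (?B I)" and injB: "\<And>v. ?B I v = 0 \<Longrightarrow> v = 0" and surjB: "surj (?B I)" if I: "I \<in> D1" for I
  proof -
    show lin: "linear (?B I)" by (rule has_derivative_linear[OF smooth_on_has_derivative[OF bD(4) I]])
    have s: "?B I (frechet_derivative (inv_into D1 b) (at (b I)) v) = v" for v
      by (rule smooth_diffeo_frechet_derivative(2)[OF bd I])
    show "surj (?B I)" by (rule surjI) (rule s)
    have bI: "b I \<in> b ` D1" using I by blast
    have "linear (frechet_derivative (inv_into D1 b) (at (b I)))"
      by (rule has_derivative_linear[OF smooth_on_has_derivative[OF bD(5) bI]])
    from linear_0[OF this] show "v = 0" if "?B I v = 0" for v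
      using smooth_diffeo_frechet_derivative(1)[OF bd I, of v] that by simp
  qed
  obtain I0 where I0: "I0 \<in> D" "torus w0 = \<Psi> ` {z. act z = I0}" using AA unfolding action_angle_def by blast
  have act: "act (zz t I) = I" for t I by (simp add: act_def)
  have w0e: "norm w0 < eps" "w0 \<noteq> 0" using w0 punctured(2) by blast+
  have p0: "\<Psi> (zz 0 I0) \<in> torus w0" unfolding I0(2) using act by blast
  have fI0: "f I0 = g w0"
    using torus_em[OF w0e(1)] p0 AA I0(1) unfolding action_angle_def by (metis act singletonD subsetD vimageD)
  have I01: "I0 \<in> D1" using I0(1) fI0 w0B by (simp add: D1_def)
  have bI0: "b I0 = w0" unfolding b_def fI0 by (rule inv_into_f_f[OF gD(3) w0V])
  \<comment> \<open>Near the given torus the base points of the tori stay in the open set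
    \<open>N\<close>. This is what makes the periods \<tau> available for neighbouring
    actions.\<close>
  define D2 where "D2 = D1 \<inter> (\<lambda>I. \<Psi> (zz 0 I)) -` N"
  have "continuous_on D1 (\<lambda>I. \<Psi> (zz 0 I))"
  proof -
    have 1: "continuous_on {z. act z \<in> D} \<Psi>" using AA unfolding action_angle_def smooth_map_into_def by blast
    have 2: "continuous_on D1 (\<lambda>I. zz 0 I)" unfolding zz_def by (intro continuous_intros)
    show ?thesis by (rule continuous_on_compose2[OF 1 2]) (use D1(2) in \<open>auto simp: act_def\<close>)
  qed
  then have D2: "open D2" unfolding D2_def by (rule continuous_open_preimage[OF _ D1(1) open_N])
  have I02: "I0 \<in> D2" using I01 p0 torus_compact(3)[OF w0e] unfolding D2_def by blast
  have lattice: "s \<bullet> ?B I (1, 0) / (2 * pi) \<in> \<int> \<and> s \<bullet> ?B I (0, 1) / (2 * pi) \<in> \<int>"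
    if I: "I \<in> D2" and s: "\<And>t. Phi (zz (s + t) (b I)) = Phi (zz t (b I))" for I s
  proof -
    have ID: "I \<in> D1" "\<Psi> (zz 0 I) \<in> N" using I unfolding D2_def by blast+
    have "f I = g (b I) \<and> b I \<in> punctured" if "I \<in> D1" for I using gb[OF that] Bp by blast
    from action_angle_lattice[OF AA D1 bD(4) this ID surjB[OF ID(1)] s] show ?thesis .
  qed

  let ?l0 = "snd (g w0)"
  define I where "I u = inv_into D f (fst (g w0), u)" for u
  have I_l0: "I ?l0 = I0" unfolding I_def using inv_into_f_f[OF fD(3) I0(1)] fI0 by simp
  have ic0: "isCont (\<lambda>u. (fst (g w0), u)) ?l0" by (intro continuous_intros)
  have ic1: "isCont (inv_into D f) (fst (g w0), ?l0)"
    using continuous_on_interior[OF smooth_on_continuous[OF fD(5)]] interior_open[OF fD(2)] fI0 I0(1)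
    by (metis imageI prod.collapse)
  have cI: "isCont I ?l0" unfolding I_def by (rule isCont_o2[OF ic0 ic1])
  have tI: "(I \<longlongrightarrow> I0) (nhds ?l0)"
    using isCont_tendsto_nhds[OF cI] unfolding I_l0 .
  have ev1: "\<forall>\<^sub>F u in nhds ?l0. I u \<in> D2" by (rule topological_tendstoD[OF tI D2 I02])
  have "((\<lambda>u. (fst (g w0), u)) \<longlongrightarrow> g w0) (nhds ?l0)"
    using isCont_tendsto_nhds[OF ic0] by simp
  then have ev2: "\<forall>\<^sub>F u in nhds ?l0. (fst (g w0), u) \<in> f ` D"
    by (rule topological_tendstoD[OF _ fD(2)]) (use fI0 I0(1) in \<open>metis imageI\<close>)

  \<comment> \<open>How often the period s winds around the angle circle of direction e, as a
    function of the second component u of the value at fixed energy. It is integer valued by the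
    lattice property and continuous, hence locally constant.\<close>
  define n where "n s e u = s (b (I u)) \<bullet> ?B (I u) e / (2 * pi)" for s :: "real \<times> real \<Rightarrow> real \<times> real" and e u
  have cn: "isCont (n s e) ?l0" if s: "continuous_on B s" for s e
  proof -
    have "continuous_on D1 (\<lambda>I. s (b I) \<bullet> ?B I e / (2 * pi))"
      by (intro continuous_intros smooth_on_continuous[OF smooth_on_frechet_derivative[OF bD(4)]]
          continuous_on_compose2[OF s smooth_on_continuous[OF bD(4)]]) (use gb(2) in auto)
    then have "isCont (\<lambda>I. s (b I) \<bullet> ?B I e / (2 * pi)) (I ?l0)"
      unfolding I_l0 using continuous_on_eq_continuous_at[OF D1(1)] I01 by blast
    from isCont_o2[OF cI this] show ?thesis unfolding n_def[abs_def] .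
  qed
  have const: "\<forall>\<^sub>F u in nhds ?l0. n s e u = n s e ?l0"
    if s: "continuous_on B s" "\<And>w t. w \<in> B \<Longrightarrow> Phi (zz (s w + t) w) = Phi (zz t w)" and e: "e = (1, 0) \<or> e = (0, 1)" for s e
  proof (rule continuous_Ints_eventually_const[OF cn[OF s(1)]])
    show "\<forall>\<^sub>F u in nhds ?l0. n s e u \<in> \<int>" using ev1
    proof eventually_elim
      case (elim u)
      have "b (I u) \<in> B" using gb(2) elim D2_def by blast
      from lattice[OF elim s(2)[OF this]] show ?case using e by (auto simp: n_def)
    qed
  qed
  let ?s2 = "\<lambda>w::real \<times> real. (0, 2 * pi) :: real \<times> real"
  have c\<tau>: "continuous_on B \<tau>"
    by (rule continuous_on_subset[OF smooth_on_continuous[OF \<tau>(1)]]) (auto simp: B_def)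
  have wB: "norm w < eps" "w \<noteq> 0" "period w (\<tau> w)" "fst (\<tau> w) > 0" "h1 w \<noteq> 0" if w: "w \<in> B" for w
  proof -
    show 1: "norm w < eps" "w \<noteq> 0" "period w (\<tau> w)" "h1 w \<noteq> 0"
      using w Bp punctured(2) \<tau>(2) unfolding B_def by blast+
    show "fst (\<tau> w) > 0" using period_time(2)[OF 1(1-3)] t0_pos by simp
  qed
  have per1: "Phi (zz (\<tau> w + t) w) = Phi (zz t w)" if w: "w \<in> B" for w t
    by (rule Phi_period[OF wB(1-3)[OF w]])
  have per2: "Phi (zz (?s2 w + t) w) = Phi (zz t w)" if w: "w \<in> B" for w t
    using Phi_lattice[OF wB(1-3)[OF w], of 0 1 t] by simp
  let ?e1 = "(1, 0) :: real \<times> real" and ?e2 = "(0, 1) :: real \<times> real"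
  define W where "W w = h2 w / h1 w * fst (\<tau> w) - snd (\<tau> w)" for w
  define A1 where "A1 = 2 * pi * n \<tau> ?e1 ?l0"
  define A2 where "A2 = 2 * pi * n \<tau> ?e2 ?l0"
  define B1 where "B1 = n ?s2 ?e1 ?l0"
  define B2 where "B2 = n ?s2 ?e2 ?l0"
  have ev: "\<forall>\<^sub>F u in nhds ?l0. \<exists>k. k \<noteq> 0 \<and> rotation_number D f (fst (g w0), u) =
      span {k *\<^sub>R (A1 + W (inv_into V g (fst (g w0), u)) * B1, A2 + W (inv_into V g (fst (g w0), u)) * B2)}"
    using ev1 ev2 const[OF c\<tau> per1, of ?e1, simplified] const[OF c\<tau> per1, of ?e2, simplified]
      const[of ?s2, OF continuous_on_const per2, of ?e1, simplified] const[of ?s2, OF continuous_on_const per2, of ?e2, simplified]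
  proof eventually_elim
    case (elim u)
    have ID: "I u \<in> D1" using elim(1) by (simp add: D2_def)
    have fI: "f (I u) = (fst (g w0), u)" unfolding I_def by (rule f_inv_into_f[OF elim(2)])
    define w where "w = b (I u)"
    have w: "w \<in> B" "inv_into V g (fst (g w0), u) = w" using gb(2)[OF ID] unfolding w_def b_def fI by auto
    have wV: "w \<in> V" using w(1) BV by blast
    have A: "\<tau> w \<bullet> ?B (I u) ?e1 = A1" "\<tau> w \<bullet> ?B (I u) ?e2 = A2"
      using elim(3,4) unfolding A1_def A2_def w_def by (simp_all add: n_def)
    have Bs: "snd (?B (I u) ?e1) = B1" "snd (?B (I u) ?e2) = B2"
      using elim(5,6) unfolding B1_def B2_def by (simp_all add: n_def inner_prod_def)
    have dg: "(g has_derivative frechet_derivative g (at w)) (at w)" by (rule smooth_on_has_derivative[OF gD(4) wV])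
    have "((\<lambda>I. fst (g (b I))) has_derivative (\<lambda>v. fst (frechet_derivative g (at w) (?B (I u) v)))) (at (I u))"
      by (rule has_derivative_fst[OF has_derivative_chain[OF smooth_on_has_derivative[OF bD(4) ID] w_def[symmetric] dg]])
    then have "((\<lambda>I. fst (f I)) has_derivative (\<lambda>v. fst (frechet_derivative g (at w) (?B (I u) v)))) (at (I u))"
      by (rule has_derivative_transform_within_open[OF _ D1(1) ID]) (simp add: gb(1))
    note fd = frechet_derivative_at[OF this, symmetric]
    have freq: "frequencies D f (fst (g w0), u) =
        (fst (?B (I u) ?e1) * h1 w + snd (?B (I u) ?e1) * h2 w, fst (?B (I u) ?e2) * h1 w + snd (?B (I u) ?e2) * h2 w)"
      unfolding frequencies_def I_def[symmetric] Let_def fd fst_derivative_g[OF wV] ..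
    let ?k = "h1 w / fst (\<tau> w)"
    have t: "fst (\<tau> w) \<noteq> 0" "h1 w \<noteq> 0" using wB(4,5)[OF w(1)] by simp_all
    \<comment> \<open>dH is written as a combination of the pairings with the periods \<tau> and (0,
      1): solving for the coefficients leaves the common factor \<open>?k\<close> and the single
      variable coefficient \<open>W\<close>.\<close>
    have comp: "x * h1 w + y * h2 w = ?k * (\<tau> w \<bullet> (x, y) + W w * y)" for x y
      using t by (simp add: W_def inner_prod_def field_simps)
    have comb: "fst v * h1 w + snd v * h2 w = ?k * (\<tau> w \<bullet> v + W w * snd v)" for v
      using comp[of "fst v" "snd v"] by simp
    have "frequencies D f (fst (g w0), u) = ?k *\<^sub>R (A1 + W w * B1, A2 + W w * B2)"
      unfolding freq comb unfolding A Bs by simp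
    then show ?case unfolding rotation_number_def w(2) using t by (intro exI[of _ ?k]) simp
  qed
  \<comment> \<open>The determinant equals \<tau>_1 times the Jacobian determinant of
    \<open>b\<close>: the two periods form a basis of the plane of times, and \<open>b\<close> is a
    local diffeomorphism.\<close>
  have det: "A1 * B2 - A2 * B1 \<noteq> 0"
  proof
    assume 0: "A1 * B2 - A2 * B1 = 0"
    obtain x1 y1 where v1: "?B I0 ?e1 = (x1, y1)" by (cases "?B I0 ?e1")
    obtain x2 y2 where v2: "?B I0 ?e2 = (x2, y2)" by (cases "?B I0 ?e2")
    have "A1 = \<tau> w0 \<bullet> (x1, y1)" "A2 = \<tau> w0 \<bullet> (x2, y2)" "B1 = y1" "B2 = y2"
      by (simp_all add: A1_def A2_def B1_def B2_def n_def I_l0 bI0 v1 v2)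
    then have "A1 * B2 - A2 * B1 = fst (\<tau> w0) * (x1 * y2 - x2 * y1)" by (simp add: inner_prod_def algebra_simps)
    then have d0: "x1 * y2 = x2 * y1" using wB(4)[OF w0B] 0 by simp
    have Bv: "?B I0 (a, c) = a *\<^sub>R (x1, y1) + c *\<^sub>R (x2, y2)" for a c
    proof -
      have "(a, c) = a *\<^sub>R ?e1 + c *\<^sub>R ?e2" by simp
      then show ?thesis using linear_add[OF linB[OF I01]] linear_scale[OF linB[OF I01]] v1 v2 by metis
    qed
    have "?B I0 (y2, - y1) = 0" unfolding Bv using d0 by (simp add: zero_prod_def mult.commute)
    from injB[OF I01 this] have y: "y1 = 0" "y2 = 0" by (simp_all add: zero_prod_def)
    have "?B I0 (x2, - x1) = 0" unfolding Bv using y by (simp add: zero_prod_def mult.commute)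
    from injB[OF I01 this] have x: "x1 = 0" "x2 = 0" by (simp_all add: zero_prod_def)
    have "?B I0 (1, 0) = 0" unfolding Bv using x y by (simp add: zero_prod_def)
    from injB[OF I01 this] show False by (simp add: zero_prod_def)
  qed
  have sW: "smooth_on W B"
    unfolding W_def
    by (intro smooth_on_diff smooth_on_mult smooth_on_divide oB smooth_on_fst smooth_on_snd smooth_on_subset[OF \<tau>(1)]
        smooth_on_subset[OF smooth_h(1) BV] smooth_on_subset[OF smooth_h(2) BV]) (auto simp: B_def)
  let ?W = "frechet_derivative W (at w0)"
  have dW: "(W has_derivative ?W) (at w0)" by (rule smooth_on_has_derivative[OF sW w0B])
  have linW: "linear ?W" by (rule has_derivative_linear[OF dW])
  let ?G = "frechet_derivative (inv_into V g) (at (g w0))"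
  have gw0: "g w0 \<in> g ` V" using w0V by blast
  have dG: "(inv_into V g has_derivative ?G) (at (g w0))" by (rule smooth_on_has_derivative[OF gD(5) gw0])
  have linG: "linear ?G" by (rule has_derivative_linear[OF dG])
  define x where "x = ?G (0, 1)"
  have "((\<lambda>u. (fst (g w0), u)) has_derivative (\<lambda>s. (0, s))) (at ?l0)"
    by (intro has_derivative_Pair has_derivative_const has_derivative_ident)
  from has_derivative_chain[OF this prod.collapse dG]
  have "((\<lambda>u. inv_into V g (fst (g w0), u)) has_derivative (\<lambda>s. ?G (0, s))) (at ?l0)" .
  from has_derivative_chain[OF this _ dW]
  have "((\<lambda>u. W (inv_into V g (fst (g w0), u))) has_derivative (\<lambda>s. ?W (?G (0, s)))) (at ?l0)"
    using inv_into_f_f[OF gD(3) w0V] by simp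
  moreover have "?W (?G (0, s)) = ?W x * s" for s
  proof -
    have "(0, s) = s *\<^sub>R (0::real, 1::real)" by simp
    then have "?G (0, s) = s *\<^sub>R x" unfolding x_def using linear_scale[OF linG] by metis
    then show ?thesis using linear_scale[OF linW] by (simp add: mult.commute)
  qed
  ultimately have dWu: "((\<lambda>u. W (inv_into V g (fst (g w0), u))) has_real_derivative ?W x) (at ?l0)"
    by (simp add: has_field_derivative_def)
  have "frechet_derivative g (at w0) x = (0, 1)"
    unfolding x_def by (rule smooth_diffeo_frechet_derivative(2)[OF g w0V])
  then have x: "fst x * h1 w0 + snd x * h2 w0 = 0" "x \<noteq> 0"
    using fst_derivative_g[OF w0V, of x] linear_0[OF has_derivative_linear[OF smooth_on_has_derivative[OF gD(4) w0V]]]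
    by (auto simp: zero_prod_def)
  \<comment> \<open>The vector x is the derivative of the value w with respect to l at constant
    energy. It is tangent to the energy level, hence a non-zero multiple of (- h2, h1).\<close>
  define k where "k = snd x / h1 w0"
  have xk: "x = k *\<^sub>R (- h2 w0, h1 w0)" using x(1) nz by (simp add: k_def prod_eq_iff field_simps)
  then have k: "k \<noteq> 0" using x(2) by (auto simp: zero_prod_def)
  have "?W x = k * ?W (- h2 w0, h1 w0)" unfolding xk linear_scale[OF linW] by simp
  then have "?W x = 0 \<longleftrightarrow> ?W (- h2 w0, h1 w0) = 0" using k by simp
  then show ?thesis using rp1_stationary_iff[OF ev dWu det] unfolding W_def[abs_def] by simp
qed

end

section \<open>The twist\<close>

text \<open>The elementary bound ln y \<le> y - 1 at y = 1 / sqrt x turns the logarithmic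
  singularity into a square root.\<close>

lemma abs_mult_ln_le:
  fixes x :: real
  assumes "0 \<le> x" "x \<le> 1"
  shows "\<bar>x * ln x\<bar> \<le> 2 * sqrt x"
proof (cases "x = 0")
  case False
  then have x: "x > 0" using assms(1) by simp
  have "- ln x = 2 * ln (1 / sqrt x)" using x by (simp add: ln_div ln_sqrt)
  also have "\<dots> \<le> 2 * (1 / sqrt x - 1)" using ln_le_minus_one[of "1 / sqrt x"] x by simp
  finally have "x * (- ln x) \<le> x * (2 * (1 / sqrt x - 1))" using x by (intro mult_left_mono) simp_all
  also have "\<dots> = 2 * sqrt x - 2 * x" using x by (simp add: field_simps)
  finally have "x * (- ln x) \<le> 2 * sqrt x" using x by linarith
  moreover have "ln x \<le> 0" using x assms(2) by simp
  ultimately show ?thesis using x by (simp add: abs_mult)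
qed simp

lemma norm_ln_tendsto_0:
  "((\<lambda>x. norm x * ln (norm x)) \<longlongrightarrow> 0) (at (0::'a::real_normed_vector))"
proof (rule Lim_null_comparison)
  show "\<forall>\<^sub>F x in at (0::'a). norm (norm x * ln (norm x)) \<le> 2 * sqrt (norm x)"
    unfolding eventually_at
  proof (intro exI[of _ 1] conjI ballI impI)
    fix x :: 'a assume "x \<noteq> 0 \<and> dist x 0 < 1"
    then show "norm (norm x * ln (norm x)) \<le> 2 * sqrt (norm x)"
      unfolding real_norm_def by (intro abs_mult_ln_le) simp_all
  qed simp
  show "((\<lambda>x. 2 * sqrt (norm x)) \<longlongrightarrow> 0) (at (0::'a))" by (auto intro!: tendsto_eq_intros)
qed

text \<open>At x = 0 the formula gives derivative zero whatever the value of \<open>ln 0\<close>. It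
  holds there because the difference quotient has modulus |h| |ln |h||, which tends to 0.\<close>

lemma has_derivative_square_ln_norm:
  fixes x :: "'a::euclidean_space"
  shows "((\<lambda>x. (x \<bullet> x) * ln (norm x)) has_derivative (\<lambda>v. (x \<bullet> v) * (2 * ln (norm x) + 1))) (at x)"
proof (cases "x = 0")
  case True
  have eq: "\<bar>norm h * ln (norm h)\<bar> = norm ((h \<bullet> h) * ln (norm h)) / norm h" if "h \<noteq> 0" for h :: 'a
    using that by (simp add: dot_square_norm power2_eq_square abs_mult)
  have "\<forall>\<^sub>F h in at (0::'a). \<bar>norm h * ln (norm h)\<bar> = norm ((h \<bullet> h) * ln (norm h)) / norm h"
    unfolding eventually_at_filter by (rule always_eventually) (use eq in blast)
  from Lim_transform_eventually[OF tendsto_rabs_zero[OF norm_ln_tendsto_0] this]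
  have "((\<lambda>h. norm ((h \<bullet> h) * ln (norm h)) / norm h) \<longlongrightarrow> 0) (at (0::'a))" .
  then have "((\<lambda>h. (h \<bullet> h) * ln (norm h)) has_derivative (\<lambda>v. 0)) (at (0::'a))"
    unfolding has_derivative_at by simp
  then show ?thesis using True by simp
next
  case False
  have 1: "((\<lambda>x. x \<bullet> x) has_derivative (\<lambda>v. x \<bullet> v + v \<bullet> x)) (at x)"
    by (intro has_derivative_inner has_derivative_ident)
  have n: "(norm has_derivative (\<lambda>v. sgn x \<bullet> v)) (at x)"
    using has_derivative_norm[OF False] by (simp add: inner_commute)
  have l: "(ln has_derivative (*) (inverse (norm x))) (at (norm x))"
    using DERIV_ln[of "norm x"] False by (simp add: has_field_derivative_def)
  have 2: "((\<lambda>x. ln (norm x)) has_derivative (\<lambda>v. inverse (norm x) * (sgn x \<bullet> v))) (at x)"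
    by (rule has_derivative_chain[OF n refl l])
  have eq: "(x \<bullet> x) * (inverse (norm x) * (sgn x \<bullet> v)) = x \<bullet> v" for v
    using False by (simp add: sgn_div_norm dot_square_norm power2_eq_square field_simps)
  have "(x \<bullet> x) * (inverse (norm x) * (sgn x \<bullet> v)) + (x \<bullet> v + v \<bullet> x) * ln (norm x) = (x \<bullet> v) * (2 * ln (norm x) + 1)" for v
    unfolding eq inner_commute[of v x] by (simp add: algebra_simps)
  then show ?thesis using has_derivative_mult[OF 1 2] by simp
qed

text \<open>The derivative contains x . v times ln |x|, which is still continuous at 0, whereas one
  more differentiation leaves an unbounded logarithm. This function limits the regularity of
  \<open>tw\<close> to C^1.\<close>

lemma Ck_on_square_ln_norm: "Ck_on (Suc 0) (\<lambda>x::'a::euclidean_space. (x \<bullet> x) * ln (norm x)) UNIV"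
proof (rule Ck_on_SucI[OF open_UNIV has_derivative_square_ln_norm])
  fix v :: 'a
  have "isCont (\<lambda>x. (x \<bullet> v) * (2 * ln (norm x) + 1)) x" for x
  proof (cases "x = 0")
    case True
    have "((\<lambda>x. (x \<bullet> v) * (2 * ln (norm x))) \<longlongrightarrow> 0) (at 0)"
    proof (rule Lim_null_comparison)
      show "\<forall>\<^sub>F x in at 0. norm ((x \<bullet> v) * (2 * ln (norm x))) \<le> 2 * norm v * \<bar>norm x * ln (norm x)\<bar>"
      proof (rule always_eventually, rule allI)
        fix x :: 'a
        have "\<bar>x \<bullet> v\<bar> * \<bar>ln (norm x)\<bar> \<le> (norm x * norm v) * \<bar>ln (norm x)\<bar>"
          by (intro mult_right_mono Cauchy_Schwarz_ineq2) simp
        then show "norm ((x \<bullet> v) * (2 * ln (norm x))) \<le> 2 * norm v * \<bar>norm x * ln (norm x)\<bar>"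
          by (simp add: abs_mult algebra_simps)
      qed
      show "((\<lambda>x. 2 * norm v * \<bar>norm x * ln (norm x)\<bar>) \<longlongrightarrow> 0) (at (0::'a))"
        by (intro tendsto_mult_right_zero tendsto_rabs_zero norm_ln_tendsto_0)
    qed
    moreover have "((\<lambda>x. x \<bullet> v) \<longlongrightarrow> 0) (at 0)" by (auto intro!: tendsto_eq_intros)
    ultimately have "((\<lambda>x. (x \<bullet> v) * (2 * ln (norm x)) + x \<bullet> v) \<longlongrightarrow> 0 + 0) (at 0)" by (rule tendsto_add)
    then show ?thesis unfolding True isCont_def by (simp add: algebra_simps)
  next
    case False
    then show ?thesis by (intro continuous_intros) auto
  qed
  then show "Ck_on 0 (\<lambda>x. (x \<bullet> v) * (2 * ln (norm x) + 1)) UNIV"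
    by (simp add: continuous_at_imp_continuous_on)
qed

section \<open>The linearization at the focus-focus point\<close>

context focus_focus_system
begin

lemma in_chart_c0_H:
  assumes "x \<in> snd c0 ` fst c0"
  shows "in_chart c0 H x = fst (g (J1 x, J2 x))" "(J1 x, J2 x) \<in> V"
proof -
  obtain p where p: "p \<in> fst c0" "x = snd c0 p" using assms by blast
  have "in_chart c0 H x = H p" unfolding p(2) by (rule in_chart_apply'[OF c0A p(1)])
  then show "in_chart c0 H x = fst (g (J1 x, J2 x))" "(J1 x, J2 x) \<in> V"
    using normal_form[OF p(1)] p(2) by (auto simp: em_map_def prod_eq_iff)
qed

lemma has_derivative_J12:
  "((\<lambda>x. (J1 x, J2 x)) has_derivative (\<lambda>b. (b$1 * x$3 + x$1 * b$3 + (b$2 * x$4 + x$2 * b$4),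
      b$1 * x$4 + x$1 * b$4 - (b$2 * x$3 + x$2 * b$3)))) (at x)"
proof -
  have nth: "((\<lambda>x. x $ i) has_derivative (\<lambda>b. b $ i)) (at x)" for i :: 4
    by (rule bounded_linear_imp_has_derivative[OF bounded_linear_vec_nth])
  show ?thesis
    unfolding J1_def J2_def by (auto intro!: derivative_eq_intros nth simp: algebra_simps)
qed

lemma ham_vf_H:
  assumes x: "x \<in> snd c0 ` fst c0"
  shows "ham_vf Om c0 H x = h1 (J1 x, J2 x) *\<^sub>R zz (x$1, x$2) (- x$3, - x$4) + h2 (J1 x, J2 x) *\<^sub>R zz (- x$2, x$1) (- x$4, x$3)"
proof -
  let ?w = "(J1 x, J2 x)"
  note wV = in_chart_c0_H(2)[OF x]
  have "((\<lambda>x. fst (g (J1 x, J2 x))) has_derivative (\<lambda>b. fst (frechet_derivative g (at ?w)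
      (b$1 * x$3 + x$1 * b$3 + (b$2 * x$4 + x$2 * b$4), b$1 * x$4 + x$1 * b$4 - (b$2 * x$3 + x$2 * b$3))))) (at x)"
    by (rule has_derivative_fst[OF has_derivative_chain[OF has_derivative_J12 refl smooth_on_has_derivative[OF gD(4) wV]]])
  then have d: "(in_chart c0 H has_derivative (\<lambda>b. fst (frechet_derivative g (at ?w)
      (b$1 * x$3 + x$1 * b$3 + (b$2 * x$4 + x$2 * b$4), b$1 * x$4 + x$1 * b$4 - (b$2 * x$3 + x$2 * b$3))))) (at x)"
    by (rule has_derivative_transform_within_open[OF _ chartD(2)[OF c0A] x]) (simp add: in_chart_c0_H(1))
  then have diff: "in_chart c0 H differentiable (at x)" by (auto simp: differentiable_def)
  show ?thesis
    unfolding ham_vf_canonical[where Om = Om and c = c0 and f = H and x = x, OF Om_c0[OF x] diff] partial_def frechet_derivative_at[OF d, symmetric] fst_derivative_g[OF wV]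
    by (simp add: vec_eq_iff forall_4 axis_def vector_def algebra_simps)
qed

text \<open>The Hamiltonian field is a combination of two linear fields with variable coefficients.
  Both linear fields vanish at the origin, so the derivatives of the coefficients drop out and only
  their values there remain.\<close>

lemma linearization_H:
  "linearization Om c0 H m *v v = h1 (0, 0) *\<^sub>R zz (v$1, v$2) (- v$3, - v$4) + h2 (0, 0) *\<^sub>R zz (- v$2, v$1) (- v$4, v$3)"
proof -
  let ?O = "snd c0 ` fst c0"
  let ?L1 = "\<lambda>v::real^4. zz (v$1, v$2) (- v$3, - v$4)" and ?L2 = "\<lambda>v::real^4. zz (- v$2, v$1) (- v$4, v$3)"
  have 0: "0 \<in> ?O" using m by force
  have J0: "J1 0 = 0" "J2 0 = 0" by (simp_all add: J1_def J2_def)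
  have "linear ?L1" "linear ?L2" by (auto intro!: linearI simp: vec_eq_iff forall_4 algebra_simps)
  then have dL: "(?L1 has_derivative ?L1) (at 0)" "(?L2 has_derivative ?L2) (at 0)"
    by (simp_all add: linear_conv_bounded_linear bounded_linear_imp_has_derivative)
  obtain D0 where D0: "((\<lambda>x::real^4. (J1 x, J2 x)) has_derivative D0) (at 0)" using has_derivative_J12[of 0] by (rule that)
  have dh: "\<exists>D. ((\<lambda>x. h (J1 x, J2 x)) has_derivative D) (at 0)" if h: "smooth_on h V" for h :: "real \<times> real \<Rightarrow> real"
  proof -
    have "(J1 0, J2 0) \<in> V" using V0 J0 by simp
    note dh = smooth_on_has_derivative[OF h this]
    have "((\<lambda>x. h (J1 x, J2 x)) has_derivative (\<lambda>v. frechet_derivative h (at (J1 0, J2 0)) (D0 v))) (at 0)"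
      by (rule has_derivative_chain[OF D0 refl dh])
    then show ?thesis by (rule exI[of "\<lambda>D. ((\<lambda>x. h (J1 x, J2 x)) has_derivative D) (at 0)"])
  qed
  obtain D1 where D1: "((\<lambda>x. h1 (J1 x, J2 x)) has_derivative D1) (at 0)" using dh[OF smooth_h(1)] by (rule exE)
  obtain D2 where D2: "((\<lambda>x. h2 (J1 x, J2 x)) has_derivative D2) (at 0)" using dh[OF smooth_h(2)] by (rule exE)
  have z: "zz (0, 0) (0, 0) = 0" by (simp add: vec_eq_iff forall_4)
  have d: "((\<lambda>x. h1 (J1 x, J2 x) *\<^sub>R ?L1 x + h2 (J1 x, J2 x) *\<^sub>R ?L2 x) has_derivative
      (\<lambda>v. (h1 (J1 0, J2 0) *\<^sub>R ?L1 v + D1 v *\<^sub>R ?L1 0) + (h2 (J1 0, J2 0) *\<^sub>R ?L2 v + D2 v *\<^sub>R ?L2 0))) (at 0)"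
    by (intro has_derivative_add has_derivative_scaleR D1 D2 dL)
  then have d: "((\<lambda>x. h1 (J1 x, J2 x) *\<^sub>R ?L1 x + h2 (J1 x, J2 x) *\<^sub>R ?L2 x) has_derivative
      (\<lambda>v. h1 (0, 0) *\<^sub>R ?L1 v + h2 (0, 0) *\<^sub>R ?L2 v)) (at 0)"
    by (simp add: J0 z)
  then have d: "(ham_vf Om c0 H has_derivative (\<lambda>v. h1 (0, 0) *\<^sub>R ?L1 v + h2 (0, 0) *\<^sub>R ?L2 v)) (at 0)"
    by (rule has_derivative_transform_within_open[OF _ chartD(2)[OF c0A] 0]) (simp add: ham_vf_H)
  show ?thesis
    unfolding linearization_def m(2) frechet_derivative_at[OF d, symmetric]
    using fun_cong[OF matrix_vector_mul(2)[OF has_derivative_linear[OF d]], of v] by simp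
qed

text \<open>On both coordinate planes the linearization is a dilation plus a rotation. If h1 h2 = 0,
  its square acts on both as the real scalar h1^2 - h2^2, so every eigenvalue has a real square; but
  the square of \<alpha> + i \<omega> has imaginary part 2 \<alpha> \<omega>.\<close>

lemma h_nonzero:
  assumes ev: "Complex \<alpha> \<omega> \<in> complex_eigenvalues (linearization Om c0 H m)" and nz: "\<alpha> \<noteq> 0" "\<omega> \<noteq> 0"
  shows "h1 (0, 0) \<noteq> 0" "h2 (0, 0) \<noteq> 0"
proof -
  let ?M = "linearization Om c0 H m"
  obtain v where v: "v \<noteq> 0" "map_matrix complex_of_real ?M *v v = Complex \<alpha> \<omega> *s v"
    using ev unfolding complex_eigenvalues_def by blast
  define p where "p = complex_of_real (h1 (0, 0))"
  define q where "q = complex_of_real (h2 (0, 0))"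
  let ?z = "Complex \<alpha> \<omega>"
  have col: "?M $ i $ j = (h1 (0, 0) *\<^sub>R zz (axis j 1$1, axis j 1$2) (- axis j 1$3, - axis j 1$4) +
      h2 (0, 0) *\<^sub>R zz (- axis j 1$2, axis j 1$1) (- axis j 1$4, axis j 1$3)) $ i" for i j
    unfolding linearization_H[symmetric] by (simp add: matrix_vector_mul_component inner_axis)
  have "?z * v$i = (\<Sum>j\<in>UNIV. complex_of_real (?M $ i $ j) * v $ j)" for i
    using arg_cong[OF v(2), of "\<lambda>x. x $ i"] by (simp add: matrix_vector_mult_def map_matrix_def)
  note * = this[unfolded sum_4 col]
  have e: "?z * v$1 = p * v$1 - q * v$2" "?z * v$2 = p * v$2 + q * v$1"
    "?z * v$3 = - p * v$3 - q * v$4" "?z * v$4 = - p * v$4 + q * v$3"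
    using *[of 1] *[of 2] *[of 3] *[of 4] by (simp_all add: axis_def p_def q_def)
  have "p * q \<noteq> 0"
  proof
    assume 0: "p * q = 0"
    obtain i where i: "v $ i \<noteq> 0" using v(1) by (auto simp: vec_eq_iff)
    have sq: "?z * ?z * a = (p' * p' - q * q) * a" "?z * ?z * b = (p' * p' - q * q) * b"
      if ab: "?z * a = p' * a - q * b" "?z * b = p' * b + q * a" and 0: "p' * q = 0" for a b p'
    proof -
      have "?z * ?z * a = p' * (?z * a) - q * (?z * b)" using arg_cong[OF ab(1), of "(*) ?z"] by (simp only: algebra_simps)
      also have "\<dots> = (p' * p' - q * q) * a - 2 * (p' * q) * b" unfolding ab by (simp add: algebra_simps)
      finally show "?z * ?z * a = (p' * p' - q * q) * a" unfolding 0 by simp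
      have "?z * ?z * b = p' * (?z * b) + q * (?z * a)" using arg_cong[OF ab(2), of "(*) ?z"] by (simp only: algebra_simps)
      also have "\<dots> = (p' * p' - q * q) * b + 2 * (p' * q) * a" unfolding ab by (simp add: algebra_simps)
      finally show "?z * ?z * b = (p' * p' - q * q) * b" unfolding 0 by simp
    qed
    have "\<forall>i. ?z * ?z * v $ i = (p * p - q * q) * v $ i"
      unfolding forall_4 using sq[OF e(1,2) 0] sq[OF e(3), unfolded minus_mult_minus] e(4) 0 by auto
    then have "?z * ?z * v $ i = (p * p - q * q) * v $ i" by blast
    then have "?z * ?z = p * p - q * q" using i by (rule_tac mult_right_cancel[THEN iffD1])
    then have "Im (?z * ?z) = 0" by (simp add: p_def q_def)
    then show False using nz by simp
  qed
  then show "h1 (0, 0) \<noteq> 0" "h2 (0, 0) \<noteq> 0" by (auto simp: p_def q_def)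
qed

section \<open>The twist as a function of the value\<close>

definition slope :: "real \<times> real \<Rightarrow> real" where "slope w = h2 w / h1 w"

text \<open>The vector \<open>(- h2, h1)\<close> is tangent to the levels of the energy.\<close>

definition along :: "(real \<times> real \<Rightarrow> 'b::real_normed_vector) \<Rightarrow> real \<times> real \<Rightarrow> 'b" where
  "along f w = h1 w *\<^sub>R frechet_derivative f (at w) (0, 1) - h2 w *\<^sub>R frechet_derivative f (at w) (1, 0)"

definition B0 :: "(real \<times> real) set" where "B0 = ball 0 eps \<inter> (V \<inter> h1 -` (- {0}))"

lemma B0: "open B0" "w \<in> B0 \<Longrightarrow> norm w < eps" "w \<in> B0 \<Longrightarrow> h1 w \<noteq> 0" "B0 \<subseteq> V" "B0 \<subseteq> ball 0 eps"
proof -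
  have "open (V \<inter> h1 -` (- {0}))"
    by (rule continuous_open_preimage[OF smooth_on_continuous[OF smooth_h(1)] gD(1)]) auto
  then show "open B0" unfolding B0_def by blast
qed (auto simp: B0_def)

lemma along_eq:
  assumes "(f has_derivative f') (at w)"
  shows "f' (- h2 w, h1 w) = along f w"
proof -
  have lin: "linear f'" by (rule has_derivative_linear[OF assms])
  have "(- h2 w, h1 w) = (- h2 w) *\<^sub>R (1, 0) + h1 w *\<^sub>R (0, 1)" by simp
  then have "f' (- h2 w, h1 w) = (- h2 w) *\<^sub>R f' (1, 0) + h1 w *\<^sub>R f' (0, 1)"
    using linear_add[OF lin] linear_scale[OF lin] by metis
  then show ?thesis by (simp add: along_def frechet_derivative_at[OF assms, symmetric])
qed

lemma smooth_along: "smooth_on f B0 \<Longrightarrow> smooth_on (along f) B0"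
  unfolding along_def
  by (intro smooth_on_diff smooth_on_scaleR B0(1) smooth_on_subset[OF smooth_h(1) B0(4)]
      smooth_on_subset[OF smooth_h(2) B0(4)] smooth_on_frechet_derivative)

lemma smooth_slope: "smooth_on slope B0"
  unfolding slope_def
  by (intro smooth_on_divide B0(1) smooth_on_subset[OF smooth_h(1) B0(4)] smooth_on_subset[OF smooth_h(2) B0(4)] B0(3))

text \<open>Collects what the smooth factor \<open>bv\<close> and the constants in \<open>qf\<close>
  contribute to the derivative of the frequency ratio. Nothing here is singular at w = 0, because
  \<open>bv\<close> does not vanish.\<close>

definition regular_part :: "real \<times> real \<Rightarrow> real" where
  "regular_part w = along slope w * (t0 + ln dl + ln (norm (bv w))) +
     slope w * Re (cnj (along bv w) / cnj (bv w)) - Im (cnj (along bv w) / cnj (bv w))"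

text \<open>\<open>|w|\<^sup>2\<close> times the derivative of the frequency ratio along the levels of the energy.\<close>

definition tw :: "real \<times> real \<Rightarrow> real" where
  "tw w = (w \<bullet> w) * regular_part w + h1 w * ((slope w)\<^sup>2 - 1) * fst w - 2 * h1 w * slope w * snd w
     - along slope w * ((w \<bullet> w) * ln (norm w))"

lemma smooth_regular_part: "smooth_on regular_part B0"
proof -
  have b: "smooth_on bv B0" by (rule smooth_on_subset[OF smooth_bv B0(5)])
  have nz: "bv w \<noteq> 0" if "w \<in> B0" for w using Phi_t0(1) B0(2) that by blast
  have pos: "Re (bv w) * Re (bv w) + Im (bv w) * Im (bv w) > 0" if "w \<in> B0" for w
    using nz[OF that] by (metis complex_neq_0 power2_eq_square)
  have "smooth_on (\<lambda>w. ln (Re (bv w) * Re (bv w) + Im (bv w) * Im (bv w)) / 2) B0"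
    by (intro smooth_on_divide smooth_on_const smooth_on_ln smooth_on_add smooth_on_mult smooth_on_Re smooth_on_Im B0(1) b pos) simp_all
  moreover have "ln (Re (bv w) * Re (bv w) + Im (bv w) * Im (bv w)) / 2 = ln (norm (bv w))" if "w \<in> B0" for w
    using pos[OF that] by (simp add: cmod_def ln_sqrt power2_eq_square)
  ultimately have ln: "smooth_on (\<lambda>w. ln (norm (bv w))) B0"
    by (rule smooth_on_cong[OF B0(1), rotated])
  have q: "smooth_on (\<lambda>w. cnj (along bv w) / cnj (bv w)) B0"
    by (intro smooth_on_divide smooth_on_cnj B0(1) smooth_along b) (simp add: nz)
  show ?thesis
    unfolding regular_part_def
    by (intro smooth_on_diff smooth_on_add smooth_on_mult smooth_on_const smooth_on_Re smooth_on_Im smooth_along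
        smooth_slope B0(1) ln q)
qed

lemma tw_eq:
  assumes w: "w \<in> B0" "w \<in> T" and T: "open T" "T \<subseteq> punctured" and \<tau>: "smooth_on \<tau> T" "\<And>w. w \<in> T \<Longrightarrow> period w (\<tau> w)"
    and d\<tau>: "\<And>v. frechet_derivative \<tau> (at w) v =
       (Re (frechet_derivative qf (at w) v / qf w), Im (frechet_derivative qf (at w) v / qf w))"
  shows "(w \<bullet> w) * frechet_derivative (\<lambda>w. h2 w / h1 w * fst (\<tau> w) - snd (\<tau> w)) (at w) (- h2 w, h1 w) = tw w"
proof -
  have wp: "w \<in> punctured" "norm w < eps" "w \<noteq> 0" using w T(2) punctured(2) by blast+
  define v where "v = (- h2 w, h1 w)"
  define \<beta> where "\<beta> = cnj (along bv w) / cnj (bv w)"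
  \<comment> \<open>The logarithmic derivative of \<open>qf\<close> splits into the smooth part
    \<beta> from \<open>bv\<close> and this singular part from 1 / cnj w. Times |w|^2 it is cnj v *
    w, which is linear in w once v is frozen at the origin.\<close>
  define X where "X = cnj (cw v) / cnj (cw w)"
  define x where "x = w \<bullet> w"
  let ?D\<tau> = "frechet_derivative \<tau> (at w)" and ?Db = "frechet_derivative bv (at w)"
  have ds: "(slope has_derivative frechet_derivative slope (at w)) (at w)" by (rule smooth_on_has_derivative[OF smooth_slope w(1)])
  have dt: "(\<tau> has_derivative ?D\<tau>) (at w)" by (rule smooth_on_has_derivative[OF \<tau>(1) w(2)])
  have "((\<lambda>w. slope w * fst (\<tau> w) - snd (\<tau> w)) has_derivative
      (\<lambda>v. slope w * fst (?D\<tau> v) + frechet_derivative slope (at w) v * fst (\<tau> w) - snd (?D\<tau> v))) (at w)"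
    by (intro has_derivative_diff has_derivative_mult ds has_derivative_fst[OF dt] has_derivative_snd[OF dt])
  from fun_cong[OF frechet_derivative_at[OF this], of v]
  have D: "frechet_derivative (\<lambda>w. h2 w / h1 w * fst (\<tau> w) - snd (\<tau> w)) (at w) v =
      slope w * fst (?D\<tau> v) + along slope w * fst (\<tau> w) - snd (?D\<tau> v)"
    unfolding slope_def[symmetric] along_eq[OF ds, symmetric] v_def by simp
  have wb: "w \<in> ball 0 eps" using wp(2) by simp
  have db: "(bv has_derivative ?Db) (at w)" by (rule smooth_on_has_derivative[OF smooth_bv wb])
  have b0: "bv w \<noteq> 0" by (rule Phi_t0(1)[OF wp(2)])
  have c0': "cw w \<noteq> 0" using wp(3) by simp
  have dc: "(cw has_derivative cw) (at w)" by (rule bounded_linear_imp_has_derivative[OF bounded_linear_cw])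
  have "((\<lambda>w. of_real dl * cnj (bv w) / cnj (cw w)) has_derivative
      (\<lambda>v. - (of_real dl * cnj (bv w)) * (inverse (cnj (cw w)) * cnj (cw v) * inverse (cnj (cw w))) +
        of_real dl * cnj (?Db v) / cnj (cw w))) (at w)"
    by (rule has_derivative_divide[OF has_derivative_mult_right[OF bounded_linear.has_derivative[OF bounded_linear_cnj db]]
          bounded_linear.has_derivative[OF bounded_linear_cnj dc]]) (simp add: wp(3))
  then have "(qf has_derivative
      (\<lambda>v. - (of_real dl * cnj (bv w)) * (inverse (cnj (cw w)) * cnj (cw v) * inverse (cnj (cw w))) +
        of_real dl * cnj (?Db v) / cnj (cw w))) (at w)"
    unfolding qf_def[abs_def] .
  from fun_cong[OF frechet_derivative_at[OF this], of v]
  have "frechet_derivative qf (at w) v / qf w = \<beta> - X"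
    unfolding \<beta>_def X_def along_eq[OF db, symmetric] v_def[symmetric] using b0 c0' dl(1) by (simp add: qf_def field_simps)
  then have Dt: "?D\<tau> v = (Re \<beta> - Re X, Im \<beta> - Im X)" unfolding d\<tau> by simp
  have "of_real x * X = cnj (cw v) * cw w"
  proof -
    have "complex_of_real x = cw w * cnj (cw w)" by (simp add: x_def cw_def complex_eq_iff inner_prod_def)
    then show ?thesis using c0' by (simp add: X_def)
  qed
  then have X: "x * Re X = fst v * fst w + snd v * snd w" "x * Im X = fst v * snd w - snd v * fst w"
    by (auto simp: complex_eq_iff cw_def)
  have "exp (fst (\<tau> w) - t0) = dl * norm (bv w) / norm w"
    using period_time(1)[OF wp(2,3) \<tau>(2)[OF w(2)]] dl(1) by (simp add: qf_def norm_mult norm_divide norm_cw)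
  from arg_cong[OF this, of ln]
  have t: "fst (\<tau> w) = t0 + ln dl + ln (norm (bv w)) - ln (norm w)"
    using dl(1) b0 wp(3) by (simp add: ln_mult ln_div)
  have h2: "h2 w = slope w * h1 w" using B0(3)[OF w(1)] by (simp add: slope_def)
  have "x * (slope w * fst (?D\<tau> v) + along slope w * fst (\<tau> w) - snd (?D\<tau> v)) =
      slope w * (x * Re \<beta>) - slope w * (x * Re X) + along slope w * x * fst (\<tau> w) - x * Im \<beta> + x * Im X"
    unfolding Dt by (simp add: algebra_simps)
  also have "\<dots> = tw w"
    unfolding X t tw_def regular_part_def \<beta>_def[symmetric] x_def[symmetric] unfolding v_def h2
    by (simp add: algebra_simps power2_eq_square)
  finally show ?thesis unfolding v_def[symmetric] D x_def[symmetric] .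
qed

lemma Ck_on_tw: "Ck_on (Suc 0) tw B0"
proof -
  note o = B0(1)
  have h: "smooth_on h1 B0" by (rule smooth_on_subset[OF smooth_h(1) B0(4)])
  have f: "smooth_on (\<lambda>w::real \<times> real. fst w) B0" "smooth_on (\<lambda>w::real \<times> real. snd w) B0"
    by (intro smooth_on_fst smooth_on_snd smooth_on_ident o)+
  have "smooth_on (\<lambda>w. (w \<bullet> w) * regular_part w + h1 w * (slope w * slope w - 1) * fst w - 2 * h1 w * slope w * snd w) B0"
    by (intro smooth_on_diff smooth_on_add smooth_on_mult smooth_on_inner smooth_on_ident smooth_on_const o h f smooth_slope
        smooth_regular_part)
  then have 1: "Ck_on (Suc 0) (\<lambda>w. (w \<bullet> w) * regular_part w + h1 w * (slope w * slope w - 1) * fst w - 2 * h1 w * slope w * snd w) B0"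
    by (rule smooth_on_Ck)
  have "smooth_on (\<lambda>w. - along slope w) B0" by (intro smooth_on_minus o smooth_along smooth_slope)
  from Ck_on_bilinear[OF o bounded_bilinear_mult smooth_on_Ck[OF this] Ck_on_subset[OF Ck_on_square_ln_norm subset_UNIV]]
  have 2: "Ck_on (Suc 0) (\<lambda>w. - along slope w * ((w \<bullet> w) * ln (norm w))) B0" .
  have "tw = (\<lambda>w. (w \<bullet> w) * regular_part w + h1 w * (slope w * slope w - 1) * fst w - 2 * h1 w * slope w * snd w +
      - along slope w * ((w \<bullet> w) * ln (norm w)))"
    by (rule ext) (simp add: tw_def power2_eq_square)
  then show ?thesis using Ck_on_add[OF o 1 2] by simp
qed

text \<open>All terms with the factor w . w have derivative zero at the origin, the one with the
  logarithm included. Only the two terms that are linear in w up to smooth coefficients contribute,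
  and neither \<open>bv\<close> nor the derivative of \<open>slope\<close> is felt.\<close>

lemma has_derivative_tw_0:
  assumes 0: "0 \<in> B0"
  shows "(tw has_derivative (\<lambda>v. h1 0 * ((slope 0)\<^sup>2 - 1) * fst v - 2 * h1 0 * slope 0 * snd v)) (at 0)"
proof -
  have h: "smooth_on h1 B0" by (rule smooth_on_subset[OF smooth_h(1) B0(4)])
  obtain DR DA DB DC where d: "(regular_part has_derivative DR) (at 0)" "(along slope has_derivative DA) (at 0)"
    and "((\<lambda>w. h1 w * (slope w * slope w - 1)) has_derivative DB) (at 0)" "((\<lambda>w. 2 * h1 w * slope w) has_derivative DC) (at 0)"
  proof -
    have "smooth_on (\<lambda>w. h1 w * (slope w * slope w - 1)) B0" "smooth_on (\<lambda>w. 2 * h1 w * slope w) B0"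
      by (intro smooth_on_diff smooth_on_mult smooth_on_const B0(1) h smooth_slope)+
    then show thesis
      by (rule that[OF smooth_on_has_derivative[OF smooth_regular_part 0] smooth_on_has_derivative[OF smooth_along[OF smooth_slope] 0]
            smooth_on_has_derivative[OF _ 0] smooth_on_has_derivative[OF _ 0]])
  qed
  then have e: "((\<lambda>w. h1 w * ((slope w)\<^sup>2 - 1)) has_derivative DB) (at 0)" "((\<lambda>w. 2 * h1 w * slope w) has_derivative DC) (at 0)"
    by (simp_all add: power2_eq_square)
  have i: "((\<lambda>w::real \<times> real. w \<bullet> w) has_derivative (\<lambda>v. 0 \<bullet> v + v \<bullet> 0)) (at 0)"
    by (intro has_derivative_inner has_derivative_ident)
  have p: "((\<lambda>w::real \<times> real. fst w) has_derivative fst) (at 0)" "((\<lambda>w::real \<times> real. snd w) has_derivative snd) (at 0)"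
    by (intro has_derivative_fst has_derivative_snd has_derivative_ident)+
  note q = has_derivative_square_ln_norm[of "0 :: real \<times> real"]
  from has_derivative_diff[OF has_derivative_diff[OF has_derivative_add[OF has_derivative_mult[OF i d(1)] has_derivative_mult[OF e(1) p(1)]]
      has_derivative_mult[OF e(2) p(2)]] has_derivative_mult[OF d(2) q]]
  show ?thesis unfolding tw_def[abs_def] by simp
qed

text \<open>With a = \<open>slope 0\<close>, the differentials of energy and twist have determinant
  - h1^2 a (a^2 + 1) at the origin. It is non-zero since h1 and h2 are, so energy and twist are
  local coordinates on the plane of values.\<close>

lemma energy_twist_chart:
  assumes nz: "h1 0 \<noteq> 0" "h2 0 \<noteq> 0"
  obtains X where "open X" "0 \<in> X" "X \<subseteq> B0" "inj_on (\<lambda>w. (fst (g w), tw w)) X" "open ((\<lambda>w. (fst (g w), tw w)) ` X)"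
proof -
  have 0: "0 \<in> B0" using eps(1) V_eps[of 0] nz(1) by (simp add: B0_def)
  have oV: "0 \<in> V" using 0 B0(4) by blast
  let ?F = "\<lambda>w. (fst (g w), tw w)"
  have dg: "(g has_derivative frechet_derivative g (at 0)) (at 0)" by (rule smooth_on_has_derivative[OF gD(4) oV])
  have dF: "(?F has_derivative (\<lambda>v. (fst v * h1 0 + snd v * h2 0, h1 0 * ((slope 0)\<^sup>2 - 1) * fst v - 2 * h1 0 * slope 0 * snd v))) (at 0)"
    using has_derivative_Pair[OF has_derivative_fst[OF dg] has_derivative_tw_0[OF 0]] unfolding fst_derivative_g[OF oV] .
  have sH: "smooth_on (\<lambda>w. fst (g w)) B0" by (intro smooth_on_fst B0(1) smooth_on_subset[OF gD(4) B0(4)])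
  have "Ck_on (Suc 0) (\<lambda>w. fst (g w) *\<^sub>R (1 :: real, 0 :: real)) B0"
    by (rule Ck_on_compose_bounded_linear[OF B0(1) bounded_linear_scaleR_left smooth_on_Ck[OF sH]])
  moreover have "Ck_on (Suc 0) (\<lambda>w. tw w *\<^sub>R (0 :: real, 1 :: real)) B0"
    by (rule Ck_on_compose_bounded_linear[OF B0(1) bounded_linear_scaleR_left Ck_on_tw])
  ultimately have "Ck_on (Suc 0) (\<lambda>w. fst (g w) *\<^sub>R (1 :: real, 0 :: real) + tw w *\<^sub>R (0 :: real, 1 :: real)) B0"
    by (rule Ck_on_add[OF B0(1)])
  then have C: "Ck_on (Suc 0) ?F B0" by simp
  have "inj (frechet_derivative ?F (at 0))"
  proof -
    have "v = 0" if "frechet_derivative ?F (at 0) v = 0" for v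
    proof -
      define a where "a = slope 0"
      have h2: "h2 0 = a * h1 0" using nz(1) by (simp add: slope_def a_def)
      have a: "a \<noteq> 0" using nz(2) h2 by auto
      have "fst v * h1 0 + snd v * (a * h1 0) = 0" "h1 0 * (a\<^sup>2 - 1) * fst v - 2 * h1 0 * a * snd v = 0"
        using that unfolding frechet_derivative_at[OF dF, symmetric] a_def[symmetric] h2 by (simp_all add: zero_prod_def)
      then have "h1 0 * (fst v + a * snd v) = 0" "h1 0 * ((a\<^sup>2 - 1) * fst v - 2 * a * snd v) = 0"
        by (simp_all only: algebra_simps)
      then have e: "fst v = - a * snd v" "(a\<^sup>2 - 1) * fst v - 2 * a * snd v = 0" using nz(1) by auto
      have "a * (a\<^sup>2 + 1) * snd v = 0" using e(2) unfolding e(1) by (simp add: algebra_simps power2_eq_square)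
      moreover have "a\<^sup>2 + 1 \<noteq> 0" using zero_le_power2[of a] by linarith
      ultimately have "snd v = 0" using a by simp
      then show "v = 0" using e(1) by (simp add: prod_eq_iff)
    qed
    then show ?thesis
      unfolding linear_injective_0[OF has_derivative_linear[OF dF[unfolded frechet_derivative_at[OF dF]]]] by blast
  qed
  then obtain X Y k where X: "open X" "X \<subseteq> B0" "0 \<in> X" "open Y" "homeomorphism X Y ?F k"
    by (rule C1_inverse_function[OF B0(1) C 0]) (rule that)
  have "inj_on ?F X" by (rule inj_on_inverseI) (rule homeomorphism_apply1[OF X(5)])
  moreover have "?F ` X = Y" by (rule homeomorphism_image1[OF X(5)])
  ultimately show thesis using that[OF X(1,3,2)] X(4) by blast
qed

text \<open>Valid for whatever action-angle coordinates are given, with the same function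
  \<open>tw\<close>. The local branch \<tau> chosen in the proof has disappeared from the
  statement.\<close>

lemma twist_iff:
  assumes w: "w \<in> B0" "w \<noteq> 0" and AA: "action_angle A Om H L (torus w) D \<Psi> f"
  shows "rp1_stationary (\<lambda>l. rotation_number D f (fst (g w), l)) (snd (g w)) \<longleftrightarrow> tw w = 0"
proof -
  have wp: "w \<in> punctured" using w B0(2) punctured(2) by blast
  obtain r \<tau> where r: "r > 0" "ball w r \<subseteq> punctured" and \<tau>: "smooth_on \<tau> (ball w r)" "\<And>y. y \<in> ball w r \<Longrightarrow> period y (\<tau> y)"
    and d\<tau>: "\<And>y v. y \<in> ball w r \<Longrightarrow> frechet_derivative \<tau> (at y) v =
       (Re (frechet_derivative qf (at y) v / qf y), Im (frechet_derivative qf (at y) v / qf y))"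
    by (rule period_branch[OF wp]) (rule that)
  have wr: "w \<in> ball w r" using r(1) by simp
  let ?D = "frechet_derivative (\<lambda>w. h2 w / h1 w * fst (\<tau> w) - snd (\<tau> w)) (at w) (- h2 w, h1 w)"
  have 1: "rp1_stationary (\<lambda>l. rotation_number D f (fst (g w), l)) (snd (g w)) \<longleftrightarrow> ?D = 0"
    by (rule rotation_number_stationary_iff[OF wp AA r \<tau> B0(3)[OF w(1)]])
  have 2: "(w \<bullet> w) * ?D = tw w" by (rule tw_eq[OF w(1) wr open_ball r(2) \<tau> d\<tau>[OF wr]])
  show ?thesis unfolding 1 2[symmetric] using w(2) by simp
qed

text \<open>In the coordinates (energy, \<open>tw\<close>) the twistless tori form a coordinate axis
  and an energy level is a line transversal to it. They meet in the point (h, 0), which for small h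
  lies in the image; existence and uniqueness are surjectivity and injectivity of these
  coordinates.\<close>

theorem unique_twistless_torus:
  assumes nz: "h1 (0, 0) \<noteq> 0" "h2 (0, 0) \<noteq> 0" and em0: "em_map H L m = (0, 0)"
  shows "\<exists>N \<epsilon>. open N \<and> singular_fibre H L m \<subseteq> N \<and> \<epsilon> > 0 \<and>
    (\<forall>h. h \<noteq> 0 \<and> \<bar>h\<bar> < \<epsilon> \<longrightarrow>
      (\<exists>l T. regular_torus A H L (h, l) T \<and> T \<subseteq> N \<and> vanishing_twist A Om H L (h, l) T \<and>
        (\<forall>l' T'. regular_torus A H L (h, l') T' \<and> T' \<subseteq> N \<and> T' \<noteq> T \<longrightarrow> \<not> vanishing_twist A Om H L (h, l') T')))"
proof -
  let ?F = "\<lambda>w. (fst (g w), tw w)"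
  have g0: "g 0 = (0, 0)" using em_m em0 by (simp add: zero_prod_def)
  obtain X where X: "open X" "0 \<in> X" "X \<subseteq> B0" "inj_on ?F X" "open (?F ` X)"
    by (rule energy_twist_chart[OF nz[folded zero_prod_def]]) (rule that)
  have "?F 0 = (0, 0)" by (simp add: g0 tw_def)
  then have "(0, 0) \<in> ?F ` X" using imageI[OF X(2), of ?F] by simp
  from bspec[OF iffD1[OF open_contains_ball X(5)] this]
  obtain \<epsilon> where \<epsilon>: "\<epsilon> > 0" "ball (0, 0) \<epsilon> \<subseteq> ?F ` X" by (elim exE conjE bexE) (rule that)
  have Xe: "norm w < eps" if "w \<in> X" for w using X(3) B0(2) that by blast
  have "open (g ` X)"
    by (rule smooth_diffeoD(2)[OF smooth_diffeo_subset[OF g X(1)]]) (use X(3) B0(4) in blast)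
  then have oP: "open (em_map H L -` (g ` X))" by (rule open_vimage[OF _ continuous_em])
  \<comment> \<open>Inside \<open>N\<close> alone a regular torus could have a value outside
    \<open>X\<close>, where nothing is known about \<open>tw\<close>. Intersecting with the preimage
    of \<open>g\<close> applied to \<open>X\<close> confines the values of all competing tori to
    \<open>X\<close>.\<close>
  define N' where "N' = N \<inter> em_map H L -` (g ` X)"
  have N': "open N'" unfolding N'_def using open_N oP by blast
  have KN: "K \<subseteq> N'"
  proof
    fix p assume p: "p \<in> K"
    have "em_map H L p = g 0" using J_in(2)[OF K_J(1)[OF p]] K_J(2)[OF p] by (simp add: zero_prod_def)
    then show "p \<in> N'" using K_N p X(2) unfolding N'_def by blast
  qed
  have torus_N': "torus w \<subseteq> N'" if "w \<in> X" "w \<noteq> 0" for w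
    using torus_compact(3)[OF Xe[OF that(1)] that(2)] torus_em[OF Xe[OF that(1)]] that(1) unfolding N'_def by blast
  \<comment> \<open>\<open>vanishing_twist\<close> asks for some action-angle coordinates.
    \<open>ex_action_angle\<close> supplies them, and by \<open>twist_iff\<close> the answer is the
    same for all of them.\<close>
  have twist: "vanishing_twist A Om H L (g w) (torus w) \<longleftrightarrow> tw w = 0" if w: "w \<in> X" "w \<noteq> 0" for w
  proof -
    have wB: "w \<in> B0" using w(1) X(3) by blast
    have wp: "w \<in> punctured" using Xe[OF w(1)] w(2) punctured(2) by blast
    obtain D \<Psi> f where AA: "action_angle A Om H L (torus w) D \<Psi> f" using ex_action_angle[OF wp] by blast
    show ?thesis
      unfolding vanishing_twist_def using twist_iff[OF wB w(2)] AA by blast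
  qed
  have *: "\<exists>l T. regular_torus A H L (h, l) T \<and> T \<subseteq> N' \<and> vanishing_twist A Om H L (h, l) T \<and>
        (\<forall>l' T'. regular_torus A H L (h, l') T' \<and> T' \<subseteq> N' \<and> T' \<noteq> T \<longrightarrow> \<not> vanishing_twist A Om H L (h, l') T')"
    if h: "h \<noteq> 0" "\<bar>h\<bar> < \<epsilon>" for h
  proof -
    have "dist (0, 0) (h, 0 :: real) < \<epsilon>" using h(2) by (simp add: dist_Pair_Pair)
    then have "(h, 0) \<in> ?F ` X" by (intro subsetD[OF \<epsilon>(2)]) (simp only: mem_ball)
    then obtain w where w: "w \<in> X" "(h, 0) = ?F w" by (rule imageE)
    \<comment> \<open>The origin has energy 0, so for h different from 0 the solution of
      \<open>tw\<close> = 0 belongs to a genuine torus.\<close>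
    have w0: "w \<noteq> 0" using w(2) h(1) g0 by auto
    have gw: "g w = (h, snd (g w))" using w(2) by (simp add: prod_eq_iff)
    show ?thesis
    proof (intro exI conjI allI impI)
      show "regular_torus A H L (h, snd (g w)) (torus w)"
        using regular_torus_torus[OF Xe[OF w(1)] w0] unfolding gw[symmetric] .
      show "torus w \<subseteq> N'" by (rule torus_N'[OF w(1) w0])
      show "vanishing_twist A Om H L (h, snd (g w)) (torus w)"
        using twist[OF w(1) w0] w(2) unfolding gw[symmetric] by simp
      fix l' T' assume T': "regular_torus A H L (h, l') T' \<and> T' \<subseteq> N' \<and> T' \<noteq> torus w"
      have ne: "(h, l') \<noteq> g (0, 0)" using h(1) g0 by (simp add: zero_prod_def)
      have TN: "T' \<subseteq> N" using T' unfolding N'_def by blast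
      obtain w' where w': "norm w' < eps" "w' \<noteq> 0" "(h, l') = g w'" "T' = torus w'"
        using regular_torus_in_N[OF _ TN ne] T' by blast
      have "T' \<noteq> {}" unfolding w'(4) torus_def by blast
      then obtain p where p: "p \<in> T'" by blast
      have "em_map H L p = g w'" using p torus_em[OF w'(1)] unfolding w'(4) by blast
      moreover have "em_map H L p \<in> g ` X" using p T' unfolding N'_def by blast
      ultimately obtain y where y: "y \<in> X" "g w' = g y" by auto
      have "w' = y" by (rule inj_onD[OF gD(3) y(2) V_eps[OF w'(1)]]) (use y(1) X(3) B0(4) in blast)
      then have w'X: "w' \<in> X" using y(1) by simp
      show "\<not> vanishing_twist A Om H L (h, l') T'"
      proof
        assume "vanishing_twist A Om H L (h, l') T'"
        then have "tw w' = 0" using twist[OF w'X w'(2)] unfolding w'(3,4) by blast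
        then have "?F w' = ?F w" using w(2) arg_cong[OF w'(3), of fst] by simp
        then have "w' = w" by (rule inj_onD[OF X(4) _ w'X w(1)])
        then show False using T' w'(4) by blast
      qed
    qed
  qed
  show ?thesis
  proof (rule exI[of _ N'], rule exI[of _ \<epsilon>], intro conjI)
    show "open N'" "K \<subseteq> N'" "\<epsilon> > 0" by (rule N', rule KN, rule \<epsilon>(1))
    show "\<forall>h. h \<noteq> 0 \<and> \<bar>h\<bar> < \<epsilon> \<longrightarrow>
      (\<exists>l T. regular_torus A H L (h, l) T \<and> T \<subseteq> N' \<and> vanishing_twist A Om H L (h, l) T \<and>
        (\<forall>l' T'. regular_torus A H L (h, l') T' \<and> T' \<subseteq> N' \<and> T' \<noteq> T \<longrightarrow> \<not> vanishing_twist A Om H L (h, l') T'))"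
      using * by simp
  qed
qed

end

theorem theorem1:
  fixes A :: "'m::{t2_space, second_countable_topology} chart set"
    and Om :: "'m form2"
    and H L :: "'m \<Rightarrow> real"
    and m :: 'm
    and \<alpha> \<omega> :: real
  assumes "symplectic_manifold A Om"
    and "liouville_integrable A Om H L"
    and "focus_focus A Om H L m \<alpha> \<omega>"
    and "em_map H L m = (0, 0)"
  shows "\<exists>N \<epsilon>. open N \<and> singular_fibre H L m \<subseteq> N \<and> \<epsilon> > 0 \<and>
           (\<forall>h. h \<noteq> 0 \<and> \<bar>h\<bar> < \<epsilon> \<longrightarrow>
              (\<exists>l T. regular_torus A H L (h, l) T \<and> T \<subseteq> N \<and>
                 vanishing_twist A Om H L (h, l) T \<and>
                 (\<forall>l' T'. regular_torus A H L (h, l') T' \<and> T' \<subseteq> N \<and> T' \<noteq> T \<longrightarrow>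
                    \<not> vanishing_twist A Om H L (h, l') T')))"
proof -
  obtain c0 g V where cc: "canonical_chart A Om c0" "m \<in> fst c0" "snd c0 m = 0"
    and gV: "(0, 0) \<in> V" "smooth_diffeo g V"
    and nf: "\<And>p. p \<in> fst c0 \<Longrightarrow> (J1 (snd c0 p), J2 (snd c0 p)) \<in> V \<and> em_map H L p = g (J1 (snd c0 p), J2 (snd c0 p))"
    using assms(3) unfolding focus_focus_def eliasson_normal_form_def by blast
  interpret focus_focus_system A Om H L g V m c0
    using assms(1-3) cc gV nf by unfold_locales (auto simp: symplectic_manifold_def focus_focus_def)
  \<comment> \<open>The loxodromic eigenvalue is read in the Eliasson chart, where it forces both
    partial derivatives of the energy with respect to w to be non-zero.\<close>
  have "Complex \<alpha> \<omega> \<in> complex_eigenvalues (linearization Om c0 H m)" "\<alpha> \<noteq> 0" "\<omega> \<noteq> 0"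
    using assms(3) c0A m(1) unfolding focus_focus_def by auto
  from unique_twistless_torus[OF h_nonzero[OF this] assms(4)] show ?thesis .
qed

end
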